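(* Let $f$ be a convex-concave function satisfying $C^f_i<\infty$ for $i=0,\dots,4$, and let $g$ either be a quadratic function, or be a convex-concave function with $C^g_i<\infty$ for $i=0,\dots,4$. Let the boundary function $\omega:D\to[0,1]$ be such that $\sup_{x\in D}|\nabla\omega(x)|<\infty$ and $\sup_{x\in D}|\nabla^2\omega(x)|<\infty$. Then there is a constant $\bar L_1$, not depending on $\epsilon$ and $u,v$, such that for all $u,v\in W$ $$\|\mathcal L^\epsilon(u)-\mathcal L^\epsilon(v)\|_2\le \frac{\bar L_1\,(1+\|u\|_2+\|v\|_2)^2}{\epsilon^3}\,\|u-v\|_2,$$ and there is a constant $\bar L_2$, not depending on $\epsilon$ and $u$, such that for all $u\in W$ $$\|\mathcal L^\epsilon(u)\|_2\le \frac{\bar L_2\,(\|u\|_2+\|u\|_2^2)}{\epsilon^{5/2}}.$$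
   Context: Let $d\in\{2,3\}$ and let $D\subset\mathbb R^d$ (the material domain) be an open set with $C^1$ boundary. $\epsilon>0$ is the horizon, $H_\epsilon(x)=\{y\in\mathbb R^d:|y-x|<\epsilon\}$, and $\omega_d$ is the volume of the unit ball in $\mathbb R^d$. $\|\cdot\|$ is the $L^2(D)$ norm and $\|u\|_2=\|u\|+\|\nabla u\|+\|\nabla^2u\|$. $W=H^2(D;\mathbb R^d)\cap H^1_0(D;\mathbb R^d)$; functions in $W$ are extended by zero outside $D$. Influence function: $J^\epsilon(r)=J(r/\epsilon)$, where $0\le J(r)\le M$ for $r<1$ and $J(r)=0$ for $r\ge1$. Boundary function: $\omega:D\to[0,1]$ equals $1$ in the interior and decays smoothly to $0$ as $x\to\partial D$; it is extended by zero outside $D$, and the bounds on its first and second derivatives are understood for this extension, so that $x\mapsto\omega(x+\epsilon\xi)\omega(x)$, $|\xi|<1$, also has first and second derivatives bounded by constants. Strains: with $e_{y-x}=\frac{y-x}{|y-x|}$, $$S(y,x;u)=\frac{u(y)-u(x)}{|y-x|}\cdot e_{y-x},\qquad \theta(x;u)=\frac1{\epsilon^d\omega_d}\int_{H_\epsilon(x)}\omega(y)J^\epsilon(|y-x|)S(y,x;u)|y-x|\,dy.$$ Potentials: $f:\mathbb R\to\mathbb R$ is at least four times differentiable and of convex-concave type: it has a well (minimum) at the origin with $f(0)=f'(0)=0$, $f\ge0$, it is convex between its inflection points $r^-<0<r^+$ and concave outside $[r^-,r^+]$, with finite limits $C^\pm$ at $\pm\infty$. $C^f_0=\sup_r|f(r)|$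 and $C^f_i=\sup_r|f^{(i)}(r)|$ for $i=1,\dots,4$. The function $g$ is either quadratic, $g(r)=\beta r^2/2$ with one well at $0$, or of the same convex-concave type as $f$ (with its own inflection points); then $C^g_i$ is defined as $C^f_i$ with $g$ in place of $f$. Peridynamic force: $\mathcal L^\epsilon=\mathcal L^\epsilon_T+\mathcal L^\epsilon_D$ with $$\mathcal L^\epsilon_T(u)(x)=\frac{2}{\epsilon^{d+1}\omega_d}\int_{H_\epsilon(x)}\omega(x)\omega(y)\frac{J^\epsilon(|y-x|)}{\sqrt{|y-x|}}f'\big(\sqrt{|y-x|}\,S(y,x;u)\big)e_{y-x}\,dy,$$ $$\mathcal L^\epsilon_D(u)(x)=\frac1{\epsilon^d\omega_d}\int_{H_\epsilon(x)}\omega(x)\omega(y)\frac{J^\epsilon(|y-x|)}{\epsilon^2}\big[g'(\theta(y;u))+g'(\theta(x;u))\big]e_{y-x}\,dy.$$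
   Formalization: For unbounded D the bounds are stated only for horizons ε up to an arbitrary prescribed ε₀, on which the constants may depend; for bounded D all ε>0 are covered. With D a half-space and ε→∞ the force is of order ε⁻², so the unrestricted claim fails. *)

theory Defs
  imports "HOL-Analysis.Analysis"
begin

section \<open>Classical derivatives and test functions\<close>

definition grad :: "(real^'n \<Rightarrow> 'b::euclidean_space) \<Rightarrow> real^'n \<Rightarrow> 'b^'n" where
  "grad u x = (\<chi> i. frechet_derivative u (at x) (axis i 1))"

primrec Ck :: "nat \<Rightarrow> (real^'n \<Rightarrow> 'b::euclidean_space) \<Rightarrow> bool" where
  "Ck 0 u \<longleftrightarrow> continuous_on UNIV u"
| "Ck (Suc k) u \<longleftrightarrow> (\<forall>x. u differentiable (at x)) \<and> (\<forall>i. Ck k (\<lambda>x. grad u x $ i))"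

definition test_fun :: "(real^'n) set \<Rightarrow> (real^'n \<Rightarrow> 'b::euclidean_space) \<Rightarrow> bool" where
  "test_fun D \<phi> \<longleftrightarrow> (\<forall>k. Ck k \<phi>) \<and> (\<exists>K. compact K \<and> K \<subseteq> D \<and> (\<forall>x. x \<notin> K \<longrightarrow> \<phi> x = 0))"

section \<open>Domains with \<open>C\<^sup>1\<close> boundary\<close>

text \<open>Near each boundary point the domain lies on one side of the graph of a \<open>C\<^sup>1\<close> function of all
  but one of the coordinates. That function is represented as a function on the whole space that
  does not depend on the remaining coordinate; the sign \<open>\<sigma>\<close> selects the side.\<close>

definition C1_boundary :: "(real^'n) set \<Rightarrow> bool" where
  "C1_boundary D \<longleftrightarrow> (\<forall>p\<in>frontier D. \<exists>r>0. \<exists>i. \<exists>\<sigma>\<in>{-1, 1::real}. \<exists>\<gamma>::real^'n \<Rightarrow> real.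
     Ck 1 \<gamma> \<and> (\<forall>x t. \<gamma> (x + t *\<^sub>R axis i 1) = \<gamma> x) \<and>
     D \<inter> ball p r = {x \<in> ball p r. \<sigma> * (x $ i) > \<sigma> * \<gamma> x})"

section \<open>Lebesgue and Sobolev spaces\<close>

text \<open>Elements of the function spaces are represented by functions on the whole space; only the
  values on \<open>D\<close> matter, except in \<open>W\<close>, which prescribes the value zero outside \<open>D\<close>.\<close>

definition L2 :: "(real^'n) set \<Rightarrow> (real^'n \<Rightarrow> 'b::euclidean_space) set" where
  "L2 D = {u. set_borel_measurable lebesgue D u \<and> set_integrable lebesgue D (\<lambda>x. (norm (u x))\<^sup>2)}"

definition L2norm :: "(real^'n) set \<Rightarrow> (real^'n \<Rightarrow> 'b::euclidean_space) \<Rightarrow> real" where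
  "L2norm D u = sqrt (LINT x:D|lebesgue. (norm (u x))\<^sup>2)"

definition locally_integrable :: "(real^'n) set \<Rightarrow> (real^'n \<Rightarrow> 'b::euclidean_space) \<Rightarrow> bool" where
  "locally_integrable D u \<longleftrightarrow> (\<forall>K. compact K \<and> K \<subseteq> D \<longrightarrow> set_integrable lebesgue K u)"

text \<open>The weak gradient has values in \<open>'b^'n\<close>, so the Hessian is the weak gradient of the weak
  gradient, and the norms of these nested vectors are the Frobenius norms.\<close>

definition has_weak_grad ::
  "(real^'n) set \<Rightarrow> (real^'n \<Rightarrow> 'b::euclidean_space) \<Rightarrow> (real^'n \<Rightarrow> 'b^'n) \<Rightarrow> bool" where
  "has_weak_grad D u G \<longleftrightarrow> locally_integrable D u \<and> locally_integrable D G \<and>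
     (\<forall>\<phi>::real^'n \<Rightarrow> real. test_fun D \<phi> \<longrightarrow>
       (\<forall>i. (LINT x:D|lebesgue. (grad \<phi> x $ i) *\<^sub>R u x) = - (LINT x:D|lebesgue. \<phi> x *\<^sub>R (G x $ i))))"

text \<open>Weak gradients are unique almost everywhere, so the choice does not affect norms.\<close>

definition weak_grad :: "(real^'n) set \<Rightarrow> (real^'n \<Rightarrow> 'b::euclidean_space) \<Rightarrow> real^'n \<Rightarrow> 'b^'n" where
  "weak_grad D u = (SOME G. has_weak_grad D u G)"

definition H2 :: "(real^'n) set \<Rightarrow> (real^'n \<Rightarrow> 'b::euclidean_space) set" where
  "H2 D = {u \<in> L2 D. \<exists>G\<in>L2 D. \<exists>H\<in>L2 D. has_weak_grad D u G \<and> has_weak_grad D G H}"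

text \<open>Meaningful for members of \<open>H2 D\<close> only.\<close>

definition H2norm :: "(real^'n) set \<Rightarrow> (real^'n \<Rightarrow> 'b::euclidean_space) \<Rightarrow> real" where
  "H2norm D u = L2norm D u + L2norm D (weak_grad D u) + L2norm D (weak_grad D (weak_grad D u))"

text \<open>The closure of the test functions in \<open>H\<^sup>1(D)\<close>.\<close>

definition H10 :: "(real^'n) set \<Rightarrow> (real^'n \<Rightarrow> 'b::euclidean_space) set" where
  "H10 D = {u \<in> L2 D. \<exists>G\<in>L2 D. has_weak_grad D u G \<and>
     (\<exists>\<phi>::nat \<Rightarrow> real^'n \<Rightarrow> 'b. (\<forall>k. test_fun D (\<phi> k)) \<and>
       (\<lambda>k. L2norm D (\<lambda>x. u x - \<phi> k x)) \<longlonglongrightarrow> 0 \<and>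
       (\<lambda>k. L2norm D (\<lambda>x. G x - grad (\<phi> k) x)) \<longlonglongrightarrow> 0)}"

definition W :: "(real^'n) set \<Rightarrow> (real^'n \<Rightarrow> real^'n) set" where
  "W D = {u \<in> H2 D \<inter> H10 D. \<forall>x. x \<notin> D \<longrightarrow> u x = 0}"

section \<open>Influence function, boundary function and potentials\<close>

text \<open>Only the values of \<open>J\<close> on the nonnegative reals are used.\<close>

definition influence_function :: "(real \<Rightarrow> real) \<Rightarrow> bool" where
  "influence_function J \<longleftrightarrow> J \<in> borel_measurable borel \<and>
     (\<exists>M. \<forall>r. 0 \<le> r \<and> r < 1 \<longrightarrow> 0 \<le> J r \<and> J r \<le> M) \<and> (\<forall>r\<ge>1. J r = 0)"

text \<open>The boundary function is given together with its extension by zero. It equals \<open>1\<close> on \<open>D\<close>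
  outside a boundary layer of some width \<open>\<delta>\<close>. Differentiability on the whole space says that it
  decays to zero at the boundary smoothly.\<close>

definition boundary_function :: "(real^'n) set \<Rightarrow> (real^'n \<Rightarrow> real) \<Rightarrow> bool" where
  "boundary_function D \<omega> \<longleftrightarrow>
     (\<forall>x\<in>D. 0 \<le> \<omega> x \<and> \<omega> x \<le> 1) \<and> (\<forall>x. x \<notin> D \<longrightarrow> \<omega> x = 0) \<and>
     (\<exists>\<delta>>0. \<forall>x. ball x \<delta> \<subseteq> D \<longrightarrow> \<omega> x = 1) \<and>
     (\<forall>x. \<omega> differentiable (at x)) \<and> (\<forall>x. grad \<omega> differentiable (at x))"

definition four_times_differentiable :: "(real \<Rightarrow> real) \<Rightarrow> bool" where
  "four_times_differentiable f \<longleftrightarrow> (\<forall>k<4. \<forall>r. ((deriv ^^ k) f) differentiable (at r))"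

text \<open>\<open>rm\<close> and \<open>rp\<close> are the inflection points.\<close>

definition convex_concave :: "(real \<Rightarrow> real) \<Rightarrow> bool" where
  "convex_concave f \<longleftrightarrow> four_times_differentiable f \<and>
     f 0 = 0 \<and> deriv f 0 = 0 \<and> (\<forall>r. f r \<ge> 0) \<and>
     (\<exists>rm rp. rm < 0 \<and> 0 < rp \<and>
        convex_on {rm..rp} f \<and> concave_on {..rm} f \<and> concave_on {rp..} f) \<and>
     (\<exists>Cm. (f \<longlongrightarrow> Cm) at_bot) \<and> (\<exists>Cp. (f \<longlongrightarrow> Cp) at_top)"

definition quadratic_potential :: "(real \<Rightarrow> real) \<Rightarrow> bool" where
  "quadratic_potential g \<longleftrightarrow> (\<exists>\<beta>>0. \<forall>r. g r = \<beta> * r\<^sup>2 / 2)"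

definition finite_sup_derivs :: "(real \<Rightarrow> real) \<Rightarrow> bool" where
  "finite_sup_derivs f \<longleftrightarrow> (\<forall>k\<le>4. bdd_above (range (\<lambda>r. \<bar>(deriv ^^ k) f r\<bar>)))"

section \<open>Peridynamic force\<close>

definition unit_dir :: "real^'n \<Rightarrow> real^'n \<Rightarrow> real^'n" where
  "unit_dir y x = (y - x) /\<^sub>R norm (y - x)"

definition ball_vol :: "'n::finite itself \<Rightarrow> real" where
  "ball_vol _ = measure lebesgue (ball (0::real^'n) 1)"

definition strain :: "(real^'n \<Rightarrow> real^'n) \<Rightarrow> real^'n \<Rightarrow> real^'n \<Rightarrow> real" where
  "strain u y x = ((u y - u x) /\<^sub>R norm (y - x)) \<bullet> unit_dir y x"

definition dilation ::
  "(real \<Rightarrow> real) \<Rightarrow> (real^'n \<Rightarrow> real) \<Rightarrow> real \<Rightarrow> (real^'n \<Rightarrow> real^'n) \<Rightarrow> real^'n \<Rightarrow> real" where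
  "dilation J \<omega> \<epsilon> u x = 1 / (\<epsilon> ^ CARD('n) * ball_vol TYPE('n)) *
     (LINT y:ball x \<epsilon>|lebesgue. \<omega> y * J (norm (y - x) / \<epsilon>) * strain u y x * norm (y - x))"

definition force_T ::
  "(real \<Rightarrow> real) \<Rightarrow> (real^'n \<Rightarrow> real) \<Rightarrow> (real \<Rightarrow> real) \<Rightarrow> real \<Rightarrow>
   (real^'n \<Rightarrow> real^'n) \<Rightarrow> real^'n \<Rightarrow> real^'n" where
  "force_T J \<omega> f \<epsilon> u x = (2 / (\<epsilon> ^ (CARD('n) + 1) * ball_vol TYPE('n))) *\<^sub>R
     (LINT y:ball x \<epsilon>|lebesgue.
        (\<omega> x * \<omega> y * (J (norm (y - x) / \<epsilon>) / sqrt (norm (y - x))) *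
         deriv f (sqrt (norm (y - x)) * strain u y x)) *\<^sub>R unit_dir y x)"

definition force_D ::
  "(real \<Rightarrow> real) \<Rightarrow> (real^'n \<Rightarrow> real) \<Rightarrow> (real \<Rightarrow> real) \<Rightarrow> real \<Rightarrow>
   (real^'n \<Rightarrow> real^'n) \<Rightarrow> real^'n \<Rightarrow> real^'n" where
  "force_D J \<omega> g \<epsilon> u x = (1 / (\<epsilon> ^ CARD('n) * ball_vol TYPE('n))) *\<^sub>R
     (LINT y:ball x \<epsilon>|lebesgue.
        (\<omega> x * \<omega> y * (J (norm (y - x) / \<epsilon>) / \<epsilon>\<^sup>2) *
         (deriv g (dilation J \<omega> \<epsilon> u y) + deriv g (dilation J \<omega> \<epsilon> u x))) *\<^sub>R unit_dir y x)"

definition force ::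
  "(real \<Rightarrow> real) \<Rightarrow> (real^'n \<Rightarrow> real) \<Rightarrow> (real \<Rightarrow> real) \<Rightarrow> (real \<Rightarrow> real) \<Rightarrow> real \<Rightarrow>
   (real^'n \<Rightarrow> real^'n) \<Rightarrow> real^'n \<Rightarrow> real^'n" where
  "force J \<omega> f g \<epsilon> u x = force_T J \<omega> f \<epsilon> u x + force_D J \<omega> g \<epsilon> u x"

end

theory Submission
 imports Defs "HOL-Computational_Algebra.Polynomial"
begin

abbreviation (input) scaleR_infix (infixr "*R" 75) where "a *R b \<equiv> scaleR a b"

abbreviation (input) bmeas :: "('a::topological_space => 'b::topological_space) set" where "bmeas \<equiv> borel_measurable borel"

abbreviation (input) nni :: "('a::euclidean_space => real) => ennreal" where "nni f \<equiv> \<integral>\<^sup>+x. ennreal (f x) \<partial>lborel"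

abbreviation (input) fder :: "('a::real_normed_vector => 'b::real_normed_vector) => 'a => 'a => 'b" where "fder f x \<equiv> frechet_derivative f (at x)"

text \<open>With \<open>y = x + z\<close> the force is an integral over \<open>z\<close> of a singular kernel in \<open>|z|\<close> times a function
of the form \<open>a(x) F(s p(x))\<close>: \<open>a\<close> is a product of values of the boundary function, \<open>F\<close> the derivative of a
potential, and \<open>p\<close> a strain or a sum of dilatations of \<open>u\<close>. For fixed \<open>z\<close> its second derivatives are computed
with difference quotients. The extension of \<open>u\<close> by zero has weak first derivatives on the whole space but
second derivatives only in \<open>D\<close>; since \<open>a\<close> is Lipschitz and vanishes where these are missing, \<open>a\<close> times
a first derivative is weakly differentiable on the whole space. The quadratic term \<open>a F''(s p) |p'|\<^sup>2\<close> is the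
critical one: by Glaeser's inequality \<open>|a'| <= c \<surd>a\<close>, so \<open>\<surd>a p'\<close> lies in \<open>L\<^sup>6\<close>, and the differences
involve products of three functions in \<open>L\<^sup>6\<close>. Minkowski's inequality then integrates over \<open>|z| < eps\<close>; if
\<open>d = 2\<close> the kernel of the cubic term is integrable only because a difference \<open>u(x + z) - u(x)\<close> gains a
factor \<open>|z| powr (1/6)\<close> in \<open>L\<^sup>6\<close>.\<close>

subsection \<open>Test functions\<close>

text \<open>The exponents of the horizon arise as follows. The argument sqrt|z| S is |z|^(-1/2)
  times the projected difference of u, so every derivative of the nonlinearity costs |z|^(-1/2).
  Together with the |z|^(-1/2) of the kernel, second derivatives cost at most |z|^(-3/2) for one
  function and |z|^(-2) for a difference of two. Over |z| < eps this integrates to eps^(d-3/2) and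
  eps^(d-2), and the prefactor eps^(-d-1) yields the exponents 5/2 and 3. Terms with other powers of
  eps are absorbed: either eps is at most \<open>\<epsilon>\<^sub>0\<close>, or D is bounded and the
  product of the two boundary weights vanishes once |z| exceeds its diameter, so that eps may be
  replaced by min eps R. The dilatational part is of order eps^(-2) only, and the ratio min eps R /
  eps supplies the missing powers. The constants must not depend on z. Hence the nonlinear estimates
  are proved for arbitrary weights and scales s, with constants depending only on bounds of the
  potential and of the weight; z enters later through s = |z|^(-1/2) and through the product weight.
  Estimates are stated for scalar Borel functions on the whole space, and the weak gradients of the
  statement are converted to this form at the end.\<close>

definition flat_exp :: "real poly => real => real" where
 "flat_exp p t = (if t > 0 then poly p (1 / t) * exp (- (1 / t)) else 0)"

lemma poly_times_exp_tendsto_0: "((%y::real. poly p y * exp (- y)) \<longlongrightarrow> 0) at_top"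
proof -
 have "((%y. \<Sum>i\<le>degree p. coeff p i * (y ^ i / exp y)) \<longlongrightarrow> (\<Sum>i\<le>degree p. coeff p i * 0)) at_top"
  by (intro tendsto_sum tendsto_mult tendsto_const tendsto_power_div_exp_0)
 moreover have "(%y. poly p y * exp (- y)) = (%y. \<Sum>i\<le>degree p. coeff p i * (y ^ i / exp y))"
  by (simp add: poly_altdef sum_distrib_right exp_minus divide_inverse mult.assoc)
 ultimately show ?thesis by simp
qed

text \<open>With y = 1/t the derivative in t of p(y) exp(-y) is y^2 (p(y) - p'(y)) exp(-y), so the
  class is closed under differentiation. At t = 0 the left quotient is zero and the right one is y
  p(y) exp(-y) as y tends to infinity.\<close>

lemma flat_exp_deriv:
 "(flat_exp p has_real_derivative flat_exp ([:0, 0, 1:] * (p - pderiv p)) t) (at t)"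
proof (cases "t = 0")
 case False
 show ?thesis
 proof (cases "t > 0")
  case True
  have "((%t. poly p (1 / t) * exp (- (1 / t))) has_real_derivative
    flat_exp ([:0, 0, 1:] * (p - pderiv p)) t) (at t)"
   using True unfolding flat_exp_def
   by (auto intro!: derivative_eq_intros DERIV_chain2[OF poly_DERIV] simp: field_simps power2_eq_square)
  then show ?thesis
   by (rule has_field_derivative_transform_within_open[where S = "{0<..}"])
     (use True in \<open>auto simp: flat_exp_def\<close>)
 next
  case F: False
  have "((%t. 0) has_real_derivative flat_exp ([:0, 0, 1:] * (p - pderiv p)) t) (at t)"
   using F by (simp add: flat_exp_def)
  then show ?thesis
   by (rule has_field_derivative_transform_within_open[where S = "{..<0}"])
     (use F False in \<open>auto simp: flat_exp_def\<close>)
 qed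
next
 case True
 have "((%h. flat_exp p h / h) \<longlongrightarrow> 0) (at_right 0)"
 proof -
  have "((%y. poly ([:0, 1:] * p) y * exp (- y)) \<longlongrightarrow> 0) at_top"
   by (rule poly_times_exp_tendsto_0)
  then have "((%h. poly ([:0, 1:] * p) (inverse h) * exp (- inverse h)) \<longlongrightarrow> 0) (at_right 0)"
   by (rule filterlim_compose[OF _ filterlim_inverse_at_top_right])
  then show ?thesis
   by (rule Lim_transform_eventually)
     (auto simp: eventually_at_filter flat_exp_def field_simps)
 qed
 moreover have "((%h. flat_exp p h / h) \<longlongrightarrow> 0) (at_left 0)"
  by (rule Lim_transform_eventually[OF tendsto_const])
    (auto simp: eventually_at_filter flat_exp_def)
 ultimately have "((%h. flat_exp p h / h) \<longlongrightarrow> 0) (at 0)"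
  by (simp add: filterlim_at_split)
 then show ?thesis
  using True by (simp add: DERIV_def flat_exp_def)
qed

text \<open>A class containing the factors of the bump functions and closed under directional
  derivatives. A single induction on the order then gives smoothness, without formulas for higher
  derivatives.\<close>

inductive_set flat_algebra :: "(real^'n => real) set" where
 const: "(%x. c) \<in> flat_algebra"
| flat: "(%x. flat_exp p (c + d * x $ i)) \<in> flat_algebra"
| add: "f \<in> flat_algebra ==> g \<in> flat_algebra ==> (%x. f x + g x) \<in> flat_algebra"
| mult: "f \<in> flat_algebra ==> g \<in> flat_algebra ==> (%x. f x * g x) \<in> flat_algebra"

lemma flat_algebra_derivative:
 fixes f :: "real^'n => real"
 assumes "f \<in> flat_algebra"
 shows "\<exists>f'. (\<forall>x. (f has_derivative f' x) (at x)) \<and> (\<forall>v. (%x. f' x v) \<in> flat_algebra)"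
 using assms
proof induction
 case (const c)
 show ?case
  by (rule exI[of _ "%x v. 0"]) (auto intro: flat_algebra.const)
next
 case (flat p c d i)
 define q where "q = [:0, 0, 1:] * (p - pderiv p)"
 have "((%x. flat_exp p (c + d * x $ i)) has_derivative
   (%v. (d * v $ i) * flat_exp q (c + d * x $ i))) (at x)" for x :: "real^'n"
 proof -
  have "((%x. c + d * x $ i) has_derivative (%v. d * v $ i)) (at x)"
   by (auto intro!: derivative_eq_intros bounded_linear.has_derivative[OF bounded_linear_vec_nth])
  from has_derivative_compose[OF this flat_exp_deriv[unfolded has_field_derivative_def, of p "c + d * x $ i"]]
  show ?thesis unfolding q_def by (simp only: mult.commute)
 qed
 moreover have "(%x. (d * v $ i) * flat_exp q (c + d * x $ i)) \<in> flat_algebra" for v :: "real^'n"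
  by (intro flat_algebra.intros)
 ultimately show ?case
  by (intro exI[of _ "%x v. (d * v $ i) * flat_exp q (c + d * x $ i)"]) blast
next
 case (add f g)
 then obtain f' g' where "\<forall>x. (f has_derivative f' x) (at x)" "\<forall>x. (g has_derivative g' x) (at x)"
  "\<forall>v. (%x. f' x v) \<in> flat_algebra" "\<forall>v. (%x. g' x v) \<in> flat_algebra" by blast
 then show ?case
  by (intro exI[of _ "%x v. f' x v + g' x v"]) (auto intro!: derivative_intros flat_algebra.intros)
next
 case (mult f g)
 then obtain f' g' where "\<forall>x. (f has_derivative f' x) (at x)" "\<forall>x. (g has_derivative g' x) (at x)"
  "\<forall>v. (%x. f' x v) \<in> flat_algebra" "\<forall>v. (%x. g' x v) \<in> flat_algebra" by blast
 then show ?case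
  using mult.hyps
  by (intro exI[of _ "%x v. f x * g' x v + f' x v * g x"]) (auto intro!: derivative_intros flat_algebra.intros)
qed

lemma flat_algebra_Ck: "f \<in> flat_algebra ==> Ck k f"
proof (induction k arbitrary: f)
 case 0
 then show ?case
  using flat_algebra_derivative[of f]
  by (auto intro!: continuous_at_imp_continuous_on dest: has_derivative_continuous)
next
 case (Suc k)
 obtain f' where f': "\<forall>x. (f has_derivative f' x) (at x)" "\<forall>v. (%x. f' x v) \<in> flat_algebra"
  using flat_algebra_derivative[OF Suc.prems] by blast
 have "grad f x $ i = f' x (axis i 1)" for x i
  using f'(1) frechet_derivative_at[of f "f' x" x] by (simp add: grad_def)
 then have "(%x. grad f x $ i) \<in> flat_algebra" for i
  using f'(2) by simp
 then show ?case
  using f'(1) Suc.IH by (auto simp: differentiable_def)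
qed

lemma flat_algebra_prod:
 "finite I ==> (!!i. i \<in> I ==> f i \<in> flat_algebra) ==> (%x. \<Prod>i\<in>I. f i x) \<in> flat_algebra"
 by (induction I rule: finite_induct) (auto intro: flat_algebra.intros)

text \<open>Since exp(-1/(m s)) tends to 1 for every s > 0, the parameter \<open>m\<close> steepens
  the bump: with values in [0,1] and support in the closed box, it converges to the indicator of the
  open box.\<close>

definition box_bump :: "nat => real^'n => real^'n => real^'n => real" where
 "box_bump m a b x =
   (\<Prod>i\<in>UNIV. flat_exp 1 (real m * (x $ i - a $ i)) * flat_exp 1 (real m * (b $ i - x $ i)))"

lemma box_bump_Ck: "Ck k (box_bump m a b)"
proof -
 have "(%x. flat_exp 1 (real m * (x $ i - a $ i)) * flat_exp 1 (real m * (b $ i - x $ i))) \<in> flat_algebra" for i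
  using flat_algebra.mult[OF flat_algebra.flat[of 1 "- real m * a $ i" "real m" i]
    flat_algebra.flat[of 1 "real m * b $ i" "- real m" i]]
  by (simp add: algebra_simps)
 then show ?thesis
  unfolding box_bump_def[abs_def] by (intro flat_algebra_Ck flat_algebra_prod) auto
qed

lemma flat_exp_1_bounds: "0 <= flat_exp 1 t" "flat_exp 1 t <= 1"
 by (auto simp: flat_exp_def)

lemma box_bump_bounds: "0 <= box_bump m a b x" "box_bump m a b x <= 1"
 unfolding box_bump_def by (auto intro!: prod_nonneg prod_le_1 mult_le_one simp: flat_exp_1_bounds)

lemma box_bump_eq_0:
 assumes "x \<notin> box a b"
 shows "box_bump m a b x = 0"
proof -
 obtain i where "x $ i <= a $ i \<or> b $ i <= x $ i"
  using assms by (auto simp: mem_box_cart not_less)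
 then have "flat_exp 1 (real m * (x $ i - a $ i)) * flat_exp 1 (real m * (b $ i - x $ i)) = 0"
  by (auto simp: flat_exp_def zero_less_mult_iff)
 then show ?thesis
  unfolding box_bump_def by (intro prod_zero) auto
qed

lemma box_bump_eq_0': "x \<notin> cbox a b ==> box_bump m a b x = 0"
 using box_bump_eq_0[of x a b] box_subset_cbox by blast

lemma box_bump_tendsto: "(%m. box_bump m a b x) \<longlonglongrightarrow> indicator (box a b) x"
proof (cases "x \<in> box a b")
 case True
 have *: "(%m. flat_exp 1 (real m * s)) \<longlonglongrightarrow> 1" if "s > 0" for s
 proof -
  have "(%m. exp (- (inverse s * inverse (real m)))) \<longlonglongrightarrow> exp (- (inverse s * 0))"
   by (intro tendsto_intros lim_inverse_n)
  moreover have "\<forall>\<^sub>F m in sequentially. exp (- (inverse s * inverse (real m))) = flat_exp 1 (real m * s)"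
   using eventually_gt_at_top[of 0]
   by eventually_elim (use that in \<open>auto simp: flat_exp_def field_simps\<close>)
  ultimately show ?thesis
   by (simp add: filterlim_cong[OF refl refl])
 qed
 have "(%m. box_bump m a b x) \<longlonglongrightarrow> (\<Prod>i\<in>(UNIV::'a set). 1 * 1)"
  unfolding box_bump_def using True
  by (intro tendsto_prod tendsto_mult *) (auto simp: mem_box_cart)
 then show ?thesis using True by simp
qed (simp add: box_bump_eq_0)

lemma test_fun_box_bump:
 assumes "cbox a b \<subseteq> D"
 shows "test_fun D (box_bump m a b)"
 unfolding test_fun_def
 using assms box_bump_Ck box_bump_eq_0'[of _ a b]
 by (auto intro!: exI[of _ "cbox a b"])

section \<open>The fundamental lemma of the calculus of variations\<close>

lemma AE_zero_if_box_integrals_zero: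
 fixes h :: "'a::euclidean_space => real"
 assumes h: "integrable lborel h" and z: "!!a b. (LINT x:box a b|lborel. h x) = 0"
  and u: "integral\<^sup>L lborel h = 0"
 shows "AE x in lborel. h x = 0"
proof -
 have int: "set_integrable lborel A h" if "A \<in> sets borel" for A
  using integrable_mult_indicator[OF _ h, of A] that by (simp add: set_integrable_def)
 have "(LINT x:A|lborel. h x) = 0" if "A \<in> sets borel" for A
 proof -
  \<comment> \<open>Dynkin's argument: boxes form an intersection-stable generator of the Borel
    sets. The vanishing integral over the whole space is what carries the property to
    complements.\<close>
  have "Int_stable (range (%(a::'a, b). box a b))" "range (%(a::'a, b). box a b) \<subseteq> Pow UNIV"
   by (auto simp: Int_stable_def box_Int_box)
  moreover have "A \<in> sigma_sets UNIV (range (%(a, b). box a b))"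
   using that by (simp add: borel_eq_box)
  ultimately show ?thesis
  proof (induction rule: sigma_sets_induct_disjoint)
   case (compl A)
   then have A: "A \<in> sets borel" by (simp add: borel_eq_box)
   have "(LINT x:A \<union> (UNIV - A)|lborel. h x) = (LINT x:A|lborel. h x) + (LINT x:UNIV - A|lborel. h x)"
    using A by (intro set_integral_Un int) auto
   moreover have "(LINT x:A \<union> (UNIV - A)|lborel. h x) = 0"
    using u by (simp add: set_lebesgue_integral_def)
   ultimately show ?case using compl by simp
  next
   case (union A)
   then have A: "!!i. A i \<in> sets borel" by (auto simp: borel_eq_box)
   have "(LINT x:(\<Union>i. A i)|lborel. h x) = (\<Sum>i. LINT x:A i|lborel. h x)"
    using A union(1) by (intro lebesgue_integral_countable_add int) (auto simp: disjoint_family_on_def)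
   then show ?case using union by simp
  qed (use z in \<open>auto simp: set_lebesgue_integral_def\<close>)
 qed
 then show ?thesis
  using density_unique_real[OF h, of "%_. 0"] by auto
qed

definition loc_int :: "'a::euclidean_space set => ('a => real) => bool" where
 "loc_int D h \<longleftrightarrow> (\<forall>K. compact K \<and> K \<subseteq> D --> set_integrable lborel K h)"

text \<open>Box bumps are test functions and converge boundedly to indicators, so the integrals over
  boxes inside D vanish. Dynkin's argument applied to h cut off to one box gives the claim there,
  and D is a countable union of closed boxes.\<close>

lemma fundamental_lemma:
 fixes h :: "real^'n => real"
 assumes D: "open D" and h: "h \<in> bmeas" "loc_int D h"
  and t: "!!phi::real^'n => real. test_fun D phi ==> (LINT x|lborel. phi x * h x) = 0"
 shows "AE x in lborel. x \<in> D --> h x = 0"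
proof -
 have box0: "(LINT x:box a b|lborel. h x) = 0" if "cbox a b \<subseteq> D" for a b
 proof -
  have int: "set_integrable lborel (cbox a b) h" using h that by (auto simp: loc_int_def)
  have "(%m. LINT x|lborel. box_bump m a b x * h x) \<longlonglongrightarrow> (LINT x|lborel. indicator (box a b) x * h x)"
  proof (rule integral_dominated_convergence[where w = "%x. indicator (cbox a b) x * norm (h x)"])
   show "(%x. box_bump m a b x * h x) \<in> borel_measurable lborel" for m
    using borel_measurable_continuous_onI[of "box_bump m a b"] box_bump_Ck[of 0 m a b] h(1)
    by (auto intro!: borel_measurable_times)
   show "integrable lborel (%x. indicator (cbox a b) x * norm (h x))"
    using integrable_norm[OF int[unfolded set_integrable_def]] by (simp add: abs_mult)
   show "AE x in lborel. norm (box_bump m a b x * h x) <= indicator (cbox a b) x * norm (h x)" for m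
    using box_bump_bounds[of m a b] box_bump_eq_0'[of _ a b m]
    by (intro AE_I2) (auto simp: abs_mult indicator_def intro!: mult_left_le_one_le)
  qed (use h box_bump_tendsto in \<open>auto intro!: AE_I2 tendsto_mult tendsto_const\<close>)
  moreover have "(LINT x|lborel. box_bump m a b x * h x) = 0" for m
   by (rule t[OF test_fun_box_bump[OF that]])
  ultimately show ?thesis by (simp add: set_lebesgue_integral_def LIMSEQ_const_iff)
 qed
 have AE_box: "AE x in lborel. x \<in> box a b --> h x = 0" if "cbox a b \<subseteq> D" for a b
 proof -
  have "set_integrable lborel (cbox a b) h" using h that by (auto simp: loc_int_def)
  then have int: "set_integrable lborel (box a b) h"
   by (rule set_integrable_subset) (auto simp: box_subset_cbox)
  have "AE x in lborel. indicator (box a b) x * h x = 0"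
  proof (rule AE_zero_if_box_integrals_zero)
   show "integrable lborel (%x. indicator (box a b) x * h x)"
    using int by (simp add: set_integrable_def)
   show "(LINT x|lborel. indicator (box a b) x * h x) = 0"
    using box0[OF that] by (simp add: set_lebesgue_integral_def)
   fix c d :: "real^'n"
   obtain e f where ef: "box a b \<inter> box c d = box e f" using box_Int_box by blast
   have "(LINT x:box c d|lborel. indicator (box a b) x * h x) = (LINT x:box e f|lborel. h x)"
    unfolding set_lebesgue_integral_def ef[symmetric]
    by (intro Bochner_Integration.integral_cong) (auto simp: indicator_def)
   also have "... = 0"
   \<comment> \<open>If the open intersection is empty, the closed box with the same corners need
     not lie in D; otherwise it is the closure of the open one and stays inside
     \<open>cbox a b\<close>.\<close>
   proof (cases "box e f = {}")
    case False
    then have "cbox e f = closure (box e f)" by (simp add: closure_box)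
    also have "... \<subseteq> closure (box a b)" using ef by (intro closure_mono) auto
    also have "... \<subseteq> cbox a b" by (intro closure_minimal box_subset_cbox closed_cbox)
    finally show ?thesis using that by (intro box0) auto
   qed (simp add: set_lebesgue_integral_def)
   finally show "(LINT x:box c d|lborel. indicator (box a b) x * h x) = 0" .
  qed
  then show ?thesis by eventually_elim (auto simp: indicator_def)
 qed
 have AE_cbox: "AE x in lborel. x \<in> cbox a b --> h x = 0" if "cbox a b \<subseteq> D" for a b
  using AE_box[OF that] AE_not_in[OF null_sets_cbox_Diff_box[of a b]]
  by eventually_elim auto
 obtain \<D> where \<D>: "countable \<D>" "\<D> \<subseteq> Pow D" "!!X. X \<in> \<D> ==> \<exists>a b. X = cbox a b" "\<Union>\<D> = D"
  using open_countable_Union_open_cbox[OF D] by metis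
 have "AE x in lborel. \<forall>X\<in>\<D>. x \<in> X --> h x = 0"
  using \<D>(2,3) AE_cbox by (subst AE_ball_countable[OF \<D>(1)]) blast
 then show ?thesis
  by eventually_elim (use \<D>(4) in auto)
qed

section \<open>Derivatives, supports and translates of test functions\<close>

lemma test_fun_has_derivative:
 "test_fun D phi ==> (phi has_derivative fder phi x) (at x)"
 using frechet_derivative_works[of phi "at x"] unfolding test_fun_def
 by (metis Ck.simps(2))

lemma frechet_derivative_eq_grad:
 fixes phi :: "real^'n => 'b::euclidean_space"
 assumes "phi differentiable (at x)"
 shows "fder phi x v = (\<Sum>i\<in>UNIV. v $ i *R (grad phi x $ i))"
proof -
 have l: "linear (fder phi x)"
  by (rule linear_frechet_derivative[OF assms])
 have "fder phi x v = fder phi x (\<Sum>i\<in>UNIV. v $ i *R axis i 1)"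
  by (simp only: basis_expansion[of v, unfolded scalar_mult_eq_scaleR])
 also have "... = (\<Sum>i\<in>UNIV. v $ i *R fder phi x (axis i 1))"
  by (simp add: linear_sum[OF l] linear_cmul[OF l])
 finally show ?thesis by (simp add: grad_def)
qed

lemma Ck1_continuous_deriv:
 fixes phi :: "real^'n => 'b::euclidean_space"
 assumes "Ck 1 phi"
 shows "continuous_on UNIV (%x. fder phi x v)"
proof -
 have eq: "fder phi x v = (\<Sum>i\<in>UNIV. v $ i *R (grad phi x $ i))" for x
  using assms by (intro frechet_derivative_eq_grad) simp
 show ?thesis unfolding eq
  using assms by (auto intro!: continuous_on_sum continuous_on_scaleR continuous_on_const)
qed

lemma test_fun_continuous_deriv:
 fixes phi :: "real^'n => 'b::euclidean_space"
 shows "test_fun D phi ==> continuous_on UNIV (%x. fder phi x v)"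
 unfolding test_fun_def by (intro Ck1_continuous_deriv) blast

lemma test_fun_continuous: "test_fun D phi ==> continuous_on UNIV phi"
 unfolding test_fun_def by (metis Ck.simps(1))

lemma test_fun_support:
 fixes phi :: "real^'n => 'b::euclidean_space"
 assumes "test_fun D phi"
 obtains K where "compact K" "K \<subseteq> D" "!!x. x \<notin> K ==> phi x = 0"
  "!!x v. x \<notin> K ==> fder phi x v = 0"
proof -
 obtain K where K: "compact K" "K \<subseteq> D" "!!x. x \<notin> K ==> phi x = 0"
  using assms by (auto simp: test_fun_def)
 have "fder phi x v = 0" if "x \<notin> K" for x v
 proof -
  have "(phi has_derivative (%_. 0)) (at x)"
   by (rule has_derivative_transform_within_open[OF has_derivative_const, of "- K"])
     (use K that in \<open>auto simp: compact_imp_closed open_Compl\<close>)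
  from frechet_derivative_at[OF this] show ?thesis by metis
 qed
 with K that show thesis by blast
qed

lemma bounded_if_continuous_compact_support:
 fixes f :: "'a::euclidean_space => 'b::real_normed_vector"
 assumes "continuous_on UNIV f" "compact K" "!!x. x \<notin> K ==> f x = 0"
 obtains B where "B > 0" "!!x. norm (f x) <= B"
proof -
 have "bounded (f ` K)"
  using assms by (intro compact_imp_bounded compact_continuous_image) (auto intro: continuous_on_subset)
 then obtain B where B: "B > 0" "!!x. x \<in> K ==> norm (f x) <= B"
  by (auto simp: bounded_pos)
 have "norm (f x) <= B" for x
  using B assms(3)[of x] by (cases "x \<in> K") auto
 with B(1) that show thesis by blast
qed

lemma test_fun_bounds:
 fixes phi :: "real^'n => 'b::euclidean_space"
 assumes "test_fun D phi"
 obtains B where "B > 0" "!!x. norm (phi x) <= B" "!!x. norm (fder phi x v) <= B"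
proof -
 obtain K where K: "compact K" "!!x. x \<notin> K ==> phi x = 0"
  "!!x v. x \<notin> K ==> fder phi x v = 0"
  using test_fun_support[OF assms] by metis
 obtain B1 where "B1 > 0" "!!x. norm (phi x) <= B1"
  using bounded_if_continuous_compact_support[OF test_fun_continuous[OF assms] K(1)] K by metis
 moreover obtain B2 where "B2 > 0" "!!x. norm (fder phi x v) <= B2"
  using bounded_if_continuous_compact_support[OF test_fun_continuous_deriv[OF assms] K(1)] K by metis
 ultimately show thesis
  by (intro that[of "max B1 B2"]) (auto intro: order_trans simp: le_max_iff_disj)
qed

lemma frechet_derivative_translate:
 fixes phi :: "'a::real_normed_vector => 'b::real_normed_vector"
 assumes "phi differentiable (at (x - c))"
 shows "((%x. phi (x - c)) has_derivative fder phi (x - c)) (at x)"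
  and "fder (%x. phi (x - c)) x = fder phi (x - c)"
proof -
 have "(phi has_derivative fder phi (x - c)) (at (x - c))"
  using assms frechet_derivative_works by blast
 then show *: "((%x. phi (x - c)) has_derivative fder phi (x - c)) (at x)"
  by (rule has_derivative_compose[of "%x. x - c" id, simplified, rotated])
    (auto intro!: derivative_eq_intros simp: id_def)
 from frechet_derivative_at[OF this]
 show "fder (%x. phi (x - c)) x = fder phi (x - c)" by simp
qed

lemma Ck_translate:
 fixes phi :: "real^'n => 'b::euclidean_space"
 shows "Ck k phi ==> Ck k (%x. phi (x - c))"
proof (induction k arbitrary: phi)
 case 0
 then show ?case
  by (auto intro!: continuous_on_compose2[of UNIV phi] continuous_intros)
next
 case (Suc k)
 then have "grad (%x. phi (x - c)) x $ i = grad phi (x - c) $ i" for x i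
  by (simp add: grad_def frechet_derivative_translate)
 then show ?case
  using Suc frechet_derivative_translate(1)[of phi _ c]
  by (metis (no_types, lifting) Ck.simps(2) differentiable_def ext)
qed

lemma test_fun_translate:
 fixes phi :: "real^'n => 'b::euclidean_space"
 assumes "!!k. Ck k phi" "compact K" "!!x. x \<notin> K ==> phi x = 0" "(%x. x + c) ` K \<subseteq> E"
 shows "test_fun E (%x. phi (x - c))"
 unfolding test_fun_def
proof (intro conjI allI exI[of _ "(%x. x + c) ` K"] impI)
 show "compact ((%x. x + c) ` K)"
  using assms(2) by (intro compact_continuous_image) (auto intro!: continuous_intros)
 fix x assume "x \<notin> (%x. x + c) ` K"
 then have "x - c \<notin> K" by (metis diff_add_cancel image_eqI)
 then show "phi (x - c) = 0" by (rule assms(3))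
qed (use assms Ck_translate[OF assms(1)] in auto)

lemma test_fun_mono: "test_fun D phi ==> D \<subseteq> E ==> test_fun E phi"
 by (auto simp: test_fun_def)

section \<open>Translation of integrals and integrability of products with test functions\<close>

lemma nn_integral_translate:
 fixes c :: "'a::euclidean_space"
 assumes [measurable]: "f \<in> bmeas"
 shows "(\<integral>\<^sup>+x. f (x + c) \<partial>lborel) = (\<integral>\<^sup>+x. f x \<partial>lborel)"
proof -
 have "(\<integral>\<^sup>+x. f x \<partial>lborel) = (\<integral>\<^sup>+x. f x \<partial>distr lborel borel ((+) c))"
  by (simp add: lborel_distr_plus)
 also have "... = (\<integral>\<^sup>+x. f (c + x) \<partial>lborel)"
  by (rule nn_integral_distr) auto
 finally show ?thesis by (simp add: add.commute)
qed

lemma lborel_integral_translate: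
 fixes c :: "'a::euclidean_space" and f :: "'a => 'b::euclidean_space"
 assumes [measurable]: "f \<in> bmeas"
 shows "(LINT x|lborel. f (x + c)) = (LINT x|lborel. f x)"
  and "integrable lborel (%x. f (x + c)) \<longleftrightarrow> integrable lborel f"
proof -
 have "(LINT x|lborel. f x) = (LINT x|distr lborel borel ((+) c). f x)"
  by (simp add: lborel_distr_plus)
 also have "... = (LINT x|lborel. f (c + x))"
  by (rule integral_distr) auto
 finally show "(LINT x|lborel. f (x + c)) = (LINT x|lborel. f x)" by (simp add: add.commute)
 have "integrable lborel f \<longleftrightarrow> integrable (distr lborel borel ((+) c)) f"
  by (simp add: lborel_distr_plus)
 also have "... \<longleftrightarrow> integrable lborel (%x. f (c + x))"
  by (rule integrable_distr_eq) auto
 finally show "integrable lborel (%x. f (x + c)) \<longleftrightarrow> integrable lborel f" by (simp add: add.commute)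
qed

lemma AE_translate:
 fixes c :: "'a::euclidean_space"
 assumes "AE x in lborel. P x"
 shows "AE x in lborel. P (x + c)"
proof -
 obtain N where N: "N \<in> null_sets lborel" "{x. \<not> P x} \<subseteq> N"
  using assms by (auto simp: eventually_ae_filter)
 then have N': "N \<in> sets borel" "emeasure lborel N = 0" by auto
 have "(\<integral>\<^sup>+x. indicator N (x + c) \<partial>lborel) = 0"
  using nn_integral_translate[of "indicator N" c] N' by simp
 then have "AE x in lborel. (indicator N (x + c) :: ennreal) = 0"
  using N' by (subst (asm) nn_integral_0_iff_AE) auto
 then show ?thesis
  by eventually_elim (use N(2) in \<open>auto simp: indicator_def split: if_splits\<close>)
qed

lemma integrable_bounded_times:
 fixes f g :: "'a => real"
 assumes "integrable M g" "f \<in> borel_measurable M" "!!x. \<bar>f x\<bar> <= B"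
 shows "integrable M (%x. f x * g x)"
proof (rule Bochner_Integration.integrable_bound[where f = "%x. B * g x"])
 have "\<bar>f x\<bar> * \<bar>g x\<bar> <= \<bar>B\<bar> * \<bar>g x\<bar>" for x
  using assms(3)[of x] by (intro mult_right_mono) auto
 then show "AE x in M. norm (f x * g x) <= norm (B * g x)"
  by (intro AE_I2) (simp add: abs_mult)
qed (use assms in auto)

lemma integrable_supported_times:
 fixes f g :: "'a::euclidean_space => real"
 assumes "set_integrable lborel K g" "f \<in> bmeas" "!!x. \<bar>f x\<bar> <= B" "!!x. x \<notin> K ==> f x = 0"
 shows "integrable lborel (%x. f x * g x)"
proof -
 have "integrable lborel (%x. f x * (indicator K x *R g x))"
  using assms by (intro integrable_bounded_times[where B = B]) (auto simp: set_integrable_def)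
 also have "(%x. f x * (indicator K x *R g x)) = (%x. f x * g x)"
  using assms(4) by (auto simp: fun_eq_iff split: split_indicator)
 finally show ?thesis .
qed

lemma test_fun_integrable:
 fixes phi :: "real^'n => real"
 assumes "test_fun D phi" "loc_int D p"
 shows "integrable lborel (%x. phi x * p x)" "integrable lborel (%x. fder phi x v * p x)"
proof -
 obtain K where K: "compact K" "K \<subseteq> D" "!!x. x \<notin> K ==> phi x = 0"
  "!!x v. x \<notin> K ==> fder phi x v = 0"
  using test_fun_support[OF assms(1)] by metis
 obtain B where B: "B > 0" "!!x. norm (phi x) <= B" "!!x. norm (fder phi x v) <= B"
  using test_fun_bounds[OF assms(1), of v] by metis
 have i: "set_integrable lborel K p" using K assms(2) by (auto simp: loc_int_def)
 show "integrable lborel (%x. phi x * p x)"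
  using i B K test_fun_continuous[OF assms(1)]
  by (intro integrable_supported_times[where B = B]) (auto intro: borel_measurable_continuous_onI)
 show "integrable lborel (%x. fder phi x v * p x)"
  using i B K test_fun_continuous_deriv[OF assms(1)]
  by (intro integrable_supported_times[where B = B]) (auto intro: borel_measurable_continuous_onI)
qed

text \<open>A scalar weak derivative along a single vector. The integrals run over the whole space,
  as test functions vanish outside D; integrability of the functions is not included and is supplied
  separately by \<open>loc_int\<close>.\<close>

definition weak_dir ::
 "(real^'n) set => real^'n => (real^'n => real) => (real^'n => real) => bool" where
 "weak_dir D v p q \<longleftrightarrow> (\<forall>phi. test_fun D phi -->
   (LINT x|lborel. fder phi x v * p x) = - (LINT x|lborel. phi x * q x))"

text \<open>The complement of this set consists of the differences of a point of the closed set
  \<open>- D\<close> and a point of the compact segment, and closed minus compact is closed.\<close>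

lemma open_segment_inside:
 fixes D :: "'a::euclidean_space set"
 assumes "open D"
 shows "open {x. \<forall>t\<in>{0..1}. x + t *R z \<in> D}"
proof -
 define C where "C = (%t::real. t *R z) ` {0..1}"
 have "compact C"
  unfolding C_def by (intro compact_continuous_image) (auto intro!: continuous_intros)
 then have cl: "closed (\<Union>x\<in>- D. \<Union>y\<in>C. {x - y})"
  using assms by (intro closed_compact_differences) (auto simp: closed_def)
 have eq: "{x. \<forall>t\<in>{0..1}. x + t *R z \<in> D} = - (\<Union>x\<in>- D. \<Union>y\<in>C. {x - y})"
 proof (intro set_eqI iffI)
  fix x assume "x \<in> - (\<Union>x\<in>- D. \<Union>y\<in>C. {x - y})"
  then have "x + y \<in> D" if "y \<in> C" for y
   using that by (metis (no_types, lifting) ComplI UN_iff add_diff_cancel_right' insertI1 ComplD)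
  then show "x \<in> {x. \<forall>t\<in>{0..1}. x + t *R z \<in> D}" by (auto simp: C_def)
 next
  fix x assume x: "x \<in> {x. \<forall>t\<in>{0..1}. x + t *R z \<in> D}"
  have "x ~= w - y" if "w \<notin> D" "y \<in> C" for w y
   using x that by (auto simp: C_def)
  then show "x \<in> - (\<Union>x\<in>- D. \<Union>y\<in>C. {x - y})" by blast
 qed
 show ?thesis by (rule ssubst[where P = "open", OF eq open_Compl[OF cl]])
qed

lemma compact_segment_sweep:
 fixes K :: "'a::euclidean_space set"
 assumes "compact K"
 shows "compact ((%(x, t). x + t *R z) ` (K \<times> {0..1::real}))"
 using assms by (intro compact_continuous_image compact_Times)
  (auto intro!: continuous_intros simp: split_beta)

lemma integrable_segment:
 fixes q :: "'a::euclidean_space => real"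
 assumes q[measurable]: "q \<in> bmeas"
  and K: "compact K" and K': "compact K'" "!!x t. x \<in> K ==> t \<in> {0..1} ==> x + t *R z \<in> K'"
  and int: "set_integrable lborel K' q"
 shows "integrable (lborel \<Otimes>\<^sub>M lborel) (%(x, t). indicator K x * (indicator {0..1} t * q (x + t *R z)))"
  (is "integrable _ ?f")
proof -
 have [measurable]: "K \<in> sets borel" "K' \<in> sets borel"
  using K K' by (auto intro: borel_compact)
 have m[measurable]: "?f \<in> borel_measurable (lborel \<Otimes>\<^sub>M lborel)" by measurable
 define C where "C = (nni (%x. indicator K' x * \<bar>q x\<bar>))"
 have "C < \<infinity>"
  using int unfolding set_integrable_def integrable_iff_bounded C_def by (simp add: abs_mult)
 have "(\<integral>\<^sup>+p. norm (?f p) \<partial>(lborel \<Otimes>\<^sub>M lborel)) = (\<integral>\<^sup>+t. \<integral>\<^sup>+x. norm (?f (x, t)) \<partial>lborel \<partial>lborel)"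
  by (rule lborel_pair.nn_integral_snd[symmetric]) auto
 also have "... <= (\<integral>\<^sup>+t. indicator {0..1::real} t * C \<partial>lborel)"
 proof (rule nn_integral_mono)
  fix t :: real
  have "(\<integral>\<^sup>+x. norm (?f (x, t)) \<partial>lborel)
    <= (\<integral>\<^sup>+x. indicator {0..1} t * ennreal (indicator K' (x + t *R z) * \<bar>q (x + t *R z)\<bar>) \<partial>lborel)"
   using K'(2) by (intro nn_integral_mono) (auto simp: indicator_def)
  also have "... = indicator {0..1} t * (nni (%x. indicator K' (x + t *R z) * \<bar>q (x + t *R z)\<bar>))"
   by (rule nn_integral_cmult) auto
  also have "(nni (%x. indicator K' (x + t *R z) * \<bar>q (x + t *R z)\<bar>)) = C"
   unfolding C_def by (rule nn_integral_translate) auto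
  finally show "(\<integral>\<^sup>+x. norm (?f (x, t)) \<partial>lborel) <= indicator {0..1} t * C" .
 qed
 also have "... = C" by (subst nn_integral_multc) auto
 finally show ?thesis
  using \<open>C < \<infinity>\<close> m by (auto simp: integrable_iff_bounded)
qed

text \<open>A test function pushed along the segment from \<open>x\<close> to \<open>x + z\<close> stays admissible, so
 \<open>t \<mapsto> \<integral>psi(x - tz) p(x) dx\<close> is differentiable and the weak derivative integrates.\<close>

lemma frechet_line:
 fixes phi :: "'a::real_normed_vector => real"
 assumes "phi differentiable (at x)"
 shows "((%h. (phi (x + h *R v) - phi x) / h) \<longlongrightarrow> fder phi x v) (at 0)"
proof -
 have "(phi has_derivative fder phi x) (at (x + 0 *R v))"
  using iffD1[OF frechet_derivative_works assms] by simp
 moreover have "((%h. x + h *R v) has_derivative (%s. s *R v)) (at 0)"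
  by (auto intro!: derivative_eq_intros)
 ultimately have "((%h. phi (x + h *R v)) has_derivative (%s. fder phi x (s *R v))) (at 0)"
  using has_derivative_compose by blast
 then have "((%h. phi (x + h *R v)) has_real_derivative fder phi x v) (at 0)"
  using linear_frechet_derivative[OF assms]
  by (simp add: has_field_derivative_def linear_cmul mult.commute[of _ "fder phi x v"])
 then show ?thesis by (simp add: DERIV_def)
qed

lemma frechet_lipschitz:
 fixes phi :: "'a::real_normed_vector => real"
 assumes d: "!!x. phi differentiable (at x)" and B: "!!x. \<bar>fder phi x v\<bar> <= B"
 shows "\<bar>phi (x + t *R v) - phi x\<bar> <= B * \<bar>t\<bar>"
proof -
 have "((%h. phi (x + h *R v)) has_real_derivative fder phi (x + t *R v) v) (at t)" for t
  using frechet_line[OF d, of "x + t *R v" v]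
  by (simp add: DERIV_def scaleR_left_distrib add.assoc)
 then have "norm (phi (x + t *R v) - phi (x + 0 *R v)) <= B * norm (t - 0)"
  by (intro field_differentiable_bound[of UNIV _ "%t. fder phi (x + t *R v) v"])
    (use B in \<open>auto intro: has_field_derivative_at_within\<close>)
 then show ?thesis by simp
qed

text \<open>Along v the function \<open>psi\<close> is Lipschitz with the bound of its derivative,
  and K contains the supports of all the shifted functions, so B |p| on K dominates the quotients.
  The sign comes from the shift by -h.\<close>

lemma test_quotient_limit:
 fixes psi :: "real^'n => real"
 assumes t: "test_fun UNIV psi" and p: "p \<in> bmeas" "set_integrable lborel K p"
  and h: "h \<longlonglongrightarrow> 0" "!!n. h n ~= 0" and out: "!!x n. x \<notin> K ==> psi (x - h n *R v) = 0 \<and> psi x = 0"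
 shows "(%n. LINT x|lborel. (psi (x - h n *R v) - psi x) / h n * p x) \<longlonglongrightarrow> (LINT x|lborel. (- fder psi x v) * p x)"
proof -
 obtain B where B: "!!x. \<bar>fder psi x v\<bar> <= B" using test_fun_bounds[OF t, of v] unfolding real_norm_def by metis
 have diff: "psi differentiable (at x)" for x using test_fun_has_derivative[OF t] by (auto simp: differentiable_def)
 have [measurable]: "psi \<in> bmeas" "(%x. fder psi x v) \<in> bmeas" "p \<in> bmeas"
  using test_fun_continuous[OF t] test_fun_continuous_deriv[OF t] p(1) by (auto intro: borel_measurable_continuous_onI)
 show ?thesis
 proof (rule integral_dominated_convergence[where w = "%x. B * norm (indicator K x *R p x)"])
  show "integrable lborel (%x. B * norm (indicator K x *R p x))" using p(2) by (auto simp: set_integrable_def)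
  show "AE x in lborel. (%n. (psi (x - h n *R v) - psi x) / h n * p x) \<longlonglongrightarrow> (- fder psi x v) * p x"
  proof (intro AE_I2 tendsto_mult tendsto_const)
   fix x
   have "filterlim (%n. - h n) (at 0) sequentially" using h(2) tendsto_minus[OF h(1)] by (auto simp: filterlim_at)
   from tendsto_minus[OF filterlim_compose[OF frechet_line[OF diff] this]]
   show "(%n. (psi (x - h n *R v) - psi x) / h n) \<longlonglongrightarrow> - fder psi x v" by simp
  qed
  show "AE x in lborel. norm ((psi (x - h n *R v) - psi x) / h n * p x) <= B * norm (indicator K x *R p x)" for n
  proof (rule AE_I2)
   fix x
   have "\<bar>(psi (x - h n *R v) - psi x) / h n\<bar> <= B * indicator K x"
   proof (cases "x \<in> K")
    case True
    have "\<bar>psi (x + (- h n) *R v) - psi x\<bar> <= B * \<bar>- h n\<bar>" by (rule frechet_lipschitz[OF diff B])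
    then show ?thesis using True h(2)[of n] by (simp add: divide_le_eq abs_divide)
   qed (use out in auto)
   then have "\<bar>(psi (x - h n *R v) - psi x) / h n\<bar> * \<bar>p x\<bar> <= B * indicator K x * \<bar>p x\<bar>" by (rule mult_right_mono) simp
   then show "norm ((psi (x - h n *R v) - psi x) / h n * p x) <= B * norm (indicator K x *R p x)" by (simp add: abs_mult)
  qed
 qed measurable
qed

lemma weak_dir_segment:
 fixes p q :: "real^'n => real"
 assumes D: "open D" and p[measurable]: "p \<in> bmeas" and q[measurable]: "q \<in> bmeas"
  and lp: "loc_int D p" and lq: "loc_int D q" and w: "weak_dir D z p q"
 shows "AE x in lborel. (\<forall>t\<in>{0..1}. x + t *R z \<in> D) -->
  p (x + z) - p x = (LINT t:{0..1}|lborel. q (x + t *R z))"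
proof -
 define U where "U = {x. \<forall>t\<in>{0..1}. x + t *R z \<in> D}"
 have U: "open U" unfolding U_def by (rule open_segment_inside[OF D])
 define h where "h = (%x. p (x + z) - p x - (LINT t:{0..1}|lborel. q (x + t *R z)))"
 have [measurable]: "(%x. LINT t:{0..1}|lborel. q (x + t *R z)) \<in> bmeas"
  unfolding set_lebesgue_integral_def by (rule lborel.borel_measurable_lebesgue_integral) measurable
 have h_m: "h \<in> bmeas" unfolding h_def by measurable
 define sweep where "sweep K = (%(x, t). x + t *R z) ` (K \<times> {0..1::real})" for K
 have sweep: "compact (sweep K)" "sweep K \<subseteq> D" "!!x t. x \<in> K ==> t \<in> {0..1} ==> x + t *R z \<in> sweep K"
  if "compact K" "K \<subseteq> U" for K
  using that compact_segment_sweep[OF that(1)] by (force simp: sweep_def U_def)+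
 have l1: "set_integrable lborel K p" "set_integrable lborel K (%x. p (x + z))"
  "integrable (lborel \<Otimes>\<^sub>M lborel) (%(x, t). indicator K x * (indicator {0..1} t * q (x + t *R z)))"
  if K: "compact K" "K \<subseteq> U" for K
 proof -
  note s = sweep[OF K]
  have i: "set_integrable lborel (sweep K) p" "set_integrable lborel (sweep K) q"
   using s lp lq by (auto simp: loc_int_def)
  have [measurable]: "K \<in> sets borel" using K by (auto intro: borel_compact)
  have "K \<subseteq> sweep K" using s(3)[of _ 0] by auto
  then show "set_integrable lborel K p"
   by (intro set_integrable_subset[OF i(1)]) auto
  have "(%x. x + z) ` K \<subseteq> sweep K" using s(3)[of _ 1] by auto
  moreover have *: "compact ((%x. x + z) ` K)"
   using K by (intro compact_continuous_image) (auto intro!: continuous_intros)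
  moreover have **: "(%x. x + z) ` K \<in> sets borel" using * by (rule borel_compact)
  ultimately have "set_integrable lborel ((%x. x + z) ` K) p"
   by (intro set_integrable_subset[OF i(1)]) auto
  then have "integrable lborel (%x. indicator ((%x. x + z) ` K) (x + z) * p (x + z))"
   using ** by (subst lborel_integral_translate) (auto simp: set_integrable_def)
  also have "(%x. indicator ((%x. x + z) ` K) (x + z) * p (x + z)) = (%x. indicator K x * p (x + z))"
   by (auto simp: fun_eq_iff split: split_indicator)
  finally show "set_integrable lborel K (%x. p (x + z))" by (simp add: set_integrable_def)
  show "integrable (lborel \<Otimes>\<^sub>M lborel) (%(x, t). indicator K x * (indicator {0..1} t * q (x + t *R z)))"
   by (rule integrable_segment[OF q K(1) s(1) s(3) i(2)])
 qed
 have l2: "set_integrable lborel K (%x. LINT t:{0..1}|lborel. q (x + t *R z))" if K: "compact K" "K \<subseteq> U" for K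
  using lborel_pair.integrable_fst'[OF l1(3)[OF K]]
  by (simp add: set_integrable_def set_lebesgue_integral_def)
 have h_l: "loc_int U h"
  unfolding loc_int_def h_def using l1(1,2) l2 by (auto intro!: set_integral_diff)
 have main: "(LINT x|lborel. psi x * h x) = 0" if psi: "test_fun U psi" for psi :: "real^'n => real"
 proof -
  obtain K where K: "compact K" "K \<subseteq> U" "!!x. x \<notin> K ==> psi x = 0"
   "!!x v. x \<notin> K ==> fder psi x v = 0"
   using test_fun_support[OF psi] by metis
  obtain B where B: "B > 0" "!!x. norm (psi x) <= B" "!!x. norm (fder psi x z) <= B"
   using test_fun_bounds[OF psi, of z] by metis
  note s = sweep[OF K(1,2)]
  have Ck: "!!k. Ck k psi" using psi by (auto simp: test_fun_def)
  have diff: "psi differentiable (at x)" for x using Ck[of 1] by simp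
  have [measurable]: "psi \<in> bmeas" "K \<in> sets borel"
   using test_fun_continuous[OF psi] K(1) by (auto intro: borel_measurable_continuous_onI borel_compact)
  have i: "set_integrable lborel (sweep K) p" "set_integrable lborel (sweep K) q"
   using s lp lq by (auto simp: loc_int_def)
  define Psi where "Psi t = (LINT x|lborel. psi (x - t *R z) * p x)" for t :: real
  have tt: "test_fun D (%x. psi (x - t *R z))" if "t \<in> {0..1}" for t
   by (rule test_fun_translate[OF Ck K(1,3)]) (use s that in auto)
  have supp: "psi (x - t *R z) = 0" if "x \<notin> sweep K" "t \<in> {0..1}" for x t
   using s(3)[of "x - t *R z" t] that K(3) by force
  \<comment> \<open>The pushed test function is supported in D for t in [0,1] only, hence the
    derivative within this interval. At each t the weak derivative is tested with psi(x - tz)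
    itself.\<close>
  have deriv: "(Psi has_real_derivative (LINT x|lborel. psi (x - t *R z) * q x)) (at t within {0..1})"
   if t: "t \<in> {0..1}" for t
   unfolding has_field_derivative_iff tendsto_at_iff_sequentially
  proof (intro allI impI)
   fix X :: "nat => real" assume X: "\<forall>i. X i \<in> {0..1} - {t}" "X \<longlonglongrightarrow> t"
   define h where "h n = X n - t" for n
   have "(%n. LINT x|lborel. (psi ((x - h n *R z) - t *R z) - psi (x - t *R z)) / h n * p x)
     \<longlonglongrightarrow> (LINT x|lborel. (- fder (%x. psi (x - t *R z)) x z) * p x)"
   proof (rule test_quotient_limit[OF test_fun_mono[OF tt[OF t] subset_UNIV] p i(1)])
    show "h \<longlonglongrightarrow> 0" using LIM_zero[OF X(2)] by (simp add: h_def[abs_def])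
    show "h n ~= 0" for n using X(1) by (auto simp: h_def)
    show "psi ((x - h n *R z) - t *R z) = 0 \<and> psi (x - t *R z) = 0" if "x \<notin> sweep K" for x n
     using supp[OF that, of "X n"] supp[OF that t] X(1) by (auto simp: h_def algebra_simps)
   qed
   also have "(LINT x|lborel. (- fder (%x. psi (x - t *R z)) x z) * p x) = (LINT x|lborel. psi (x - t *R z) * q x)"
    using w[unfolded weak_dir_def, rule_format, OF tt[OF t]] by simp
   also have "(%n. LINT x|lborel. (psi ((x - h n *R z) - t *R z) - psi (x - t *R z)) / h n * p x) = (%y. (Psi y - Psi t) / (y - t)) \<circ> X"
   proof
    fix n
    have e: "x - h n *R z - t *R z = x - X n *R z" for x by (simp add: h_def algebra_simps)
    have "(LINT x|lborel. (psi (x - h n *R z - t *R z) - psi (x - t *R z)) / h n * p x)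
     = (LINT x|lborel. (psi (x - X n *R z) * p x - psi (x - t *R z) * p x) / (X n - t))"
     unfolding e h_def by (simp add: algebra_simps diff_divide_distrib)
    also have "... = (Psi (X n) - Psi t) / (X n - t)"
     unfolding Psi_def using test_fun_integrable(1)[OF tt lp] X(1) t
     by (subst integral_divide_zero, subst Bochner_Integration.integral_diff) auto
    finally show "(LINT x|lborel. (psi (x - h n *R z - t *R z) - psi (x - t *R z)) / h n * p x) = ((%y. (Psi y - Psi t) / (y - t)) \<circ> X) n" by simp
   qed
   finally show "((%y. (Psi y - Psi t) / (y - t)) \<circ> X) \<longlonglongrightarrow> (LINT x|lborel. psi (x - t *R z) * q x)" .
  qed
  have HK: "((%t. LINT x|lborel. psi (x - t *R z) * q x) has_integral Psi 1 - Psi 0) {0..1}"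
   using deriv by (intro fundamental_theorem_of_calculus) (auto simp: has_real_derivative_iff_has_vector_derivative)
  have tr: "(LINT x|lborel. psi (x - t *R z) * q x) = (LINT x|lborel. psi x * q (x + t *R z))" for t
   by (subst lborel_integral_translate(1)[where c = "t *R z", symmetric]) auto
  \<comment> \<open>Joint integrability for the theorem of Fubini; \<open>psi\<close> is bounded and
    vanishes off K, so the integrability over K of the shifted q along the segment suffices.\<close>
  have I: "integrable (lborel \<Otimes>\<^sub>M lborel) (%(x, t). psi x * (indicator {0..1} t * q (x + t *R z)))"
  proof -
   have "integrable (lborel \<Otimes>\<^sub>M lborel) (%p. psi (fst p) * (case p of (x, t) => indicator K x * (indicator {0..1} t * q (x + t *R z))))"
    using B(2) by (intro integrable_bounded_times[OF l1(3)[OF K(1,2)], where B = B]) auto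
   also have "(%p. psi (fst p) * (case p of (x, t) => indicator K x * (indicator {0..1} t * q (x + t *R z))))
     = (%(x, t). psi x * (indicator {0..1} t * q (x + t *R z)))"
    using K(3) by (auto simp: fun_eq_iff split: split_indicator)
   finally show ?thesis .
  qed
  have eq1: "(LINT x|lborel. psi x * (indicator {0..1} t * q (x + t *R z)))
    = indicator {0..1} t *R (LINT x|lborel. psi (x - t *R z) * q x)" for t
   by (simp add: tr indicator_def)
  have J: "set_integrable lborel {0..1} (%t. LINT x|lborel. psi (x - t *R z) * q x)"
   using lborel_pair.integrable_fst'[OF lborel_pair.integrable_product_swap[OF I]]
   by (simp add: eq1 set_integrable_def)
  have "(LINT t:{0..1}|lborel. LINT x|lborel. psi (x - t *R z) * q x) = Psi 1 - Psi 0"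
   using set_borel_integral_eq_integral(2)[OF J] integral_unique[OF HK] by simp
  moreover have "(LINT t:{0..1}|lborel. LINT x|lborel. psi (x - t *R z) * q x)
    = (LINT x|lborel. psi x * (LINT t:{0..1}|lborel. q (x + t *R z)))"
   using lborel_pair.Fubini_integral[of "%x t. psi x * (indicator {0..1} t * q (x + t *R z))", OF I]
   unfolding set_lebesgue_integral_def by (simp add: eq1)
  moreover have "Psi 1 = (LINT x|lborel. psi x * p (x + z))"
   unfolding Psi_def by (subst lborel_integral_translate(1)[where c = z, symmetric]) auto
  moreover have "Psi 0 = (LINT x|lborel. psi x * p x)" by (simp add: Psi_def)
  moreover have ii: "integrable lborel (%x. psi x * p (x + z))" "integrable lborel (%x. psi x * p x)"
   "integrable lborel (%x. psi x * (LINT t:{0..1}|lborel. q (x + t *R z)))"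
   using l1(1,2)[OF K(1,2)] l2[OF K(1,2)] B K(3) by (auto intro!: integrable_supported_times[where B = B])
  moreover have "(LINT x|lborel. psi x * h x) = (LINT x|lborel. psi x * p (x + z)) - (LINT x|lborel. psi x * p x)
    - (LINT x|lborel. psi x * (LINT t:{0..1}|lborel. q (x + t *R z)))"
   unfolding h_def right_diff_distrib using ii by simp
  ultimately show ?thesis by simp
 qed
 have "AE x in lborel. x \<in> U --> h x = 0"
  by (rule fundamental_lemma[OF U h_m h_l]) (rule main)
 then show ?thesis by eventually_elim (auto simp: U_def h_def)
qed

subsection \<open>Bounds in $L^p$\<close>

text \<open>The number \<open>al\<close> is any bound of the norm and not the norm itself, so bounds
  compose by arithmetic. With an integral in \<open>ennreal\<close>, finiteness is part of the
  statement and no integrability has to be proved first.\<close>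

definition Lb :: "nat => ('a::euclidean_space => real) => real => bool" where
 "Lb p f al \<longleftrightarrow> f \<in> bmeas \<and> 0 <= al \<and>
   (nni (%x. \<bar>f x\<bar> ^ p)) <= ennreal (al ^ p)"

lemma LbD:
 assumes "Lb p f al"
 shows "f \<in> bmeas" "0 <= al" "(nni (%x. \<bar>f x\<bar> ^ p)) <= ennreal (al ^ p)"
 using assms by (auto simp: Lb_def)

lemma Lb_mono: "Lb p f al ==> al <= be ==> Lb p f be"
 unfolding Lb_def by (auto intro: order_trans[OF _ ennreal_leI] power_mono)

lemma Lb_dominated:
 assumes "Lb p f al" "g \<in> bmeas" "AE x in lborel. \<bar>g x\<bar> <= \<bar>f x\<bar>"
 shows "Lb p g al"
proof -
 have "(nni (%x. \<bar>g x\<bar> ^ p)) <= (nni (%x. \<bar>f x\<bar> ^ p))"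
  by (rule nn_integral_mono_AE) (use assms(3) in \<open>auto elim!: eventually_mono intro!: ennreal_leI power_mono\<close>)
 then show ?thesis using assms(1,2) by (auto simp: Lb_def)
qed

lemma Lb_cong_AE:
 assumes "Lb p f al" "g \<in> bmeas" "AE x in lborel. g x = f x"
 shows "Lb p g al"
 using assms by (intro Lb_dominated[OF assms(1)]) (auto elim: eventually_mono)

lemma Lb_cmult:
 assumes "Lb p f al"
 shows "Lb p (%x. c * f x) (\<bar>c\<bar> * al)"
proof -
 have [measurable]: "f \<in> bmeas" using assms by (simp add: Lb_def)
 have "(nni (%x. \<bar>c * f x\<bar> ^ p)) = (\<integral>\<^sup>+x. ennreal (\<bar>c\<bar> ^ p) * ennreal (\<bar>f x\<bar> ^ p) \<partial>lborel)"
  by (intro nn_integral_cong) (simp add: abs_mult power_mult_distrib ennreal_mult)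
 also have "... = ennreal (\<bar>c\<bar> ^ p) * (nni (%x. \<bar>f x\<bar> ^ p))"
  by (rule nn_integral_cmult) auto
 also have "... <= ennreal (\<bar>c\<bar> ^ p) * ennreal (al ^ p)"
  using LbD[OF assms] by (intro mult_left_mono) auto
 also have "... = ennreal ((\<bar>c\<bar> * al) ^ p)"
  using LbD[OF assms] by (simp add: ennreal_mult power_mult_distrib)
 finally show ?thesis using LbD[OF assms] by (auto simp: Lb_def)
qed

lemma Lb_bounded_mult:
 assumes "Lb p f al" "b \<in> bmeas" "AE x in lborel. \<bar>b x\<bar> <= K"
 shows "Lb p (%x. b x * f x) (\<bar>K\<bar> * al)"
proof (rule Lb_dominated[OF Lb_cmult[OF assms(1), of K]])
 show "AE x in lborel. \<bar>b x * f x\<bar> <= \<bar>K * f x\<bar>"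
  using assms(3) by eventually_elim (auto simp: abs_mult intro!: mult_right_mono)
qed (use assms LbD(1)[OF assms(1)] in auto)

lemma Lb_translate:
 assumes "Lb p f al"
 shows "Lb p (%x. f (x + c)) al"
proof -
 have [measurable]: "f \<in> bmeas" using assms by (simp add: Lb_def)
 show ?thesis
  using assms nn_integral_translate[of "%x. ennreal (\<bar>f x\<bar> ^ p)" c] by (auto simp: Lb_def)
qed

lemma Lb_minus: "Lb p f al ==> Lb p (%x. - f x) al"
 by (auto simp: Lb_def)

lemma Lb_0: "Lb p f 0 ==> p > 0 ==> AE x in lborel. f x = 0"
proof -
 assume a: "Lb p f 0" "p > 0"
 then have [measurable]: "f \<in> bmeas" by (simp add: Lb_def)
 have "(nni (%x. \<bar>f x\<bar> ^ p)) = 0" using a by (auto simp: Lb_def zero_power)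
 then have "AE x in lborel. ennreal (\<bar>f x\<bar> ^ p) = 0"
  by (subst (asm) nn_integral_0_iff_AE) auto
 then show ?thesis by eventually_elim (use a in \<open>auto simp: ennreal_eq_0_iff power_le_zero_eq\<close>)
qed

text \<open>In the induction step the defect is s t (a - b)(a^n - b^n), and both factors have the
  same sign.\<close>

lemma convex_power_real:
 fixes a b s t :: real
 assumes "0 <= a" "0 <= b" "0 <= s" "0 <= t" "s + t = 1"
 shows "(s * a + t * b) ^ n <= s * a ^ n + t * b ^ n"
proof (induction n)
 case 0
 then show ?case using assms by simp
next
 case (Suc n)
 have "(s * a + t * b) ^ Suc n <= (s * a + t * b) * (s * a ^ n + t * b ^ n)"
  using Suc assms by (simp add: mult_left_mono)
 also have "... = s * a ^ Suc n + t * b ^ Suc n - s * t * ((a - b) * (a ^ n - b ^ n))"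
 proof -
  have t: "t = 1 - s" using assms by simp
  show ?thesis unfolding t by (simp add: algebra_simps)
 qed
 also have "(a - b) * (a ^ n - b ^ n) >= 0"
  using assms power_mono[of a b n] power_mono[of b a n]
  by (cases "a <= b") (auto intro: mult_nonpos_nonpos mult_nonneg_nonneg)
 then have "s * a ^ Suc n + t * b ^ Suc n - s * t * ((a - b) * (a ^ n - b ^ n)) <= s * a ^ Suc n + t * b ^ Suc n"
  using assms by (simp add: mult_nonneg_nonneg)
 finally show ?case .
qed

text \<open>Minkowski's inequality from convexity of the power: |f + g| / (al + be) is at most the
  convex combination of |f| / al and |g| / be with weights al / (al + be) and be / (al + be).
  Vanishing bounds are treated apart because of the divisions.\<close>

lemma Lb_add:
 assumes f: "Lb p f al" and g: "Lb p g be" and p: "p > 0"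
 shows "Lb p (%x. f x + g x) (al + be)"
proof (cases "al = 0 \<or> be = 0")
 case True
 have m: "(%x. f x + g x) \<in> bmeas" using f g by (auto simp: Lb_def)
 from True show ?thesis
 proof
  assume "al = 0"
  then have "AE x in lborel. f x + g x = g x" using Lb_0[of p f] f p by (auto elim: eventually_mono)
  from Lb_cong_AE[OF g m this] show ?thesis using \<open>al = 0\<close> by simp
 next
  assume "be = 0"
  then have "AE x in lborel. f x + g x = f x" using Lb_0[of p g] g p by (auto elim: eventually_mono)
  from Lb_cong_AE[OF f m this] show ?thesis using \<open>be = 0\<close> by simp
 qed
next
 case False
 have [measurable]: "f \<in> bmeas" "g \<in> bmeas" using f g by (auto simp: Lb_def)
 have pos: "al > 0" "be > 0" using False f g by (auto simp: Lb_def)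
 define s t where "s = al / (al + be)" and "t = be / (al + be)"
 have st: "s > 0" "t > 0" "s + t = 1" using pos by (auto simp: s_def t_def add_divide_distrib[symmetric])
 have pw: "\<bar>f x + g x\<bar> ^ p <= (al + be) ^ p * (s / al ^ p) * \<bar>f x\<bar> ^ p + (al + be) ^ p * (t / be ^ p) * \<bar>g x\<bar> ^ p" for x
 proof -
  have "\<bar>f x + g x\<bar> <= (al + be) * (s * (\<bar>f x\<bar> / al) + t * (\<bar>g x\<bar> / be))"
  proof -
   have "(al + be) * s = al" "(al + be) * t = be" using pos by (auto simp: s_def t_def)
   then have "(al + be) * (s * (\<bar>f x\<bar> / al) + t * (\<bar>g x\<bar> / be)) = al * (\<bar>f x\<bar> / al) + be * (\<bar>g x\<bar> / be)"
    by (simp only: distrib_left mult.assoc[symmetric])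
   then show ?thesis using pos abs_triangle_ineq[of "f x" "g x"] by simp
  qed
  then have "\<bar>f x + g x\<bar> ^ p <= ((al + be) * (s * (\<bar>f x\<bar> / al) + t * (\<bar>g x\<bar> / be))) ^ p"
   by (rule power_mono) simp
  also have "... <= (al + be) ^ p * (s * (\<bar>f x\<bar> / al) ^ p + t * (\<bar>g x\<bar> / be) ^ p)"
   unfolding power_mult_distrib using pos st by (intro mult_left_mono convex_power_real) auto
  also have "... = (al + be) ^ p * (s / al ^ p) * \<bar>f x\<bar> ^ p + (al + be) ^ p * (t / be ^ p) * \<bar>g x\<bar> ^ p"
   by (simp add: power_divide algebra_simps)
  finally show ?thesis .
 qed
 have "(nni (%x. \<bar>f x + g x\<bar> ^ p))
   <= (\<integral>\<^sup>+x. ennreal ((al + be) ^ p * (s / al ^ p)) * ennreal (\<bar>f x\<bar> ^ p)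
      + ennreal ((al + be) ^ p * (t / be ^ p)) * ennreal (\<bar>g x\<bar> ^ p) \<partial>lborel)"
  using pw pos st
  by (intro nn_integral_mono) (auto simp: ennreal_mult[symmetric] ennreal_plus[symmetric] simp del: ennreal_plus intro!: ennreal_leI)
 also have "... = ennreal ((al + be) ^ p * (s / al ^ p)) * (nni (%x. \<bar>f x\<bar> ^ p))
      + ennreal ((al + be) ^ p * (t / be ^ p)) * (nni (%x. \<bar>g x\<bar> ^ p))"
  by (subst nn_integral_add) (auto simp: nn_integral_cmult)
 also have "... <= ennreal ((al + be) ^ p * (s / al ^ p)) * ennreal (al ^ p)
      + ennreal ((al + be) ^ p * (t / be ^ p)) * ennreal (be ^ p)"
  using LbD[OF f] LbD[OF g] by (intro add_mono mult_left_mono) auto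
 also have "... = ennreal ((al + be) ^ p * s + (al + be) ^ p * t)"
  using pos st by (subst ennreal_plus) (auto simp: ennreal_mult[symmetric])
 also have "(al + be) ^ p * s + (al + be) ^ p * t = (al + be) ^ p"
  using st by (simp add: distrib_left[symmetric])
 finally show ?thesis using pos by (auto simp: Lb_def)
qed

lemma Lb_diff:
 assumes "Lb p f al" "Lb p g be" "p > 0"
 shows "Lb p (%x. f x - g x) (al + be)"
 using Lb_add[OF assms(1) Lb_minus[OF assms(2)] assms(3)] by simp

lemma Lb_zero: "p > 0 ==> Lb p (%x. 0) 0"
 by (simp add: Lb_def zero_power)

lemma Lb_sum:
 assumes "finite I" "!!i. i \<in> I ==> Lb p (f i) (al i)" "p > 0"
 shows "Lb p (%x. \<Sum>i\<in>I. f i x) (\<Sum>i\<in>I. al i)"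
 using assms(1,2) by (induction I rule: finite_induct) (auto intro: Lb_zero Lb_add assms(3))

lemma ennreal_power2_le_D:
 assumes "(x::ennreal)^2 <= ennreal (a^2)" "a >= 0"
 shows "x <= ennreal a"
proof (cases x)
 case (real r)
 then have "r^2 <= a^2" using assms by (simp add: ennreal_power)
 then show ?thesis using real assms(2) by (simp add: power2_le_iff_abs_le)
next
 case top
 then show ?thesis using assms(1) by (simp add: power2_eq_square ennreal_mult_top top_unique)
qed

lemma nn_Cauchy_Schwarz:
 fixes f g :: "'a => real"
 assumes [measurable]: "f \<in> borel_measurable M" "g \<in> borel_measurable M"
  and "(\<integral>\<^sup>+x. ennreal ((f x)^2) \<partial>M) <= ennreal A" "(\<integral>\<^sup>+x. ennreal ((g x)^2) \<partial>M) <= ennreal B" "A >= 0" "B >= 0"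
 shows "(\<integral>\<^sup>+x. ennreal \<bar>f x * g x\<bar> \<partial>M) <= ennreal (sqrt (A * B))"
proof (rule ennreal_power2_le_D)
 have "(\<integral>\<^sup>+x. ennreal \<bar>f x * g x\<bar> \<partial>M)^2 = (\<integral>\<^sup>+x. ennreal \<bar>f x\<bar> * ennreal \<bar>g x\<bar> \<partial>M)^2"
  by (simp add: abs_mult ennreal_mult)
 also have "... <= (\<integral>\<^sup>+x. (ennreal \<bar>f x\<bar>)\<^sup>2 \<partial>M) * (\<integral>\<^sup>+x. (ennreal \<bar>g x\<bar>)\<^sup>2 \<partial>M)"
  by (rule Cauchy_Schwarz_nn_integral) auto
 also have "... = (\<integral>\<^sup>+x. ennreal ((f x)^2) \<partial>M) * (\<integral>\<^sup>+x. ennreal ((g x)^2) \<partial>M)"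
  by (simp add: ennreal_power)
 also have "... <= ennreal A * ennreal B" using assms by (intro mult_mono) auto
 also have "... = ennreal ((sqrt (A * B))^2)" using assms by (simp add: ennreal_mult)
 finally show "(\<integral>\<^sup>+x. ennreal \<bar>f x * g x\<bar> \<partial>M)^2 <= ennreal ((sqrt (A * B))^2)" .
qed (use assms in auto)

lemma Lb_mult_44:
 assumes f: "Lb 4 f al" and g: "Lb 4 g be"
 shows "Lb 2 (%x. f x * g x) (al * be)"
proof -
 have [measurable]: "f \<in> bmeas" "g \<in> bmeas" using f g by (auto simp: Lb_def)
 have "(\<integral>\<^sup>+x. ennreal \<bar>(f x)\<^sup>2 * (g x)^2\<bar> \<partial>lborel) <= ennreal (sqrt (al ^ 4 * be ^ 4))"
  using LbD[OF f] LbD[OF g] by (intro nn_Cauchy_Schwarz) auto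
 also have "sqrt (al ^ 4 * be ^ 4) = (al * be)^2"
  by (rule real_sqrt_unique) (auto simp: power_mult_distrib)
 finally show ?thesis using LbD[OF f] LbD[OF g] by (auto simp: Lb_def power_mult_distrib abs_mult)
qed

text \<open>Cauchy-Schwarz for the factorization |f|^4 = |f| |f|^3.\<close>

lemma Lb_4_interp:
 assumes 2: "Lb 2 f al" and 6: "Lb 6 f al"
 shows "Lb 4 f al"
proof -
 have [measurable]: "f \<in> bmeas" using 2 by (auto simp: Lb_def)
 have "(\<integral>\<^sup>+x. ennreal \<bar>f x * f x ^ 3\<bar> \<partial>lborel) <= ennreal (sqrt (al ^ 2 * al ^ 6))"
  using LbD[OF 2] LbD[OF 6] by (intro nn_Cauchy_Schwarz) (auto simp: power_abs)
 also have "sqrt (al ^ 2 * al ^ 6) = al ^ 4"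
  by (rule real_sqrt_unique) auto
 also have "(%x. \<bar>f x * f x ^ 3\<bar>) = (%x. \<bar>f x\<bar> ^ 4)"
  by (auto simp: fun_eq_iff power_abs abs_mult numeral_eq_Suc)
 finally show ?thesis using LbD[OF 2] by (auto simp: Lb_def)
qed

text \<open>Cauchy-Schwarz for |f|^6 = |f| |f|^5. Applied to a difference of translates in dimension
  two, smallness in L2 is turned into smallness in L6, at the price of the exponent 1/6.\<close>

lemma Lb_6_gain:
 assumes 2: "Lb 2 f al" and 10: "Lb 10 f be"
 shows "(nni (%x. \<bar>f x\<bar> ^ 6)) <= ennreal (al * be ^ 5)"
proof -
 have [measurable]: "f \<in> bmeas" using 2 by (auto simp: Lb_def)
 have "(\<integral>\<^sup>+x. ennreal \<bar>f x * f x ^ 5\<bar> \<partial>lborel) <= ennreal (sqrt (al ^ 2 * be ^ 10))"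
  using LbD[OF 2] LbD[OF 10] by (intro nn_Cauchy_Schwarz) (auto simp: power_abs)
 also have "sqrt (al ^ 2 * be ^ 10) = al * be ^ 5"
  using LbD(2)[OF 2] LbD(2)[OF 10] by (intro real_sqrt_unique) (auto simp: power_mult_distrib)
 also have "(%x. \<bar>f x * f x ^ 5\<bar>) = (%x. \<bar>f x\<bar> ^ 6)"
  by (auto simp: fun_eq_iff power_abs abs_mult numeral_eq_Suc)
 finally show ?thesis .
qed

lemma prod3_le:
 fixes a b c :: real
 assumes "a >= 0" "b >= 0" "c >= 0"
 shows "3 * (a * b * c) <= a ^ 3 + b ^ 3 + c ^ 3"
proof -
 have "a ^ 3 + b ^ 3 + c ^ 3 - 3 * (a * b * c) = (a + b + c) * ((a - b)^2 + (b - c)^2 + (c - a)^2) / 2"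
  by (simp add: power2_eq_square power3_eq_cube field_simps)
 also have "... >= 0" using assms by simp
 finally show ?thesis by simp
qed

text \<open>Hoelder's inequality for three factors: the inequality between arithmetic and geometric
  means is applied to the squares of the functions divided by their bounds. Vanishing bounds are
  again separated.\<close>

lemma Lb_mult_666:
 assumes f: "Lb 6 f al" and g: "Lb 6 g be" and h: "Lb 6 h gam"
 shows "Lb 2 (%x. f x * g x * h x) (al * be * gam)"
proof (cases "al = 0 \<or> be = 0 \<or> gam = 0")
 case True
 have [measurable]: "f \<in> bmeas" "g \<in> bmeas" "h \<in> bmeas"
  using f g h by (auto simp: Lb_def)
 have "AE x in lborel. f x * g x * h x = 0"
  using True f g h Lb_0[of 6 f] Lb_0[of 6 g] Lb_0[of 6 h]
  by (auto elim: eventually_mono)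
 then have "Lb 2 (%x. f x * g x * h x) 0"
  by (intro Lb_cong_AE[OF Lb_zero]) auto
 then show ?thesis using True by auto
next
 case False
 have [measurable]: "f \<in> bmeas" "g \<in> bmeas" "h \<in> bmeas"
  using f g h by (auto simp: Lb_def)
 have pos: "al > 0" "be > 0" "gam > 0" using False f g h by (auto simp: Lb_def)
 define c where "c = (al * be * gam)^2 / 3"
 have c: "c > 0" using pos by (simp add: c_def)
 have pw: "\<bar>f x * g x * h x\<bar>\<^sup>2 <= c / al ^ 6 * \<bar>f x\<bar> ^ 6 + c / be ^ 6 * \<bar>g x\<bar> ^ 6 + c / gam ^ 6 * \<bar>h x\<bar> ^ 6" for x
 proof -
  have "\<bar>f x * g x * h x\<bar>\<^sup>2 = (al * be * gam)^2 * ((\<bar>f x\<bar> / al)^2 * (\<bar>g x\<bar> / be)^2 * (\<bar>h x\<bar> / gam)^2)"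
   using pos by (simp add: power_mult_distrib power_divide abs_mult)
  also have "... <= (al * be * gam)^2 * ((((\<bar>f x\<bar> / al)^2) ^ 3 + ((\<bar>g x\<bar> / be)^2) ^ 3 + ((\<bar>h x\<bar> / gam)^2) ^ 3) / 3)"
   using prod3_le[of "(\<bar>f x\<bar> / al)^2" "(\<bar>g x\<bar> / be)^2" "(\<bar>h x\<bar> / gam)^2"]
   by (intro mult_left_mono) auto
  also have "... = c / al ^ 6 * \<bar>f x\<bar> ^ 6 + c / be ^ 6 * \<bar>g x\<bar> ^ 6 + c / gam ^ 6 * \<bar>h x\<bar> ^ 6"
   unfolding c_def power_mult[symmetric] by (simp add: power_divide algebra_simps add_divide_distrib)
  finally show ?thesis .
 qed
 have "(nni (%x. \<bar>f x * g x * h x\<bar>\<^sup>2))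
   <= (\<integral>\<^sup>+x. ennreal (c / al ^ 6) * ennreal (\<bar>f x\<bar> ^ 6) + ennreal (c / be ^ 6) * ennreal (\<bar>g x\<bar> ^ 6)
      + ennreal (c / gam ^ 6) * ennreal (\<bar>h x\<bar> ^ 6) \<partial>lborel)"
  using pw pos c
  by (intro nn_integral_mono) (auto simp: ennreal_mult[symmetric] ennreal_plus[symmetric] simp del: ennreal_plus intro!: ennreal_leI)
 also have "... = ennreal (c / al ^ 6) * (nni (%x. \<bar>f x\<bar> ^ 6))
    + ennreal (c / be ^ 6) * (nni (%x. \<bar>g x\<bar> ^ 6))
    + ennreal (c / gam ^ 6) * (nni (%x. \<bar>h x\<bar> ^ 6))"
  by (simp add: nn_integral_add nn_integral_cmult)
 also have "... <= ennreal (c / al ^ 6) * ennreal (al ^ 6) + ennreal (c / be ^ 6) * ennreal (be ^ 6)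
    + ennreal (c / gam ^ 6) * ennreal (gam ^ 6)"
  using LbD[OF f] LbD[OF g] LbD[OF h] by (intro add_mono mult_left_mono) auto
 also have "... = ennreal ((al * be * gam)^2)"
  using pos c by (simp add: ennreal_mult[symmetric] ennreal_plus[symmetric] c_def del: ennreal_plus)
 finally show ?thesis using pos by (auto simp: Lb_def)
qed

section \<open>Square integrable functions without a specified bound\<close>

definition sq :: "('a::euclidean_space => real) => bool" where
 "sq f \<longleftrightarrow> (\<exists>al. Lb 2 f al)"

lemma sqI: "Lb 2 f al ==> sq f" by (auto simp: sq_def)
lemma sq_measurable: "sq f ==> f \<in> bmeas" by (auto simp: sq_def Lb_def)

lemma sq_iff_integrable: "sq f \<longleftrightarrow> f \<in> bmeas \<and> integrable lborel (%x. (f x)\<^sup>2)"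
proof
 assume "sq f"
 then obtain al where "Lb 2 f al" by (auto simp: sq_def)
 then show "f \<in> bmeas \<and> integrable lborel (%x. (f x)\<^sup>2)"
  by (auto simp: Lb_def integrable_iff_bounded intro: le_less_trans)
next
 assume f: "f \<in> bmeas \<and> integrable lborel (%x. (f x)\<^sup>2)"
 then have "(nni (%x. \<bar>f x\<bar>\<^sup>2)) = ennreal (LINT x|lborel. (f x)\<^sup>2)"
  by (simp add: nn_integral_eq_integral)
 then have "Lb 2 f (sqrt (LINT x|lborel. (f x)\<^sup>2))"
  using f by (auto simp: Lb_def)
 then show "sq f" by (rule sqI)
qed

lemma sq_set_integrable:
 assumes "sq f" "compact K"
 shows "set_integrable lborel K f"
proof -
 have [measurable]: "f \<in> bmeas" "K \<in> sets borel"
  using assms by (auto intro: sq_measurable borel_compact)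
 have "integrable lborel (%x. indicator K x + (f x)^2)"
  using assms(1) emeasure_compact_finite[OF assms(2)]
  by (intro Bochner_Integration.integrable_add) (auto simp: sq_iff_integrable integrable_indicator_iff)
 then show ?thesis
  unfolding set_integrable_def
 proof (rule Bochner_Integration.integrable_bound)
  have "\<bar>a\<bar> <= 1 + a^2" for a :: real
   using zero_le_power2[of "\<bar>a\<bar> - 1"] zero_le_power2[of a] by (simp add: power2_diff)
  then show "AE x in lborel. norm (indicator K x *R f x) <= norm (indicator K x + (f x)^2)"
   by (intro AE_I2) (auto split: split_indicator)
 qed auto
qed

lemma sq_loc_int: "sq f ==> loc_int D f"
 by (auto simp: loc_int_def intro: sq_set_integrable)

lemma sq_add: "sq f ==> sq g ==> sq (%x. f x + g x)"
 unfolding sq_def using Lb_add[of 2 f _ g] by force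
lemma sq_diff: "sq f ==> sq g ==> sq (%x. f x - g x)"
 unfolding sq_def using Lb_diff[of 2 f _ g] by force
lemma sq_cmult: "sq f ==> sq (%x. c * f x)"
 unfolding sq_def using Lb_cmult[of 2 f _ c] by blast
lemma sq_translate: "sq f ==> sq (%x. f (x + c))"
 unfolding sq_def using Lb_translate[of 2 f _ c] by blast
lemma sq_bounded_mult: "sq f ==> b \<in> bmeas ==> (!!x. \<bar>b x\<bar> <= K) ==> sq (%x. b x * f x)"
 unfolding sq_def using Lb_bounded_mult[of 2 f _ b K] by (auto intro: AE_I2)
lemma sq_zero: "sq (%x. 0)"
 unfolding sq_def using Lb_zero[of 2] by auto
lemma sq_sum: "finite I ==> (!!i. i \<in> I ==> sq (f i)) ==> sq (%x. \<Sum>i\<in>I. f i x)"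
 by (induction I rule: finite_induct) (auto intro: sq_zero sq_add)

lemma sq_mult_integrable:
 assumes "sq f" "sq g"
 shows "integrable lborel (%x. f x * g x)"
proof -
 have [measurable]: "f \<in> bmeas" "g \<in> bmeas"
  using assms by (auto intro: sq_measurable)
 show ?thesis
 proof (rule Bochner_Integration.integrable_bound[of _ "%x. (f x)\<^sup>2 + (g x)^2"])
  have "\<bar>a * b\<bar> <= a^2 + b^2" for a b :: real
  proof -
   have "2 * (\<bar>a\<bar> * \<bar>b\<bar>) <= a^2 + b^2"
    using sum_squares_bound[of "\<bar>a\<bar>" "\<bar>b\<bar>"] by (simp add: mult.assoc)
   moreover have "0 <= \<bar>a\<bar> * \<bar>b\<bar>" by simp
   ultimately show ?thesis unfolding abs_mult by linarith
  qed
  then show "AE x in lborel. norm (f x * g x) <= norm ((f x)^2 + (g x)^2)" by auto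
 qed (use assms in \<open>auto simp: sq_iff_integrable\<close>)
qed

text \<open>Minkowski's integral inequality in L2, by Cauchy-Schwarz with |k| split into sqrt(|k|
  sig) and sqrt(|k| / sig), followed by Tonelli. The weight \<open>sig\<close> records how the bound
  of \<open>Psi z\<close> grows at the singularity. A bound is asked only where k does not vanish,
  which leaves room to exclude z = 0.\<close>

lemma Lb_param_integral:
 fixes Psi :: "'b::euclidean_space => 'a::euclidean_space => real"
 assumes [measurable]: "case_prod Psi \<in> borel_measurable (borel \<Otimes>\<^sub>M borel)"
   "k \<in> bmeas" "sig \<in> bmeas"
  and sig: "!!z. 0 < sig z" and L: "!!z. k z ~= 0 ==> Lb 2 (Psi z) (b * sig z)"
  and S: "(nni (%z. \<bar>k z\<bar> * sig z)) <= ennreal S" "0 <= S" "0 <= b"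
 shows "Lb 2 (%x. LINT z|lborel. k z * Psi z x) (S * b)"
  and "AE x in lborel. integrable lborel (%z. k z * Psi z x)"
proof -
 have m[measurable]: "(%x. LINT z|lborel. k z * Psi z x) \<in> bmeas"
  by (rule lborel.borel_measurable_lebesgue_integral) measurable
 define N where "N x = (\<integral>\<^sup>+z. ennreal \<bar>k z * Psi z x\<bar> \<partial>lborel)" for x
 have [measurable]: "N \<in> bmeas" unfolding N_def by measurable
 have N2: "(\<integral>\<^sup>+x. (N x)\<^sup>2 \<partial>lborel) <= ennreal ((S * b)^2)"
 proof -
  have "(N x)^2 <= ennreal S * (\<integral>\<^sup>+z. ennreal (\<bar>k z\<bar> / sig z) * ennreal ((Psi z x)^2) \<partial>lborel)" for x
  proof -
   have "N x = (\<integral>\<^sup>+z. ennreal (sqrt (\<bar>k z\<bar> * sig z)) * ennreal (sqrt (\<bar>k z\<bar> / sig z) * \<bar>Psi z x\<bar>) \<partial>lborel)"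
    unfolding N_def
   proof (rule nn_integral_cong)
    fix z
    have "sqrt (\<bar>k z\<bar> * sig z) * sqrt (\<bar>k z\<bar> / sig z) = \<bar>k z\<bar>"
     using sig[of z] by (simp add: real_sqrt_mult[symmetric])
    then show "ennreal \<bar>k z * Psi z x\<bar> = ennreal (sqrt (\<bar>k z\<bar> * sig z)) * ennreal (sqrt (\<bar>k z\<bar> / sig z) * \<bar>Psi z x\<bar>)"
     using sig[of z] by (simp add: ennreal_mult[symmetric] abs_mult mult.assoc[symmetric])
   qed
   also have "...\<^sup>2 <= (\<integral>\<^sup>+z. (ennreal (sqrt (\<bar>k z\<bar> * sig z)))\<^sup>2 \<partial>lborel) * (\<integral>\<^sup>+z. (ennreal (sqrt (\<bar>k z\<bar> / sig z) * \<bar>Psi z x\<bar>))\<^sup>2 \<partial>lborel)"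
    by (rule Cauchy_Schwarz_nn_integral) measurable
   also have "(\<integral>\<^sup>+z. (ennreal (sqrt (\<bar>k z\<bar> * sig z)))\<^sup>2 \<partial>lborel) = (nni (%z. \<bar>k z\<bar> * sig z))"
    using sig by (intro nn_integral_cong) (simp add: ennreal_power less_imp_le)
   also have "(\<integral>\<^sup>+z. (ennreal (sqrt (\<bar>k z\<bar> / sig z) * \<bar>Psi z x\<bar>))\<^sup>2 \<partial>lborel) = (\<integral>\<^sup>+z. ennreal (\<bar>k z\<bar> / sig z) * ennreal ((Psi z x)^2) \<partial>lborel)"
    using sig by (intro nn_integral_cong) (simp add: ennreal_power ennreal_mult[symmetric] power_mult_distrib less_imp_le)
   finally show ?thesis
    by (rule order_trans) (intro mult_right_mono S, simp)
  qed
  then have "(\<integral>\<^sup>+x. (N x)\<^sup>2 \<partial>lborel) <= (\<integral>\<^sup>+x. ennreal S * (\<integral>\<^sup>+z. ennreal (\<bar>k z\<bar> / sig z) * ennreal ((Psi z x)^2) \<partial>lborel) \<partial>lborel)"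
   by (intro nn_integral_mono)
  also have "... = ennreal S * (\<integral>\<^sup>+x. \<integral>\<^sup>+z. ennreal (\<bar>k z\<bar> / sig z) * ennreal ((Psi z x)^2) \<partial>lborel \<partial>lborel)"
   by (rule nn_integral_cmult) measurable
  also have "(\<integral>\<^sup>+x. \<integral>\<^sup>+z. ennreal (\<bar>k z\<bar> / sig z) * ennreal ((Psi z x)^2) \<partial>lborel \<partial>lborel)
    = (\<integral>\<^sup>+z. \<integral>\<^sup>+x. ennreal (\<bar>k z\<bar> / sig z) * ennreal ((Psi z x)^2) \<partial>lborel \<partial>lborel)"
   by (rule lborel_pair.Fubini') measurable
  also have "... <= (\<integral>\<^sup>+z. ennreal (b^2) * ennreal (\<bar>k z\<bar> * sig z) \<partial>lborel)"
  proof (rule nn_integral_mono)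
   fix z
   show "(\<integral>\<^sup>+x. ennreal (\<bar>k z\<bar> / sig z) * ennreal ((Psi z x)^2) \<partial>lborel) <= ennreal (b^2) * ennreal (\<bar>k z\<bar> * sig z)"
   proof (cases "k z = 0")
    case False
    have "(\<integral>\<^sup>+x. ennreal (\<bar>k z\<bar> / sig z) * ennreal ((Psi z x)^2) \<partial>lborel) = ennreal (\<bar>k z\<bar> / sig z) * (nni (%x. (Psi z x)\<^sup>2))"
     by (rule nn_integral_cmult) measurable
    also have "... <= ennreal (\<bar>k z\<bar> / sig z) * ennreal ((b * sig z)^2)"
     using LbD(3)[OF L[OF False]] by (intro mult_left_mono) auto
    also have "... = ennreal (b^2) * ennreal (\<bar>k z\<bar> * sig z)"
     using sig[of z] by (simp add: ennreal_mult'[symmetric] power2_eq_square field_simps)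
    finally show ?thesis .
   qed simp
  qed
  also have "... = ennreal (b^2) * (nni (%z. \<bar>k z\<bar> * sig z))"
   by (rule nn_integral_cmult) measurable
  also have "... <= ennreal (b^2) * ennreal S" by (intro mult_left_mono S) simp
  also have "ennreal S * ... = ennreal ((S * b)^2)"
   using S by (simp add: ennreal_mult[symmetric] power2_eq_square mult_ac)
  finally show ?thesis by (simp add: mult_left_mono)
 qed
 have "AE x in lborel. (N x)\<^sup>2 ~= \<infinity>"
  using N2 by (intro nn_integral_PInf_AE) (auto simp: top_unique)
 then show I: "AE x in lborel. integrable lborel (%z. k z * Psi z x)"
  by eventually_elim (auto simp: integrable_iff_bounded N_def less_top power2_eq_square ennreal_mult_eq_top_iff)
 have "(nni (%x. \<bar>LINT z|lborel. k z * Psi z x\<bar>\<^sup>2)) <= (\<integral>\<^sup>+x. (N x)\<^sup>2 \<partial>lborel)"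
 proof (rule nn_integral_mono)
  fix x
  have "ennreal \<bar>LINT z|lborel. k z * Psi z x\<bar> <= N x"
   unfolding N_def
   by (cases "integrable lborel (%z. k z * Psi z x)")
     (use integral_norm_bound_ennreal[of lborel "%z. k z * Psi z x"] in \<open>auto simp: not_integrable_integral_eq\<close>)
  then show "ennreal (\<bar>LINT z|lborel. k z * Psi z x\<bar>\<^sup>2) <= (N x)^2"
   by (subst ennreal_power[symmetric]) (auto intro: power_mono)
 qed
 with N2 show "Lb 2 (%x. LINT z|lborel. k z * Psi z x) (S * b)"
  using m S unfolding Lb_def by (auto intro: order_trans)
qed

subsection \<open>Continuity of translations\<close>

text \<open>As |a - b| = 2 max 0 (b - a) - (b - a) and the last term integrates to zero by
  translation invariance, only points leaving U count. These disappear pointwise because U is open,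
  with the indicator of U as a dominating function.\<close>

lemma L1_translate_open:
 fixes U :: "'a::euclidean_space set"
 assumes U: "open U" "emeasure lborel U < \<infinity>" and X: "X \<longlonglongrightarrow> 0"
 shows "(%n. LINT x|lborel. \<bar>indicator U (x + X n) - indicator U x :: real\<bar>) \<longlonglongrightarrow> 0"
proof -
 have [measurable]: "U \<in> sets borel" using U by auto
 have i: "integrable lborel (indicator U :: 'a => real)" using U by (simp add: integrable_indicator_iff)
 have ii: "integrable lborel (%x. indicator U (x + c) :: real)" for c
  using i by (subst lborel_integral_translate) auto
 have e: "(LINT x|lborel. \<bar>indicator U (x + c) - indicator U x :: real\<bar>)
   = 2 * (LINT x|lborel. max 0 (indicator U x - indicator U (x + c)))" for c
 proof -
  have "(LINT x|lborel. \<bar>indicator U (x + c) - indicator U x :: real\<bar>)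
    = (LINT x|lborel. 2 * max 0 (indicator U x - indicator U (x + c)) - (indicator U x - indicator U (x + c)))"
   by (rule Bochner_Integration.integral_cong) (auto split: split_indicator)
  also have "... = 2 * (LINT x|lborel. max 0 (indicator U x - indicator U (x + c)))
    - ((LINT x|lborel. indicator U x) - (LINT x|lborel. indicator U (x + c)))"
   using i ii[of c] by (subst Bochner_Integration.integral_diff) (auto intro!: integrable_max)
  also have "(LINT x|lborel. indicator U (x + c) :: real) = (LINT x|lborel. indicator U x)"
   by (rule lborel_integral_translate) auto
  finally show ?thesis by simp
 qed
 have "(%n. LINT x|lborel. max 0 (indicator U x - indicator U (x + X n) :: real)) \<longlonglongrightarrow> (LINT x::'a|lborel. 0)"
 proof (rule integral_dominated_convergence[where w = "indicator U"])
  show "AE x in lborel. (%n. max 0 (indicator U x - indicator U (x + X n) :: real)) \<longlonglongrightarrow> 0"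
  proof (rule AE_I2)
   fix x
   show "(%n. max 0 (indicator U x - indicator U (x + X n) :: real)) \<longlonglongrightarrow> 0"
   proof (cases "x \<in> U")
    case True
    have "(%n. x + X n) \<longlonglongrightarrow> x" using tendsto_add[OF tendsto_const X, of x] by simp
    then have "\<forall>\<^sub>F n in sequentially. x + X n \<in> U" using U True by (metis topological_tendstoD)
    then have "\<forall>\<^sub>F n in sequentially. max 0 (indicator U x - indicator U (x + X n) :: real) = 0"
     by eventually_elim (use True in auto)
    then show ?thesis by (rule tendsto_eventually)
   qed (auto split: split_indicator)
  qed
 qed (auto intro!: i AE_I2 split: split_indicator)
 then have "(%n. 2 * (LINT x|lborel. max 0 (indicator U x - indicator U (x + X n) :: real))) \<longlonglongrightarrow> 0"
  using tendsto_mult_left[of _ 0 sequentially 2] by simp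
 then show ?thesis by (simp add: e)
qed

subsection \<open>Difference quotients\<close>

lemma Lb_mult_22:
 assumes f: "Lb 2 f al" and g: "Lb 2 g be"
 shows "Lb 1 (%x. f x * g x) (al * be)"
proof -
 have [measurable]: "f \<in> bmeas" "g \<in> bmeas" using f g by (auto simp: Lb_def)
 have "(\<integral>\<^sup>+x. ennreal \<bar>f x * g x\<bar> \<partial>lborel) <= ennreal (sqrt (al ^ 2 * be ^ 2))"
  using LbD[OF f] LbD[OF g] by (intro nn_Cauchy_Schwarz) auto
 also have "sqrt (al ^ 2 * be ^ 2) = al * be"
  using LbD(2)[OF f] LbD(2)[OF g] by (intro real_sqrt_unique) (auto simp: power_mult_distrib)
 finally show ?thesis using LbD[OF f] LbD[OF g] by (auto simp: Lb_def)
qed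

lemma Lb_1_integral_le:
 assumes "Lb 1 f al"
 shows "\<bar>LINT x|lborel. f x\<bar> <= al"
proof -
 have "ennreal \<bar>LINT x|lborel. f x\<bar> <= ennreal al"
 proof (cases "integrable lborel f")
  case True
  then show ?thesis
   using integral_norm_bound_ennreal[OF True] LbD(3)[OF assms] by (auto intro: order_trans)
 qed (use LbD(2)[OF assms] in \<open>simp add: not_integrable_integral_eq\<close>)
 then show ?thesis using LbD(2)[OF assms] by simp
qed

section \<open>Convergence to zero in Lp\<close>

definition Lconv :: "nat => (nat => 'a::euclidean_space => real) => bool" where
 "Lconv p F \<longleftrightarrow> (\<forall>e>0. \<forall>\<^sub>F n in sequentially. Lb p (F n) e)"

lemma LconvD: "Lconv p F ==> e > 0 ==> \<forall>\<^sub>F n in sequentially. Lb p (F n) e"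
 by (auto simp: Lconv_def)

lemma Lconv_add:
 assumes "Lconv p F" "Lconv p G" "p > 0"
 shows "Lconv p (%n x. F n x + G n x)"
 unfolding Lconv_def
proof (intro allI impI)
 fix e :: real assume "e > 0"
 then have "e / 2 > 0" by simp
 from LconvD[OF assms(1) this] LconvD[OF assms(2) this]
 show "\<forall>\<^sub>F n in sequentially. Lb p (%x. F n x + G n x) e"
 proof eventually_elim
  case (elim n)
  from Lb_add[OF elim assms(3)] show ?case by simp
 qed
qed

lemma Lconv_dominated:
 assumes "Lconv p F" "!!n. G n \<in> bmeas"
  and "!!n. AE x in lborel. \<bar>G n x\<bar> <= \<bar>F n x\<bar>"
 shows "Lconv p G"
 unfolding Lconv_def
proof (intro allI impI)
 fix e :: real assume "e > 0"
 from LconvD[OF assms(1) this] show "\<forall>\<^sub>F n in sequentially. Lb p (G n) e"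
  by eventually_elim (rule Lb_dominated[OF _ assms(2,3)])
qed

lemma Lconv_scaled:
 assumes F: "Lconv p F" and G: "!!e n. 0 < e ==> Lb p (F n) e ==> Lb q (G n) (K * e)" and K: "0 <= K"
 shows "Lconv q G"
 unfolding Lconv_def
proof (intro allI impI)
 fix e :: real assume e: "e > 0"
 \<comment> \<open>The summand 1 avoids a division by zero when K = 0.\<close>
 then have "e / (K + 1) > 0" using K by simp
 from LconvD[OF F this] show "\<forall>\<^sub>F n in sequentially. Lb q (G n) e"
 proof eventually_elim
  case (elim n)
  have "K * (e / (K + 1)) <= e" using K e by (simp add: field_simps)
  then show ?case using G[OF \<open>e / (K + 1) > 0\<close> elim] by (rule Lb_mono[rotated])
 qed
qed

lemma Lconv_bounded_mult:
 assumes "Lconv p F" "!!n. b n \<in> bmeas" "!!n x. \<bar>b n x\<bar> <= K"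
 shows "Lconv p (%n x. b n x * F n x)"
 by (rule Lconv_scaled[OF assms(1)]) (auto intro!: Lb_bounded_mult assms AE_I2)

lemma Lconv_cmult: "Lconv p F ==> Lconv p (%n x. c * F n x)"
 by (rule Lconv_scaled[where K = "\<bar>c\<bar>"]) (auto intro: Lb_cmult)

lemma Lconv_abs: "Lconv p F ==> Lconv p (%n x. \<bar>F n x\<bar>)"
 by (rule Lconv_scaled[where K = 1]) (auto simp: Lb_def)

lemma Lconv_mult_22:
 assumes "Lconv 2 F" "!!n. Lb 2 (G n) K"
 shows "Lconv 1 (%n x. F n x * G n x)"
proof (rule Lconv_scaled[OF assms(1), where K = K])
 show "0 <= K" using LbD(2)[OF assms(2)] .
 fix e n assume "Lb 2 (F n) e"
 from Lb_mult_22[OF this assms(2)] show "Lb 1 (%x. F n x * G n x) (K * e)" by (simp add: mult.commute)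
qed

text \<open>Dominated convergence for the squares. Convergence of the factor is asked only where g
  is nonzero, so nothing has to be known outside the support of g.\<close>

lemma Lconv_dct:
 assumes g: "sq g" and b[measurable]: "!!n. b n \<in> bmeas" and K: "!!n x. \<bar>b n x\<bar> <= K"
  and lim: "!!x. g x ~= 0 ==> (%n. b n x) \<longlonglongrightarrow> 0"
 shows "Lconv 2 (%n x. b n x * g x)"
proof -
 have [measurable]: "g \<in> bmeas" using g by (rule sq_measurable)
 have gi: "integrable lborel (%x. (g x)\<^sup>2)" using g by (simp add: sq_iff_integrable)
 have bound: "(b n x * g x)^2 <= K^2 * (g x)^2" for n x
  unfolding power_mult_distrib by (intro mult_right_mono) (use K[of n x] in \<open>auto simp: abs_le_square_iff[symmetric]\<close>)
 have I: "integrable lborel (%x. (b n x * g x)\<^sup>2)" for n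
  by (rule Bochner_Integration.integrable_bound[where f = "%x. K\<^sup>2 * (g x)^2"]) (use gi bound in auto)
 have "(%n. LINT x|lborel. (b n x * g x)\<^sup>2) \<longlonglongrightarrow> (LINT x::'a|lborel. 0)"
 proof (rule integral_dominated_convergence[where w = "%x. K\<^sup>2 * (g x)^2"])
  show "AE x in lborel. (%n. (b n x * g x)\<^sup>2) \<longlonglongrightarrow> 0"
  proof (rule AE_I2)
   fix x
   show "(%n. (b n x * g x)\<^sup>2) \<longlonglongrightarrow> 0"
   proof (cases "g x = 0")
    case False
    from tendsto_power[OF tendsto_mult_right[OF lim[OF False], of "g x"], of 2] show ?thesis by simp
   qed simp
  qed
 qed (use gi bound in auto)
 then have lim0: "(%n. LINT x|lborel. (b n x * g x)\<^sup>2) \<longlonglongrightarrow> 0" by simp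
 show ?thesis
  unfolding Lconv_def
 proof (intro allI impI)
  fix e :: real assume e: "e > 0"
  from order_tendstoD(2)[OF lim0, of "e^2"] e
  have "\<forall>\<^sub>F n in sequentially. (LINT x|lborel. (b n x * g x)\<^sup>2) < e\<^sup>2" by simp
  then show "\<forall>\<^sub>F n in sequentially. Lb 2 (%x. b n x * g x) e"
  proof eventually_elim
   case (elim n)
   have "(nni (%x. \<bar>b n x * g x\<bar>\<^sup>2)) = ennreal (LINT x|lborel. (b n x * g x)\<^sup>2)"
    using I[of n] by (simp add: nn_integral_eq_integral)
   also have "... <= ennreal (e^2)" using elim by (intro ennreal_leI) simp
   finally show ?case using e by (auto simp: Lb_def)
  qed
 qed
qed

text \<open>One fixed null sequence of increments: difference quotients become sequences, to which
  dominated convergence applies directly.\<close>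

definition step :: "nat => real" where "step n = inverse (real (Suc n))"

lemma step_pos: "0 < step n" by (simp add: step_def)
lemma step_tendsto: "step \<longlonglongrightarrow> 0" unfolding step_def[abs_def] by (rule LIMSEQ_inverse_real_of_nat)
lemma step_le_1: "step n <= 1" by (simp add: step_def field_simps)

abbreviation dq :: "'n => nat => (real^'n => real) => real^'n => real" where
 "dq i n p x \<equiv> (p (x + step n *R axis i 1) - p x) / step n"

lemma step_axis_tendsto: "(%n. step n *R axis i (1::real)) \<longlonglongrightarrow> 0"
 using tendsto_scaleR[OF step_tendsto tendsto_const] by simp

lemma Lb_1I:
 assumes "integrable lborel f" "(LINT x|lborel. \<bar>f x\<bar>) <= e"
 shows "Lb 1 f e"
proof -
 have "0 <= e" by (rule order_trans[OF _ assms(2)]) simp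
 moreover have "(\<integral>\<^sup>+x. ennreal \<bar>f x\<bar> \<partial>lborel) = ennreal (LINT x|lborel. \<bar>f x\<bar>)"
  using assms(1) by (intro nn_integral_eq_integral) auto
 ultimately show ?thesis
  using assms borel_measurable_integrable[OF assms(1)] by (auto simp: Lb_def intro!: ennreal_leI)
qed

lemma Lconv_1I:
 assumes "!!n. integrable lborel (F n)" "(%n. LINT x|lborel. \<bar>F n x\<bar>) \<longlonglongrightarrow> 0"
 shows "Lconv 1 F"
 unfolding Lconv_def
proof (intro allI impI)
 fix e :: real assume "0 < e"
 from order_tendstoD(2)[OF assms(2) this] show "\<forall>\<^sub>F n in sequentially. Lb 1 (F n) e"
  by eventually_elim (rule Lb_1I[OF assms(1) less_imp_le])
qed

lemma Lconv_translate_approx: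
 assumes "!!e. 0 < e ==> \<exists>g. Lb 1 (%x. f x - g x) e \<and> Lconv 1 (%n x. g (x + X n) - g x)"
 shows "Lconv 1 (%n x. f (x + X n) - f x)"
 unfolding Lconv_def
proof (intro allI impI)
 fix e :: real assume "0 < e"
 then obtain g where g: "Lb 1 (%x. f x - g x) (e / 3)" "Lconv 1 (%n x. g (x + X n) - g x)" using assms[of "e / 3"] by auto
 from LconvD[OF g(2), of "e / 3"] \<open>0 < e\<close> have "\<forall>\<^sub>F n in sequentially. Lb 1 (%x. g (x + X n) - g x) (e / 3)" by simp
 then show "\<forall>\<^sub>F n in sequentially. Lb 1 (%x. f (x + X n) - f x) e"
 proof eventually_elim
  case (elim n)
  from Lb_diff[OF Lb_add[OF Lb_translate[OF g(1), of "X n"] elim] g(1)] show ?case by simp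
 qed
qed

text \<open>By approximation: indicators of measurable sets are reduced to open sets by outer
  regularity, and pointwise dominated limits pass over because translating the error does not change
  its L1 norm.\<close>

lemma L1_translate:
 fixes f :: "'a::euclidean_space => real"
 assumes f: "integrable lborel f" and X: "X \<longlonglongrightarrow> 0"
 shows "Lconv 1 (%n x. f (x + X n) - f x)"
 using f
proof (induction rule: integrable_induct)
 case (base A c)
 then have [measurable]: "A \<in> sets borel" and fin: "emeasure lborel A < \<infinity>" by auto
 have "Lconv 1 (%n x. indicator A (x + X n) - indicator A x :: real)"
 proof (rule Lconv_translate_approx)
  fix e :: real assume e: "0 < e"
  obtain U where U: "open U" "A \<subseteq> U" "emeasure lborel (U - A) < ennreal e"
   using outer_regular_lborel[of A e] e by auto
  have [measurable]: "U \<in> sets borel" using U by auto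
  have "emeasure lborel U = emeasure lborel A + emeasure lborel (U - A)"
   using U(2) by (subst plus_emeasure) (auto intro!: arg_cong[where f = "emeasure lborel"])
  then have finU: "emeasure lborel U < \<infinity>"
   using fin order.strict_trans[OF U(3) ennreal_less_top] by (auto simp: ennreal_add_eq_top less_top)
  then have "integrable lborel (%x. indicator U (x + c) :: real)" for c
   by (auto simp: lborel_integral_translate integrable_indicator_iff)
  from Bochner_Integration.integrable_diff[OF this this[of 0]]
  have "Lconv 1 (%n x. indicator U (x + X n) - indicator U x :: real)"
   using L1_translate_open[OF U(1) finU X] by (intro Lconv_1I) auto
  moreover have "Lb 1 (%x. indicator A x - indicator U x :: real) e"
  proof -
   have "(nni (%x. \<bar>indicator A x - indicator U x\<bar> ^ 1)) = (\<integral>\<^sup>+x. indicator (U - A) x \<partial>lborel)"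
    using U(2) by (intro nn_integral_cong) (auto split: split_indicator)
   then show ?thesis using U(3) e by (auto simp: Lb_def)
  qed
  ultimately show "\<exists>g. Lb 1 (%x. indicator A x - g x :: real) e \<and> Lconv 1 (%n x. g (x + X n) - g x)" by blast
 qed
 from Lconv_cmult[OF this, of c] show ?case by (simp add: right_diff_distrib mult.commute)
next
 case (add f g)
 from Lconv_add[OF add.IH] show ?case by (simp add: algebra_simps)
next
 case (lim f s)
 show ?case
 proof (rule Lconv_translate_approx)
  fix e :: real assume e: "0 < e"
  have m: "f \<in> bmeas" "s i \<in> bmeas" for i
   using borel_measurable_integrable[OF lim.hyps(4)] borel_measurable_integrable[OF lim.hyps(1)] by auto
  have "(%i. LINT x|lborel. \<bar>f x - s i x\<bar>) \<longlonglongrightarrow> (LINT x::'a|lborel. 0)"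
  proof (rule integral_dominated_convergence[where w = "%x. 3 * \<bar>f x\<bar>"])
   show "AE x in lborel. (%i. \<bar>f x - s i x\<bar>) \<longlonglongrightarrow> 0"
   proof (rule AE_I2)
    show "(%i. \<bar>f x - s i x\<bar>) \<longlonglongrightarrow> 0" for x
     using tendsto_rabs_zero[OF LIM_zero[OF lim.hyps(2)[of x]]] by (simp add: abs_minus_commute)
   qed
   show "AE x in lborel. norm \<bar>f x - s i x\<bar> <= 3 * \<bar>f x\<bar>" for i
   proof (rule AE_I2)
    show "norm \<bar>f x - s i x\<bar> <= 3 * \<bar>f x\<bar>" for x using lim.hyps(3)[of x i] by simp
   qed
  qed (use lim.hyps(4) m in auto)
  then have "(%i. LINT x|lborel. \<bar>f x - s i x\<bar>) \<longlonglongrightarrow> 0" by simp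
  from order_tendstoD(2)[OF this e] obtain i where "(LINT x|lborel. \<bar>f x - s i x\<bar>) < e" by (auto simp: eventually_sequentially)
  then have "Lb 1 (%x. f x - s i x) e" using lim.hyps(1,4) by (intro Lb_1I) auto
  with lim.IH show "\<exists>g. Lb 1 (%x. f x - g x) e \<and> Lconv 1 (%n x. g (x + X n) - g x)" by blast
 qed
qed

text \<open>Reduction to L1 through g = f |f|, which is integrable and satisfies (a - b)^2 <= 2 |
  a|a| - b|b| |. The factor 2 accounts for arguments of opposite sign.\<close>

lemma L2_translate:
 fixes f :: "'a::euclidean_space => real"
 assumes f: "sq f" and e: "0 < e"
 obtains d where "d > 0" "!!c. norm c < d ==> Lb 2 (%x. f (x + c) - f x) e"
proof -
 have [measurable]: "f \<in> bmeas" using f by (rule sq_measurable)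
 define g where "g x = f x * \<bar>f x\<bar>" for x
 have [measurable]: "g \<in> bmeas" unfolding g_def by measurable
 have g: "integrable lborel g"
  using f by (intro Bochner_Integration.integrable_bound[of lborel "%x. (f x)\<^sup>2" g])
   (auto simp: sq_iff_integrable g_def abs_mult power2_eq_square)
 have gt: "integrable lborel (%x. g (x + c))" for c using g by (simp add: lborel_integral_translate)
 have "\<exists>d>0. \<forall>c. norm c < d --> (LINT x|lborel. \<bar>g (x + c) - g x\<bar>) < e\<^sup>2 / 2"
 proof (rule ccontr)
  assume "\<not> ?thesis"
  then have "\<forall>n. \<exists>c. norm c < inverse (real (Suc n)) \<and> (LINT x|lborel. \<bar>g (x + c) - g x\<bar>) >= e^2 / 2"
   by (metis inverse_positive_iff_positive not_le of_nat_0_less_iff zero_less_Suc)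
  then obtain X where X: "!!n. norm (X n) < inverse (real (Suc n))" "!!n. (LINT x|lborel. \<bar>g (x + X n) - g x\<bar>) >= e^2 / 2"
   by metis
  have "X \<longlonglongrightarrow> 0"
   by (rule Lim_null_comparison[OF _ LIMSEQ_inverse_real_of_nat])
     (use X(1) in \<open>auto intro!: always_eventually less_imp_le simp del: of_nat_Suc\<close>)
  from LconvD[OF Lconv_abs[OF L1_translate[OF g this]], of "e^2 / 4"] e
  obtain N where "Lb 1 (%x. \<bar>g (x + X N) - g x\<bar>) (e^2 / 4)" by (auto simp: eventually_sequentially)
  from Lb_1_integral_le[OF this] X(2)[of N] show False using zero_less_power[OF e, of 2] by linarith
 qed
 then obtain d where d: "d > 0" "!!c. norm c < d ==> (LINT x|lborel. \<bar>g (x + c) - g x\<bar>) < e\<^sup>2 / 2" by blast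
 have ineq: "(a - b)^2 <= 2 * \<bar>a * \<bar>a\<bar> - b * \<bar>b\<bar>\<bar>" for a b :: real
 proof -
  have pp: "(a - b)^2 <= 2 * \<bar>a * a - b * b\<bar>" if "a >= 0" "b >= 0" for a b :: real
  proof -
   have "\<bar>a - b\<bar> * \<bar>a - b\<bar> <= \<bar>a - b\<bar> * (a + b)" using that by (intro mult_left_mono) auto
   also have "... = \<bar>(a - b) * (a + b)\<bar>" using that by (simp add: abs_mult)
   also have "(a - b) * (a + b) = a * a - b * b" by (simp add: algebra_simps)
   finally show ?thesis by (simp add: power2_eq_square) (smt (verit) abs_ge_zero abs_mult_self_eq)
  qed
  have pn: "(a - b)^2 <= 2 * (a * a + b * b)" for a b :: real
   using zero_le_power2[of "a + b"] by (simp add: power2_eq_square algebra_simps)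
  consider "a >= 0" "b >= 0" | "a < 0" "b < 0" | "a >= 0" "b < 0" | "a < 0" "b >= 0" by linarith
  then show ?thesis
  proof cases
   case 1 then show ?thesis using pp by simp
  next
   case 2 then show ?thesis using pp[of "-a" "-b"] by (simp add: power2_commute) (smt (verit))
  next
   case 3
   then have "\<bar>a * \<bar>a\<bar> - b * \<bar>b\<bar>\<bar> = a * a + b * b" by simp
   then show ?thesis using pn[of a b] by simp
  next
   case 4
   then have "\<bar>a * \<bar>a\<bar> - b * \<bar>b\<bar>\<bar> = \<bar>- (a * a + b * b)\<bar>" by simp
   then have "\<bar>a * \<bar>a\<bar> - b * \<bar>b\<bar>\<bar> = a * a + b * b" by (simp only: abs_minus_cancel) simp
   then show ?thesis using pn[of a b] by simp
  qed
 qed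
 show thesis
 proof (rule that[OF d(1)])
  fix c :: 'a assume c: "norm c < d"
  have "(nni (%x. \<bar>f (x + c) - f x\<bar>\<^sup>2)) <= (nni (%x. 2 * \<bar>g (x + c) - g x\<bar>))"
   using ineq by (intro nn_integral_mono) (auto simp: g_def intro!: ennreal_leI)
  also have "... = ennreal (LINT x|lborel. 2 * \<bar>g (x + c) - g x\<bar>)"
   using g gt[of c] by (intro nn_integral_eq_integral) auto
  also have "... <= ennreal (e^2)"
   using d(2)[OF c] by (intro ennreal_leI) simp
  finally show "Lb 2 (%x. f (x + c) - f x) e" using e by (auto simp: Lb_def)
 qed
qed

lemma Lconv_translate:
 assumes "sq p" "X \<longlonglongrightarrow> 0"
 shows "Lconv 2 (%n x. p (x + X n) - p x)"
 unfolding Lconv_def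
proof (intro allI impI)
 fix e :: real assume "e > 0"
 from L2_translate[OF assms(1) this] obtain d where d: "d > 0" "!!c. norm c < d ==> Lb 2 (%x. p (x + c) - p x) e" by blast
 have "\<forall>\<^sub>F n in sequentially. norm (X n) < d"
  using tendstoD[OF assms(2) d(1)] by simp
 then show "\<forall>\<^sub>F n in sequentially. Lb 2 (%x. p (x + X n) - p x) e"
  by eventually_elim (rule d(2))
qed

text \<open>The partial derivative on the whole space as a strong L2 limit of quotients. By
  \<open>DQ_iff\<close> this is the same as a weak derivative for square integrable functions; the
  strong form suits products and compositions, the weak form suits limits and parameter
  integrals.\<close>

definition DQ :: "'n => (real^'n => real) => (real^'n => real) => bool" where
 "DQ i p q \<longleftrightarrow> sq p \<and> sq q \<and> Lconv 2 (%n x. dq i n p x - q x)"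

text \<open>Summation by parts: the shift is moved from P to the test function, whose quotients
  converge by \<open>test_quotient_limit\<close>. Convergence in L1 after multiplication with a test
  function is enough, so P and Q may be merely locally integrable.\<close>

lemma weak_dir_of_dq:
 fixes P Q :: "real^'n => real"
 assumes P: "P \<in> bmeas" "loc_int UNIV P" and Q: "Q \<in> bmeas" "loc_int UNIV Q"
  and c: "!!phi. test_fun UNIV phi ==> Lconv 1 (%n x. phi x * (dq i n P x - Q x))"
 shows "weak_dir UNIV (axis i 1) P Q"
 unfolding weak_dir_def
proof (intro allI impI)
 fix phi :: "real^'n => real" assume phi: "test_fun UNIV phi"
 define e where "e n = step n *R (axis i 1 :: real^'n)" for n
 note [measurable] = P(1) Q(1)
 obtain K where K: "compact K" "!!x. x \<notin> K ==> phi x = 0"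
  using test_fun_support[OF phi] by metis
 have [measurable]: "phi \<in> bmeas"
  using test_fun_continuous[OF phi] by (rule borel_measurable_continuous_onI)
 have phit: "test_fun UNIV (%x. phi (x - c))" for c
  using phi K by (intro test_fun_translate[where K = K]) (auto simp: test_fun_def)
 have i1: "integrable lborel (%x. phi x * P (x + c))" for c
 proof -
  have "integrable lborel (%x. phi (x - c) * P x)" by (rule test_fun_integrable[OF phit P(2)])
  then show ?thesis
   using lborel_integral_translate(2)[of "%x. phi (x - c) * P x" c] by simp
 qed
 have i2: "integrable lborel (%x. phi x * Q x)" by (rule test_fun_integrable[OF phi Q(2)])
 have eq: "(LINT x|lborel. phi x * (dq i n P x - Q x))
   = (LINT x|lborel. (phi (x - e n) - phi x) / step n * P x) - (LINT x|lborel. phi x * Q x)" for n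
 proof -
  have "(LINT x|lborel. phi x * (dq i n P x - Q x))
   = (LINT x|lborel. (phi x * P (x + e n) - phi x * P x) / step n - phi x * Q x)"
   by (simp add: e_def algebra_simps diff_divide_distrib)
  also have "... = ((LINT x|lborel. phi x * P (x + e n)) - (LINT x|lborel. phi x * P x)) / step n - (LINT x|lborel. phi x * Q x)"
   using i1[of "e n"] i1[of 0] i2 by simp
  also have "(LINT x|lborel. phi x * P (x + e n)) = (LINT x|lborel. phi (x - e n) * P x)"
   using lborel_integral_translate(1)[of "%x. phi (x - e n) * P x" "e n"] by simp
  also have "((LINT x|lborel. phi (x - e n) * P x) - (LINT x|lborel. phi x * P x)) / step n
    = (LINT x|lborel. (phi (x - e n) * P x - phi x * P x) / step n)"
   using test_fun_integrable(1)[OF phit P(2), of "e n"] i1[of 0] by simp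
  also have "... = (LINT x|lborel. (phi (x - e n) - phi x) / step n * P x)"
   by (simp add: algebra_simps diff_divide_distrib)
  finally show ?thesis .
 qed
 have z: "(%n. LINT x|lborel. phi x * (dq i n P x - Q x)) \<longlonglongrightarrow> 0"
 proof (rule LIMSEQ_I)
  fix r :: real assume "r > 0"
  then have "r / 2 > 0" by simp
  from LconvD[OF c[OF phi] this]
  obtain N where N: "!!n. n >= N ==> Lb 1 (%x. phi x * (dq i n P x - Q x)) (r / 2)"
   by (auto simp: eventually_sequentially)
  show "\<exists>no. \<forall>n\<ge>no. norm ((LINT x|lborel. phi x * (dq i n P x - Q x)) - 0) < r"
   using Lb_1_integral_le[OF N] \<open>r > 0\<close> by (intro exI[of _ N]) force
 qed
 \<comment> \<open>One compact set for the supports of phi and of all its shifts, since no step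
   exceeds 1.\<close>
 define K' where "K' = (%(x, t). x + t *R (axis i 1 :: real^'n)) ` (K \<times> {0..1})"
 have K': "compact K'" unfolding K'_def by (rule compact_segment_sweep[OF K(1)])
 have out: "phi (x - e n) = 0" "phi x = 0" if "x \<notin> K'" for x n
 proof -
  have "y \<notin> K" if "x = y + t *R axis i 1" "0 <= t" "t <= 1" for y t
   using \<open>x \<notin> K'\<close> that by (auto simp: K'_def)
  from this[of "x - e n" "step n"] this[of x 0] show "phi (x - e n) = 0" "phi x = 0"
   using step_pos[of n] step_le_1[of n] K(2) by (auto simp: e_def)
 qed
 have "(%n. LINT x|lborel. (phi (x - e n) - phi x) / step n * P x)
   \<longlonglongrightarrow> (LINT x|lborel. (- fder phi x (axis i 1)) * P x)"
  unfolding e_def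
 proof (rule test_quotient_limit[OF phi P(1) _ step_tendsto, where K = K'])
  show "set_integrable lborel K' P" using P(2) K' by (auto simp: loc_int_def)
  show "step n ~= 0" for n using step_pos[of n] by simp
  show "phi (x - step n *R axis i 1) = 0 \<and> phi x = 0" if "x \<notin> K'" for x n using out[OF that] by (simp add: e_def)
 qed
 from tendsto_diff[OF this tendsto_const, of "LINT x|lborel. phi x * Q x"]
 have "(%n. LINT x|lborel. phi x * (dq i n P x - Q x))
   \<longlonglongrightarrow> (LINT x|lborel. (- fder phi x (axis i 1)) * P x) - (LINT x|lborel. phi x * Q x)"
  by (simp only: eq)
 from LIMSEQ_unique[OF this z]
 show "(LINT x|lborel. fder phi x (axis i 1) * P x) = - (LINT x|lborel. phi x * Q x)"
  by simp
qed

lemma test_fun_sq: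
 fixes phi :: "real^'n => real"
 assumes "test_fun D phi"
 shows "sq phi" "sq (%x. fder phi x v)"
proof -
 obtain K where K: "compact K" "!!x. x \<notin> K ==> phi x = 0"
  "!!x v. x \<notin> K ==> fder phi x v = 0"
  using test_fun_support[OF assms] by metis
 obtain B where B: "B > 0" "!!x. norm (phi x) <= B" "!!x. norm (fder phi x v) <= B"
  using test_fun_bounds[OF assms, of v] by metis
 have *: "sq f" if "continuous_on UNIV f" "!!x. x \<notin> K ==> f x = 0" "!!x. norm (f x) <= B" for f :: "real^'n => real"
 proof -
  have [measurable]: "f \<in> bmeas" "K \<in> sets borel"
   using that(1) K(1) by (auto intro: borel_measurable_continuous_onI borel_compact)
  have "integrable lborel (%x. (f x)\<^sup>2)"
  proof (rule Bochner_Integration.integrable_bound[where f = "%x. B\<^sup>2 * indicator K x"])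
   show "integrable lborel (%x. B\<^sup>2 * indicator K x)"
    using emeasure_compact_finite[OF K(1)] by (intro integrable_mult_right) (auto simp: integrable_indicator_iff)
   have "(f x)^2 <= B^2" for x using that(3)[of x] B(1) by (simp add: abs_le_square_iff[symmetric])
   then show "AE x in lborel. norm ((f x)^2) <= norm (B^2 * indicator K x)"
    using that(2) by (intro AE_I2) (auto split: split_indicator)
  qed auto
  then show ?thesis by (simp add: sq_iff_integrable)
 qed
 show "sq phi" using test_fun_continuous[OF assms] K B by (intro *) auto
 show "sq (%x. fder phi x v)" using test_fun_continuous_deriv[OF assms] K B by (intro *) auto
qed

lemma DQ_weak_dir:
 assumes "DQ i p q"
 shows "weak_dir UNIV (axis i 1) p q"
proof (rule weak_dir_of_dq)
 fix phi :: "real^'a => real" assume "test_fun UNIV phi"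
 from test_fun_sq(1)[OF this] obtain K where "Lb 2 phi K" by (auto simp: sq_def)
 then show "Lconv 1 (%n x. phi x * (dq i n p x - q x))"
  using Lconv_mult_22[of "%n x. dq i n p x - q x" "%n. phi" K] assms by (simp add: DQ_def mult.commute)
qed (use assms in \<open>auto simp: DQ_def intro: sq_measurable sq_loc_int\<close>)

lemma weak_dir_scale:
 assumes "weak_dir D v p q"
 shows "weak_dir D (c *R v) p (%x. c * q x)"
 unfolding weak_dir_def
proof (intro allI impI)
 fix phi :: "real^'a => real" assume phi: "test_fun D phi"
 then have diff: "phi differentiable (at x)" for x by (metis Ck.simps(2) test_fun_def)
 have "(LINT x|lborel. fder phi x (c *R v) * p x) = c * (LINT x|lborel. fder phi x v * p x)"
  using linear_frechet_derivative[OF diff] by (simp add: linear_cmul mult.assoc)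
 also have "... = - (LINT x|lborel. phi x * (c * q x))"
  using assms phi by (simp add: weak_dir_def mult.left_commute)
 finally show "(LINT x|lborel. fder phi x (c *R v) * p x) = - (LINT x|lborel. phi x * (c * q x))" .
qed

text \<open>Minkowski over t in [0,1], since every intermediate shift t c is no longer than c and L2
  translations are continuous.\<close>

lemma segment_average_L2:
 fixes q :: "'a::euclidean_space => real"
 assumes q: "sq q" and e: "e > 0"
 obtains d where "d > 0" "!!c. norm c < d ==> Lb 2 (%x. (LINT t:{0..1}|lborel. q (x + t *R c)) - q x) e"
proof -
 have [measurable]: "q \<in> bmeas" using q by (rule sq_measurable)
 obtain d where d: "d > 0" "!!c. norm c < d ==> Lb 2 (%x. q (x + c) - q x) e"
  using L2_translate[OF q e] by blast
 show thesis
 proof (rule that[OF d(1)])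
  fix c :: 'a assume c: "norm c < d"
  have "Lb 2 (%x. LINT t|lborel. indicator {0..1} t * (q (x + t *R c) - q x)) (1 * e)"
   "AE x in lborel. integrable lborel (%t. indicator {0..1} t * (q (x + t *R c) - q x))"
  proof (rule_tac [!] Lb_param_integral[where sig = "%_::real. 1"])
   have "Lb 2 (%x. q (x + t *R c) - q x) (e * 1)" if "t \<in> {0..1}" for t :: real
   proof -
    have "norm (t *R c) <= 1 * norm c" using that by (simp add: mult_left_le_one_le)
    then show ?thesis using d(2)[of "t *R c"] c by simp
   qed
   then show "indicator {0..1} t ~= (0::real) ==> Lb 2 (%x. q (x + t *R c) - q x) (e * 1)"
     "indicator {0..1} t ~= (0::real) ==> Lb 2 (%x. q (x + t *R c) - q x) (e * 1)" for t :: real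
    by (auto split: split_indicator_asm)
   have "(nni (%z. \<bar>indicator {0..1::real} z\<bar> * 1)) = (\<integral>\<^sup>+z. indicator {0..1::real} z \<partial>lborel)"
    by (intro nn_integral_cong) (auto split: split_indicator)
   then show "(nni (%z. \<bar>indicator {0..1::real} z\<bar> * 1)) <= ennreal 1"
    "(nni (%z. \<bar>indicator {0..1::real} z\<bar> * 1)) <= ennreal 1" by auto
  qed (use e in \<open>auto simp: split_beta'\<close>)
  moreover have "(%x. (LINT t:{0..1}|lborel. q (x + t *R c)) - q x) \<in> bmeas"
   unfolding set_lebesgue_integral_def
   by (intro borel_measurable_diff lborel.borel_measurable_lebesgue_integral) measurable
  moreover have "AE x in lborel. (LINT t:{0..1}|lborel. q (x + t *R c)) - q x
    = (LINT t|lborel. indicator {0..1} t * (q (x + t *R c) - q x))"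
   using calculation(2)
  proof eventually_elim
   case (elim x)
   have i: "integrable lborel (%t::real. indicator {0..1} t * q x)" by auto
   from Bochner_Integration.integrable_add[OF elim i]
   have "integrable lborel (%t. indicator {0..1} t * q (x + t *R c))" by (simp add: algebra_simps)
   with i show ?case by (simp add: set_lebesgue_integral_def right_diff_distrib)
  qed
  ultimately show "Lb 2 (%x. (LINT t:{0..1}|lborel. q (x + t *R c)) - q x) e"
   using Lb_cong_AE by force
 qed
qed

lemma weak_dir_dq_eq:
 assumes "open D" "p \<in> bmeas" "q \<in> bmeas" "loc_int D p" "loc_int D q"
  and "weak_dir D (axis i 1) p q"
 shows "AE x in lborel. (\<forall>t\<in>{0..1}. x + t *R (step n *R axis i 1) \<in> D) -->
  dq i n p x = (LINT t:{0..1}|lborel. q (x + t *R (step n *R axis i 1)))"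
proof -
 have "loc_int D (%x. step n * q x)"
  using assms(5) by (auto simp: loc_int_def)
 moreover have "(%x. step n * q x) \<in> bmeas" using assms(3) by simp
 ultimately have "AE x in lborel. (\<forall>t\<in>{0..1}. x + t *R (step n *R axis i 1) \<in> D) -->
   p (x + step n *R axis i 1) - p x = (LINT t:{0..1}|lborel. step n * q (x + t *R (step n *R axis i 1)))"
  by (intro weak_dir_segment assms(1,2,4) weak_dir_scale[OF assms(6)])
 then show ?thesis
  by eventually_elim (use step_pos[of n] in simp)
qed

lemma Lconv_segment_average:
 fixes q :: "real^'n => real"
 assumes "sq q"
 shows "Lconv 2 (%n x. (LINT t:{0..1}|lborel. q (x + t *R (step n *R axis i 1))) - q x)"
 unfolding Lconv_def
proof (intro allI impI)
 fix e :: real assume "e > 0"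
 from segment_average_L2[OF assms this] obtain d where
  d: "d > 0" "!!c. norm c < d ==> Lb 2 (%x. (LINT t:{0..1}|lborel. q (x + t *R c)) - q x) e" by blast
 have "\<forall>\<^sub>F n in sequentially. norm (step n *R axis i 1 :: real^'n) < d"
  using tendstoD[OF step_axis_tendsto d(1)] by simp
 then show "\<forall>\<^sub>F n in sequentially. Lb 2 (%x. (LINT t:{0..1}|lborel. q (x + t *R (step n *R axis i 1))) - q x) e"
  by eventually_elim (rule d(2))
qed

text \<open>By \<open>weak_dir_dq_eq\<close> the quotient is almost everywhere the mean of q over a
  short segment, and such means converge to q in L2.\<close>

lemma weak_dir_DQ:
 assumes "sq p" "sq q" "weak_dir UNIV (axis i 1) p q"
 shows "DQ i p q"
proof -
 note [measurable] = sq_measurable[OF assms(1)] sq_measurable[OF assms(2)]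
 have "Lconv 2 (%n x. dq i n p x - q x)"
 proof (rule Lconv_dominated[OF Lconv_segment_average[OF assms(2), of i]])
  fix n
  have "AE x in lborel. dq i n p x = (LINT t:{0..1}|lborel. q (x + t *R (step n *R axis i 1)))"
   using weak_dir_dq_eq[OF open_UNIV _ _ sq_loc_int[OF assms(1)] sq_loc_int[OF assms(2)] assms(3), of n] by simp
  then show "AE x in lborel. \<bar>dq i n p x - q x\<bar> <= \<bar>(LINT t:{0..1}|lborel. q (x + t *R (step n *R axis i 1))) - q x\<bar>"
   by eventually_elim simp
 qed measurable
 then show ?thesis using assms by (simp add: DQ_def)
qed

lemma DQ_iff: "DQ i p q \<longleftrightarrow> sq p \<and> sq q \<and> weak_dir UNIV (axis i 1) p q"
 by (metis weak_dir_DQ DQ_weak_dir DQ_def)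

subsection \<open>Calculus of difference quotients\<close>

lemma DQ_sq: "DQ i p q ==> sq p" "DQ i p q ==> sq q"
 by (auto simp: DQ_def)

lemma DQ_cong_AE:
 assumes "DQ i p q" "sq p'" "sq q'" "AE x in lborel. p' x = p x" "AE x in lborel. q' x = q x"
 shows "DQ i p' q'"
proof -
 note [measurable] = sq_measurable[OF assms(2)] sq_measurable[OF assms(3)]
 have "Lconv 2 (%n x. dq i n p' x - q' x)"
 proof (rule Lconv_dominated)
  show "Lconv 2 (%n x. dq i n p x - q x)" using assms by (simp add: DQ_def)
  fix n
  show "AE x in lborel. \<bar>dq i n p' x - q' x\<bar> <= \<bar>dq i n p x - q x\<bar>"
   using assms(4,5) AE_translate[OF assms(4), of "step n *R axis i 1"]
   by eventually_elim simp
 qed measurable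
 then show ?thesis using assms by (simp add: DQ_def)
qed

lemma DQ_add:
 assumes "DQ i p q" "DQ i p' q'"
 shows "DQ i (%x. p x + p' x) (%x. q x + q' x)"
proof -
 have "Lconv 2 (%n x. (dq i n p x - q x) + (dq i n p' x - q' x))"
  using assms by (intro Lconv_add) (auto simp: DQ_def)
 also have "(%n x. (dq i n p x - q x) + (dq i n p' x - q' x)) = (%n x. dq i n (%x. p x + p' x) x - (q x + q' x))"
  by (simp add: fun_eq_iff add_divide_distrib diff_divide_distrib)
 finally show ?thesis using assms by (auto simp: DQ_def intro: sq_add)
qed

lemma DQ_cmult:
 assumes "DQ i p q"
 shows "DQ i (%x. c * p x) (%x. c * q x)"
proof -
 have "Lconv 2 (%n x. c * (dq i n p x - q x))"
  using assms by (intro Lconv_cmult) (auto simp: DQ_def)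
 also have "(%n x. c * (dq i n p x - q x)) = (%n x. dq i n (%x. c * p x) x - c * q x)"
  by (simp add: fun_eq_iff right_diff_distrib diff_divide_distrib)
 finally show ?thesis using assms by (auto simp: DQ_def intro: sq_cmult)
qed

lemma DQ_diff:
 assumes "DQ i p q" "DQ i p' q'"
 shows "DQ i (%x. p x - p' x) (%x. q x - q' x)"
 using DQ_add[OF assms(1) DQ_cmult[OF assms(2), of "-1"]] by simp

lemma DQ_zero: "DQ i (%x. 0) (%x. 0)"
 by (simp add: DQ_iff sq_zero weak_dir_def)

lemma DQ_sum:
 assumes "finite I" "!!j. j \<in> I ==> DQ i (p j) (q j)"
 shows "DQ i (%x. \<Sum>j\<in>I. p j x) (%x. \<Sum>j\<in>I. q j x)"
 using assms by (induction I rule: finite_induct) (auto intro: DQ_zero DQ_add)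

lemma DQ_translate:
 assumes "DQ i p q"
 shows "DQ i (%x. p (x + c)) (%x. q (x + c))"
proof -
 have "Lconv 2 (%n x. dq i n p (x + c) - q (x + c))"
  by (rule Lconv_scaled[where F = "%n x. dq i n p x - q x" and p = 2 and K = 1])
    (use assms Lb_translate[of 2 "%x. dq i _ p x - q x"] in \<open>auto simp: DQ_def\<close>)
 then show ?thesis using assms by (auto simp: DQ_def add.assoc add.commute[of c] intro: sq_translate)
qed

text \<open>The derivative appears only as the pointwise limit of the quotients along
  \<open>step\<close>, and the Lipschitz bound along the axis provides their domination. One
  constant serves for all three bounds.\<close>

definition Mult :: "real => 'n => (real^'n => real) => (real^'n => real) => bool" where
 "Mult K i b b' \<longleftrightarrow> b \<in> bmeas \<and> b' \<in> bmeas \<and>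
   (\<forall>x. \<bar>b x\<bar> <= K) \<and> (\<forall>x. \<bar>b' x\<bar> <= K) \<and>
   (\<forall>x t. \<bar>b (x + t *R axis i 1) - b x\<bar> <= K * \<bar>t\<bar>) \<and> (\<forall>x. (%n. dq i n b x) \<longlonglongrightarrow> b' x)"

lemma MultD:
 assumes "Mult K i b b'"
 shows "b \<in> bmeas" "b' \<in> bmeas" "\<bar>b x\<bar> <= K" "\<bar>b' x\<bar> <= K"
  "\<bar>b (x + t *R axis i 1) - b x\<bar> <= K * \<bar>t\<bar>" "(%n. dq i n b x) \<longlonglongrightarrow> b' x" "0 <= K" "\<bar>dq i n b x\<bar> <= K"
proof -
 show "b \<in> bmeas" "b' \<in> bmeas" "\<bar>b x\<bar> <= K" "\<bar>b' x\<bar> <= K"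
  "\<bar>b (x + t *R axis i 1) - b x\<bar> <= K * \<bar>t\<bar>" "(%n. dq i n b x) \<longlonglongrightarrow> b' x"
  using assms unfolding Mult_def by blast+
 have "\<bar>b x\<bar> <= K" "\<bar>b (x + step n *R axis i 1) - b x\<bar> <= K * \<bar>step n\<bar>" using assms unfolding Mult_def by blast+
 then show "0 <= K" "\<bar>dq i n b x\<bar> <= K" using step_pos[of n] by (auto simp: field_simps)
qed

text \<open>The error splits into the quotient of b times a translation difference of p, small by
  continuity of translations, and (quotient - b') p, small by dominated convergence.\<close>

lemma Lconv_mult_dq:
 assumes M: "Mult K i b b'" and p: "sq p"
 shows "Lconv 2 (%n x. dq i n b x * p (x + step n *R axis i 1) - b' x * p x)"
proof -
 note [measurable] = MultD(1,2)[OF M] sq_measurable[OF p]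
 have 1: "Lconv 2 (%n x. dq i n b x * (p (x + step n *R axis i 1) - p x))"
  by (rule Lconv_bounded_mult[OF Lconv_translate[OF p step_axis_tendsto], where K = K])
    (use MultD[OF M] in auto)
 have 2: "Lconv 2 (%n x. (dq i n b x - b' x) * p x)"
 proof (rule Lconv_dct[OF p, where K = "2 * K"])
  show "\<bar>dq i n b x - b' x\<bar> <= 2 * K" for n x
   using MultD(8)[OF M, where n = n and x = x] MultD(4)[OF M, where x = x] by linarith
  show "(%n. dq i n b x - b' x) \<longlonglongrightarrow> 0" for x
   using MultD(6)[OF M, where x = x] by (simp add: LIM_zero)
 qed measurable
 have eq: "a * (c - d) + (a - b) * d = a * c - b * d" for a b c d :: real
  by (simp add: algebra_simps)
 from Lconv_add[OF 1 2] show ?thesis by (simp only: eq)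
qed

lemma dq_mult:
 "dq i n (%x. b x * p x) x = dq i n b x * p (x + step n *R axis i 1) + b x * dq i n p x"
 using step_pos[of n] by (simp add: field_simps)

lemma DQ_mult:
 assumes M: "Mult K i b b'" and p: "DQ i p q"
 shows "DQ i (%x. b x * p x) (%x. b' x * p x + b x * q x)"
proof -
 note s = DQ_sq[OF p]
 have "Lconv 2 (%n x. (dq i n b x * p (x + step n *R axis i 1) - b' x * p x) + b x * (dq i n p x - q x))"
  using p by (intro Lconv_add Lconv_mult_dq[OF M] s Lconv_bounded_mult[where K = K] MultD[OF M]) (auto simp: DQ_def)
 then have "Lconv 2 (%n x. dq i n (%x. b x * p x) x - (b' x * p x + b x * q x))"
  unfolding dq_mult by (simp add: algebra_simps)
 then show ?thesis
  using s by (auto simp: DQ_def intro!: sq_add sq_bounded_mult[where K = K] MultD[OF M])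
qed

text \<open>A product of two L2 functions is only known to be in L1, so the product rule is obtained
  in weak form; the three error terms are products of an L2 null sequence and a bounded sequence in
  L2.\<close>

lemma DQ_product_weak:
 assumes p: "DQ i p p'" and q: "DQ i q q'"
 shows "weak_dir UNIV (axis i 1) (%x. p x * q x) (%x. p' x * q x + p x * q' x)"
proof (rule weak_dir_of_dq)
 note s = DQ_sq[OF p] DQ_sq[OF q]
 note [measurable] = s[THEN sq_measurable]
 show "(%x. p x * q x) \<in> bmeas" "(%x. p' x * q x + p x * q' x) \<in> bmeas"
  by measurable
 show "loc_int UNIV (%x. p x * q x)" "loc_int UNIV (%x. p' x * q x + p x * q' x)"
  unfolding loc_int_def
  using s by (auto intro!: integrable_mult_indicator Bochner_Integration.integrable_add sq_mult_integrable
    simp: set_integrable_def borel_compact simp del: real_scaleR_def)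
 fix phi :: "real^'a => real" assume phi: "test_fun UNIV phi"
 then obtain B where B: "!!x. norm (phi x) <= B" using test_fun_bounds by metis
 obtain A1 A2 A4 where A: "Lb 2 p A1" "Lb 2 q A2" and A4: "Lb 2 p' A4" using s by (auto simp: sq_def)
 have 1: "Lconv 1 (%n x. (dq i n p x - p' x) * q (x + step n *R axis i 1))"
  using p by (intro Lconv_mult_22[where K = A2] Lb_translate A) (auto simp: DQ_def)
 have 2: "Lconv 1 (%n x. (q (x + step n *R axis i 1) - q x) * p' x)"
  by (intro Lconv_mult_22[where K = A4] Lconv_translate A4 s step_axis_tendsto)
 have 3: "Lconv 1 (%n x. (dq i n q x - q' x) * p x)"
  using q by (intro Lconv_mult_22[where K = A1] A) (auto simp: DQ_def)
 have sum: "Lconv 1 (%n x. ((dq i n p x - p' x) * q (x + step n *R axis i 1) + (q (x + step n *R axis i 1) - q x) * p' x)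
   + (dq i n q x - q' x) * p x)"
  by (intro Lconv_add 1 2 3) auto
 have ident: "((a - a') * c + (c - b) * a') + (e - b') * d = a * c + d * e - (a' * b + d * b')" for a a' b b' c d e :: real
  by (simp add: algebra_simps)
 have eq: "((dq i n p x - p' x) * q (x + step n *R axis i 1) + (q (x + step n *R axis i 1) - q x) * p' x)
   + (dq i n q x - q' x) * p x = dq i n (%x. p x * q x) x - (p' x * q x + p x * q' x)" for n x
  unfolding dq_mult by (rule ident)
 have "Lconv 1 (%n x. dq i n (%x. p x * q x) x - (p' x * q x + p x * q' x))"
  by (rule sum[unfolded eq])
 then show "Lconv 1 (%n x. phi x * (dq i n (%x. p x * q x) x - (p' x * q x + p x * q' x)))"
  using B test_fun_continuous[OF phi] by (intro Lconv_bounded_mult[where K = B]) (auto intro: borel_measurable_continuous_onI)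
qed

text \<open>The quotient of F(p) is the quotient of p times a secant slope of F. The slope deviates
  from F'(p) by at most L times a translation difference of p, which tends to zero in L2; multiplied
  with q it tends to zero only in L1, so the derivative is first identified weakly and then upgraded
  by \<open>weak_dir_DQ\<close>.\<close>

lemma DQ_chain:
 assumes p: "DQ i p q" and F0: "F 0 = 0" and F: "!!r. (F has_real_derivative F' r) (at r)"
  and C: "!!r. \<bar>F' r\<bar> <= C" and L: "!!r s. \<bar>F' r - F' s\<bar> <= L * \<bar>r - s\<bar>"
 shows "DQ i (%x. F (p x)) (%x. F' (p x) * q x)"
proof (rule weak_dir_DQ)
 note s = DQ_sq[OF p]
 note [measurable] = s[THEN sq_measurable]
 have "continuous_on UNIV F" by (rule DERIV_continuous_on) (rule has_field_derivative_at_within[OF F])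
 then have [measurable]: "F \<in> bmeas" by (rule borel_measurable_continuous_onI)
 have "L-lipschitz_on UNIV F'" if "L >= 0" using L that by (auto simp: lipschitz_on_def dist_real_def)
 moreover have L0: "L >= 0" using L[of 1 0] by (simp add: order_trans[OF abs_ge_zero])
 ultimately have "continuous_on UNIV F'" using lipschitz_on_continuous_on by blast
 then have [measurable]: "F' \<in> bmeas" by (rule borel_measurable_continuous_onI)
 have lip: "\<bar>F r - F s\<bar> <= C * \<bar>r - s\<bar>" for r s
  using field_differentiable_bound[of UNIV F F' C r s] F C by (auto intro: has_field_derivative_at_within)
 obtain A where A: "Lb 2 p A" using s by (auto simp: sq_def)
 have C0: "C >= 0" using C[of 0] by linarith
 have "Lb 2 (%x. F (p x)) (\<bar>C\<bar> * A)"
 proof (rule Lb_dominated[OF Lb_cmult[OF A]])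
  show "AE x in lborel. \<bar>F (p x)\<bar> <= \<bar>C * p x\<bar>"
   using lip[of _ 0] F0 C0 by (auto simp: abs_mult)
 qed measurable
 then show sF: "sq (%x. F (p x))" by (rule sqI)
 show sF': "sq (%x. F' (p x) * q x)" using C by (intro sq_bounded_mult s) auto
 \<comment> \<open>The secant slope, completed by the derivative on the diagonal so that the
   factorization of F r - F s holds for all arguments.\<close>
 define m where "m r s = (if r = s then F' s else (F r - F s) / (r - s))" for r s
 have m1: "F r - F s = m r s * (r - s)" for r s by (simp add: m_def)
 have m2: "\<bar>m r s\<bar> <= C" for r s
  using lip[of r s] C by (auto simp: m_def field_simps)
 have m3: "\<bar>m r s - F' s\<bar> <= L * \<bar>r - s\<bar>" for r s
 proof (cases "r = s")
  case False
  have "\<exists>z. \<bar>z - s\<bar> <= \<bar>r - s\<bar> \<and> F r - F s = (r - s) * F' z"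
  proof (cases "r < s")
   case True
   from MVT2[OF True, of F F'] F obtain z where "r < z" "z < s" "F s - F r = (s - r) * F' z" by auto
   then show ?thesis by (intro exI[of _ z]) (auto simp: algebra_simps)
  next
   case rs: False
   then have "s < r" using False by simp
   from MVT2[OF this, of F F'] F obtain z where "s < z" "z < r" "F r - F s = (r - s) * F' z" by auto
   then show ?thesis by (intro exI[of _ z]) auto
  qed
  then obtain z where z: "\<bar>z - s\<bar> <= \<bar>r - s\<bar>" "F r - F s = (r - s) * F' z" by blast
  then have "m r s = F' z" using False by (simp add: m_def)
  then show ?thesis using L[of z s] z(1) L0 by (smt (verit) mult_left_mono)
 qed (simp add: m_def)
 have [measurable]: "(%x. m (f x) (g x)) \<in> bmeas"
  if [measurable]: "f \<in> bmeas" "g \<in> bmeas" for f g :: "real^'a => real"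
  unfolding m_def by measurable
 obtain B where B: "Lb 2 q B" using s by (auto simp: sq_def)
 show "weak_dir UNIV (axis i 1) (%x. F (p x)) (%x. F' (p x) * q x)"
 proof (rule weak_dir_of_dq)
  fix phi :: "real^'a => real" assume phi: "test_fun UNIV phi"
  then obtain M where M: "!!x. norm (phi x) <= M" using test_fun_bounds by metis
  have [measurable]: "phi \<in> bmeas"
   using test_fun_continuous[OF phi] by (rule borel_measurable_continuous_onI)
  obtain N where N: "Lb 2 phi N" using test_fun_sq[OF phi] by (auto simp: sq_def)
  have "Lconv 2 (%n x. m (p (x + step n *R axis i 1)) (p x) * (dq i n p x - q x))"
   using p m2 by (intro Lconv_bounded_mult[where K = C]) (auto simp: DQ_def)
  then have 1: "Lconv 1 (%n x. (m (p (x + step n *R axis i 1)) (p x) * (dq i n p x - q x)) * phi x)"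
   by (rule Lconv_mult_22[OF _ N])
  have "Lconv 1 (%n x. (p (x + step n *R axis i 1) - p x) * q x)"
   by (rule Lconv_mult_22[OF Lconv_translate[OF s(1) step_axis_tendsto] B])
  then have "Lconv 1 (%n x. (M * L) * ((p (x + step n *R axis i 1) - p x) * q x))"
   by (rule Lconv_cmult)
  then have 2: "Lconv 1 (%n x. phi x * ((m (p (x + step n *R axis i 1)) (p x) - F' (p x)) * q x))"
  proof (rule Lconv_dominated)
   fix n
   have "\<bar>phi x\<bar> * \<bar>m (p (x + step n *R axis i 1)) (p x) - F' (p x)\<bar> <= M * (L * \<bar>p (x + step n *R axis i 1) - p x\<bar>)" for x
    using M[of x] m3 by (intro mult_mono) (auto intro: order_trans[OF abs_ge_zero])
   from mult_right_mono[OF this abs_ge_zero]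
   show "AE x in lborel. \<bar>phi x * ((m (p (x + step n *R axis i 1)) (p x) - F' (p x)) * q x)\<bar>
    <= \<bar>M * L * ((p (x + step n *R axis i 1) - p x) * q x)\<bar>"
    using L0 M[of 0] by (intro AE_I2) (simp add: abs_mult mult.assoc order_trans[OF abs_ge_zero])
  qed measurable
  have eq: "phi x * (dq i n (%x. F (p x)) x - F' (p x) * q x)
   = (m (p (x + step n *R axis i 1)) (p x) * (dq i n p x - q x)) * phi x
    + phi x * ((m (p (x + step n *R axis i 1)) (p x) - F' (p x)) * q x)" for n x
  proof -
   have "dq i n (%x. F (p x)) x = m (p (x + step n *R axis i 1)) (p x) * dq i n p x"
    using m1[of "p (x + step n *R axis i 1)" "p x"] by simp
   moreover have "f * (m' * d - c * b) = (m' * (d - b)) * f + f * ((m' - c) * b)" for f m' d c b :: real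
    by (simp add: algebra_simps)
   ultimately show ?thesis by (simp only:)
  qed
  show "Lconv 1 (%n x. phi x * (dq i n (%x. F (p x)) x - F' (p x) * q x))"
   unfolding eq by (rule Lconv_add[OF 1 2]) simp
 qed (use sF sF' in \<open>auto intro: sq_loc_int\<close>)
qed

text \<open>Within one step of the boundary \<open>\<bar>rho\<bar> <= K h\<close>, which compensates the factor \<open>1/h\<close> in the
 difference quotient of \<open>G\<close> across the boundary.\<close>

lemma DQ_cutoff:
 assumes D: "open D" and M: "Mult K i rho rho'" and rho0: "!!x. x \<notin> D ==> rho x = 0"
  and G: "sq G" "!!x. x \<notin> D ==> G x = 0" and H: "sq H" and w: "weak_dir D (axis i 1) G H"
 shows "DQ i (%x. rho x * G x) (%x. rho' x * G x + rho x * H x)"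
proof -
 note [measurable] = MultD(1,2)[OF M] sq_measurable[OF G(1)] sq_measurable[OF H]
 define e where "e n = step n *R (axis i 1 :: real^'a)" for n
 define U where "U n = {x. \<forall>t\<in>{0..1}. x + t *R e n \<in> D}" for n
 have "open (U n)" for n unfolding U_def by (rule open_segment_inside[OF D])
 then have [measurable]: "U n \<in> sets borel" for n by simp
 have [measurable]: "D \<in> sets borel" using D by simp
 have K0: "0 <= K" by (rule MultD(7)[OF M])
 define avg where "avg n x = (LINT t:{0..1}|lborel. H (x + t *R e n)) - H x" for n x
 define b :: "nat => real^'a => real" where "b n = indicator (D - U n)" for n
 have 1: "Lconv 2 (%n x. K * \<bar>avg n x\<bar>)"
  unfolding avg_def e_def by (intro Lconv_cmult Lconv_abs Lconv_segment_average H)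
 have 2: "Lconv 2 (%n x. K * \<bar>G (x + e n) - G x\<bar>)"
  unfolding e_def by (intro Lconv_cmult Lconv_abs Lconv_translate G step_axis_tendsto)
 have 3: "Lconv 2 (%n x. (2 * K) * \<bar>b n x * G x\<bar>)"
 proof (intro Lconv_cmult Lconv_abs Lconv_dct[OF G(1), where K = 1])
  fix x assume "G x ~= 0"
  then have "x \<in> D" using G(2) by blast
  then obtain r where r: "r > 0" "ball x r \<subseteq> D" using D open_contains_ball by blast
  have "\<forall>\<^sub>F n in sequentially. step n < r" using order_tendstoD(2)[OF step_tendsto r(1)] .
  then have "\<forall>\<^sub>F n in sequentially. b n x = 0"
  proof eventually_elim
   case (elim n)
   have "x + t *R e n \<in> D" if "t \<in> {0..1}" for t
   proof -
    have "norm (t *R e n) <= step n"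
     using that step_pos[of n] by (auto simp: e_def mult_left_le_one_le)
    then have "x + t *R e n \<in> ball x r" using elim by (simp add: dist_norm)
    then show ?thesis using r(2) by blast
   qed
   then show ?case by (simp add: b_def U_def)
  qed
  then show "(%n. b n x) \<longlonglongrightarrow> 0" by (rule tendsto_eventually)
 qed (auto simp: b_def split: split_indicator)
 have 4: "Lconv 2 (%n x. K * \<bar>step n * H x\<bar>)"
  by (intro Lconv_cmult Lconv_abs Lconv_dct[OF H, where K = 1] step_tendsto)
    (use step_pos step_le_1 in \<open>auto simp: less_imp_le\<close>)
 have "Lconv 2 (%n x. K * \<bar>avg n x\<bar> + K * \<bar>G (x + e n) - G x\<bar> + (2 * K) * \<bar>b n x * G x\<bar> + K * \<bar>step n * H x\<bar>)"
  by (intro Lconv_add 1 2 3 4) auto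
 then have third: "Lconv 2 (%n x. rho x * (dq i n G x - H x))"
 proof (rule Lconv_dominated)
  fix n
  have "AE x in lborel. x \<in> U n --> dq i n G x = (LINT t:{0..1}|lborel. H (x + t *R e n))"
   using weak_dir_dq_eq[OF D _ _ sq_loc_int[OF G(1)] sq_loc_int[OF H] w, of n] by (simp add: U_def e_def)
  then show "AE x in lborel. \<bar>rho x * (dq i n G x - H x)\<bar>
   <= \<bar>K * \<bar>avg n x\<bar> + K * \<bar>G (x + e n) - G x\<bar> + (2 * K) * \<bar>b n x * G x\<bar> + K * \<bar>step n * H x\<bar>\<bar>"
  proof eventually_elim
   case (elim x)
   have nn: "0 <= K * \<bar>avg n x\<bar>" "0 <= K * \<bar>G (x + e n) - G x\<bar>" "0 <= (2 * K) * \<bar>b n x * G x\<bar>" "0 <= K * \<bar>step n * H x\<bar>"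
    using K0 by auto
   have S: "a <= \<bar>a + b + c + d\<bar>" "b + d <= \<bar>a + b + c + d\<bar>" if "0 <= a" "0 <= b" "0 <= c" "0 <= d" for a b c d :: real
    using that by auto
   consider "x \<in> U n" | "x \<notin> D" | "x \<in> D" "x \<notin> U n" by blast
   then show ?case
   proof cases
    case 1
    then have "\<bar>rho x * (dq i n G x - H x)\<bar> = \<bar>rho x\<bar> * \<bar>avg n x\<bar>" using elim by (simp add: avg_def abs_mult)
    also have "... <= K * \<bar>avg n x\<bar>" using MultD(3)[OF M] by (intro mult_right_mono) auto
    finally show ?thesis using S(1)[OF nn] by (rule order_trans)
   next
    case 2
    then have "rho x = 0" by (rule rho0)
    then show ?thesis by simp
   next
    case 3
    \<comment> \<open>After the Lipschitz bound has cancelled the 1/h, what remains is K |G(x + h e)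
      - G(x)| + K h |H(x)|, which tends to zero in L2.\<close>
    then obtain t where t: "0 <= t" "t <= 1" "x + t *R e n \<notin> D" by (auto simp: U_def)
    have "\<bar>rho (x + (t * step n) *R axis i 1) - rho x\<bar> <= K * \<bar>t * step n\<bar>" by (rule MultD(5)[OF M])
    then have "\<bar>rho x\<bar> <= K * (t * step n)" using rho0[OF t(3)] t(1) step_pos[of n] by (simp add: e_def abs_mult)
    also have "... <= K * step n" using mult_left_le_one_le[OF less_imp_le[OF step_pos[of n]] t(1,2)] K0 by (intro mult_left_mono) auto
    finally have r: "\<bar>rho x\<bar> <= K * step n" .
    have "\<bar>rho x * (dq i n G x - H x)\<bar> <= (K * step n) * \<bar>dq i n G x - H x\<bar>"
     unfolding abs_mult by (intro mult_right_mono r) simp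
    also have "... <= (K * step n) * (\<bar>dq i n G x\<bar> + \<bar>H x\<bar>)"
     using K0 step_pos[of n] by (intro mult_left_mono abs_triangle_ineq4) auto
    also have "... = K * \<bar>G (x + e n) - G x\<bar> + K * \<bar>step n * H x\<bar>"
     using step_pos[of n] by (simp add: e_def abs_mult abs_divide distrib_left mult.assoc)
    finally show ?thesis using S(2)[OF nn] by (rule order_trans)
   qed
  qed
 qed measurable
 have "Lconv 2 (%n x. (dq i n rho x * G (x + step n *R axis i 1) - rho' x * G x) + rho x * (dq i n G x - H x))"
  by (intro Lconv_add Lconv_mult_dq[OF M] G third) auto
 then have "Lconv 2 (%n x. dq i n (%x. rho x * G x) x - (rho' x * G x + rho x * H x))"
  unfolding dq_mult by (simp add: algebra_simps)
 then show ?thesis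
  using G H by (auto simp: DQ_def intro!: sq_add sq_bounded_mult[where K = K] MultD[OF M])
qed

subsection \<open>Weak derivatives of parameter integrals\<close>

text \<open>The hypothesis of the theorem of Fubini: Cauchy-Schwarz in x for each z, then
  integrability of |k| sig in z.\<close>

lemma pair_integrable_test:
 fixes Psi :: "'b::euclidean_space => 'a::euclidean_space => real"
 assumes [measurable]: "case_prod Psi \<in> borel_measurable (borel \<Otimes>\<^sub>M borel)"
   "k \<in> bmeas" "sig \<in> bmeas"
  and sig: "!!z. 0 < sig z" and L: "!!z. k z ~= 0 ==> Lb 2 (Psi z) (b * sig z)"
  and S: "(nni (%z. \<bar>k z\<bar> * sig z)) <= ennreal S" "0 <= S" "0 <= b"
  and psi: "Lb 2 psi C"
 shows "integrable (lborel \<Otimes>\<^sub>M lborel) (%(z, x). psi x * (k z * Psi z x))"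
proof -
 have [measurable]: "psi \<in> bmeas" using psi by (simp add: Lb_def)
 have C0: "0 <= C" using LbD(2)[OF psi] .
 have "(\<integral>\<^sup>+w. ennreal (norm (case w of (z, x) => psi x * (k z * Psi z x))) \<partial>(lborel \<Otimes>\<^sub>M lborel))
   = (\<integral>\<^sup>+z. nni (%x. norm (psi x * (k z * Psi z x))) \<partial>lborel)"
  by (subst lborel.nn_integral_fst[symmetric]) auto
 also have "... <= (\<integral>\<^sup>+z. ennreal (C * b) * ennreal (\<bar>k z\<bar> * sig z) \<partial>lborel)"
 proof (rule nn_integral_mono)
  fix z
  show "(nni (%x. norm (psi x * (k z * Psi z x)))) <= ennreal (C * b) * ennreal (\<bar>k z\<bar> * sig z)"
  proof (cases "k z = 0")
   case False
   have "(nni (%x. norm (psi x * (k z * Psi z x)))) = (\<integral>\<^sup>+x. ennreal \<bar>k z\<bar> * ennreal \<bar>psi x * Psi z x\<bar> \<partial>lborel)"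
    by (intro nn_integral_cong) (simp add: abs_mult ennreal_mult[symmetric] mult_ac)
   also have "... = ennreal \<bar>k z\<bar> * (\<integral>\<^sup>+x. ennreal \<bar>psi x * Psi z x\<bar> \<partial>lborel)"
    by (rule nn_integral_cmult) measurable
   also have "... <= ennreal \<bar>k z\<bar> * ennreal (C * (b * sig z))"
    using LbD(3)[OF Lb_mult_22[OF psi L[OF False]]] by (intro mult_left_mono) auto
   also have "... = ennreal (C * b) * ennreal (\<bar>k z\<bar> * sig z)"
    using sig[of z] C0 S by (simp add: ennreal_mult'[symmetric] mult_ac)
   finally show ?thesis .
  qed simp
 qed
 also have "... = ennreal (C * b) * (nni (%z. \<bar>k z\<bar> * sig z))"
  by (rule nn_integral_cmult) measurable
 also have "... <= ennreal (C * b) * ennreal S" by (intro mult_left_mono S) simp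
 also have "... < \<infinity>" using C0 S by (simp add: ennreal_mult[symmetric])
 finally show ?thesis by (auto simp: integrable_iff_bounded)
qed

text \<open>A weak derivative is tested linearly, so it passes through the integral over z by
  exchanging the order of integration on both sides.\<close>

lemma param_weak_dir:
 fixes Phi Phi' :: "'b::euclidean_space => real^'n => real"
 assumes [measurable]: "case_prod Phi \<in> borel_measurable (borel \<Otimes>\<^sub>M borel)" "case_prod Phi' \<in> borel_measurable (borel \<Otimes>\<^sub>M borel)"
   "k \<in> bmeas" "sig \<in> bmeas"
  and sig: "!!z. 0 < sig z"
  and L: "!!z. k z ~= 0 ==> Lb 2 (Phi z) (b * sig z)" "!!z. k z ~= 0 ==> Lb 2 (Phi' z) (b' * sig z)"
  and S: "(nni (%z. \<bar>k z\<bar> * sig z)) <= ennreal S" "0 <= S" "0 <= b" "0 <= b'"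
  and w: "!!z. k z ~= 0 ==> weak_dir UNIV v (Phi z) (Phi' z)"
 shows "weak_dir UNIV v (%x. LINT z|lborel. k z * Phi z x) (%x. LINT z|lborel. k z * Phi' z x)"
 unfolding weak_dir_def
proof (intro allI impI)
 fix phi :: "real^'n => real" assume phi: "test_fun UNIV phi"
 obtain C1 C2 where C: "Lb 2 (%x. fder phi x v) C1" "Lb 2 phi C2"
  using test_fun_sq(1)[OF phi] test_fun_sq(2)[OF phi, of v] by (auto simp: sq_def)
 note I1 = pair_integrable_test[OF assms(1,3,4) sig L(1) S(1,2,3) C(1)]
 note I2 = pair_integrable_test[OF assms(2,3,4) sig L(2) S(1,2,4) C(2)]
 have "(LINT x|lborel. fder phi x v * (LINT z|lborel. k z * Phi z x))
   = (LINT x|lborel. LINT z|lborel. fder phi x v * (k z * Phi z x))"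
  by simp
 also have "... = (LINT z|lborel. LINT x|lborel. fder phi x v * (k z * Phi z x))"
  by (rule lborel_pair.Fubini_integral[OF I1])
 also have "... = (LINT z|lborel. - (LINT x|lborel. phi x * (k z * Phi' z x)))"
 proof (rule Bochner_Integration.integral_cong[OF refl])
  fix z
  show "(LINT x|lborel. fder phi x v * (k z * Phi z x)) = - (LINT x|lborel. phi x * (k z * Phi' z x))"
  proof (cases "k z = 0")
   case False
   from w[OF False] phi
   have "k z * (LINT x|lborel. fder phi x v * Phi z x) = k z * - (LINT x|lborel. phi x * Phi' z x)"
    by (simp add: weak_dir_def)
   then show ?thesis by (simp add: mult.left_commute[of _ "k z"])
  qed simp
 qed
 also have "... = - (LINT z|lborel. LINT x|lborel. phi x * (k z * Phi' z x))" by simp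
 also have "(LINT z|lborel. LINT x|lborel. phi x * (k z * Phi' z x)) = (LINT x|lborel. LINT z|lborel. phi x * (k z * Phi' z x))"
  by (rule lborel_pair.Fubini_integral[OF I2, symmetric])
 also have "... = (LINT x|lborel. phi x * (LINT z|lborel. k z * Phi' z x))" by simp
 finally show "(LINT x|lborel. fder phi x v * (LINT z|lborel. k z * Phi z x))
   = - (LINT x|lborel. phi x * (LINT z|lborel. k z * Phi' z x))" .
qed

subsection \<open>Iterated integrals along the axes\<close>

text \<open>The partial integral is kept as a function on the whole space that is constant in
  direction i. Thereby coordinates can be integrated out one after the other without splitting the
  space into factors.\<close>

definition line_int :: "'n => (real^'n => ennreal) => real^'n => ennreal" where
 "line_int i f x = (\<integral>\<^sup>+t. f (x + t *R axis i 1) \<partial>lborel)"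

lemma line_int_measurable[measurable]:
 assumes [measurable]: "f \<in> bmeas"
 shows "line_int i f \<in> bmeas"
 unfolding line_int_def by measurable

lemma line_int_invariant:
 assumes [measurable]: "f \<in> bmeas"
 shows "line_int i f (x + s *R axis i 1) = line_int i f x"
proof -
 have "line_int i f (x + s *R axis i 1) = (\<integral>\<^sup>+t. f (x + (t + s) *R axis i 1) \<partial>lborel)"
  unfolding line_int_def by (simp add: algebra_simps)
 also have "... = line_int i f x"
  unfolding line_int_def by (rule nn_integral_translate[of "%t. f (x + t *R axis i 1)"]) measurable
 finally show ?thesis .
qed

lemma line_int_invariant2:
 assumes "!!x s. f (x + s *R axis j 1) = f x"
 shows "line_int i f (x + s *R axis j 1) = line_int i f x"
proof -
 have "f (x + s *R axis j 1 + t *R axis i 1) = f (x + t *R axis i 1)" for t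
  using assms[of "x + t *R axis i 1" s] by (simp add: algebra_simps)
 then show ?thesis by (simp add: line_int_def)
qed

lemma line_int_mono: "(!!x. f x <= g x) ==> line_int i f x <= line_int i g x"
 unfolding line_int_def by (intro nn_integral_mono)

lemma line_int_mult_invariant:
 assumes "!!x s. c (x + s *R axis i 1) = c x" and [measurable]: "f \<in> bmeas"
 shows "line_int i (%x. c x * f x) x = c x * line_int i f x"
 unfolding line_int_def assms(1) by (rule nn_integral_cmult) measurable

text \<open>The integral over the coordinate subspace of the directions in I, written with the
  product measure by which \<open>lborel\<close> is given; it serves to peel off one coordinate at a
  time.\<close>

definition slab_int :: "'n set => (real^'n => ennreal) => ennreal" where
 "slab_int I f = (\<integral>\<^sup>+g. f (\<Sum>b\<in>(%i. axis i 1) ` I. g b *R b) \<partial>(\<Pi>\<^sub>M b\<in>(%i. axis i 1) ` I. lborel))"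

lemma slab_int_empty: "slab_int {} f = f 0"
 by (simp add: slab_int_def PiM_empty nn_integral_count_space_finite)

lemma slab_int_insert:
 fixes f :: "real^'n => ennreal"
 assumes [measurable]: "f \<in> bmeas" and I: "i \<notin> I"
 shows "slab_int (insert i I) f = slab_int I (line_int i f)"
proof -
 interpret product_sigma_finite "%_::real^'n. lborel :: real measure" ..
 define A where "A = (%i. axis i (1::real) :: real^'n) ` I"
 have fin: "finite A" by (simp add: A_def)
 have ni: "axis i 1 \<notin> A" using I by (auto simp: A_def axis_eq_axis)
 have "slab_int (insert i I) f = (\<integral>\<^sup>+g. f (\<Sum>b\<in>insert (axis i 1) A. g b *R b) \<partial>(\<Pi>\<^sub>M b\<in>insert (axis i 1) A. lborel))"
  by (simp add: slab_int_def A_def)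
 also have "... = (\<integral>\<^sup>+g. \<integral>\<^sup>+t. f (\<Sum>b\<in>insert (axis i 1) A. (g(axis i 1 := t)) b *R b) \<partial>lborel \<partial>(\<Pi>\<^sub>M b\<in>A. lborel))"
  by (rule product_nn_integral_insert[OF fin ni]) measurable
 also have "... = (\<integral>\<^sup>+g. line_int i f (\<Sum>b\<in>A. g b *R b) \<partial>(\<Pi>\<^sub>M b\<in>A. lborel))"
 proof (intro nn_integral_cong)
  fix g :: "real^'n => real"
  have "(\<Sum>b\<in>A. (g(axis i 1 := t)) b *R b) = (\<Sum>b\<in>A. g b *R b)" for t
   using ni by (intro sum.cong) auto
  then have "(\<Sum>b\<in>insert (axis i 1) A. (g(axis i 1 := t)) b *R b) = (\<Sum>b\<in>A. g b *R b) + t *R axis i 1" for t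
   using fin ni by (simp add: add.commute)
  then show "(\<integral>\<^sup>+t. f (\<Sum>b\<in>insert (axis i 1) A. (g(axis i 1 := t)) b *R b) \<partial>lborel) = line_int i f (\<Sum>b\<in>A. g b *R b)"
   by (simp add: line_int_def)
 qed
 finally show ?thesis by (simp add: slab_int_def A_def)
qed

lemma nn_integral_lborel_slab:
 fixes f :: "real^'n => ennreal"
 assumes [measurable]: "f \<in> bmeas"
 shows "(\<integral>\<^sup>+x. f x \<partial>lborel) = slab_int UNIV f"
proof -
 have "(\<integral>\<^sup>+x. f x \<partial>lborel) = (\<integral>\<^sup>+x. f x \<partial>distr (\<Pi>\<^sub>M b\<in>Basis. lborel) borel (%f. \<Sum>b\<in>Basis. f b *R b))"
  by (simp add: lborel_eq[symmetric])
 also have "... = (\<integral>\<^sup>+g. f (\<Sum>b\<in>Basis. g b *R b) \<partial>(\<Pi>\<^sub>M b\<in>Basis. lborel))"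
  by (rule nn_integral_distr) measurable
 also have "Basis = (%i. axis i (1::real) :: real^'n) ` UNIV"
  by (auto simp: Basis_vec_def)
 finally show ?thesis by (simp add: slab_int_def)
qed

text \<open>The base point x does not matter, because f may be translated by x before the
  coordinates are separated.\<close>

lemma iterated_2:
 fixes f :: "real^'n => ennreal"
 assumes m: "f \<in> bmeas" and U: "(UNIV::'n set) = {i, j}" "i ~= j"
 shows "line_int j (line_int i f) x = (\<integral>\<^sup>+x. f x \<partial>lborel)"
proof -
 have mx: "(%y. f (y + x)) \<in> bmeas" using m by measurable
 have "(\<integral>\<^sup>+y. f y \<partial>lborel) = (\<integral>\<^sup>+y. f (y + x) \<partial>lborel)" by (simp add: nn_integral_translate[OF m])
 also have "... = slab_int {i, j} (%y. f (y + x))" using nn_integral_lborel_slab[OF mx] U by simp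
 also have "... = line_int j (line_int i (%y. f (y + x))) 0"
  using U(2) mx by (simp add: slab_int_insert slab_int_empty line_int_measurable)
 finally show ?thesis by (simp add: line_int_def algebra_simps)
qed

lemma iterated_3:
 fixes f :: "real^'n => ennreal"
 assumes m: "f \<in> bmeas" and U: "(UNIV::'n set) = {i, j, k}" "i ~= j" "i ~= k" "j ~= k"
 shows "line_int k (line_int j (line_int i f)) x = (\<integral>\<^sup>+x. f x \<partial>lborel)"
proof -
 have mx: "(%y. f (y + x)) \<in> bmeas" using m by measurable
 have "(\<integral>\<^sup>+y. f y \<partial>lborel) = (\<integral>\<^sup>+y. f (y + x) \<partial>lborel)" by (simp add: nn_integral_translate[OF m])
 also have "... = slab_int {i, j, k} (%y. f (y + x))" using nn_integral_lborel_slab[OF mx] U by simp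
 also have "... = line_int k (line_int j (line_int i (%y. f (y + x)))) 0"
  using U(2-4) mx by (simp add: slab_int_insert slab_int_empty line_int_measurable)
 finally show ?thesis by (simp add: line_int_def algebra_simps)
qed

subsection \<open>Sobolev inequalities\<close>

text \<open>Along the axis |v(x)| is at most the integral of |g| over the line plus |v(x + h e)|.
  Integrated over a fixed ball, the remainder is the integral of |v| over a ball that escapes to
  infinity with h, hence vanishes in the limit.\<close>

lemma line_bound:
 fixes v g :: "real^'n => real"
 assumes v: "integrable lborel v" and g: "integrable lborel g"
  and w: "weak_dir UNIV (axis i 1) v g"
 shows "AE x in lborel. ennreal \<bar>v x\<bar> <= line_int i (%x. ennreal \<bar>g x\<bar>) x"
proof -
 have [measurable]: "v \<in> bmeas" "g \<in> bmeas"
  using v g borel_measurable_integrable by fastforce+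
 define I where "I = line_int i (%x. ennreal \<bar>g x\<bar>)"
 have [measurable]: "I \<in> bmeas" unfolding I_def by measurable
 define e :: "real^'n" where "e = axis i 1"
 have l: "loc_int UNIV v" "loc_int UNIV (%x. c * g x)" for c
  using v g by (auto simp: loc_int_def set_integrable_def borel_compact intro!: integrable_mult_indicator simp del: real_scaleR_def)
 have le: "AE x in lborel. \<forall>n::nat. ennreal \<bar>v x\<bar> <= I x + ennreal \<bar>v (x + real (Suc n) *R e)\<bar>"
  unfolding AE_all_countable
 proof
  fix n :: nat
  define h where "h = real (Suc n)"
  have h: "h > 0" by (simp add: h_def)
  have "AE x in lborel. v (x + h *R e) - v x = (LINT t:{0..1}|lborel. h * g (x + t *R (h *R e)))"
   using weak_dir_segment[OF open_UNIV _ _ l(1) l(2) weak_dir_scale[OF w]] unfolding e_def by simp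
  then show "AE x in lborel. ennreal \<bar>v x\<bar> <= I x + ennreal \<bar>v (x + real (Suc n) *R e)\<bar>"
  proof eventually_elim
   case (elim x)
   have "ennreal \<bar>LINT t:{0..1}|lborel. h * g (x + t *R (h *R e))\<bar>
     <= (nni (%t. norm (indicator {0..1} t *R (h * g (x + t *R (h *R e))))))"
    unfolding set_lebesgue_integral_def
   proof (cases "integrable lborel (%t. indicator {0..1} t *R (h * g (x + t *R (h *R e))))")
    case True
    from integral_norm_bound_ennreal[OF True]
    show "ennreal \<bar>LINT t|lborel. indicator {0..1} t *R (h * g (x + t *R (h *R e)))\<bar>
     <= (nni (%t. norm (indicator {0..1} t *R (h * g (x + t *R (h *R e))))))"
     by (simp only: real_norm_def)
   qed (simp add: not_integrable_integral_eq)
   also have "... <= (\<integral>\<^sup>+t. ennreal h * ennreal \<bar>g (x + (h * t) *R e)\<bar> \<partial>lborel)"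
    using h by (intro nn_integral_mono) (auto simp: ennreal_mult[symmetric] abs_mult mult.commute split: split_indicator)
   also have "... = ennreal h * (\<integral>\<^sup>+t. ennreal \<bar>g (x + (0 + h * t) *R e)\<bar> \<partial>lborel)"
    by (simp add: nn_integral_cmult)
   also have "... = (\<integral>\<^sup>+t. ennreal \<bar>g (x + t *R e)\<bar> \<partial>lborel)"
    using nn_integral_real_affine[of "%t. ennreal \<bar>g (x + t *R e)\<bar>" h 0] h by simp
   also have "... = I x" by (simp add: I_def line_int_def e_def)
   finally have "ennreal \<bar>v (x + h *R e) - v x\<bar> <= I x" using elim by simp
   moreover have "ennreal \<bar>v x\<bar> <= ennreal \<bar>v (x + h *R e) - v x\<bar> + ennreal \<bar>v (x + h *R e)\<bar>"
    by (subst ennreal_plus[symmetric]) (auto intro!: ennreal_leI simp del: ennreal_plus)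
   ultimately show ?case unfolding h_def using add_right_mono order_trans by blast
  qed
 qed
 \<comment> \<open>Truncated subtraction: w is zero exactly where the bound holds, also where the
   line integral is infinite.\<close>
 define w where "w x = ennreal \<bar>v x\<bar> - I x" for x
 have [measurable]: "w \<in> bmeas" unfolding w_def by measurable
 have "AE x in lborel. \<forall>R::nat. x \<in> ball 0 (real R) --> w x = 0"
  unfolding AE_all_countable
 proof
  fix R :: nat
  have [measurable]: "ball (0::real^'n) (real R) \<in> sets borel" by (rule borel_open) simp
  have im[measurable]: "(%x. indicator (ball 0 (real R)) (x - c) :: real) \<in> bmeas" for c :: "real^'n"
   by (rule measurable_compose[of "%x. x - c" borel borel]) auto
  have *: "(\<integral>\<^sup>+x. indicator (ball 0 (real R)) x * w x \<partial>lborel)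
    <= (nni (%x. indicator (ball 0 (real R)) (x - real (Suc n) *R e) * \<bar>v x\<bar>))" for n
  proof -
   have "(\<integral>\<^sup>+x. indicator (ball 0 (real R)) x * w x \<partial>lborel)
    <= (nni (%x. indicator (ball 0 (real R)) x * \<bar>v (x + real (Suc n) *R e)\<bar>))"
   proof (rule nn_integral_mono_AE)
    show "AE x in lborel. indicator (ball 0 (real R)) x * w x
     <= ennreal (indicator (ball 0 (real R)) x * \<bar>v (x + real (Suc n) *R e)\<bar>)"
     using le
    proof eventually_elim
     case (elim x)
     then have "w x <= ennreal \<bar>v (x + real (Suc n) *R e)\<bar>"
      by (simp add: w_def ennreal_minus_le_iff)
     then show ?case by (auto split: split_indicator)
    qed
   qed
   also have "... = (nni (%x. indicator (ball 0 (real R)) (x - real (Suc n) *R e) * \<bar>v x\<bar>))"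
    using nn_integral_translate[of "%x. ennreal (indicator (ball 0 (real R)) (x - real (Suc n) *R e) * \<bar>v x\<bar>)" "real (Suc n) *R e"] im
    by simp
   finally show ?thesis .
  qed
  have "(%n. nni (%x. indicator (ball 0 (real R)) (x - real (Suc n) *R e) * \<bar>v x\<bar>))
    \<longlonglongrightarrow> (\<integral>\<^sup>+x. (0::ennreal) \<partial>(lborel :: (real^'n) measure))"
  proof (rule nn_integral_dominated_convergence[where w = "%x. ennreal \<bar>v x\<bar>"])
   show "(\<integral>\<^sup>+x. ennreal \<bar>v x\<bar> \<partial>lborel) < \<infinity>" using v by (simp add: integrable_iff_bounded)
   show "AE x in lborel. (%n. ennreal (indicator (ball 0 (real R)) (x - real (Suc n) *R e) * \<bar>v x\<bar>)) \<longlonglongrightarrow> 0"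
   proof (rule AE_I2)
    fix x :: "real^'n"
    obtain N :: nat where N: "norm x + real R < real N" using reals_Archimedean2 by blast
    have "\<forall>\<^sub>F n in sequentially. ennreal (indicator (ball 0 (real R)) (x - real (Suc n) *R e) * \<bar>v x\<bar>) = 0"
     using eventually_ge_at_top[of N]
    proof eventually_elim
     case (elim n)
     have "norm (real (Suc n) *R e) <= norm x + norm (x - real (Suc n) *R e)"
      by (metis norm_minus_commute norm_triangle_sub add.commute)
     then have "real (Suc n) <= norm x + norm (x - real (Suc n) *R e)" by (simp add: e_def)
     then have "x - real (Suc n) *R e \<notin> ball 0 (real R)" using N elim
      by (simp add: dist_norm norm_minus_commute)
     then show ?case by simp
    qed
    then show "(%n. ennreal (indicator (ball 0 (real R)) (x - real (Suc n) *R e) * \<bar>v x\<bar>)) \<longlonglongrightarrow> 0"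
     by (rule tendsto_eventually)
   qed
   show "AE x in lborel. ennreal (indicator (ball 0 (real R)) (x - real (Suc n) *R e) * \<bar>v x\<bar>) <= ennreal \<bar>v x\<bar>" for n
    by (intro AE_I2) (auto split: split_indicator)
  qed (use im in auto)
  then have "(\<integral>\<^sup>+x. indicator (ball 0 (real R)) x * w x \<partial>lborel) <= 0"
   using * by (intro LIMSEQ_le_const[where X = "%n. nni (%x. indicator (ball 0 (real R)) (x - real (Suc n) *R e) * \<bar>v x\<bar>)"]) auto
  then have "AE x in lborel. indicator (ball 0 (real R)) x * w x = 0"
   by (subst nn_integral_0_iff_AE[symmetric]) auto
  then show "AE x in lborel. x \<in> ball 0 (real R) --> w x = 0"
   by eventually_elim auto
 qed
 then show ?thesis
 proof eventually_elim
  case (elim x)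
  obtain R :: nat where "norm x < real R" using reals_Archimedean2 by blast
  then have "w x = 0" using elim by (auto simp: dist_norm)
  then show ?case by (simp add: w_def I_def diff_eq_0_iff_ennreal)
 qed
qed

text \<open>With the value \<open>top\<close> at \<open>top\<close>, squaring and root are mutually
  inverse on all of \<open>ennreal\<close>, and the inequalities on lines hold without any
  finiteness.\<close>

definition esqrt :: "ennreal => ennreal" where
 "esqrt x = (if x = top then top else ennreal (sqrt (enn2real x)))"

lemma esqrt_measurable[measurable]: "esqrt \<in> bmeas"
 unfolding esqrt_def by measurable

lemma esqrt_ennreal: "0 <= r ==> esqrt (ennreal r) = ennreal (sqrt r)"
 by (simp add: esqrt_def)

lemma esqrt_square: "esqrt (x^2) = x"
 by (cases x) (auto simp: esqrt_def ennreal_power power2_eq_square ennreal_mult_top ennreal_mult[symmetric])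

lemma square_esqrt: "(esqrt x)^2 = x"
 by (cases x) (auto simp: esqrt_def ennreal_power power2_eq_square ennreal_mult[symmetric])

lemma esqrt_mono: "x <= y ==> esqrt x <= esqrt y"
 by (cases x; cases y) (auto simp: esqrt_def top_unique intro: ennreal_leI)

lemma esqrt_mult: "esqrt (x * y) = esqrt x * esqrt y"
proof -
 have "esqrt (x * y) = esqrt ((esqrt x * esqrt y)^2)"
  by (simp add: power_mult_distrib square_esqrt)
 then show ?thesis by (simp add: esqrt_square)
qed

lemma line_int_Cauchy_Schwarz:
 assumes [measurable]: "f \<in> bmeas" "g \<in> bmeas"
 shows "line_int i (%x. esqrt (f x) * esqrt (g x)) x <= esqrt (line_int i f x) * esqrt (line_int i g x)"
proof -
 have "(line_int i (%x. esqrt (f x) * esqrt (g x)) x)^2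
   <= (\<integral>\<^sup>+t. (esqrt (f (x + t *R axis i 1)))\<^sup>2 \<partial>lborel) * (\<integral>\<^sup>+t. (esqrt (g (x + t *R axis i 1)))\<^sup>2 \<partial>lborel)"
  unfolding line_int_def by (rule Cauchy_Schwarz_nn_integral) measurable
 also have "... = line_int i f x * line_int i g x" by (simp add: square_esqrt line_int_def)
 finally show ?thesis using esqrt_mono by (metis esqrt_square esqrt_mult)
qed

text \<open>The Loomis-Whitney inequality. Integrating along i, the factor that is constant in
  direction i is pulled out and the other two are handled by Cauchy-Schwarz; the same is repeated
  along j and k.\<close>

lemma loomis_whitney_3:
 fixes g :: "'n => real^'n => ennreal"
 assumes m[measurable]: "!!l. g l \<in> bmeas"
  and U: "(UNIV::'n set) = {i, j, k}" "i ~= j" "i ~= k" "j ~= k"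
 shows "(\<integral>\<^sup>+x. esqrt (line_int i (g i) x) * (esqrt (line_int j (g j) x) * esqrt (line_int k (g k) x)) \<partial>lborel)
   <= esqrt (integral\<^sup>N lborel (g i)) * (esqrt (integral\<^sup>N lborel (g j)) * esqrt (integral\<^sup>N lborel (g k)))"
proof -
 define a b c where "a = line_int i (g i)" and "b = line_int j (g j)" and "c = line_int k (g k)"
 have [measurable]: "a \<in> bmeas" "b \<in> bmeas" "c \<in> bmeas"
  unfolding a_def b_def c_def by measurable
 have inv: "a (x + s *R axis i 1) = a x" "b (x + s *R axis j 1) = b x" "c (x + s *R axis k 1) = c x" for x s
  unfolding a_def b_def c_def by (simp_all add: line_int_invariant)
 define A where "A = line_int j a"
 define B where "B = line_int i b"
 define C where "C = line_int j (line_int i c)"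
 have [measurable]: "A \<in> bmeas" "B \<in> bmeas" "C \<in> bmeas"
  unfolding A_def B_def C_def by measurable
 have Bj: "B (x + s *R axis j 1) = B x" for x s unfolding B_def by (rule line_int_invariant2) (rule inv)
 have Cc: "C x = integral\<^sup>N lborel (g k)" for x
  unfolding C_def c_def using U by (intro iterated_3 m) auto
 have kA: "line_int k A x = integral\<^sup>N lborel (g i)" for x
  unfolding A_def a_def using U by (intro iterated_3 m) auto
 have kB: "line_int k B x = integral\<^sup>N lborel (g j)" for x
  unfolding B_def b_def using U by (intro iterated_3 m) auto
 have s1: "line_int i (%x. esqrt (a x) * (esqrt (b x) * esqrt (c x))) x
   <= esqrt (B x) * (esqrt (a x) * esqrt (line_int i c x))" for x
 proof -
  have "line_int i (%x. esqrt (a x) * (esqrt (b x) * esqrt (c x))) x = esqrt (a x) * line_int i (%x. esqrt (b x) * esqrt (c x)) x"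
   by (rule line_int_mult_invariant) (auto simp: inv)
  also have "... <= esqrt (a x) * (esqrt (B x) * esqrt (line_int i c x))"
   unfolding B_def by (intro mult_left_mono line_int_Cauchy_Schwarz) auto
  finally show ?thesis by (simp add: mult_ac)
 qed
 have s2: "line_int j (%x. esqrt (B x) * (esqrt (a x) * esqrt (line_int i c x))) x
   <= esqrt (C x) * (esqrt (A x) * esqrt (B x))" for x
 proof -
  have "line_int j (%x. esqrt (B x) * (esqrt (a x) * esqrt (line_int i c x))) x
    = esqrt (B x) * line_int j (%x. esqrt (a x) * esqrt (line_int i c x)) x"
   by (rule line_int_mult_invariant) (auto simp: Bj)
  also have "... <= esqrt (B x) * (esqrt (A x) * esqrt (C x))"
   unfolding A_def C_def by (intro mult_left_mono line_int_Cauchy_Schwarz) auto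
  finally show ?thesis by (simp add: mult_ac)
 qed
 have "(\<integral>\<^sup>+x. esqrt (a x) * (esqrt (b x) * esqrt (c x)) \<partial>lborel)
   = line_int k (line_int j (line_int i (%x. esqrt (a x) * (esqrt (b x) * esqrt (c x))))) 0"
  using U by (intro iterated_3[symmetric]) auto
 also have "... <= line_int k (line_int j (%x. esqrt (B x) * (esqrt (a x) * esqrt (line_int i c x)))) 0"
  by (intro line_int_mono s1)
 also have "... <= line_int k (%x. esqrt (C x) * (esqrt (A x) * esqrt (B x))) 0"
  by (intro line_int_mono s2)
 also have "... = esqrt (integral\<^sup>N lborel (g k)) * line_int k (%x. esqrt (A x) * esqrt (B x)) 0"
  unfolding Cc by (rule line_int_mult_invariant) auto
 also have "... <= esqrt (integral\<^sup>N lborel (g k)) * (esqrt (line_int k A 0) * esqrt (line_int k B 0))"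
  by (intro mult_left_mono line_int_Cauchy_Schwarz) auto
 finally show ?thesis unfolding kA kB a_def b_def c_def by (simp add: mult_ac)
qed

text \<open>In the plane the two factors depend on complementary coordinates, so the integral of the
  product separates with equality.\<close>

lemma loomis_whitney_2:
 fixes g :: "'n => real^'n => ennreal"
 assumes m[measurable]: "!!l. g l \<in> bmeas" and U: "(UNIV::'n set) = {i, j}" "i ~= j"
 shows "(\<integral>\<^sup>+x. line_int i (g i) x * line_int j (g j) x \<partial>lborel) = integral\<^sup>N lborel (g i) * integral\<^sup>N lborel (g j)"
proof -
 have "(\<integral>\<^sup>+x. line_int i (g i) x * line_int j (g j) x \<partial>lborel)
   = line_int j (line_int i (%x. line_int i (g i) x * line_int j (g j) x)) 0"
  using U by (intro iterated_2[symmetric]) auto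
 also have "line_int i (%x. line_int i (g i) x * line_int j (g j) x)
   = (%x. line_int i (g i) x * line_int i (line_int j (g j)) x)"
  by (intro ext line_int_mult_invariant) (auto simp: line_int_invariant)
 also have "(%x. line_int i (line_int j (g j)) x) = (%x. integral\<^sup>N lborel (g j))"
  using U by (intro ext iterated_2) auto
 also have "line_int j (%x. line_int i (g i) x * integral\<^sup>N lborel (g j)) 0
   = integral\<^sup>N lborel (g j) * line_int j (line_int i (g i)) 0"
  by (subst mult.commute, rule line_int_mult_invariant) auto
 also have "line_int j (line_int i (g i)) 0 = integral\<^sup>N lborel (g i)"
  using U by (intro iterated_2) auto
 finally show ?thesis by (simp add: mult.commute)
qed

section \<open>Gagliardo-Nirenberg inequalities for bounded functions\<close>

lemma sq_integrable_power:
 assumes P: "sq P" and B: "!!x. \<bar>P x\<bar> <= B"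
 shows "sq (%x. P x ^ Suc k)" "integrable lborel (%x. P x ^ (k + 2))"
proof -
 note [measurable] = sq_measurable[OF P]
 have "\<bar>P x ^ k\<bar> <= B ^ k" for x using B[of x] by (simp add: power_abs power_mono)
 from sq_bounded_mult[OF P _ this] show s: "sq (%x. P x ^ Suc k)" by (simp add: mult.commute)
 from sq_mult_integrable[OF P s] show "integrable lborel (%x. P x ^ (k + 2))" by (simp add: mult.left_commute)
qed

lemma DQ_power:
 assumes P: "DQ i P P'" and B: "!!x. \<bar>P x\<bar> <= B"
 shows "DQ i (%x. P x ^ Suc k) (%x. real (Suc k) * P x ^ k * P' x)"
proof (induction k)
 case 0
 then show ?case using P by simp
next
 case (Suc k)
 note s = DQ_sq[OF P]
 note [measurable] = s[THEN sq_measurable]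
 have "weak_dir UNIV (axis i 1) (%x. P x * P x ^ Suc k) (%x. P' x * P x ^ Suc k + P x * (real (Suc k) * P x ^ k * P' x))"
  by (rule DQ_product_weak[OF P Suc])
 moreover have "P x * P x ^ Suc k = P x ^ Suc (Suc k)"
  "P' x * P x ^ Suc k + P x * (real (Suc k) * P x ^ k * P' x) = real (Suc (Suc k)) * P x ^ Suc k * P' x" for x
  by (auto simp: algebra_simps)
 ultimately have "weak_dir UNIV (axis i 1) (%x. P x ^ Suc (Suc k)) (%x. real (Suc (Suc k)) * P x ^ Suc k * P' x)"
  by (simp only:)
 moreover have "\<bar>real (Suc (Suc k)) * P x ^ Suc k\<bar> <= real (Suc (Suc k)) * B ^ Suc k" for x
  using power_mono[OF B abs_ge_zero, of x "Suc k"] by (simp only: abs_mult power_abs) (simp add: mult_left_mono)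
 then have "sq (%x. (real (Suc (Suc k)) * P x ^ Suc k) * P' x)"
  by (intro sq_bounded_mult[OF s(2)]) measurable
 ultimately show ?case
  using sq_integrable_power(1)[OF s(1) B, of "Suc k"] by (intro weak_dir_DQ)
qed

lemma power_deriv_nn_bound:
 assumes P: "Lb (2 * Suc k) P be" and P': "Lb 2 P' al" and c: "c >= 0"
 shows "(\<integral>\<^sup>+x. ennreal \<bar>c * P x ^ Suc k * P' x\<bar> \<partial>lborel) <= ennreal (c * be ^ Suc k * al)"
proof -
 note [measurable] = LbD(1)[OF P] LbD(1)[OF P']
 have e: "\<bar>P x ^ Suc k\<bar>\<^sup>2 = \<bar>P x\<bar> ^ (2 * Suc k)" for x
  by (metis mult.commute power_abs power_mult)
 have "Lb 2 (%x. P x ^ Suc k) (be ^ Suc k)"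
  unfolding Lb_def e using LbD[OF P]
  by (simp only: power_mult[symmetric] mult.commute[of 2] zero_le_power) (simp add: mult.commute)
 from Lb_mult_22[OF Lb_cmult[OF this, of c] P']
 show ?thesis using c by (simp add: Lb_def)
qed

text \<open>Loomis-Whitney for v = P^(k+2): the integral of v^2 is at most the product of the
  integrals of its two partial derivatives, each bounded by (k+2) |P|^(k+1) |P'| and thus by the
  previous exponent. Every step contributes the factor k+2, whence the factorial.\<close>

lemma sobolev_bounded_2:
 fixes P :: "real^'n => real"
 assumes U: "(UNIV::'n set) = {i, j}" "i ~= j" and P: "!!l. DQ l P (P' l)" and B: "!!x. \<bar>P x\<bar> <= B"
  and L: "Lb 2 P al" "!!l. Lb 2 (P' l) al"
 shows "Lb (2 * Suc k) P (fact (Suc k) * al)"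
proof (induction k)
 case 0
 then show ?case using L by simp
next
 case (Suc k)
 define be where "be = fact (Suc k) * al"
 have al: "0 <= al" using LbD(2)[OF L(1)] .
 note sP = DQ_sq(1)[OF P]
 note [measurable] = sq_measurable[OF sP] DQ_sq(2)[OF P, THEN sq_measurable]
 define v where "v x = P x ^ Suc (Suc k)" for x
 define g where "g l x = real (Suc (Suc k)) * P x ^ Suc k * P' l x" for l x
 have [measurable]: "g l \<in> bmeas" "v \<in> bmeas" for l unfolding g_def v_def by measurable
 have vi: "integrable lborel v" unfolding v_def using sq_integrable_power(2)[OF sP B, of k] by simp
 have gi: "integrable lborel (g l)" for l
  unfolding g_def using sq_mult_integrable[OF sq_cmult[OF sq_integrable_power(1)[OF sP B]] DQ_sq(2)[OF P]] by simp
 have w: "weak_dir UNIV (axis l 1) v (g l)" for l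
  unfolding v_def g_def by (rule DQ_weak_dir[OF DQ_power[OF P B]])
 have gb: "(\<integral>\<^sup>+x. ennreal \<bar>g l x\<bar> \<partial>lborel) <= ennreal (real (Suc (Suc k)) * be ^ Suc k * al)" for l
  unfolding g_def by (rule power_deriv_nn_bound) (use Suc L in \<open>auto simp: be_def\<close>)
 have "(nni (%x. \<bar>P x\<bar> ^ (2 * Suc (Suc k)))) = (\<integral>\<^sup>+x. ennreal \<bar>v x\<bar> * ennreal \<bar>v x\<bar> \<partial>lborel)"
  by (intro nn_integral_cong) (simp only: v_def power_abs power_add[symmetric] ennreal_mult[symmetric] abs_ge_zero mult_2 zero_le_power)
 also have "... <= (\<integral>\<^sup>+x. line_int i (%x. ennreal \<bar>g i x\<bar>) x * line_int j (%x. ennreal \<bar>g j x\<bar>) x \<partial>lborel)"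
  using line_bound[OF vi gi w, of i] line_bound[OF vi gi w, of j]
  by (intro nn_integral_mono_AE) (elim AE_mp, intro AE_I2 impI mult_mono, auto)
 also have "... = (\<integral>\<^sup>+x. ennreal \<bar>g i x\<bar> \<partial>lborel) * (\<integral>\<^sup>+x. ennreal \<bar>g j x\<bar> \<partial>lborel)"
  by (rule loomis_whitney_2[OF _ U]) measurable
 also have "... <= ennreal (real (Suc (Suc k)) * be ^ Suc k * al) * ennreal (real (Suc (Suc k)) * be ^ Suc k * al)"
  by (intro mult_mono gb) auto
 also have "... = ennreal ((real (Suc (Suc k)) * be ^ Suc k * al)^2)"
  using al by (subst ennreal_mult[symmetric]) (auto simp: be_def power2_eq_square simp del: of_nat_Suc power_Suc)
 also have "... <= ennreal ((fact (Suc (Suc k)) * al) ^ (2 * Suc (Suc k)))"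
 proof (rule ennreal_leI)
  have "real (Suc (Suc k)) * be ^ Suc k * al <= (real (Suc (Suc k)) * be) ^ Suc (Suc k)"
  proof -
   have 1: "1 <= real (Suc (Suc k)) ^ Suc k" by (intro one_le_power) simp
   have 2: "al <= be" unfolding be_def using al by (simp add: mult_ge1_I fact_ge_1 mult_le_cancel_right1 del: fact_Suc)
   have "real (Suc (Suc k)) * be ^ Suc k * al <= real (Suc (Suc k)) * be ^ Suc k * be"
    using 2 al by (intro mult_left_mono) (auto simp: be_def simp del: of_nat_Suc power_Suc fact_Suc)
   also have "... = real (Suc (Suc k)) * be ^ Suc (Suc k) * 1" by simp
   also have "... <= real (Suc (Suc k)) * be ^ Suc (Suc k) * real (Suc (Suc k)) ^ Suc k"
    using 1 al by (intro mult_left_mono) (auto simp: be_def simp del: of_nat_Suc power_Suc fact_Suc)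
   also have "... = (real (Suc (Suc k)) * be) ^ Suc (Suc k)"
    by (simp add: power_mult_distrib)
   finally show ?thesis .
  qed
  moreover have "real (Suc (Suc k)) * be = fact (Suc (Suc k)) * al" by (simp add: be_def)
  ultimately have "real (Suc (Suc k)) * be ^ Suc k * al <= (fact (Suc (Suc k)) * al) ^ Suc (Suc k)" by (simp only:)
  then have "(real (Suc (Suc k)) * be ^ Suc k * al)^2 <= ((fact (Suc (Suc k)) * al) ^ Suc (Suc k))^2"
   using al by (intro power_mono) (auto simp: be_def simp del: of_nat_Suc power_Suc fact_Suc)
  then show "(real (Suc (Suc k)) * be ^ Suc k * al)^2 <= (fact (Suc (Suc k)) * al) ^ (2 * Suc (Suc k))"
   by (simp only: power_mult[symmetric] mult.commute)
 qed
 finally show ?case using al by (auto simp: Lb_def simp del: fact_Suc)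
qed

text \<open>For v = P^4 one has P^6 = |v|^(3/2). With y the square root of the integral of P^6,
  Loomis-Whitney gives y^2 <= (4 y al)^(3/2), that is y^4 <= (4 al)^3 y^3, and y can be cancelled.
  The cancellation requires y to be finite, which boundedness of P guarantees.\<close>

lemma sobolev_bounded_3:
 fixes P :: "real^'n => real"
 assumes U: "(UNIV::'n set) = {i, j, k}" "i ~= j" "i ~= k" "j ~= k"
  and P: "!!l. DQ l P (P' l)" and B: "!!x. \<bar>P x\<bar> <= B"
  and L: "Lb 2 P al" "!!l. Lb 2 (P' l) al"
 shows "Lb 6 P (4 * al)"
proof -
 have al: "0 <= al" using LbD(2)[OF L(1)] .
 note sP = DQ_sq(1)[OF P]
 note [measurable] = sq_measurable[OF sP] DQ_sq(2)[OF P, THEN sq_measurable]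
 define X where "X = (LINT x|lborel. \<bar>P x\<bar> ^ 6)"
 have X0: "0 <= X" unfolding X_def by (rule integral_nonneg_AE) simp
 have i6: "integrable lborel (%x. \<bar>P x\<bar> ^ 6)"
  using sq_integrable_power(2)[OF sP B, of 4] by (simp add: power_even_abs)
 have X: "(nni (%x. \<bar>P x\<bar> ^ 6)) = ennreal X"
  unfolding X_def using i6 by (intro nn_integral_eq_integral) auto
 define y where "y = sqrt X"
 have y: "0 <= y" "y^2 = X" using X0 by (auto simp: y_def)
 define v where "v x = P x ^ 4" for x
 define g where "g l x = 4 * P x ^ 3 * P' l x" for l x
 have [measurable]: "g l \<in> bmeas" "v \<in> bmeas" for l unfolding g_def v_def by measurable
 have vi: "integrable lborel v" unfolding v_def using sq_integrable_power(2)[OF sP B, of 2] by simp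
 have gi: "integrable lborel (g l)" for l
  unfolding g_def using sq_mult_integrable[OF sq_cmult[OF sq_integrable_power(1)[OF sP B, of 2]] DQ_sq(2)[OF P]]
  by (simp add: numeral_3_eq_3)
 have w: "weak_dir UNIV (axis l 1) v (g l)" for l
  using DQ_weak_dir[OF DQ_power[OF P B, where k = 3]] unfolding v_def g_def by (simp add: numeral_eq_Suc)
 have gb: "(\<integral>\<^sup>+x. ennreal \<bar>g l x\<bar> \<partial>lborel) <= ennreal (4 * y * al)" for l
 proof -
  have "(\<integral>\<^sup>+x. ennreal \<bar>(4 * P x ^ 3) * P' l x\<bar> \<partial>lborel) <= ennreal (sqrt ((16 * X) * al^2))"
  proof (rule nn_Cauchy_Schwarz)
   have "(nni (%x. (4 * P x ^ 3)\<^sup>2)) = (\<integral>\<^sup>+x. ennreal 16 * ennreal (\<bar>P x\<bar> ^ 6) \<partial>lborel)"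
    by (intro nn_integral_cong) (simp add: ennreal_mult'[symmetric] power_mult_distrib power_even_abs del: ennreal_numeral)
   also have "... = ennreal 16 * ennreal X" using X by (subst nn_integral_cmult) (auto simp: power_even_abs)
   finally show "(nni (%x. (4 * P x ^ 3)\<^sup>2)) <= ennreal (16 * X)"
    by (simp add: ennreal_mult'[symmetric] del: ennreal_numeral)
   show "(nni (%x. (P' l x)\<^sup>2)) <= ennreal (al^2)" using LbD(3)[OF L(2)] by simp
  qed (use X0 in auto)
  also have "sqrt ((16 * X) * al^2) = 4 * y * al" using al by (simp add: y_def real_sqrt_mult)
  finally show ?thesis by (simp add: g_def)
 qed
 have e: "ennreal (\<bar>P x\<bar> ^ 6) = esqrt (ennreal \<bar>v x\<bar>) * (esqrt (ennreal \<bar>v x\<bar>) * esqrt (ennreal \<bar>v x\<bar>))" for x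
 proof -
  have "sqrt \<bar>v x\<bar> = \<bar>P x\<bar> ^ 2" unfolding v_def by (rule real_sqrt_unique) (auto simp: power_abs)
  then have "esqrt (ennreal \<bar>v x\<bar>) = ennreal (\<bar>P x\<bar> ^ 2)" by (simp add: esqrt_ennreal)
  then show ?thesis by (simp add: ennreal_mult[symmetric] power_add[symmetric] del: power2_abs)
 qed
 have "ennreal X = (\<integral>\<^sup>+x. esqrt (ennreal \<bar>v x\<bar>) * (esqrt (ennreal \<bar>v x\<bar>) * esqrt (ennreal \<bar>v x\<bar>)) \<partial>lborel)"
  unfolding X[symmetric] by (intro nn_integral_cong e)
 also have "... <= (\<integral>\<^sup>+x. esqrt (line_int i (%x. ennreal \<bar>g i x\<bar>) x) * (esqrt (line_int j (%x. ennreal \<bar>g j x\<bar>) x)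
   * esqrt (line_int k (%x. ennreal \<bar>g k x\<bar>) x)) \<partial>lborel)"
  using line_bound[OF vi gi w, of i] line_bound[OF vi gi w, of j] line_bound[OF vi gi w, of k]
  by (intro nn_integral_mono_AE) (elim AE_mp, intro AE_I2 impI mult_mono esqrt_mono, auto)
 also have "... <= esqrt (\<integral>\<^sup>+x. ennreal \<bar>g i x\<bar> \<partial>lborel) * (esqrt (\<integral>\<^sup>+x. ennreal \<bar>g j x\<bar> \<partial>lborel)
   * esqrt (\<integral>\<^sup>+x. ennreal \<bar>g k x\<bar> \<partial>lborel))"
  by (rule loomis_whitney_3[OF _ U]) measurable
 also have "... <= esqrt (ennreal (4 * y * al)) * (esqrt (ennreal (4 * y * al)) * esqrt (ennreal (4 * y * al)))"
  by (intro mult_mono esqrt_mono gb) auto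
 also have "... = ennreal (sqrt (4 * y * al) ^ 3)"
  using y al by (simp add: esqrt_ennreal ennreal_mult[symmetric] power3_eq_cube mult.assoc)
 finally have "X <= sqrt (4 * y * al) ^ 3" using y al by (simp add: ennreal_le_iff)
 then have "X^2 <= (sqrt (4 * y * al) ^ 3)^2" using X0 by (rule power_mono)
 also have "... = ((sqrt (4 * y * al))^2) ^ 3" by (simp only: power_mult[symmetric] mult.commute)
 also have "... = (4 * y * al) ^ 3" using y al by simp
 finally have "y ^ 4 <= (4 * y * al) ^ 3" unfolding y(2)[symmetric] by (simp add: power_mult[symmetric])
 then have "y ^ 3 * y <= y ^ 3 * (4 * al) ^ 3" by (simp add: power_mult_distrib numeral_eq_Suc mult_ac)
 then have "y <= (4 * al) ^ 3"
  using y(1) al by (cases "y = 0") (auto simp del: power_mult_distrib)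
 then have "y^2 <= ((4 * al) ^ 3)^2" using y(1) by (intro power_mono)
 then have "X <= (4 * al) ^ 6" unfolding y(2) by (simp only: power_mult[symmetric]) simp
 then show ?thesis using al X by (auto simp: Lb_def intro: ennreal_leI)
qed

text \<open>A bounded truncation that fixes 0, has slope between 0 and 1 and Lipschitz slope. Hence
  the chain rule applies, neither the function nor its gradient grows, and the argument is recovered
  as N tends to infinity.\<close>

definition trunc :: "nat => real => real" where
 "trunc N r = real (Suc N) * arctan (r / real (Suc N))"

definition trunc' :: "nat => real => real" where
 "trunc' N r = inverse (1 + (r / real (Suc N))^2)"

lemma trunc_deriv: "(trunc N has_real_derivative trunc' N r) (at r)"
 unfolding trunc_def[abs_def] trunc'_def by (auto intro!: derivative_eq_intros)

lemma trunc'_bound: "\<bar>trunc' N r\<bar> <= 1"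
 unfolding trunc'_def by (simp add: inverse_le_1_iff abs_of_nonneg)

lemma trunc'_lipschitz: "\<bar>trunc' N r - trunc' N s\<bar> <= 1 * \<bar>r - s\<bar>"
proof -
 define a b where "a = r / real (Suc N)" and "b = s / real (Suc N)"
 have p: "1 + a^2 > 0" "1 + b^2 > 0" by (auto intro: add_pos_nonneg)
 have "inverse (1 + a^2) - inverse (1 + b^2) = (b - a) * ((a + b) / ((1 + a^2) * (1 + b^2)))"
  using p by (simp add: field_simps power2_eq_square)
 moreover have "\<bar>(a + b) / ((1 + a^2) * (1 + b^2))\<bar> <= 1"
 proof -
  have t: "2 * \<bar>x\<bar> <= 1 + x^2" for x :: real
   using zero_le_power2[of "\<bar>x\<bar> - 1"] by (simp add: power2_diff)
  have "\<bar>a + b\<bar> <= (1 + a^2) * (1 + b^2)"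
  proof -
   have "2 * \<bar>a + b\<bar> <= (1 + a^2) + (1 + b^2)" using t[of a] t[of b] abs_triangle_ineq[of a b] by argo
   also have "... <= 2 * ((1 + a^2) * (1 + b^2))" by (simp add: algebra_simps)
   finally show ?thesis by simp
  qed
  then show ?thesis using p by (simp add: abs_mult)
 qed
 ultimately have "\<bar>inverse (1 + a^2) - inverse (1 + b^2)\<bar> <= \<bar>b - a\<bar> * 1"
  unfolding abs_mult by (metis abs_ge_zero abs_mult mult_left_mono)
 also have "\<bar>b - a\<bar> * 1 <= \<bar>r - s\<bar>"
 proof -
  have "\<bar>b - a\<bar> = \<bar>r - s\<bar> / real (Suc N)"
   unfolding a_def b_def diff_divide_distrib[symmetric] abs_divide by (simp add: abs_minus_commute)
  also have "... <= \<bar>r - s\<bar> / 1" by (rule divide_left_mono) auto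
  finally show ?thesis by simp
 qed
 finally show ?thesis by (simp add: trunc'_def a_def b_def)
qed

lemma trunc_0[simp]: "trunc N 0 = 0" by (simp add: trunc_def)

lemma trunc_bound: "\<bar>trunc N r\<bar> <= 2 * real (Suc N)"
proof -
 have "\<bar>arctan x\<bar> <= 2" for x using arctan_bounded[of x] pi_less_4 by auto
 from mult_left_mono[OF this, of "real (Suc N)"] show ?thesis
  unfolding trunc_def abs_mult by (simp only: abs_of_nat of_nat_0_le_iff mult.commute[of 2] simp_thms)
qed

lemma trunc_le: "\<bar>trunc N r\<bar> <= \<bar>r\<bar>"
proof -
 have "norm (trunc N r - trunc N 0) <= 1 * norm (r - 0)"
  by (rule field_differentiable_bound[of UNIV _ "trunc' N"])
    (use trunc_deriv trunc'_bound in \<open>auto intro: has_field_derivative_at_within\<close>)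
 then show ?thesis by simp
qed

lemma trunc_tendsto: "(%N. trunc N r) \<longlonglongrightarrow> r"
proof (cases "r = 0")
 case False
 have "((%h. arctan h / h) \<longlongrightarrow> 1) (at 0)"
  using DERIV_arctan[of 0] by (simp add: DERIV_def)
 moreover have "filterlim (%N. r * inverse (real (Suc N))) (at 0) sequentially"
  using False tendsto_mult_right_zero[OF LIMSEQ_inverse_real_of_nat, of r]
  by (auto simp: filterlim_at)
 ultimately have "(%N. arctan (r * inverse (real (Suc N))) / (r * inverse (real (Suc N)))) \<longlonglongrightarrow> 1"
  by (rule filterlim_compose)
 from tendsto_mult_left[OF this, of r]
 have "(%N. r * (arctan (r * inverse (real (Suc N))) / (r * inverse (real (Suc N))))) \<longlonglongrightarrow> r" by simp
 also have "(%N. r * (arctan (r * inverse (real (Suc N))) / (r * inverse (real (Suc N))))) = (%N. trunc N r)"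
  unfolding trunc_def using False by (intro ext) (simp add: divide_inverse del: of_nat_Suc)
 finally show ?thesis .
qed simp

lemma Lb_liminf:
 assumes F: "!!n. Lb p (F n) c" and f: "f \<in> bmeas" and lim: "AE x in lborel. (%n. F n x) \<longlonglongrightarrow> f x"
 shows "Lb p f c"
proof -
 note [measurable] = LbD(1)[OF F] f
 have "(nni (%x. \<bar>f x\<bar> ^ p)) = (\<integral>\<^sup>+x. liminf (%n. ennreal (\<bar>F n x\<bar> ^ p)) \<partial>lborel)"
 proof (rule nn_integral_cong_AE)
  show "AE x in lborel. ennreal (\<bar>f x\<bar> ^ p) = liminf (%n. ennreal (\<bar>F n x\<bar> ^ p))"
   using lim
  proof eventually_elim
   case (elim x)
   then have "(%n. ennreal (\<bar>F n x\<bar> ^ p)) \<longlonglongrightarrow> ennreal (\<bar>f x\<bar> ^ p)"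
    by (intro tendsto_intros) auto
   from lim_imp_Liminf[OF _ this] show ?case by simp
  qed
 qed
 also have "... <= liminf (%n. nni (%x. \<bar>F n x\<bar> ^ p))"
  by (rule nn_integral_liminf) measurable
 also have "... <= ennreal (c ^ p)"
  using LbD(3)[OF F] by (intro Liminf_le) auto
 finally show ?thesis using f LbD(2)[OF F[of 0]] by (auto simp: Lb_def)
qed

text \<open>The boundedness assumption is removed: the truncations satisfy the bound with the same
  constant, and Fatou's lemma passes to the limit.\<close>

lemma sobolev_trunc:
 fixes q :: "real^'n => real"
 assumes q: "!!l. DQ l q (q' l)" and L: "Lb 2 q al" "!!l. Lb 2 (q' l) al"
  and bd: "!!(P::real^'n => real) P' B. (!!l. DQ l P (P' l)) ==> (!!x. \<bar>P x\<bar> <= B) ==> Lb 2 P al ==> (!!l. Lb 2 (P' l) al) ==> Lb p P c"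
 shows "Lb p q c"
proof (rule Lb_liminf[where F = "%N x. trunc N (q x)"])
 note [measurable] = LbD(1)[OF L(1)] LbD(1)[OF L(2)]
 fix N
 have [measurable]: "trunc N \<in> bmeas" "trunc' N \<in> bmeas"
  unfolding trunc_def[abs_def] trunc'_def[abs_def] by measurable
 show "Lb p (%x. trunc N (q x)) c"
 proof (rule bd[of "%x. trunc N (q x)" "%l x. trunc' N (q x) * q' l x" "2 * real (Suc N)"])
  show "!!l. DQ l (%x. trunc N (q x)) (%x. trunc' N (q x) * q' l x)"
   by (rule DQ_chain[OF q _ trunc_deriv trunc'_bound trunc'_lipschitz]) simp
  show "!!x. \<bar>trunc N (q x)\<bar> <= 2 * real (Suc N)" by (rule trunc_bound)
  show "Lb 2 (%x. trunc N (q x)) al"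
   by (rule Lb_dominated[OF L(1)]) (auto intro: trunc_le)
  fix l show "Lb 2 (%x. trunc' N (q x) * q' l x) al"
   by (rule Lb_dominated[OF L(2)[of l]]) (use trunc'_bound in \<open>auto simp: abs_mult intro!: mult_left_le_one_le\<close>)
 qed
qed (use LbD(1)[OF L(1)] trunc_tendsto in auto)

lemma sobolev_2:
 fixes q :: "real^'n => real"
 assumes c: "CARD('n) = 2" and q: "!!l. DQ l q (q' l)" and L: "Lb 2 q al" "!!l. Lb 2 (q' l) al"
 shows "Lb (2 * Suc k) q (fact (Suc k) * al)"
proof -
 obtain i j :: 'n where U: "UNIV = {i, j}" "i ~= j" using c by (auto simp: card_2_iff)
 show ?thesis by (rule sobolev_trunc[OF q L]) (rule sobolev_bounded_2[OF U])
qed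

text \<open>The common constant 6 is 3! from dimension two; dimension three gives the smaller
  constant 4.\<close>

lemma sobolev_6:
 fixes q :: "real^'n => real"
 assumes c: "CARD('n) = 2 \<or> CARD('n) = 3" and q: "!!l. DQ l q (q' l)" and L: "Lb 2 q al" "!!l. Lb 2 (q' l) al"
 shows "Lb 6 q (6 * al)"
 using c
proof
 assume "CARD('n) = 2"
 from sobolev_2[OF this q L, of 2] show ?thesis by (simp add: fact_numeral)
next
 assume "CARD('n) = 3"
 then obtain i j k :: 'n where U: "UNIV = {i, j, k}" "i ~= j" "i ~= k" "j ~= k" by (auto simp: card_3_iff)
 have "Lb 6 q (4 * al)" by (rule sobolev_trunc[OF q L]) (rule sobolev_bounded_3[OF U])
 then show ?thesis by (rule Lb_mono) (use LbD(2)[OF L(1)] in simp)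
qed

subsection \<open>Supremum bound\<close>

lemma weak_dir_add:
 assumes "weak_dir D v p q" "weak_dir D v p' q'" "loc_int D p" "loc_int D q" "loc_int D p'" "loc_int D q'"
 shows "weak_dir D v (%x. p x + p' x) (%x. q x + q' x)"
 unfolding weak_dir_def
proof (intro allI impI)
 fix phi :: "real^'a => real" assume phi: "test_fun D phi"
 show "(LINT x|lborel. fder phi x v * (p x + p' x)) = - (LINT x|lborel. phi x * (q x + q' x))"
  using assms(1,2) phi test_fun_integrable[OF phi assms(3)] test_fun_integrable[OF phi assms(4)]
   test_fun_integrable[OF phi assms(5)] test_fun_integrable[OF phi assms(6)]
  by (simp add: weak_dir_def distrib_left)
qed

lemma weak_dir_combine:
 fixes p :: "real^'n => real"
 assumes w: "!!i. weak_dir UNIV (axis i 1) p (q i)" and p: "sq p" and q: "!!i. sq (q i)"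
 shows "weak_dir UNIV z p (%x. \<Sum>i\<in>UNIV. z $ i * q i x)"
 unfolding weak_dir_def
proof (intro allI impI)
 fix phi :: "real^'n => real" assume phi: "test_fun UNIV phi"
 have diff: "phi differentiable (at x)" for x using phi by (metis Ck.simps(2) test_fun_def)
 note I = test_fun_integrable[OF phi sq_loc_int[OF p]] test_fun_integrable[OF phi sq_loc_int[OF q]]
 have "fder phi x z = (\<Sum>i\<in>UNIV. z $ i * fder phi x (axis i 1))" for x
  using frechet_derivative_eq_grad[OF diff, of x z] by (simp add: grad_def)
 then have "(LINT x|lborel. fder phi x z * p x)
   = (LINT x|lborel. (\<Sum>i\<in>UNIV. z $ i * (fder phi x (axis i 1) * p x)))"
  by (simp add: sum_distrib_right mult.assoc)
 also have "... = (\<Sum>i\<in>UNIV. z $ i * (LINT x|lborel. fder phi x (axis i 1) * p x))"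
  using I by (subst Bochner_Integration.integral_sum) auto
 also have "... = (\<Sum>i\<in>UNIV. z $ i * - (LINT x|lborel. phi x * q i x))"
  using w phi by (simp add: weak_dir_def)
 also have "... = - (LINT x|lborel. (\<Sum>i\<in>UNIV. z $ i * (phi x * q i x)))"
  using I by (subst Bochner_Integration.integral_sum) (auto simp: sum_negf)
 also have "(LINT x|lborel. (\<Sum>i\<in>UNIV. z $ i * (phi x * q i x))) = (LINT x|lborel. phi x * (\<Sum>i\<in>UNIV. z $ i * q i x))"
  by (simp add: sum_distrib_left mult_ac)
 finally show "(LINT x|lborel. fder phi x z * p x) = - (LINT x|lborel. phi x * (\<Sum>i\<in>UNIV. z $ i * q i x))" .
qed

lemma nn_integral_scale:
 fixes f :: "'a::euclidean_space => ennreal"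
 assumes [measurable]: "f \<in> bmeas" and c: "0 < c"
 shows "(\<integral>\<^sup>+z. f (x + c *R z) \<partial>lborel) = ennreal (inverse (c ^ DIM('a))) * (\<integral>\<^sup>+z. f z \<partial>lborel)"
proof -
 have "(\<integral>\<^sup>+z. f z \<partial>lborel) = (\<integral>\<^sup>+z. f z \<partial>density (distr lborel borel (%z. x + c *R z)) (%_. \<bar>c\<bar> ^ DIM('a)))"
  using c by (subst lborel_affine[of c x]) auto
 also have "... = (\<integral>\<^sup>+z. ennreal (c ^ DIM('a)) * f z \<partial>distr lborel borel (%z. x + c *R z))"
  using c by (subst nn_integral_density) auto
 also have "... = (\<integral>\<^sup>+z. ennreal (c ^ DIM('a)) * f (x + c *R z) \<partial>lborel)"
  by (subst nn_integral_distr) auto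
 also have "... = ennreal (c ^ DIM('a)) * (\<integral>\<^sup>+z. f (x + c *R z) \<partial>lborel)"
  by (rule nn_integral_cmult) measurable
 finally have "ennreal (inverse (c ^ DIM('a))) * (\<integral>\<^sup>+z. f z \<partial>lborel)
   = (ennreal (inverse (c ^ DIM('a))) * ennreal (c ^ DIM('a))) * (\<integral>\<^sup>+z. f (x + c *R z) \<partial>lborel)"
  by (simp add: mult.assoc)
 also have "ennreal (inverse (c ^ DIM('a))) * ennreal (c ^ DIM('a)) = 1"
  using c by (simp add: ennreal_mult[symmetric])
 finally show ?thesis by simp
qed

text \<open>The exponent is -d/4 for d = 3, the price of rescaling an L4 norm by t. Its
  integrability at 0 is the condition d < 4 of Morrey's inequality.\<close>

lemma nn_integral_unit_powr: "(nni (%t. indicator {0..1} t * t powr (- 3 / 4))) = ennreal 4"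
proof -
 have "((%t::real. t powr (- 3 / 4)) has_integral (1 powr (- 3 / 4 + 1) / (- 3 / 4 + 1))) {0..1}"
  by (rule has_integral_powr_from_0) auto
 then have "((%t::real. t powr (- 3 / 4)) has_integral 4) {0..1}" by simp
 then show ?thesis
  by (rule nn_integral_has_integral_lebesgue[rotated]) simp
qed

text \<open>Cauchy-Schwarz twice; the nested roots are V^(3/4) Y^(1/4).\<close>

lemma nn_jensen_4:
 fixes H :: "'a => real"
 assumes [measurable]: "H \<in> borel_measurable M" "A \<in> sets M"
  and V: "emeasure M A = ennreal V" "0 <= V" and H: "(\<integral>\<^sup>+z. ennreal (H z ^ 4) \<partial>M) <= ennreal Y" "0 <= Y"
 shows "(\<integral>\<^sup>+z. ennreal (indicator A z * \<bar>H z\<bar>) \<partial>M) <= ennreal (sqrt (V * sqrt (V * Y)))"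
proof -
 have A: "(\<integral>\<^sup>+z. ennreal ((indicator A z)^2) \<partial>M) <= ennreal V"
 proof -
  have "(\<integral>\<^sup>+z. ennreal ((indicator A z)^2) \<partial>M) = (\<integral>\<^sup>+z. indicator A z \<partial>M)"
   by (intro nn_integral_cong) (auto split: split_indicator)
  then show ?thesis using V by simp
 qed
 have 1: "(\<integral>\<^sup>+z. ennreal \<bar>indicator A z * (H z)^2\<bar> \<partial>M) <= ennreal (sqrt (V * Y))"
  by (rule nn_Cauchy_Schwarz[OF _ _ A]) (use V H in auto)
 have "(\<integral>\<^sup>+z. ennreal \<bar>indicator A z * (indicator A z * H z)\<bar> \<partial>M) <= ennreal (sqrt (V * sqrt (V * Y)))"
 proof (rule nn_Cauchy_Schwarz[OF _ _ A])
  have "(\<integral>\<^sup>+z. ennreal ((indicator A z * H z)^2) \<partial>M) = (\<integral>\<^sup>+z. ennreal \<bar>indicator A z * (H z)^2\<bar> \<partial>M)"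
   by (intro nn_integral_cong) (auto split: split_indicator)
  then show "(\<integral>\<^sup>+z. ennreal ((indicator A z * H z)^2) \<partial>M) <= ennreal (sqrt (V * Y))" using 1 by simp
 qed (use V H in auto)
 moreover have "\<bar>indicator A z * (indicator A z * H z)\<bar> = indicator A z * \<bar>H z\<bar>" for z
  by (auto split: split_indicator)
 ultimately show ?thesis by simp
qed

text \<open>Morrey's inequality: q(x) is q(x + z) minus the integral of the gradient along the
  segment, averaged over z in the unit ball. For fixed t the gradient at x + tz is averaged by its
  L4 norm, with a factor of at most t^(-3/4), which is integrable over [0,1].\<close>

lemma sup_bound:
 assumes c: "CARD('n) <= 3"
 obtains C where "C >= 0" "!!(q::real^'n => real) q' al be. (!!i. DQ i q (q' i)) ==> Lb 2 q al ==> (!!i. Lb 4 (q' i) be)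
  ==> AE x in lborel. \<bar>q x\<bar> <= C * (al + be)"
proof -
 define B where "B = ball (0::real^'n) 1"
 define V where "V = measure lborel B"
 define n where "n = real CARD('n)"
 have n0: "n >= 0" by (simp add: n_def)
 have [measurable]: "B \<in> sets borel" by (simp add: B_def)
 have VE: "emeasure lborel B = ennreal V"
  unfolding V_def B_def using emeasure_lborel_ball_finite[of "0::real^'n" 1] by (intro emeasure_eq_ennreal_measure) auto
 have V: "V > 0" unfolding V_def B_def by (simp add: content_ball_pos)
 \<comment> \<open>The first entry is the factor of \<open>al\<close> from Cauchy-Schwarz for the
   mean of q, the second the factor of \<open>be\<close>: V^(3/4), the number of partial
   derivatives, and 4 for the integral of t^(-3/4), divided by the volume V.\<close>
 define C where "C = max (sqrt V / V) (sqrt (V * sqrt V) * n * 4 / V)"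
 show thesis
 proof (rule that[of C])
  show "C >= 0" using V by (simp add: C_def le_max_iff_disj)
  fix q :: "real^'n => real" and q' al be
  assume q: "!!i. DQ i q (q' i)" and a: "Lb 2 q al" and b: "!!i. Lb 4 (q' i) be"
  note s = DQ_sq(1)[OF q] DQ_sq(2)[OF q]
  note [measurable] = s[THEN sq_measurable]
  have al: "0 <= al" "0 <= be" using LbD(2)[OF a] LbD(2)[OF b] by auto
  define h where "h x = (\<Sum>i\<in>UNIV. \<bar>q' i x\<bar>)" for x
  have [measurable]: "h \<in> bmeas" unfolding h_def by measurable
  have h0: "h x >= 0" for x unfolding h_def by (simp add: sum_nonneg)
  have hL: "Lb 4 h (n * be)"
  proof -
   have "Lb 4 (%x. \<bar>q' i x\<bar>) be" for i using b[of i] by (simp add: Lb_def)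
   from Lb_sum[of UNIV 4 "%i x. \<bar>q' i x\<bar>" "%_. be", OF _ this] show ?thesis by (simp add: h_def[abs_def] n_def)
  qed
  have [measurable]: "(%z::real^'n. z $ i) \<in> bmeas" for i
   by (intro borel_measurable_continuous_onI) (auto intro!: continuous_intros)
  define G where "G z x = (LINT t:{0..1}|lborel. (\<Sum>i\<in>UNIV. z $ i * q' i (x + t *R z)))" for z x :: "real^'n"
  have [measurable]: "case_prod G \<in> borel_measurable (borel \<Otimes>\<^sub>M borel)"
   unfolding G_def set_lebesgue_integral_def case_prod_beta
   by (rule lborel.borel_measurable_lebesgue_integral) measurable
  have "AE z in lborel. AE x in lborel. q (x + z) - q x = G z x"
  proof (rule AE_I2)
   fix z :: "real^'n"
   have sz: "sq (%x. \<Sum>i\<in>UNIV. z $ i * q' i x)" by (intro sq_sum sq_cmult s) simp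
   show "AE x in lborel. q (x + z) - q x = G z x"
    using weak_dir_segment[OF open_UNIV _ _ sq_loc_int[OF s(1)] sq_loc_int[OF sz] weak_dir_combine[OF DQ_weak_dir[OF q] s]]
    by (simp add: G_def)
  qed
  \<comment> \<open>The segment formula holds for each z outside a null set of points x that depends
    on z; exchanging the quantifiers gives, for almost every x, the formula for almost every
    z.\<close>
  then have AE: "AE x in lborel. AE z in lborel. q (x + z) - q x = G z x"
  proof (subst lborel_pair.AE_commute)
   show "{x \<in> space (lborel \<Otimes>\<^sub>M lborel). q (fst x + snd x) - q (fst x) = G (snd x) (fst x)} \<in> sets (lborel \<Otimes>\<^sub>M lborel)"
    by measurable
  qed
  then show "AE x in lborel. \<bar>q x\<bar> <= C * (al + be)"
  proof eventually_elim
   case (elim x)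
   have le: "AE z in lborel. indicator B z * ennreal \<bar>q x\<bar>
     <= ennreal (indicator B z * \<bar>q (x + z)\<bar>) + (nni (%t. indicator {0..1} t * (indicator B z * h (x + t *R z))))"
    using elim
   proof eventually_elim
    case (elim z)
    show ?case
    proof (cases "z \<in> B")
     case True
     have "\<bar>z $ i\<bar> <= 1" for i using component_le_norm_cart[of z i] True by (simp add: B_def)
     then have "\<bar>\<Sum>i\<in>UNIV. z $ i * q' i (x + t *R z)\<bar> <= h (x + t *R z)" for t
      unfolding h_def by (intro order_trans[OF sum_abs] sum_mono) (simp add: abs_mult mult_left_le_one_le)
     then have p: "norm (indicator {0..1} t *R (\<Sum>i\<in>UNIV. z $ i * q' i (x + t *R z))) <= indicator {0..1} t * h (x + t *R z)" for t :: real
      by (auto split: split_indicator)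
     have "ennreal \<bar>G z x\<bar> <= (nni (%t. norm (indicator {0..1} t *R (\<Sum>i\<in>UNIV. z $ i * q' i (x + t *R z)))))"
     proof (cases "integrable lborel (%t. indicator {0..1} t *R (\<Sum>i\<in>UNIV. z $ i * q' i (x + t *R z)))")
      case True
      from integral_norm_bound_ennreal[OF True] show ?thesis
       unfolding G_def set_lebesgue_integral_def by (simp only: real_norm_def)
     qed (simp add: G_def set_lebesgue_integral_def not_integrable_integral_eq)
     also have "... <= (nni (%t. indicator {0..1} t * (indicator B z * h (x + t *R z))))"
      using p True by (intro nn_integral_mono ennreal_leI) simp
     finally have g: "ennreal \<bar>G z x\<bar> <= ..." .
     have "ennreal \<bar>q x\<bar> <= ennreal \<bar>q (x + z)\<bar> + ennreal \<bar>G z x\<bar>"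
      unfolding elim[symmetric] by (subst ennreal_plus[symmetric]) (auto intro!: ennreal_leI simp del: ennreal_plus)
     also have "... <= ennreal \<bar>q (x + z)\<bar> + (nni (%t. indicator {0..1} t * (indicator B z * h (x + t *R z))))"
      by (intro add_left_mono g)
     finally show ?thesis using True by simp
    qed simp
   qed
   have "ennreal (V * \<bar>q x\<bar>) = (\<integral>\<^sup>+z. indicator B z * ennreal \<bar>q x\<bar> \<partial>lborel)"
    using V by (subst nn_integral_multc) (auto simp: VE ennreal_mult)
   also have "... <= (\<integral>\<^sup>+z. ennreal (indicator B z * \<bar>q (x + z)\<bar>)
     + (nni (%t. indicator {0..1} t * (indicator B z * h (x + t *R z)))) \<partial>lborel)"
    by (rule nn_integral_mono_AE[OF le])
   also have "... = (nni (%z. indicator B z * \<bar>q (x + z)\<bar>))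
     + (\<integral>\<^sup>+z. nni (%t. indicator {0..1} t * (indicator B z * h (x + t *R z))) \<partial>lborel)"
    by (rule nn_integral_add) measurable
   also have "(\<integral>\<^sup>+z. nni (%t. indicator {0..1} t * (indicator B z * h (x + t *R z))) \<partial>lborel)
     = (\<integral>\<^sup>+t. nni (%z. indicator {0..1} t * (indicator B z * h (x + t *R z))) \<partial>lborel)"
    by (rule lborel_pair.Fubini'[symmetric]) measurable
   also have "... <= (\<integral>\<^sup>+t. ennreal (sqrt (V * sqrt V) * (n * be)) * ennreal (indicator {0..1} t * t powr (- 3 / 4)) \<partial>lborel)"
   proof (rule nn_integral_mono_AE)
    have "AE t in lborel. t ~= (0::real)" by (rule AE_lborel_singleton)
    then show "AE t in lborel. (nni (%z. indicator {0..1} t * (indicator B z * h (x + t *R z))))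
      <= ennreal (sqrt (V * sqrt V) * (n * be)) * ennreal (indicator {0..1} t * t powr (- 3 / 4))"
    proof eventually_elim
     case (elim t)
     show ?case
     proof (cases "t \<in> {0..1}")
      case True
      then have t: "0 < t" "t <= 1" using elim by auto
      define Y where "Y = inverse (t ^ CARD('n)) * (n * be) ^ 4"
      have Y0: "0 <= Y" using t n0 al by (simp add: Y_def)
      have "(nni (%z. indicator B z * \<bar>h (x + t *R z)\<bar>)) <= ennreal (sqrt (V * sqrt (V * Y)))"
      proof (rule nn_jensen_4)
       have "(nni (%z. h (x + t *R z) ^ 4)) = ennreal (inverse (t ^ CARD('n))) * (nni (%z. h z ^ 4))"
        using nn_integral_scale[of "%z. ennreal (h z ^ 4)" t x] t by simp
       also have "... <= ennreal (inverse (t ^ CARD('n))) * ennreal ((n * be) ^ 4)"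
        using LbD(3)[OF hL] h0 by (intro mult_left_mono) auto
       also have "... = ennreal Y" using t by (simp add: Y_def ennreal_mult'[symmetric])
       finally show "(nni (%z. h (x + t *R z) ^ 4)) <= ennreal Y" .
      qed (use VE V Y0 in auto)
      also have "sqrt (V * sqrt (V * Y)) <= sqrt (V * sqrt V) * (n * be) * t powr (- 3 / 4)"
      proof -
       \<comment> \<open>As t is at most 1, dimension three is the worst case.\<close>
       have "inverse (t ^ CARD('n)) <= inverse (t ^ 3)"
        using t c by (intro le_imp_inverse_le power_decreasing) auto
       also have "... = (t powr (- 3 / 4)) ^ 4"
       proof -
        have "(t powr (- 3 / 4)) ^ 4 = t powr (- 3)" using t by (simp add: powr_power)
        also have "... = inverse (t ^ 3)" using t by (simp add: powr_minus powr_numeral)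
        finally show ?thesis by simp
       qed
       finally have "Y <= (t powr (- 3 / 4) * (n * be)) ^ 4"
        unfolding Y_def power_mult_distrib using n0 al by (intro mult_right_mono) auto
       then have "sqrt (V * sqrt (V * Y)) <= sqrt (V * sqrt (V * (t powr (- 3 / 4) * (n * be)) ^ 4))"
        using V by (intro real_sqrt_le_mono mult_left_mono) auto
       also have "sqrt (V * (t powr (- 3 / 4) * (n * be)) ^ 4) = sqrt V * (t powr (- 3 / 4) * (n * be))^2"
       proof -
        have "sqrt ((t powr (- 3 / 4) * (n * be)) ^ 4) = (t powr (- 3 / 4) * (n * be))^2"
         by (rule real_sqrt_unique) (auto simp: power_mult_distrib)
        then show ?thesis by (simp add: real_sqrt_mult)
       qed
       also have "sqrt (V * (sqrt V * (t powr (- 3 / 4) * (n * be))^2)) = sqrt (V * sqrt V) * (t powr (- 3 / 4) * (n * be))"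
       proof -
        have *: "sqrt (V * (sqrt V * X^2)) = sqrt (V * sqrt V) * X" if "0 <= X" for X
         using that by (simp only: mult.assoc[symmetric] real_sqrt_mult[of _ "X^2"] real_sqrt_abs abs_of_nonneg)
        show ?thesis using n0 al by (intro *) auto
       qed
       finally show ?thesis by (simp add: mult_ac)
      qed
      finally show ?thesis using True h0 n0 al V by (simp add: ennreal_mult'[symmetric] ennreal_leI)
     qed simp
    qed
   qed
   also have "... = ennreal (sqrt (V * sqrt V) * (n * be)) * ennreal 4"
    by (subst nn_integral_cmult) (auto simp: nn_integral_unit_powr[simplified])
   also have "... = ennreal (sqrt (V * sqrt V) * (n * be) * 4)"
    using V n0 al by (subst ennreal_mult'[symmetric]) auto
   also have "(nni (%z. indicator B z * \<bar>q (x + z)\<bar>)) <= ennreal (sqrt (V * al^2))"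
   proof -
    have "(\<integral>\<^sup>+z. ennreal \<bar>indicator B z * q (x + z)\<bar> \<partial>lborel) <= ennreal (sqrt (V * al^2))"
    proof (rule nn_Cauchy_Schwarz)
     have "(nni (%z. (indicator B z)\<^sup>2)) = (\<integral>\<^sup>+z. indicator B z \<partial>lborel)"
      by (intro nn_integral_cong) (auto split: split_indicator)
     then show "(nni (%z. (indicator B z)\<^sup>2)) <= ennreal V" using VE by simp
     have "(nni (%z. (q (x + z))\<^sup>2)) = (nni (%z. \<bar>q z\<bar>\<^sup>2))"
      using nn_integral_translate[of "%z. ennreal ((q z)^2)" x] by (simp add: add.commute)
     then show "(nni (%z. (q (x + z))\<^sup>2)) <= ennreal (al^2)" using LbD(3)[OF a] by simp
    qed (use V in auto)
    then show ?thesis by (simp add: abs_mult)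
   qed
   finally have "ennreal (V * \<bar>q x\<bar>) <= ennreal (sqrt (V * al^2)) + ennreal (sqrt (V * sqrt V) * (n * be) * 4)"
    by (simp add: add_mono)
   then have "ennreal (V * \<bar>q x\<bar>) <= ennreal (sqrt (V * al^2) + sqrt (V * sqrt V) * (n * be) * 4)"
    using V n0 al by simp
   then have "V * \<bar>q x\<bar> <= sqrt (V * al^2) + sqrt (V * sqrt V) * (n * be) * 4"
    using V n0 al by (subst (asm) ennreal_le_iff) auto
   then have "\<bar>q x\<bar> <= (sqrt V * al + sqrt (V * sqrt V) * (n * be) * 4) / V"
    using V al by (simp add: real_sqrt_mult pos_le_divide_eq mult.commute)
   also have "... = (sqrt V / V) * al + (sqrt (V * sqrt V) * n * 4 / V) * be"
    by (simp add: add_divide_distrib)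
   also have "... <= C * al + C * be"
    using al by (intro add_mono mult_right_mono) (auto simp: C_def)
   finally show ?case by (simp add: distrib_left)
  qed
 qed
qed

subsection \<open>Weights and functions with a weighted second derivative\<close>

lemma MultI:
 assumes "b \<in> bmeas" "b' \<in> bmeas"
  and d: "!!x. ((%t. b (x + t *R axis i 1)) has_real_derivative b' x) (at 0)"
  and K: "!!x. \<bar>b x\<bar> <= K" "!!x. \<bar>b' x\<bar> <= K"
 shows "Mult K i b b'"
 unfolding Mult_def
proof (intro conjI allI assms)
 have d': "((%t. b (x + t *R axis i 1)) has_real_derivative b' (x + t *R axis i 1)) (at t)" for x t
 proof -
  have "((%s. b (x + t *R axis i 1 + s *R axis i 1)) has_real_derivative b' (x + t *R axis i 1)) (at 0)"
   by (rule d)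
  then have "((%s. b (x + (s + t) *R axis i 1)) has_real_derivative b' (x + t *R axis i 1)) (at 0)"
   by (simp add: algebra_simps)
  then show ?thesis using DERIV_shift[of "%t. b (x + t *R axis i 1)" _ 0 t] by simp
 qed
 fix x t
 have "norm (b (x + t *R axis i 1) - b (x + 0 *R axis i 1)) <= K * norm (t - 0)"
  by (rule field_differentiable_bound[of UNIV _ "%t. b' (x + t *R axis i 1)"])
    (use d' K in \<open>auto intro: has_field_derivative_at_within\<close>)
 then show "\<bar>b (x + t *R axis i 1) - b x\<bar> <= K * \<bar>t\<bar>" by simp
next
 fix x
 have "((%h. (b (x + h *R axis i 1) - b x) / h) \<longlongrightarrow> b' x) (at 0)" using d[of x] by (simp add: DERIV_def)
 moreover have "filterlim step (at 0) sequentially"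
  using step_pos step_tendsto by (auto simp: filterlim_at less_imp_neq[symmetric] intro!: always_eventually)
 ultimately show "(%n. dq i n b x) \<longlonglongrightarrow> b' x" by (rule filterlim_compose)
qed

text \<open>A cutoff supported in E whose gradient is itself bounded and Lipschitz along the axes;
  the second derivatives are only limits of quotients. The requirement \<open>1 <= K\<close> lets K
  absorb absolute constants and be compared with its square.\<close>

definition Weight :: "real => (real^'n) set => (real^'n => real) => ('n => real^'n => real)
  => ('n => 'n => real^'n => real) => bool" where
 "Weight K E a a1 a2 \<longleftrightarrow> 1 <= K \<and> (\<forall>x. 0 <= a x \<and> a x <= 1) \<and> (\<forall>x. x \<notin> E --> a x = 0) \<and>
   (\<forall>i x. ((%t. a (x + t *R axis i 1)) has_real_derivative a1 i x) (at 0)) \<and>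
   (\<forall>i. Mult K i a (a1 i)) \<and> (\<forall>i k. Mult K k (a1 i) (a2 i k))"

lemma WeightD:
 assumes "Weight K E a a1 a2"
 shows "1 <= K" "0 <= a x" "a x <= 1" "x \<notin> E ==> a x = 0"
  "((%t. a (x + t *R axis i 1)) has_real_derivative a1 i x) (at 0)"
  "Mult K i a (a1 i)" "Mult K k (a1 i) (a2 i k)"
 using assms unfolding Weight_def by blast+

text \<open>Glaeser's inequality.\<close>

lemma Weight_gradient_bound:
 assumes W: "Weight K E a a1 a2"
 shows "\<bar>a1 i x\<bar> <= 2 * K * sqrt (a x)"
proof -
 have K: "1 <= K" by (rule WeightD(1)[OF W])
 \<comment> \<open>The minimizer of a x + t (a1 i x) + K t^2. The mean value inequality bounds the
   deviation of the weight from its tangent by K t^2, and nonnegativity at the minimum bounds the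
   slope.\<close>
 define T where "T = - a1 i x / (2 * K)"
 define g where "g t = a (x + t *R axis i 1) - t * a1 i x" for t
 have d': "((%t. a (x + t *R axis i 1)) has_real_derivative a1 i (x + t *R axis i 1)) (at t)" for t
 proof -
  have "((%s. a (x + t *R axis i 1 + s *R axis i 1)) has_real_derivative a1 i (x + t *R axis i 1)) (at 0)"
   by (rule WeightD(5)[OF W])
  then have "((%s. a (x + (s + t) *R axis i 1)) has_real_derivative a1 i (x + t *R axis i 1)) (at 0)"
   by (simp add: algebra_simps)
  then show ?thesis using DERIV_shift[of "%t. a (x + t *R axis i 1)" _ 0 t] by simp
 qed
 have "norm (g T - g 0) <= (K * \<bar>T\<bar>) * norm (T - 0)"
 proof (rule field_differentiable_bound[of "{- \<bar>T\<bar>..\<bar>T\<bar>}" _ "%t. a1 i (x + t *R axis i 1) - a1 i x"])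
  fix t assume t: "t \<in> {- \<bar>T\<bar>..\<bar>T\<bar>}"
  show "(g has_real_derivative a1 i (x + t *R axis i 1) - a1 i x) (at t within {- \<bar>T\<bar>..\<bar>T\<bar>})"
   unfolding g_def by (rule has_field_derivative_at_within) (auto intro!: derivative_eq_intros d')
  have "\<bar>a1 i (x + t *R axis i 1) - a1 i x\<bar> <= K * \<bar>t\<bar>" by (rule MultD(5)[OF WeightD(7)[OF W]])
  also have "... <= K * \<bar>T\<bar>" using t K by (intro mult_left_mono) auto
  finally show "norm (a1 i (x + t *R axis i 1) - a1 i x) <= K * \<bar>T\<bar>" by simp
 qed auto
 moreover have "\<bar>T\<bar> * \<bar>T\<bar> = T^2" by (simp add: power2_eq_square)
 ultimately have "g T <= g 0 + K * T^2" by (simp add: abs_le_iff mult.assoc)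
 moreover have "a (x + T *R axis i 1) >= 0" by (rule WeightD(2)[OF W])
 ultimately have "0 <= a x + T * a1 i x + K * T^2" by (simp add: g_def)
 also have "T * a1 i x + K * T^2 = - (a1 i x)\<^sup>2 / (4 * K)"
  using K by (simp add: T_def power2_eq_square field_simps)
 then have "a x + T * a1 i x + K * T^2 = a x - (a1 i x)^2 / (4 * K)" by simp
 finally have "(a1 i x)^2 <= 4 * K * a x" using K by (simp add: field_simps)
 also have "... <= 4 * K * K * a x" using K WeightD(2)[OF W, of x] by (intro mult_right_mono) auto
 also have "... = (2 * K * sqrt (a x))^2" using WeightD(2)[OF W, of x] by (simp add: power_mult_distrib power2_eq_square)
 finally show ?thesis using K WeightD(2)[OF W, of x] by (simp add: abs_le_square_iff[symmetric])
qed

text \<open>Encodes functions with first derivatives on the whole space and second derivatives only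
  in E, without speaking of the boundary of E: every Lipschitz cutoff vanishing outside E makes the
  first derivatives differentiable on the whole space. The class is stable under translation,
  shrinking of E and linear combinations.\<close>

definition wclass :: "(real^'n) set => (real^'n => real) => ('n => real^'n => real)
  => ('n => 'n => real^'n => real) => bool" where
 "wclass E p p1 p2 \<longleftrightarrow> (\<forall>i. DQ i p (p1 i)) \<and> (\<forall>i k. sq (p2 i k)) \<and>
   (\<forall>K rho rho' i k. Mult K k rho rho' --> (\<forall>x. x \<notin> E --> rho x = 0) -->
    DQ k (%x. rho x * p1 i x) (%x. rho' x * p1 i x + rho x * p2 i k x))"

lemma wclassD:
 assumes "wclass E p p1 p2"
 shows "DQ i p (p1 i)" "sq p" "sq (p1 i)" "sq (p2 i k)"
  "Mult K k rho rho' ==> (!!x. x \<notin> E ==> rho x = 0) ==> DQ k (%x. rho x * p1 i x) (%x. rho' x * p1 i x + rho x * p2 i k x)"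
 using assms unfolding wclass_def by (auto dest: DQ_sq)

lemma wclass_mono:
 assumes "wclass E p p1 p2" "E' \<subseteq> E"
 shows "wclass E' p p1 p2"
 unfolding wclass_def
proof (intro conjI allI impI)
 fix K rho rho' i k assume "Mult K k rho rho'" "\<forall>x. x \<notin> E' --> rho x = 0"
 then show "DQ k (%x. rho x * p1 i x) (%x. rho' x * p1 i x + rho x * p2 i k x)"
  using assms(2) by (intro wclassD(5)[OF assms(1)]) auto
qed (use wclassD[OF assms(1)] in auto)

lemma wclass_diff:
 assumes "wclass E p p1 p2" "wclass E q q1 q2"
 shows "wclass E (%x. p x - q x) (%i x. p1 i x - q1 i x) (%i k x. p2 i k x - q2 i k x)"
 unfolding wclass_def
proof (intro conjI allI impI)
 fix K rho rho' i k assume M: "Mult K k rho rho'" and rho: "\<forall>x. x \<notin> E --> rho x = 0"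
 from DQ_diff[OF wclassD(5)[OF assms(1) M] wclassD(5)[OF assms(2) M], of i i] rho
 have "DQ k (%x. rho x * p1 i x - rho x * q1 i x)
   (%x. (rho' x * p1 i x + rho x * p2 i k x) - (rho' x * q1 i x + rho x * q2 i k x))" by blast
 moreover have "rho x * p1 i x - rho x * q1 i x = rho x * (p1 i x - q1 i x)"
  "(rho' x * p1 i x + rho x * p2 i k x) - (rho' x * q1 i x + rho x * q2 i k x) = rho' x * (p1 i x - q1 i x) + rho x * (p2 i k x - q2 i k x)" for x
  by (auto simp: algebra_simps)
 ultimately show "DQ k (%x. rho x * (p1 i x - q1 i x)) (%x. rho' x * (p1 i x - q1 i x) + rho x * (p2 i k x - q2 i k x))"
  by (simp only:)
qed (auto intro!: DQ_diff sq_diff wclassD[OF assms(1)] wclassD[OF assms(2)])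

definition wbound :: "real => (real^'n => real) => ('n => real^'n => real)
  => ('n => 'n => real^'n => real) => bool" where
 "wbound nu p p1 p2 \<longleftrightarrow> Lb 2 p nu \<and> (\<forall>i. Lb 2 (p1 i) nu) \<and> (\<forall>i k. Lb 2 (p2 i k) nu)"

abbreviation (input) wdist where
 "wdist nu p p1 p2 q q1 q2 \<equiv> wbound nu (%x. p x - q x) (%i x. p1 i x - q1 i x) (%i k x. p2 i k x - q2 i k x)"

lemma wboundD:
 assumes "wbound nu p p1 p2"
 shows "Lb 2 p nu" "Lb 2 (p1 i) nu" "Lb 2 (p2 i k) nu" "0 <= nu"
 using assms unfolding wbound_def by (auto dest: LbD)

lemma wbound_mono: "wbound nu p p1 p2 ==> nu <= nu' ==> wbound nu' p p1 p2"
 unfolding wbound_def by (auto intro: Lb_mono)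

lemma Lb_le_cmult:
 assumes "Lb p f al" "g \<in> bmeas" "AE x in lborel. \<bar>g x\<bar> <= c * \<bar>f x\<bar>" "0 <= c"
 shows "Lb p g (c * al)"
 using Lb_dominated[OF Lb_cmult[OF assms(1), of c] assms(2)] assms(3,4) by (simp add: abs_mult)

lemma sqrt_add_diff_le: "0 <= a ==> 0 <= d ==> sqrt (a + d) - sqrt d <= sqrt a"
 using sqrt_add_le_add_sqrt[of a d] by simp

text \<open>The root of a is not smooth where a vanishes. Its regularization sqrt(a + h) - sqrt(h)
  still vanishes outside E and, by Glaeser's inequality, has a gradient bounded by K uniformly in h;
  Sobolev's inequality and Fatou's lemma finish. In the constant, 6 is Sobolev's and K + 1 comes
  from the product rule.\<close>

lemma wclass_weighted_6:
 fixes p :: "real^'n => real"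
 assumes c: "CARD('n) = 2 \<or> CARD('n) = 3" and W: "Weight K E a a1 a2" and p: "wclass E p p1 p2" and b: "wbound nu p p1 p2"
 shows "Lb 6 (%x. sqrt (a x) * p1 i x) (6 * (K + 1) * nu)"
proof (rule Lb_liminf)
 note a0 = WeightD(2)[OF W] note K = WeightD(1)[OF W] note nu = wboundD(4)[OF b]
 note [measurable] = MultD(1,2)[OF WeightD(6)[OF W]] MultD(1,2)[OF WeightD(7)[OF W]]
  LbD(1)[OF wboundD(1)[OF b]] LbD(1)[OF wboundD(2)[OF b]] LbD(1)[OF wboundD(3)[OF b]]
 define r where "r n x = sqrt (a x + step n) - sqrt (step n)" for n x
 define r' where "r' n k x = a1 k x / (2 * sqrt (a x + step n))" for n k x
 have [measurable]: "r n \<in> bmeas" "r' n k \<in> bmeas" for n k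
  unfolding r_def r'_def by measurable
 have r0: "0 <= r n x" "r n x <= 1" for n x
  using a0[of x] step_pos[of n] sqrt_add_diff_le[of "a x" "step n"] real_sqrt_le_1_iff[of "a x"] WeightD(3)[OF W, of x]
  by (auto simp: r_def intro: order_trans)
 have r'0: "\<bar>r' n k x\<bar> <= K" for n k x
 proof -
  have "\<bar>a1 k x\<bar> <= 2 * K * sqrt (a x)" by (rule Weight_gradient_bound[OF W])
  also have "... <= 2 * K * sqrt (a x + step n)" using K step_pos[of n] by (intro mult_left_mono) auto
  finally show ?thesis using a0[of x] step_pos[of n] by (simp add: r'_def field_simps)
 qed
 have M: "Mult K k (r n) (r' n k)" for n k
 proof (rule MultI)
  fix x
  show "((%t. r n (x + t *R axis k 1)) has_real_derivative r' n k x) (at 0)"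
   unfolding r_def r'_def using a0[of x] step_pos[of n]
   by (auto intro!: derivative_eq_intros WeightD(5)[OF W] simp: field_simps)
  show "\<bar>r n x\<bar> <= K" using r0[of n x] K by simp
  show "\<bar>r' n k x\<bar> <= K" by (rule r'0)
 qed measurable
 fix n
 show "Lb 6 (%x. r n x * p1 i x) (6 * (K + 1) * nu)"
  unfolding mult.assoc
 proof (rule sobolev_6[OF c])
  show "DQ k (%x. r n x * p1 i x) (%x. r' n k x * p1 i x + r n x * p2 i k x)" for k
   using WeightD(4)[OF W] by (intro wclassD(5)[OF p M]) (simp add: r_def)
  have 1: "Lb 2 (%x. r n x * q x) nu" if "Lb 2 q nu" for q
   using Lb_bounded_mult[OF that, of "r n" 1] r0 by simp
  have "nu <= (K + 1) * nu" using K nu mult_right_mono[of 1 "K + 1" nu] by simp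
  then show "Lb 2 (%x. r n x * p1 i x) ((K + 1) * nu)" using Lb_mono[OF 1[OF wboundD(2)[OF b]]] by blast
  have 2: "Lb 2 (%x. r' n k x * p1 i x) (K * nu)" for k
   using Lb_bounded_mult[OF wboundD(2)[OF b], of "r' n k" K] r'0 K by simp
  have "Lb 2 (%x. r' n k x * p1 i x + r n x * p2 i k x) (K * nu + nu)" for k
   by (intro Lb_add 1 2 wboundD(3)[OF b]) simp
  then show "Lb 2 (%x. r' n k x * p1 i x + r n x * p2 i k x) ((K + 1) * nu)" for k
   by (simp add: distrib_right)
 qed
 show "AE x in lborel. (%n. r n x * p1 i x) \<longlonglongrightarrow> sqrt (a x) * p1 i x"
 proof (intro AE_I2 tendsto_mult tendsto_const)
  fix x
  have "(%n. r n x) \<longlonglongrightarrow> sqrt (a x + 0) - sqrt 0"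
   unfolding r_def by (intro tendsto_intros step_tendsto)
  then show "(%n. r n x) \<longlonglongrightarrow> sqrt (a x)" by simp
 qed
next
 note [measurable] = MultD(1,2)[OF WeightD(6)[OF W]] LbD(1)[OF wboundD(2)[OF b]]
 show "(%x. sqrt (a x) * p1 i x) \<in> bmeas" by measurable
qed

text \<open>Here F is the first derivative of a potential, so the Lipschitz condition on F2 stands
  for a bound of the fourth derivative. F itself need not be bounded, which admits the linear
  derivative of a quadratic potential.\<close>

definition Pot :: "real => (real => real) => (real => real) => (real => real) => bool" where
 "Pot C F F1 F2 \<longleftrightarrow> F 0 = 0 \<and> (\<forall>r. (F has_real_derivative F1 r) (at r)) \<and> (\<forall>r. (F1 has_real_derivative F2 r) (at r)) \<and>
   (\<forall>r. \<bar>F1 r\<bar> <= C) \<and> (\<forall>r. \<bar>F2 r\<bar> <= C) \<and> (\<forall>r s. \<bar>F2 r - F2 s\<bar> <= C * \<bar>r - s\<bar>)"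

lemma PotD:
 assumes "Pot C F F1 F2"
 shows "F 0 = 0" "(F has_real_derivative F1 r) (at r)" "(F1 has_real_derivative F2 r) (at r)"
  "\<bar>F1 r\<bar> <= C" "\<bar>F2 r\<bar> <= C" "\<bar>F2 r - F2 s\<bar> <= C * \<bar>r - s\<bar>" "0 <= C"
  "\<bar>F1 r - F1 s\<bar> <= C * \<bar>r - s\<bar>" "\<bar>F r - F s\<bar> <= C * \<bar>r - s\<bar>"
proof -
 show *: "F 0 = 0" "(F has_real_derivative F1 r) (at r)" "(F1 has_real_derivative F2 r) (at r)"
  "\<bar>F1 r\<bar> <= C" "\<bar>F2 r\<bar> <= C" "\<bar>F2 r - F2 s\<bar> <= C * \<bar>r - s\<bar>" for r s
  using assms by (auto simp: Pot_def)
 show "0 <= C" using *(4)[of 0] by linarith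
 show "\<bar>F1 r - F1 s\<bar> <= C * \<bar>r - s\<bar>" "\<bar>F r - F s\<bar> <= C * \<bar>r - s\<bar>"
  using field_differentiable_bound[of UNIV F1 F2 C r s] field_differentiable_bound[of UNIV F F1 C r s] *
  by (auto intro: has_field_derivative_at_within)
qed

lemma Pot_measurable:
 assumes "Pot C F F1 F2"
 shows "F \<in> bmeas" "F1 \<in> bmeas" "F2 \<in> bmeas"
proof -
 have "continuous_on UNIV F" by (rule DERIV_continuous_on) (rule has_field_derivative_at_within[OF PotD(2)[OF assms]])
 then show "F \<in> bmeas" by (rule borel_measurable_continuous_onI)
 have "continuous_on UNIV F1" by (rule DERIV_continuous_on) (rule has_field_derivative_at_within[OF PotD(3)[OF assms]])
 then show "F1 \<in> bmeas" by (rule borel_measurable_continuous_onI)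
 have "C-lipschitz_on UNIV F2" using PotD(6,7)[OF assms] by (auto simp: lipschitz_on_def dist_real_def)
 then have "continuous_on UNIV F2" by (rule lipschitz_on_continuous_on)
 then show "F2 \<in> bmeas" by (rule borel_measurable_continuous_onI)
qed

section \<open>The weighted nonlinear expression and its derivatives\<close>

definition nlw0 where
 "nlw0 s F a p x = a x * F (s * p x)"

definition nlw1 where
 "nlw1 s F F1 a a1 p p1 i x = a1 i x * F (s * p x) + s * (F1 (s * p x) * (a x * p1 i x))"

text \<open>The grouping keeps \<open>a * p1 i\<close> together, the product that is differentiable
  on the whole space; its derivative in direction k is
  \<open>a1 k * p1 i + a * p2 i k\<close>.\<close>

definition nlw2 where
 "nlw2 s F F1 F2 a a1 a2 p p1 p2 i k x = a2 i k x * F (s * p x) + s * (a1 i x * (F1 (s * p x) * p1 k x))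
   + s * (F1 (s * p x) * (a1 k x * p1 i x + a x * p2 i k x)) + s^2 * (F2 (s * p x) * p1 k x * (a x * p1 i x))"

locale nonlinear_weighted =
 fixes C K s :: real and F F1 F2 :: "real => real" and E :: "(real^'n) set"
  and a :: "real^'n => real" and a1 :: "'n => real^'n => real" and a2 :: "'n => 'n => real^'n => real"
 assumes pot: "Pot C F F1 F2" and weight: "Weight K E a a1 a2" and s: "0 < s"
begin

abbreviation "nl0 \<equiv> nlw0 s F a"
abbreviation "nl1 \<equiv> nlw1 s F F1 a a1"
abbreviation "nl2 \<equiv> nlw2 s F F1 F2 a a1 a2"

lemma a_measurable[measurable]:
 "a \<in> bmeas" "a1 i \<in> bmeas" "a2 i k \<in> bmeas"
 using MultD(1,2)[OF WeightD(6)[OF weight]] MultD(2)[OF WeightD(7)[OF weight]] by auto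

lemma F_measurable[measurable]:
 "F \<in> bmeas" "F1 \<in> bmeas" "F2 \<in> bmeas"
 using Pot_measurable[OF pot] by auto

lemma DQ_F:
 assumes "DQ i p p'"
 shows "DQ i (%x. F (s * p x)) (%x. F1 (s * p x) * (s * p' x))"
 by (rule DQ_chain[OF DQ_cmult[OF assms] PotD(1,2,4,8)[OF pot]])

text \<open>Subtracting \<open>F1 0\<close>, in general nonzero, makes the composition square
  integrable over the whole space.\<close>

lemma DQ_F1:
 assumes "DQ i p p'"
 shows "DQ i (%x. F1 (s * p x) - F1 0) (%x. F2 (s * p x) * (s * p' x))"
proof (rule DQ_chain[OF DQ_cmult[OF assms], where F = "%r. F1 r - F1 0"])
 show "((%r. F1 r - F1 0) has_real_derivative F2 r) (at r)" for r
  using PotD(3)[OF pot] by (auto intro!: derivative_eq_intros)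
qed (use PotD(5,6)[OF pot] in auto)

lemma nl0_DQ:
 assumes p: "wclass E p p1 p2"
 shows "DQ i (nl0 p) (nl1 p p1 i)"
proof -
 have "DQ i (%x. a x * F (s * p x)) (%x. a1 i x * F (s * p x) + a x * (F1 (s * p x) * (s * p1 i x)))"
  by (rule DQ_mult[OF WeightD(6)[OF weight] DQ_F[OF wclassD(1)[OF p]]])
 then show ?thesis by (simp add: nlw0_def[abs_def] nlw1_def[abs_def] mult_ac)
qed

lemma weights_le: "\<bar>a x\<bar> <= 1" "\<bar>a1 i x\<bar> <= K" "\<bar>a2 i k x\<bar> <= K"
 using WeightD(2,3)[OF weight, of x] MultD(3,4)[OF WeightD(7)[OF weight], where x = x] by auto

lemma Lb_F_diff:
 assumes [measurable]: "b \<in> bmeas" "p \<in> bmeas" "q \<in> bmeas"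
  and B: "!!x. \<bar>b x\<bar> <= B" and w: "Lb 2 (%x. p x - q x) \<eta>"
 shows "Lb 2 (%x. b x * (F (s * p x) - F (s * q x))) (C * B * (s * \<eta>))"
proof -
 have B0: "0 <= B" using B[of 0] by (rule order_trans[OF abs_ge_zero])
 have "Lb 2 (%x. b x * (F (s * p x) - F (s * q x))) (B * (C * s) * \<eta>)"
 proof (rule Lb_le_cmult[OF w])
  have "\<bar>F (s * p x) - F (s * q x)\<bar> <= C * s * \<bar>p x - q x\<bar>" for x
   using PotD(9)[OF pot, of "s * p x" "s * q x"] s by (simp add: right_diff_distrib[symmetric] abs_mult mult.assoc)
  then show "AE x in lborel. \<bar>b x * (F (s * p x) - F (s * q x))\<bar> <= B * (C * s) * \<bar>p x - q x\<bar>"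
   unfolding abs_mult mult.assoc[of B] using B B0 by (intro AE_I2 mult_mono) auto
 qed (use B0 s PotD(7)[OF pot] in auto)
 then show ?thesis by (simp add: mult_ac)
qed

lemma Lb_F1:
 assumes [measurable]: "b \<in> bmeas" "p \<in> bmeas"
  and B: "!!x. \<bar>b x\<bar> <= B" and f: "Lb 2 f \<eta>"
 shows "Lb 2 (%x. s * (F1 (s * p x) * (b x * f x))) (C * B * (s * \<eta>))"
proof -
 note [measurable] = LbD(1)[OF f]
 have B0: "0 <= B" using B[of 0] by (rule order_trans[OF abs_ge_zero])
 have "Lb 2 (%x. s * (F1 (s * p x) * (b x * f x))) (s * C * B * \<eta>)"
 proof (rule Lb_le_cmult[OF f])
  show "AE x in lborel. \<bar>s * (F1 (s * p x) * (b x * f x))\<bar> <= s * C * B * \<bar>f x\<bar>"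
   unfolding abs_mult mult.assoc using B PotD(4,7)[OF pot] B0 s by (intro AE_I2 mult_mono) auto
 qed (use B0 s PotD(7)[OF pot] in auto)
 then show ?thesis by (simp add: mult_ac)
qed

lemma Lb_F2:
 assumes [measurable]: "f \<in> bmeas" "g \<in> bmeas" "q \<in> bmeas"
  and fg: "Lb 4 (%x. sqrt (a x) * f x) al" "Lb 4 (%x. sqrt (a x) * g x) be"
 shows "Lb 2 (%x. s\<^sup>2 * (F2 (s * q x) * (f x * (a x * g x)))) (s^2 * C * (al * be))"
proof (rule Lb_le_cmult[OF Lb_mult_44[OF fg]])
 note a01 = WeightD(2)[OF weight]
 show "AE x in lborel. \<bar>s\<^sup>2 * (F2 (s * q x) * (f x * (a x * g x)))\<bar> <= s^2 * C * \<bar>sqrt (a x) * f x * (sqrt (a x) * g x)\<bar>"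
 proof (rule AE_I2)
  fix x
  have "\<bar>s^2 * (F2 (s * q x) * (f x * (a x * g x)))\<bar> <= s^2 * (C * (\<bar>f x\<bar> * (\<bar>a x\<bar> * \<bar>g x\<bar>)))"
   unfolding abs_mult using PotD(5,7)[OF pot] by (intro mult_mono) auto
  also have "\<bar>a x\<bar> = sqrt (a x) * sqrt (a x)" using a01[of x] by simp
  finally show "\<bar>s^2 * (F2 (s * q x) * (f x * (a x * g x)))\<bar> <= s^2 * C * \<bar>sqrt (a x) * f x * (sqrt (a x) * g x)\<bar>"
   using a01[of x] by (simp only: abs_mult abs_of_nonneg[OF real_sqrt_ge_zero[OF a01]] mult_ac)
 qed
 show "0 <= s^2 * C" using PotD(7)[OF pot] by simp
qed measurable

text \<open>The factor F1(s p) is split into the constant \<open>F1 0\<close> and a remainder in L2.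
  The constant multiplies a function that has a derivative in L2; the remainder times
  \<open>a * p1 i\<close> is a product of two such functions and is differentiated weakly.\<close>

lemma nl1_weak:
 assumes p: "wclass E p p1 p2"
 shows "weak_dir UNIV (axis k 1) (nl1 p p1 i) (nl2 p p1 p2 i k)"
proof -
 note [measurable] = wclassD(2-4)[OF p, THEN sq_measurable]
 define q where "q x = a x * p1 i x" for x
 define q' where "q' x = a1 k x * p1 i x + a x * p2 i k x" for x
 have q: "DQ k q q'"
  unfolding q_def q'_def by (rule wclassD(5)[OF p WeightD(6)[OF weight] WeightD(4)[OF weight]])
 have A: "DQ k (%x. a1 i x * F (s * p x)) (%x. a2 i k x * F (s * p x) + a1 i x * (F1 (s * p x) * (s * p1 k x)))"
  by (rule DQ_mult[OF WeightD(7)[OF weight] DQ_F[OF wclassD(1)[OF p]]])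
 have B: "DQ k (%x. (s * F1 0) * q x) (%x. (s * F1 0) * q' x)" by (rule DQ_cmult[OF q])
 have 1: "DQ k (%x. s * (F1 (s * p x) - F1 0)) (%x. s * (F2 (s * p x) * (s * p1 k x)))"
  by (rule DQ_cmult[OF DQ_F1[OF wclassD(1)[OF p]]])
 have D: "weak_dir UNIV (axis k 1) (%x. s * (F1 (s * p x) - F1 0) * q x)
   (%x. s * (F2 (s * p x) * (s * p1 k x)) * q x + s * (F1 (s * p x) - F1 0) * q' x)"
  by (rule DQ_product_weak[OF 1 q])
 have AB: "DQ k (%x. a1 i x * F (s * p x) + (s * F1 0) * q x)
   (%x. (a2 i k x * F (s * p x) + a1 i x * (F1 (s * p x) * (s * p1 k x))) + (s * F1 0) * q' x)"
  by (rule DQ_add[OF A B])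
 have l: "loc_int UNIV (%x. s * (F1 (s * p x) - F1 0) * q x)"
  "loc_int UNIV (%x. s * (F2 (s * p x) * (s * p1 k x)) * q x + s * (F1 (s * p x) - F1 0) * q' x)"
  unfolding loc_int_def
  using DQ_sq[OF 1] DQ_sq[OF q]
  by (auto intro!: integrable_mult_indicator Bochner_Integration.integrable_add sq_mult_integrable
    simp: set_integrable_def borel_compact simp del: real_scaleR_def)
 have "weak_dir UNIV (axis k 1) (%x. (a1 i x * F (s * p x) + (s * F1 0) * q x) + s * (F1 (s * p x) - F1 0) * q x)
   (%x. ((a2 i k x * F (s * p x) + a1 i x * (F1 (s * p x) * (s * p1 k x))) + (s * F1 0) * q' x)
    + (s * (F2 (s * p x) * (s * p1 k x)) * q x + s * (F1 (s * p x) - F1 0) * q' x))"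
  by (rule weak_dir_add[OF DQ_weak_dir[OF AB] D sq_loc_int[OF DQ_sq(1)[OF AB]] sq_loc_int[OF DQ_sq(2)[OF AB]] l])
 moreover have "(a1 i x * F (s * p x) + (s * F1 0) * q x) + s * (F1 (s * p x) - F1 0) * q x = nl1 p p1 i x" for x
  by (simp add: nlw1_def q_def algebra_simps)
 moreover have "((a2 i k x * F (s * p x) + a1 i x * (F1 (s * p x) * (s * p1 k x))) + (s * F1 0) * q' x)
    + (s * (F2 (s * p x) * (s * p1 k x)) * q x + s * (F1 (s * p x) - F1 0) * q' x) = nl2 p p1 p2 i k x" for x
  by (simp add: nlw2_def q_def q'_def algebra_simps power2_eq_square)
 ultimately show ?thesis by (simp only:)
qed

section \<open>Differences of two nonlinear expressions\<close>

context
 fixes p p1 p2 q q1 q2 w w1 w2 nu nuw mu c1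
 assumes c: "CARD('n) = 2 \<or> CARD('n) = 3"
  and p: "wclass E p p1 p2" "wbound nu p p1 p2" and q: "wclass E q q1 q2" "wbound nu q q1 q2"
  and w_def: "w = (%x. p x - q x)" "w1 = (%i x. p1 i x - q1 i x)" "w2 = (%i k x. p2 i k x - q2 i k x)"
  and w: "wbound nuw w w1 w2" and mu: "Lb 6 w mu"
  and c1: "AE x in lborel. \<bar>a x * w x\<bar> <= c1 * nuw" "0 <= c1"
begin

lemma wc: "wclass E w w1 w2"
 unfolding w_def by (rule wclass_diff[OF p(1) q(1)])

lemma pq_measurable[measurable]:
 "p \<in> bmeas" "p1 i \<in> bmeas" "p2 i k \<in> bmeas"
 "q \<in> bmeas" "q1 i \<in> bmeas" "q2 i k \<in> bmeas"
 "w \<in> bmeas" "w1 i \<in> bmeas" "w2 i k \<in> bmeas"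
 using wclassD(2-4)[OF p(1), THEN sq_measurable] wclassD(2-4)[OF q(1), THEN sq_measurable]
  wclassD(2-4)[OF wc, THEN sq_measurable] by auto

definition k1 where "k1 = 6 * (K + 1)"

lemma bounds0: "0 <= C" "1 <= K" "0 <= nu" "0 <= nuw" "0 <= mu" "12 <= k1"
 using PotD(7)[OF pot] WeightD(1)[OF weight] wboundD(4)[OF p(2)] wboundD(4)[OF w] LbD(2)[OF mu]
 by (auto simp: k1_def)

lemma R6: "Lb 6 (%x. sqrt (a x) * p1 i x) (k1 * nu)" "Lb 6 (%x. sqrt (a x) * q1 i x) (k1 * nu)"
 "Lb 6 (%x. sqrt (a x) * w1 i x) (k1 * nuw)"
 unfolding k1_def
 by (rule wclass_weighted_6[OF c weight p] wclass_weighted_6[OF c weight q] wclass_weighted_6[OF c weight wc w])+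

lemma R2: assumes "Lb 2 f al" shows "Lb 2 (%x. sqrt (a x) * f x) (k1 * al)"
proof -
 have "Lb 2 (%x. sqrt (a x) * f x) (\<bar>1\<bar> * al)"
  by (rule Lb_bounded_mult[OF assms]) (use WeightD(2,3)[OF weight] in auto)
 then show ?thesis
  by (rule Lb_mono) (use bounds0 LbD(2)[OF assms] mult_right_mono[of 1 k1 al] in auto)
qed

lemma R4: "Lb 4 (%x. sqrt (a x) * p1 i x) (k1 * nu)" "Lb 4 (%x. sqrt (a x) * q1 i x) (k1 * nu)"
 "Lb 4 (%x. sqrt (a x) * w1 i x) (k1 * nuw)"
 using R6 R2[OF wboundD(2)[OF p(2)]] R2[OF wboundD(2)[OF q(2)]] R2[OF wboundD(2)[OF w]] by (auto intro!: Lb_4_interp)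

lemma w4: "Lb 4 w (6 * nuw)"
proof (rule Lb_4_interp)
 show "Lb 6 w (6 * nuw)" by (rule sobolev_6[OF c wclassD(1)[OF wc] wboundD(1,2)[OF w]])
 show "Lb 2 w (6 * nuw)" by (rule Lb_mono[OF wboundD(1)[OF w]]) (use bounds0 in simp)
qed

lemma Fdiff: "\<bar>F (s * p x) - F (s * q x)\<bar> <= C * s * \<bar>w x\<bar>"
 "\<bar>F1 (s * p x) - F1 (s * q x)\<bar> <= C * s * \<bar>w x\<bar>" "\<bar>F2 (s * p x) - F2 (s * q x)\<bar> <= C * s * \<bar>w x\<bar>"
proof -
 have e: "\<bar>s * p x - s * q x\<bar> = s * \<bar>w x\<bar>"
  using s by (simp add: w_def right_diff_distrib[symmetric] abs_mult)
 show "\<bar>F (s * p x) - F (s * q x)\<bar> <= C * s * \<bar>w x\<bar>"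
  "\<bar>F1 (s * p x) - F1 (s * q x)\<bar> <= C * s * \<bar>w x\<bar>" "\<bar>F2 (s * p x) - F2 (s * q x)\<bar> <= C * s * \<bar>w x\<bar>"
  using PotD(9)[OF pot, of "s * p x" "s * q x"] PotD(8)[OF pot, of "s * p x" "s * q x"] PotD(6)[OF pot, of "s * p x" "s * q x"]
  unfolding e by (simp_all add: mult.assoc)
qed

lemma a_le_sqrt: "a x <= sqrt (a x)" "a x = sqrt (a x) * sqrt (a x)"
 using WeightD(2,3)[OF weight, of x] real_le_rsqrt[of "a x" "a x"] mult_left_le_one_le[of "a x" "a x"]
 by (auto simp: power2_eq_square)

text \<open>The cubic term carries \<open>mu\<close>, the L6 bound of w, in place of
  \<open>nuw\<close>; a factor gained for the L6 norm of a difference thus survives in the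
  estimate.\<close>

definition diffbound :: real where
 "diffbound = C * (3 * K + 1 + 24 * K * k1 + c1 + 3 * k1^2) * ((s + s^2) * (1 + nu) * nuw + s ^ 3 * nu^2 * mu)"

text \<open>The terms produced by changing one factor at a time, with four kinds of bounds: a
  bounded factor times L2; two functions in L4; the supremum of a w against the second derivative of
  q, which is only in L2; and three functions in L6 for the difference of F2. In the products of
  type L4 and L6 each first derivative of p, q or w receives a root of the weight.\<close>

lemma pieces:
 "Lb 2 (%x. a x * (F (s * p x) - F (s * q x))) (C * (s * nuw))"
 "Lb 2 (%x. a1 i x * (F (s * p x) - F (s * q x))) (C * K * (s * nuw))"
 "Lb 2 (%x. a2 i k x * (F (s * p x) - F (s * q x))) (C * K * (s * nuw))"
 "Lb 2 (%x. s * (F1 (s * p x) * (a x * w1 i x))) (C * (s * nuw))"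
 "Lb 2 (%x. s * ((F1 (s * p x) - F1 (s * q x)) * (a x * q1 i x))) (C * 6 * k1 * (s^2 * nu * nuw))"
 "Lb 2 (%x. s * (a1 i x * (F1 (s * p x) * w1 k x))) (C * K * (s * nuw))"
 "Lb 2 (%x. s * ((F1 (s * p x) - F1 (s * q x)) * (a1 i x * q1 k x))) (C * 12 * K * k1 * (s^2 * nu * nuw))"
 "Lb 2 (%x. s * (F1 (s * p x) * (a x * w2 i k x))) (C * (s * nuw))"
 "Lb 2 (%x. s * ((F1 (s * p x) - F1 (s * q x)) * (a x * q2 i k x))) (C * c1 * (s^2 * nu * nuw))"
 "Lb 2 (%x. s\<^sup>2 * ((F2 (s * p x) - F2 (s * q x)) * (p1 k x * (a x * p1 i x)))) (C * k1^2 * (s ^ 3 * nu^2 * mu))"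
 "Lb 2 (%x. s\<^sup>2 * (F2 (s * q x) * (w1 k x * (a x * p1 i x)))) (C * k1^2 * (s^2 * nu * nuw))"
 "Lb 2 (%x. s\<^sup>2 * (F2 (s * q x) * (q1 k x * (a x * w1 i x)))) (C * k1^2 * (s^2 * nu * nuw))"
proof -
 note cs = bounds0 s
 note a01 = WeightD(2,3)[OF weight]
 show "Lb 2 (%x. a x * (F (s * p x) - F (s * q x))) (C * (s * nuw))"
  using Lb_F_diff[of a p q 1 nuw] weights_le wboundD(1)[OF w] by (simp add: w_def(1))
 show "Lb 2 (%x. a1 i x * (F (s * p x) - F (s * q x))) (C * K * (s * nuw))"
  using Lb_F_diff[of "a1 i" p q K nuw] weights_le wboundD(1)[OF w] by (simp add: w_def(1))
 show "Lb 2 (%x. a2 i k x * (F (s * p x) - F (s * q x))) (C * K * (s * nuw))"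
  using Lb_F_diff[of "a2 i k" p q K nuw] weights_le wboundD(1)[OF w] by (simp add: w_def(1))
 show "Lb 2 (%x. s * (F1 (s * p x) * (a x * w1 i x))) (C * (s * nuw))"
  using Lb_F1[of a p 1 "w1 i" nuw] weights_le wboundD(2)[OF w] by (simp add: mult_ac)
 show "Lb 2 (%x. s * (a1 i x * (F1 (s * p x) * w1 k x))) (C * K * (s * nuw))"
  using Lb_F1[of "a1 i" p K "w1 k" nuw] weights_le wboundD(2)[OF w] by (simp add: mult_ac)
 show "Lb 2 (%x. s * (F1 (s * p x) * (a x * w2 i k x))) (C * (s * nuw))"
  using Lb_F1[of a p 1 "w2 i k" nuw] weights_le wboundD(3)[OF w] by (simp add: mult_ac)
 \<comment> \<open>Covers both b = a, where a <= sqrt a, and b = a1, where Glaeser's inequality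
   bounds |a1| by 2 K sqrt a.\<close>
 have base2: "Lb 2 (%x. s * ((F1 (s * p x) - F1 (s * q x)) * (b x * q1 i x))) (C * s^2 * B * ((6 * nuw) * (k1 * nu)))"
  if [measurable]: "b \<in> bmeas" and B: "!!x. \<bar>b x\<bar> <= B * sqrt (a x)" and B0: "0 <= B" for b B i
 proof (rule Lb_le_cmult[OF Lb_mult_44[OF w4 R4(2)[of i]]])
  show "AE x in lborel. \<bar>s * ((F1 (s * p x) - F1 (s * q x)) * (b x * q1 i x))\<bar> <= C * s^2 * B * \<bar>w x * (sqrt (a x) * q1 i x)\<bar>"
  proof (rule AE_I2)
   fix x
   have "\<bar>s * ((F1 (s * p x) - F1 (s * q x)) * (b x * q1 i x))\<bar> <= s * ((C * s * \<bar>w x\<bar>) * ((B * sqrt (a x)) * \<bar>q1 i x\<bar>))"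
    unfolding abs_mult using B[of x] Fdiff(2)[of x] cs a01(1)[of x] B0 by (intro mult_mono) auto
   then show "\<bar>s * ((F1 (s * p x) - F1 (s * q x)) * (b x * q1 i x))\<bar> <= C * s^2 * B * \<bar>w x * (sqrt (a x) * q1 i x)\<bar>"
    using a01(1)[of x] by (simp add: abs_mult power2_eq_square mult_ac)
  qed
  show "0 <= C * s^2 * B" using B0 cs by simp
 qed measurable
 show "Lb 2 (%x. s * ((F1 (s * p x) - F1 (s * q x)) * (a x * q1 i x))) (C * 6 * k1 * (s^2 * nu * nuw))"
  using base2[of a 1 i] a_le_sqrt(1) a01(1) by (simp add: mult_ac)
 show "Lb 2 (%x. s * ((F1 (s * p x) - F1 (s * q x)) * (a1 i x * q1 k x))) (C * 12 * K * k1 * (s^2 * nu * nuw))"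
  using base2[of "a1 i" "2 * K" k] Weight_gradient_bound[OF weight] cs by (simp add: mult_ac)
 have "Lb 2 (%x. s * ((F1 (s * p x) - F1 (s * q x)) * (a x * q2 i k x))) ((C * s^2 * (c1 * nuw)) * nu)"
 proof (rule Lb_le_cmult[OF wboundD(3)[OF q(2), of i k]])
  show "AE x in lborel. \<bar>s * ((F1 (s * p x) - F1 (s * q x)) * (a x * q2 i k x))\<bar> <= (C * s^2 * (c1 * nuw)) * \<bar>q2 i k x\<bar>"
   using c1(1)
  proof eventually_elim
   case (elim x)
   have "\<bar>s * ((F1 (s * p x) - F1 (s * q x)) * (a x * q2 i k x))\<bar> <= s * ((C * s * \<bar>w x\<bar>) * (\<bar>a x\<bar> * \<bar>q2 i k x\<bar>))"
    unfolding abs_mult using Fdiff(2)[of x] cs by (intro mult_mono) auto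
   also have "... = C * s^2 * \<bar>a x * w x\<bar> * \<bar>q2 i k x\<bar>" by (simp add: abs_mult power2_eq_square mult_ac)
   also have "... <= C * s^2 * (c1 * nuw) * \<bar>q2 i k x\<bar>"
    using elim cs by (intro mult_right_mono mult_left_mono) auto
   finally show ?case .
  qed
  show "0 <= C * s^2 * (c1 * nuw)" using cs c1 by simp
 qed measurable
 then show "Lb 2 (%x. s * ((F1 (s * p x) - F1 (s * q x)) * (a x * q2 i k x))) (C * c1 * (s^2 * nu * nuw))"
  by (simp add: mult_ac)
 have "Lb 2 (%x. s\<^sup>2 * ((F2 (s * p x) - F2 (s * q x)) * (p1 k x * (a x * p1 i x)))) ((C * s ^ 3) * (mu * (k1 * nu) * (k1 * nu)))"
 proof (rule Lb_le_cmult[OF Lb_mult_666[OF mu R6(1)[of k] R6(1)[of i]]])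
  show "AE x in lborel. \<bar>s\<^sup>2 * ((F2 (s * p x) - F2 (s * q x)) * (p1 k x * (a x * p1 i x)))\<bar>
    <= C * s ^ 3 * \<bar>w x * (sqrt (a x) * p1 k x) * (sqrt (a x) * p1 i x)\<bar>"
  proof (rule AE_I2)
   fix x
   have "\<bar>s^2 * ((F2 (s * p x) - F2 (s * q x)) * (p1 k x * (a x * p1 i x)))\<bar>
     <= s^2 * ((C * s * \<bar>w x\<bar>) * (\<bar>p1 k x\<bar> * (\<bar>a x\<bar> * \<bar>p1 i x\<bar>)))"
    unfolding abs_mult using Fdiff(3)[of x] cs by (intro mult_mono) auto
   also have "\<bar>a x\<bar> = sqrt (a x) * sqrt (a x)" using a01(1)[of x] by simp
   finally show "\<bar>s^2 * ((F2 (s * p x) - F2 (s * q x)) * (p1 k x * (a x * p1 i x)))\<bar>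
    <= C * s ^ 3 * \<bar>w x * (sqrt (a x) * p1 k x) * (sqrt (a x) * p1 i x)\<bar>"
    using a01(1)[of x] by (simp only: abs_mult abs_of_nonneg[OF real_sqrt_ge_zero[OF a01(1)]] power2_eq_square power3_eq_cube mult_ac)
  qed
  show "0 <= C * s ^ 3" using cs by simp
 qed measurable
 then show "Lb 2 (%x. s\<^sup>2 * ((F2 (s * p x) - F2 (s * q x)) * (p1 k x * (a x * p1 i x)))) (C * k1^2 * (s ^ 3 * nu^2 * mu))"
  by (simp add: mult_ac power2_eq_square)
 show "Lb 2 (%x. s\<^sup>2 * (F2 (s * q x) * (w1 k x * (a x * p1 i x)))) (C * k1^2 * (s^2 * nu * nuw))"
  using Lb_F2[OF _ _ _ R4(3)[of k] R4(1)[of i]] by (simp add: mult_ac power2_eq_square)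
 show "Lb 2 (%x. s\<^sup>2 * (F2 (s * q x) * (q1 k x * (a x * w1 i x)))) (C * k1^2 * (s^2 * nu * nuw))"
  using Lb_F2[OF _ _ _ R4(2)[of k] R4(3)[of i]] by (simp add: mult_ac power2_eq_square)
qed

lemma diffbound_ge:
 assumes "0 <= A" "0 <= B" "0 <= D" "A <= 3 * K + 1" "B <= 24 * K * k1 + c1 + 2 * k1^2" "D <= k1^2"
 shows "C * A * (s * nuw) + C * B * (s^2 * nu * nuw) + C * D * (s ^ 3 * nu^2 * mu) <= diffbound"
proof -
 define X where "X = (s + s^2) * (1 + nu) * nuw"
 define Y where "Y = s ^ 3 * nu^2 * mu"
 note cs = bounds0 s
 have X: "s * nuw <= X" "s^2 * nu * nuw <= X" "0 <= X" "0 <= Y"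
 proof -
  have "X = s * nuw + (s * nu * nuw + s^2 * nuw + s^2 * nu * nuw)" by (simp add: X_def algebra_simps)
  moreover have "0 <= s * nuw" "0 <= s * nu * nuw" "0 <= s^2 * nuw" "0 <= s^2 * nu * nuw" using cs by auto
  ultimately show "s * nuw <= X" "s^2 * nu * nuw <= X" "0 <= X" by linarith+
  show "0 <= Y" using cs by (simp add: Y_def)
 qed
 have "C * A * (s * nuw) + C * B * (s^2 * nu * nuw) + C * D * Y <= C * A * X + C * B * X + C * D * Y"
  using X cs assms by (intro add_mono mult_left_mono) auto
 also have "... = C * ((A + B) * X + D * Y)" by (simp add: algebra_simps)
 also have "... <= C * ((3 * K + 1 + 24 * K * k1 + c1 + 3 * k1^2) * X + (3 * K + 1 + 24 * K * k1 + c1 + 3 * k1^2) * Y)"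
 proof -
  have "0 <= K * k1" "0 <= k1^2" using cs by auto
  then have "A + B <= 3 * K + 1 + 24 * K * k1 + c1 + 3 * k1^2" "D <= 3 * K + 1 + 24 * K * k1 + c1 + 3 * k1^2"
   using assms c1(2) cs by (simp_all add: mult.assoc)
  from add_mono[OF mult_right_mono[OF this(1) X(3)] mult_right_mono[OF this(2) X(4)]]
  show ?thesis using cs(1) by (rule mult_left_mono)
 qed
 also have "... = diffbound" unfolding diffbound_def X_def Y_def by (simp add: algebra_simps)
 finally show ?thesis unfolding Y_def .
qed

lemma nl0_diff: "Lb 2 (%x. nl0 p x - nl0 q x) diffbound"
proof (rule Lb_mono)
 show "Lb 2 (%x. nl0 p x - nl0 q x) (C * (s * nuw))"
  using pieces(1) by (simp add: nlw0_def right_diff_distrib)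
 show "C * (s * nuw) <= diffbound"
  using diffbound_ge[of 1 0 0] bounds0 c1(2) by simp
qed

lemma nl1_diff: "Lb 2 (%x. nl1 p p1 i x - nl1 q q1 i x) diffbound"
proof (rule Lb_mono)
 have "Lb 2 (%x. a1 i x * (F (s * p x) - F (s * q x)) + s * (F1 (s * p x) * (a x * w1 i x))
   + s * ((F1 (s * p x) - F1 (s * q x)) * (a x * q1 i x)))
   (C * K * (s * nuw) + C * (s * nuw) + C * 6 * k1 * (s^2 * nu * nuw))"
  by (intro Lb_add pieces) auto
 moreover have "a1 i x * (F (s * p x) - F (s * q x)) + s * (F1 (s * p x) * (a x * w1 i x))
   + s * ((F1 (s * p x) - F1 (s * q x)) * (a x * q1 i x)) = nl1 p p1 i x - nl1 q q1 i x" for x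
  by (simp add: nlw1_def w_def algebra_simps)
 ultimately show "Lb 2 (%x. nl1 p p1 i x - nl1 q q1 i x) (C * K * (s * nuw) + C * (s * nuw) + C * 6 * k1 * (s^2 * nu * nuw))"
  by (simp only:)
 have "6 * k1 <= 24 * K * k1" using bounds0 by (intro mult_right_mono) auto
 then have "6 * k1 <= 24 * K * k1 + c1 + 2 * k1^2" using c1(2) by (simp add: add_increasing2)
 then show "C * K * (s * nuw) + C * (s * nuw) + C * 6 * k1 * (s^2 * nu * nuw) <= diffbound"
  using diffbound_ge[of "K + 1" "6 * k1" 0] bounds0 by (simp add: algebra_simps)
qed

lemma nl2_diff: "Lb 2 (%x. nl2 p p1 p2 i k x - nl2 q q1 q2 i k x) diffbound"
proof (rule Lb_mono)
 let ?A = "C * K * (s * nuw) + C * K * (s * nuw) + C * 12 * K * k1 * (s^2 * nu * nuw) + C * K * (s * nuw) + C * (s * nuw)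
   + C * 12 * K * k1 * (s^2 * nu * nuw) + C * c1 * (s^2 * nu * nuw) + C * k1^2 * (s ^ 3 * nu^2 * mu)
   + C * k1^2 * (s^2 * nu * nuw) + C * k1^2 * (s^2 * nu * nuw)"
 have 4: "Lb 2 (%x. s * (F1 (s * p x) * (a1 k x * w1 i x))) (C * K * (s * nuw))"
  using pieces(6)[of k i] by (simp add: mult.left_commute)
 have "Lb 2 (%x. a2 i k x * (F (s * p x) - F (s * q x)) + s * (a1 i x * (F1 (s * p x) * w1 k x))
   + s * ((F1 (s * p x) - F1 (s * q x)) * (a1 i x * q1 k x))
   + s * (F1 (s * p x) * (a1 k x * w1 i x)) + s * (F1 (s * p x) * (a x * w2 i k x))
   + s * ((F1 (s * p x) - F1 (s * q x)) * (a1 k x * q1 i x)) + s * ((F1 (s * p x) - F1 (s * q x)) * (a x * q2 i k x))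
   + s^2 * ((F2 (s * p x) - F2 (s * q x)) * (p1 k x * (a x * p1 i x)))
   + s^2 * (F2 (s * q x) * (w1 k x * (a x * p1 i x))) + s^2 * (F2 (s * q x) * (q1 k x * (a x * w1 i x)))) ?A"
  by (intro Lb_add pieces 4) auto
 moreover have "a2 i k x * (F (s * p x) - F (s * q x)) + s * (a1 i x * (F1 (s * p x) * w1 k x))
   + s * ((F1 (s * p x) - F1 (s * q x)) * (a1 i x * q1 k x))
   + s * (F1 (s * p x) * (a1 k x * w1 i x)) + s * (F1 (s * p x) * (a x * w2 i k x))
   + s * ((F1 (s * p x) - F1 (s * q x)) * (a1 k x * q1 i x)) + s * ((F1 (s * p x) - F1 (s * q x)) * (a x * q2 i k x))
   + s^2 * ((F2 (s * p x) - F2 (s * q x)) * (p1 k x * (a x * p1 i x)))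
   + s^2 * (F2 (s * q x) * (w1 k x * (a x * p1 i x))) + s^2 * (F2 (s * q x) * (q1 k x * (a x * w1 i x)))
   = nl2 p p1 p2 i k x - nl2 q q1 q2 i k x" for x
  by (simp add: nlw2_def w_def algebra_simps)
 ultimately show "Lb 2 (%x. nl2 p p1 p2 i k x - nl2 q q1 q2 i k x) ?A"
  by (simp only:)
 have "?A = C * (3 * K + 1) * (s * nuw) + C * (24 * K * k1 + c1 + 2 * k1^2) * (s^2 * nu * nuw) + C * k1^2 * (s ^ 3 * nu^2 * mu)"
  by (simp add: algebra_simps)
 also have "... <= diffbound"
  using bounds0 c1(2) by (intro diffbound_ge) auto
 finally show "?A <= diffbound" .
qed

end

section \<open>A single nonlinear expression\<close>

context
 fixes p p1 p2 nu
 assumes c: "CARD('n) = 2 \<or> CARD('n) = 3" and p: "wclass E p p1 p2" "wbound nu p p1 p2"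
begin

definition singlebound :: real where
 "singlebound = C * (3 * K + 1 + (6 * (K + 1))^2) * ((s + s^2) * (nu + nu^2))"

lemma nl_single:
 "Lb 2 (nl0 p) singlebound" "Lb 2 (nl1 p p1 i) singlebound" "Lb 2 (nl2 p p1 p2 i k) singlebound"
proof -
 define k1 where "k1 = 6 * (K + 1)"
 have cs: "0 <= C" "1 <= K" "0 <= nu" "12 <= k1" "0 < s"
  using PotD(7)[OF pot] WeightD(1)[OF weight] wboundD(4)[OF p(2)] s by (auto simp: k1_def)
 note [measurable] = wclassD(2-4)[OF p(1), THEN sq_measurable] and pm = wclassD(2)[OF p(1), THEN sq_measurable]
 note a01 = WeightD(2,3)[OF weight]
 note aK = weights_le
 \<comment> \<open>As F vanishes at 0, the difference estimate is applied against the zero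
   function.\<close>
 have b0: "Lb 2 (%x. b x * F (s * p x)) (C * B * (s * nu))" if "b \<in> bmeas" "!!x. \<bar>b x\<bar> <= B" for b B
  using Lb_F_diff[of b p "%_. 0" B nu] that wboundD(1)[OF p(2)] PotD(1)[OF pot] by simp
 note b1 = Lb_F1[OF _ pm]
 have R4: "Lb 4 (%x. sqrt (a x) * p1 i x) (k1 * nu)" for i
 proof (rule Lb_4_interp)
  show "Lb 6 (%x. sqrt (a x) * p1 i x) (k1 * nu)" unfolding k1_def by (rule wclass_weighted_6[OF c weight p])
  have "Lb 2 (%x. sqrt (a x) * p1 i x) (\<bar>1\<bar> * nu)"
   by (rule Lb_bounded_mult[OF wboundD(2)[OF p(2)]]) (use a01 in auto)
  then show "Lb 2 (%x. sqrt (a x) * p1 i x) (k1 * nu)"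
   by (rule Lb_mono) (use cs mult_right_mono[of 1 k1 nu] in auto)
 qed
 have b2: "Lb 2 (%x. s\<^sup>2 * (F2 (s * p x) * p1 k x * (a x * p1 i x))) (C * k1^2 * (s^2 * nu^2))" for i k
  using Lb_F2[OF _ _ pm R4[of k] R4[of i]] by (simp add: mult_ac power2_eq_square)
 have ge: "C * A * (s * nu) + C * B * (s^2 * nu^2) <= singlebound"
  if "0 <= A" "0 <= B" "A <= 3 * K + 1" "B <= k1^2" for A B
 proof -
  define X where "X = (s + s^2) * (nu + nu^2)"
  have "X = s * nu + (s * nu^2 + s^2 * nu + s^2 * nu^2)" by (simp add: X_def algebra_simps)
  moreover have "0 <= s * nu" "0 <= s * nu^2" "0 <= s^2 * nu" "0 <= s^2 * nu^2" using cs by auto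
  ultimately have X: "s * nu <= X" "s^2 * nu^2 <= X" "0 <= X" by linarith+
  have "C * A * (s * nu) + C * B * (s^2 * nu^2) <= C * A * X + C * B * X"
   using X cs that by (intro add_mono mult_left_mono) auto
  also have "... = C * (A + B) * X" by (simp add: algebra_simps)
  also have "... <= C * (3 * K + 1 + k1^2) * X"
   using X cs that by (intro mult_right_mono mult_left_mono) auto
  finally show ?thesis unfolding singlebound_def X_def k1_def .
 qed
 show "Lb 2 (nl0 p) singlebound"
  using Lb_mono[OF b0[of a 1]] ge[of 1 0] aK cs by (simp add: nlw0_def[abs_def])
 have "Lb 2 (nl1 p p1 i) (C * K * (s * nu) + C * 1 * (s * nu))"
  unfolding nlw1_def[abs_def] by (intro Lb_add b0 b1 aK wboundD(2)[OF p(2)]) auto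
 then show "Lb 2 (nl1 p p1 i) singlebound"
  by (rule Lb_mono) (use ge[of "K + 1" 0] cs in \<open>simp add: algebra_simps\<close>)
 have e: "nl2 p p1 p2 i k = (%x. a2 i k x * F (s * p x) + s * (F1 (s * p x) * (a1 i x * p1 k x))
   + s * (F1 (s * p x) * (a1 k x * p1 i x)) + s * (F1 (s * p x) * (a x * p2 i k x)) + s^2 * (F2 (s * p x) * p1 k x * (a x * p1 i x)))"
  by (simp add: nlw2_def[abs_def] algebra_simps fun_eq_iff)
 have "Lb 2 (nl2 p p1 p2 i k) (C * K * (s * nu) + C * K * (s * nu) + C * K * (s * nu) + C * 1 * (s * nu) + C * k1^2 * (s^2 * nu^2))"
  unfolding e by (intro Lb_add b0 b1 b2 aK wboundD[OF p(2)]) auto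
 then show "Lb 2 (nl2 p p1 p2 i k) singlebound"
  by (rule Lb_mono) (use ge[of "3 * K + 1" "k1^2"] cs in \<open>simp add: algebra_simps\<close>)
qed

end

end

text \<open>Morrey's inequality for a p, whose gradient a1 p + a p1 lies in L4: p by Sobolev and
  interpolation, and a p1 because a <= sqrt a. The factor a is essential, as near the boundary of E
  nothing better than L2 is known for p1. The constant 19 comes from 7 + 12 K <= 19 K.\<close>

lemma weighted_sup:
 assumes c: "CARD('n) = 2 \<or> CARD('n) = 3"
 obtains M where "0 <= M" "!!K E a a1 a2 (p::real^'n => real) p1 p2 nu. Weight K E a a1 a2 ==> wclass E p p1 p2 ==>
   wbound nu p p1 p2 ==> AE x in lborel. \<bar>a x * p x\<bar> <= (M * K) * nu"
proof -
 have "CARD('n) <= 3" using c by auto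
 from sup_bound[OF this] obtain B where B: "B >= 0"
  "!!(q::real^'n => real) q' al be. (!!i. DQ i q (q' i)) ==> Lb 2 q al ==> (!!i. Lb 4 (q' i) be)
   ==> AE x in lborel. \<bar>q x\<bar> <= B * (al + be)" by blast
 show thesis
 proof (rule that[of "B * 19"])
  show "0 <= B * 19" using B by simp
  fix K E a a1 a2 and p :: "real^'n => real" and p1 p2 nu
  assume W: "Weight K E a a1 a2" and p: "wclass E p p1 p2" and b: "wbound nu p p1 p2"
  note K = WeightD(1)[OF W] note nu = wboundD(4)[OF b] note a01 = WeightD(2,3)[OF W]
  note [measurable] = MultD(1,2)[OF WeightD(6)[OF W]] wclassD(2,3)[OF p, THEN sq_measurable]
  have "DQ i (%x. a x * p x) (%x. a1 i x * p x + a x * p1 i x)" for i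
   by (rule DQ_mult[OF WeightD(6)[OF W] wclassD(1)[OF p]])
  moreover have "Lb 2 (%x. a x * p x) (\<bar>1\<bar> * nu)"
   by (rule Lb_bounded_mult[OF wboundD(1)[OF b]]) (use a01 in auto)
  moreover have "Lb 4 (%x. a1 i x * p x + a x * p1 i x) (K * (6 * nu) + 6 * (K + 1) * nu)" for i
  proof (rule Lb_add)
   have p4: "Lb 4 p (6 * nu)"
    by (rule Lb_4_interp[OF Lb_mono[OF wboundD(1)[OF b]] sobolev_6[OF c wclassD(1)[OF p] wboundD(1,2)[OF b]]]) (use nu in simp)
   show "Lb 4 (%x. a1 i x * p x) (K * (6 * nu))"
    using Lb_bounded_mult[OF p4, of "a1 i" K] MultD(4)[OF WeightD(6)[OF W]] K by simp
   have r4: "Lb 4 (%x. sqrt (a x) * p1 i x) (6 * (K + 1) * nu)"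
   proof (rule Lb_4_interp[OF _ wclass_weighted_6[OF c W p b]])
    have "Lb 2 (%x. sqrt (a x) * p1 i x) (\<bar>1\<bar> * nu)"
     by (rule Lb_bounded_mult[OF wboundD(2)[OF b]]) (use a01 in auto)
    moreover have "nu <= 6 * (K + 1) * nu" using mult_right_mono[of 1 "6 * (K + 1)" nu] K nu by simp
    ultimately show "Lb 2 (%x. sqrt (a x) * p1 i x) (6 * (K + 1) * nu)" by (simp add: Lb_mono)
   qed
   show "Lb 4 (%x. a x * p1 i x) (6 * (K + 1) * nu)"
   proof (rule Lb_dominated[OF r4])
    have "a x <= sqrt (a x)" for x
     using a01[of x] real_le_rsqrt[of "a x" "a x"] mult_left_le_one_le[of "a x" "a x"] by (auto simp: power2_eq_square)
    then show "AE x in lborel. \<bar>a x * p1 i x\<bar> <= \<bar>sqrt (a x) * p1 i x\<bar>"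
     using a01 by (intro AE_I2) (auto simp: abs_mult intro!: mult_right_mono)
   qed measurable
  qed simp
  ultimately have "AE x in lborel. \<bar>a x * p x\<bar> <= B * (\<bar>1\<bar> * nu + (K * (6 * nu) + 6 * (K + 1) * nu))" by (rule B(2))
  moreover have "B * (\<bar>1\<bar> * nu + (K * (6 * nu) + 6 * (K + 1) * nu)) <= (B * 19 * K) * nu"
  proof -
   have "\<bar>1\<bar> * nu + (K * (6 * nu) + 6 * (K + 1) * nu) = (7 + 12 * K) * nu" by (simp add: algebra_simps)
   also have "... <= (19 * K) * nu" using K nu by (intro mult_right_mono) auto
   finally show ?thesis using B(1) by (simp add: mult.assoc mult_left_mono)
  qed
  ultimately show "AE x in lborel. \<bar>a x * p x\<bar> <= (B * 19 * K) * nu"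
   by (auto elim: eventually_mono)
 qed
qed

text \<open>The constant depends only on C, K and the dimension. Uniformity in s, in the weight and
  in E is what allows the estimates to be used for every z with s = |z|^(-1/2) and a weight
  depending on z.\<close>

lemma nonlinear_estimates:
 fixes C K :: real
 assumes c: "CARD('n) = 2 \<or> CARD('n) = 3" and C: "0 <= C" and K: "1 <= K"
 obtains L where "0 <= L"
  "!!s F F1 F2 E a a1 a2 (p::real^'n => real) p1 p2 nu.
    Pot C F F1 F2 ==> Weight K E a a1 a2 ==> 0 < s ==> wclass E p p1 p2 ==> wbound nu p p1 p2 ==>
    wbound (L * ((s + s^2) * (nu + nu^2))) (nlw0 s F a p) (nlw1 s F F1 a a1 p p1) (nlw2 s F F1 F2 a a1 a2 p p1 p2)"
  "!!s F F1 F2 E a a1 a2 (p::real^'n => real) p1 p2 q q1 q2 nu nuw mu.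
    Pot C F F1 F2 ==> Weight K E a a1 a2 ==> 0 < s ==> wclass E p p1 p2 ==> wbound nu p p1 p2 ==>
    wclass E q q1 q2 ==> wbound nu q q1 q2 ==> wdist nuw p p1 p2 q q1 q2 ==> Lb 6 (%x. p x - q x) mu ==>
    wdist (L * ((s + s^2) * (1 + nu) * nuw + s ^ 3 * nu^2 * mu))
     (nlw0 s F a p) (nlw1 s F F1 a a1 p p1) (nlw2 s F F1 F2 a a1 a2 p p1 p2)
     (nlw0 s F a q) (nlw1 s F F1 a a1 q q1) (nlw2 s F F1 F2 a a1 a2 q q1 q2)"
proof -
 from weighted_sup[OF c] obtain M where M: "0 <= M" "!!K E a a1 a2 (p::real^'n => real) p1 p2 nu. Weight K E a a1 a2 ==> wclass E p p1 p2 ==>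
   wbound nu p p1 p2 ==> AE x in lborel. \<bar>a x * p x\<bar> <= (M * K) * nu" by blast
 define kk where "kk = 6 * (K + 1)"
 define L1 where "L1 = C * (3 * K + 1 + kk^2)"
 define L2 where "L2 = C * (3 * K + 1 + 24 * K * kk + M * K + 3 * kk^2)"
 have L: "0 <= L1" "0 <= L2" using C K M(1) by (auto simp: L1_def L2_def kk_def)
 show thesis
 proof (rule that[of "L1 + L2"])
  show "0 <= L1 + L2" using L by simp
 next
  fix s :: real and F F1 F2 E a a1 a2 and p :: "real^'n => real" and p1 p2 nu
  assume "Pot C F F1 F2" "Weight K E a a1 a2" "0 < s" and p: "wclass E p p1 p2" "wbound nu p p1 p2"
  then interpret nonlinear_weighted C K s F F1 F2 E a a1 a2 by unfold_locales
  have "singlebound nu = L1 * ((s + s^2) * (nu + nu^2))"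
   unfolding singlebound_def[OF c p] L1_def kk_def by simp
  also have "... <= (L1 + L2) * ((s + s^2) * (nu + nu^2))"
   using L s wboundD(4)[OF p(2)] by (intro mult_right_mono) auto
  finally have le: "singlebound nu <= (L1 + L2) * ((s + s^2) * (nu + nu^2))" .
  show "wbound ((L1 + L2) * ((s + s^2) * (nu + nu^2))) (nl0 p) (nl1 p p1) (nl2 p p1 p2)"
   using nl_single[OF c p] le unfolding wbound_def by (blast intro: Lb_mono)
 next
  fix s :: real and F F1 F2 E a a1 a2 and p :: "real^'n => real" and p1 p2 q q1 q2 nu nuw mu
  assume "Pot C F F1 F2" and W: "Weight K E a a1 a2" and "0 < s" and p: "wclass E p p1 p2" "wbound nu p p1 p2"
   and q: "wclass E q q1 q2" "wbound nu q q1 q2"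
   and w: "wdist nuw p p1 p2 q q1 q2"
   and mu: "Lb 6 (%x. p x - q x) mu"
  then interpret nonlinear_weighted C K s F F1 F2 E a a1 a2 by unfold_locales
  have sup: "AE x in lborel. \<bar>a x * (p x - q x)\<bar> <= (M * K) * nuw"
   by (rule M(2)[OF W wclass_diff[OF p(1) q(1)] w])
  have c1: "0 <= M * K" using M(1) K by simp
  note ctx = c p q refl refl refl w mu sup c1
  have "diffbound nu nuw mu (M * K) = L2 * ((s + s^2) * (1 + nu) * nuw + s ^ 3 * nu^2 * mu)"
   unfolding diffbound_def[OF ctx] k1_def[OF ctx] L2_def kk_def by simp
  also have "... <= (L1 + L2) * ((s + s^2) * (1 + nu) * nuw + s ^ 3 * nu^2 * mu)"
   using L s wboundD(4)[OF p(2)] wboundD(4)[OF w] LbD(2)[OF mu] by (intro mult_right_mono) auto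
  finally have le: "diffbound nu nuw mu (M * K) <= (L1 + L2) * ((s + s^2) * (1 + nu) * nuw + s ^ 3 * nu^2 * mu)" .
  show "wdist ((L1 + L2) * ((s + s^2) * (1 + nu) * nuw + s ^ 3 * nu^2 * mu)) (nl0 p) (nl1 p p1) (nl2 p p1 p2) (nl0 q) (nl1 q q1) (nl2 q q1 q2)"
   using nl0_diff[OF ctx] nl1_diff[OF ctx] nl2_diff[OF ctx] le unfolding wbound_def by (blast intro: Lb_mono)
 qed
qed

subsection \<open>Products, translations and combinations\<close>

lemma Mult_translate:
 assumes "Mult K i b b'"
 shows "Mult K i (%x. b (x + c)) (%x. b' (x + c))"
proof -
 note [measurable] = MultD(1,2)[OF assms]
 have "\<bar>b (x + t *R axis i 1 + c) - b (x + c)\<bar> <= K * \<bar>t\<bar>" for x t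
  using MultD(5)[OF assms, where x = "x + c" and t = t] by (simp add: algebra_simps)
 moreover have "(%n. (b (x + step n *R axis i 1 + c) - b (x + c)) / step n) \<longlonglongrightarrow> b' (x + c)" for x
  using MultD(6)[OF assms, where x = "x + c"] by (simp add: algebra_simps)
 ultimately show ?thesis using MultD(3,4)[OF assms] by (auto simp: Mult_def)
qed

lemma Mult_mono: "Mult K i b b' ==> K <= K' ==> Mult K' i b b'"
 unfolding Mult_def by (meson abs_ge_zero mult_right_mono order_trans)

lemma Mult_add:
 assumes A: "Mult K i a a'" and B: "Mult K' i b b'"
 shows "Mult (K + K') i (%x. a x + b x) (%x. a' x + b' x)"
 unfolding Mult_def
proof (intro conjI allI)
 note [measurable] = MultD(1,2)[OF A] MultD(1,2)[OF B]
 fix x t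
 show "\<bar>a x + b x\<bar> <= K + K'" "\<bar>a' x + b' x\<bar> <= K + K'"
  using MultD(3,4)[OF A, where x = x] MultD(3,4)[OF B, where x = x] by linarith+
 show "\<bar>a (x + t *R axis i 1) + b (x + t *R axis i 1) - (a x + b x)\<bar> <= (K + K') * \<bar>t\<bar>"
  using MultD(5)[OF A, where x = x and t = t] MultD(5)[OF B, where x = x and t = t] by (simp add: distrib_right)
 have "(%n. dq i n a x + dq i n b x) \<longlonglongrightarrow> a' x + b' x"
  by (intro tendsto_add MultD(6)[OF A] MultD(6)[OF B])
 then show "(%n. dq i n (%x. a x + b x) x) \<longlonglongrightarrow> a' x + b' x"
  by (simp add: add_divide_distrib diff_divide_distrib algebra_simps)
qed (use MultD(1,2)[OF A] MultD(1,2)[OF B] in auto)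

lemma Mult_prod:
 assumes A: "Mult K i a a'" and B: "Mult K' i b b'"
 shows "Mult (2 * K * K') i (%x. a x * b x) (%x. a' x * b x + a x * b' x)"
 unfolding Mult_def
proof (intro conjI allI)
 note K = MultD(7)[OF A] MultD(7)[OF B]
 fix x t
 have m: "\<bar>u * v\<bar> <= K * K'" if "\<bar>u\<bar> <= K" "\<bar>v\<bar> <= K'" for u v
  unfolding abs_mult using that K by (intro mult_mono) auto
 have KK: "0 <= K * K'" using K by simp
 show "\<bar>a x * b x\<bar> <= 2 * K * K'" using m[OF MultD(3)[OF A] MultD(3)[OF B], of x x] KK by simp
 show "\<bar>a' x * b x + a x * b' x\<bar> <= 2 * K * K'"
  using m[OF MultD(4)[OF A] MultD(3)[OF B], of x x] m[OF MultD(3)[OF A] MultD(4)[OF B], of x x] by simp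
 let ?y = "x + t *R axis i 1"
 have "a ?y * b ?y - a x * b x = (a ?y - a x) * b ?y + a x * (b ?y - b x)" by (simp add: algebra_simps)
 also have "\<bar>...\<bar> <= \<bar>a ?y - a x\<bar> * \<bar>b ?y\<bar> + \<bar>a x\<bar> * \<bar>b ?y - b x\<bar>"
  unfolding abs_mult[symmetric] by (rule abs_triangle_ineq)
 also have "... <= (K * \<bar>t\<bar>) * K' + K * (K' * \<bar>t\<bar>)"
  using K MultD(3,5)[OF A] MultD(3,5)[OF B] by (intro add_mono mult_mono) auto
 finally show "\<bar>a ?y * b ?y - a x * b x\<bar> <= 2 * K * K' * \<bar>t\<bar>" by (simp add: algebra_simps)
 have "(%n. b (x + step n *R axis i 1)) \<longlonglongrightarrow> b x"
 proof (rule Lim_null_comparison[THEN LIM_zero_cancel])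
  show "\<forall>\<^sub>F n in sequentially. norm (b (x + step n *R axis i 1) - b x) <= K' * \<bar>step n\<bar>"
   using MultD(5)[OF B] by (intro always_eventually) simp
  show "(%n. K' * \<bar>step n\<bar>) \<longlonglongrightarrow> 0"
   using tendsto_mult_left[OF tendsto_rabs_zero[OF step_tendsto], of K'] by simp
 qed
 then have "(%n. dq i n a x * b (x + step n *R axis i 1) + a x * dq i n b x) \<longlonglongrightarrow> a' x * b x + a x * b' x"
  by (intro tendsto_add tendsto_mult tendsto_const MultD(6)[OF A] MultD(6)[OF B])
 then show "(%n. dq i n (%x. a x * b x) x) \<longlonglongrightarrow> a' x * b x + a x * b' x"
  unfolding dq_mult .
qed (use MultD(1,2)[OF A] MultD(1,2)[OF B] in auto)

text \<open>The product vanishes outside the intersection of E with its translate, which is where u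
  and u(. + z) both have second derivatives.\<close>

lemma Weight_prod_translate:
 assumes W: "Weight K E a a1 a2"
 shows "Weight (8 * K^2) (E \<inter> {x. x + z \<in> E}) (%x. a x * a (x + z))
  (%i x. a1 i x * a (x + z) + a x * a1 i (x + z))
  (%i k x. (a2 i k x * a (x + z) + a1 i x * a1 k (x + z)) + (a1 k x * a1 i (x + z) + a x * a2 i k (x + z)))"
 unfolding Weight_def
proof (intro conjI allI impI)
 note K = WeightD(1)[OF W]
 have K2: "K <= K^2" "1 <= K^2" using K mult_mono[OF K K] by (auto simp: power2_eq_square)
 show "1 <= 8 * K^2" using K2 by simp
 fix x
 show "0 <= a x * a (x + z)" using WeightD(2)[OF W] by simp
 show "a x * a (x + z) <= 1" using WeightD(2,3)[OF W] by (intro mult_le_one) auto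
 show "x \<notin> E \<inter> {x. x + z \<in> E} ==> a x * a (x + z) = 0" using WeightD(4)[OF W] by auto
 fix i
 have "((%t. a (x + z + t *R axis i 1)) has_real_derivative a1 i (x + z)) (at 0)" by (rule WeightD(5)[OF W])
 then have "((%t. a (x + t *R axis i 1 + z)) has_real_derivative a1 i (x + z)) (at 0)" by (simp add: algebra_simps)
 from DERIV_mult[OF WeightD(5)[OF W] this]
 show "((%t. a (x + t *R axis i 1) * a (x + t *R axis i 1 + z)) has_real_derivative
   a1 i x * a (x + z) + a x * a1 i (x + z)) (at 0)" by (simp add: algebra_simps)
next
 note K = WeightD(1)[OF W]
 have K2: "0 <= K^2" by simp
 fix i
 show "Mult (8 * K^2) i (%x. a x * a (x + z)) (%x. a1 i x * a (x + z) + a x * a1 i (x + z))"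
  by (rule Mult_mono[OF Mult_prod[OF WeightD(6)[OF W] Mult_translate[OF WeightD(6)[OF W]]]])
    (use K2 in \<open>simp add: power2_eq_square\<close>)
 fix k
 show "Mult (8 * K^2) k (%x. a1 i x * a (x + z) + a x * a1 i (x + z))
   (%x. (a2 i k x * a (x + z) + a1 i x * a1 k (x + z)) + (a1 k x * a1 i (x + z) + a x * a2 i k (x + z)))"
  by (rule Mult_mono[OF Mult_add[OF Mult_prod[OF WeightD(7)[OF W] Mult_translate[OF WeightD(6)[OF W]]]
    Mult_prod[OF WeightD(6)[OF W] Mult_translate[OF WeightD(7)[OF W]]]]])
    (use K2 in \<open>simp add: power2_eq_square\<close>)
qed

lemma wclass_translate:
 assumes p: "wclass E p p1 p2"
 shows "wclass {x. x + z \<in> E} (%x. p (x + z)) (%i x. p1 i (x + z)) (%i k x. p2 i k (x + z))"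
 unfolding wclass_def
proof (intro conjI allI impI)
 fix K rho rho' i k assume M: "Mult K k rho rho'" and 0: "\<forall>x. x \<notin> {x. x + z \<in> E} --> rho x = 0"
 have "DQ k (%x. rho (x + (- z)) * p1 i x) (%x. rho' (x + (- z)) * p1 i x + rho (x + (- z)) * p2 i k x)"
  using 0 by (intro wclassD(5)[OF p Mult_translate[OF M]]) simp
 from DQ_translate[OF this, of z]
 show "DQ k (%x. rho x * p1 i (x + z)) (%x. rho' x * p1 i (x + z) + rho x * p2 i k (x + z))" by simp
qed (use wclassD[OF p] in \<open>auto intro: DQ_translate sq_translate\<close>)

lemma wclass_lincomb:
 assumes p: "!!j. j \<in> J ==> wclass E (p j) (p1 j) (p2 j)" and J: "finite J"
 shows "wclass E (%x. \<Sum>j\<in>J. c j * p j x) (%i x. \<Sum>j\<in>J. c j * p1 j i x) (%i k x. \<Sum>j\<in>J. c j * p2 j i k x)"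
 unfolding wclass_def
proof (intro conjI allI impI)
 fix K rho rho' i k assume M: "Mult K k rho rho'" and 0: "\<forall>x. x \<notin> E --> rho x = 0"
 have "DQ k (%x. \<Sum>j\<in>J. c j * (rho x * p1 j i x)) (%x. \<Sum>j\<in>J. c j * (rho' x * p1 j i x + rho x * p2 j i k x))"
  using 0 by (intro DQ_sum J DQ_cmult wclassD(5)[OF p M]) auto
 moreover have "(\<Sum>j\<in>J. c j * (rho x * p1 j i x)) = rho x * (\<Sum>j\<in>J. c j * p1 j i x)"
  "(\<Sum>j\<in>J. c j * (rho' x * p1 j i x + rho x * p2 j i k x)) = rho' x * (\<Sum>j\<in>J. c j * p1 j i x) + rho x * (\<Sum>j\<in>J. c j * p2 j i k x)" for x
  by (auto simp: sum_distrib_left sum.distrib distrib_left mult_ac)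
 ultimately show "DQ k (%x. rho x * (\<Sum>j\<in>J. c j * p1 j i x)) (%x. rho' x * (\<Sum>j\<in>J. c j * p1 j i x) + rho x * (\<Sum>j\<in>J. c j * p2 j i k x))"
  by simp
qed (auto intro!: DQ_sum sq_sum J DQ_cmult sq_cmult wclassD[OF p])

lemma wbound_translate: "wbound nu p p1 p2 ==> wbound nu (%x. p (x + z)) (%i x. p1 i (x + z)) (%i k x. p2 i k (x + z))"
 unfolding wbound_def by (auto intro: Lb_translate)

lemma wbound_diff:
 "wbound nu p p1 p2 ==> wbound nu' q q1 q2 ==> wdist (nu + nu') p p1 p2 q q1 q2"
 unfolding wbound_def by (auto intro: Lb_diff)

lemma Lb_lincomb:
 assumes p: "!!j. j \<in> J ==> Lb m (p j) nu" and J: "finite J" and c: "!!j. j \<in> J ==> \<bar>c j\<bar> <= 1" and m: "m > 0"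
 shows "Lb m (%x. \<Sum>j\<in>J. c j * p j x) (real (card J) * nu)"
proof -
 have "Lb m (%x. \<Sum>j\<in>J. c j * p j x) (\<Sum>j\<in>J. nu)"
 proof (rule Lb_sum[OF J _ m])
  fix j assume j: "j \<in> J"
  from Lb_cmult[OF p[OF j], of "c j"] show "Lb m (%x. c j * p j x) nu"
   by (rule Lb_mono) (use c[OF j] LbD(2)[OF p[OF j]] in \<open>auto intro: mult_left_le_one_le\<close>)
 qed
 then show ?thesis by simp
qed

lemma wbound_lincomb:
 assumes p: "!!j. j \<in> J ==> wbound nu (p j) (p1 j) (p2 j)" and J: "finite J" and c: "!!j. j \<in> J ==> \<bar>c j\<bar> <= 1"
 shows "wbound (real (card J) * nu) (%x. \<Sum>j\<in>J. c j * p j x) (%i x. \<Sum>j\<in>J. c j * p1 j i x) (%i k x. \<Sum>j\<in>J. c j * p2 j i k x)"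
 unfolding wbound_def using p by (auto intro!: Lb_lincomb J c dest: wboundD)

text \<open>The difference is the mean over the segment of the derivative along z. The vector z is
  normalized so that its components are coefficients of absolute value at most 1.\<close>

lemma translate_diff_L2:
 fixes p :: "real^'n => real"
 assumes p: "!!i. DQ i p (p1 i)" and b: "!!i. Lb 2 (p1 i) nu"
 shows "Lb 2 (%x. p (x + z) - p x) (norm z * (real CARD('n) * nu))"
proof -
 note [measurable] = DQ_sq(1)[OF p, THEN sq_measurable] DQ_sq(2)[OF p, THEN sq_measurable]
 define q where "q x = (\<Sum>i\<in>UNIV. z $ i * p1 i x)" for x
 have sz: "sq q" unfolding q_def by (intro sq_sum sq_cmult DQ_sq(2)[OF p]) simp
 note [measurable] = sz[THEN sq_measurable]
 have q: "Lb 2 q (norm z * (real CARD('n) * nu))"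
 proof (cases "z = 0")
  case True
  then show ?thesis using Lb_zero[of 2] by (simp add: q_def[abs_def])
 next
  case False
  have "Lb 2 (%x. \<Sum>i\<in>UNIV. (z $ i / norm z) * p1 i x) (real CARD('n) * nu)"
   using b component_le_norm_cart[of z] False by (intro Lb_lincomb) (auto simp: field_simps)
  from Lb_cmult[OF this, of "norm z"]
  show ?thesis using False by (simp add: q_def[abs_def] sum_distrib_left)
 qed
 have "AE x in lborel. p (x + z) - p x = (LINT t:{0..1}|lborel. q (x + t *R z))"
  using weak_dir_segment[OF open_UNIV _ _ sq_loc_int[OF DQ_sq(1)[OF p]] sq_loc_int[OF sz]
    weak_dir_combine[OF DQ_weak_dir[OF p] DQ_sq[OF p], of z, folded q_def]] by simp
 moreover have "Lb 2 (%x. LINT t|lborel. indicator {0..1} t * q (x + t *R z)) (1 * (norm z * (real CARD('n) * nu)))"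
 proof (rule Lb_param_integral(1)[where sig = "%_::real. 1"])
  show "Lb 2 (%x. q (x + t *R z)) (norm z * (real CARD('n) * nu) * 1)" for t
   using Lb_translate[OF q] by simp
  have "(nni (%z. \<bar>indicator {0..1::real} z\<bar> * 1)) = (\<integral>\<^sup>+z. indicator {0..1::real} z \<partial>lborel)"
   by (intro nn_integral_cong) (auto split: split_indicator)
  then show "(nni (%z. \<bar>indicator {0..1::real} z\<bar> * 1)) <= ennreal 1" by auto
 qed (use LbD(2)[OF q] in \<open>auto simp: split_beta'\<close>)
 then have "Lb 2 (%x. LINT t|lborel. indicator {0..1} t * q (x + t *R z)) (norm z * (real CARD('n) * nu))" by simp
 ultimately show ?thesis
  by (elim Lb_cong_AE[rotated -1]) (simp_all add: set_lebesgue_integral_def)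
qed

subsection \<open>The singular kernel\<close>

lemma emeasure_ball_scale:
 assumes r: "0 < r"
 shows "emeasure lborel (ball (0::'a::euclidean_space) r) = ennreal (r ^ DIM('a) * measure lborel (ball (0::'a) 1))"
proof -
 have [measurable]: "ball (0::'a) rho \<in> sets borel" for rho by (rule borel_open) simp
 have "(\<integral>\<^sup>+z. indicator (ball (0::'a) r) (0 + r *R z) \<partial>lborel)
   = ennreal (inverse (r ^ DIM('a))) * (\<integral>\<^sup>+z. indicator (ball (0::'a) r) z \<partial>lborel)"
  by (rule nn_integral_scale[OF _ r]) measurable
 also have "(%z::'a. indicator (ball (0::'a) r) (0 + r *R z)) = (indicator (ball 0 1) :: 'a => ennreal)"
  using r by (auto simp: fun_eq_iff dist_norm split: split_indicator)
 finally have "emeasure lborel (ball (0::'a) 1) = ennreal (inverse (r ^ DIM('a))) * emeasure lborel (ball (0::'a) r)" by simp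
 then have "ennreal (r ^ DIM('a)) * emeasure lborel (ball (0::'a) 1)
   = ennreal (r ^ DIM('a)) * ennreal (inverse (r ^ DIM('a))) * emeasure lborel (ball (0::'a) r)" by (simp add: mult.assoc)
 also have "ennreal (r ^ DIM('a)) * ennreal (inverse (r ^ DIM('a))) = 1" using r by (simp add: ennreal_mult[symmetric])
 finally have "emeasure lborel (ball (0::'a) r) = ennreal (r ^ DIM('a)) * emeasure lborel (ball (0::'a) 1)" by simp
 also have "emeasure lborel (ball (0::'a) 1) = ennreal (measure lborel (ball (0::'a) 1))"
  using emeasure_lborel_ball_finite[of "0::'a" 1] by (intro emeasure_eq_ennreal_measure) auto
 finally show ?thesis using r by (simp add: ennreal_mult[symmetric])
qed

text \<open>Dyadic decomposition: where 2^(-k-1) <= |z| < 2^(-k) the kernel is at most 2^(al (k+1))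
  and the volume at most V 2^(-kd), giving a geometric series of ratio 2^(al - d).\<close>

lemma kernel_unit_finite:
 fixes al :: real
 assumes a: "0 <= al" "al < DIM('a::euclidean_space)"
 shows "(nni (%z. indicator (ball (0::'a) 1) z * norm z powr (- al))) < \<infinity>"
proof -
 define V where "V = measure lborel (ball (0::'a) 1)"
 have V0: "0 <= V" by (simp add: V_def)
 define g where "g k z = ennreal ((2 powr al) ^ Suc k) * indicator (ball (0::'a) ((1 / 2) ^ k)) z" for k and z :: 'a
 have [measurable]: "ball (0::'a) rho \<in> sets borel" for rho by (rule borel_open) simp
 have [measurable]: "g k \<in> bmeas" for k unfolding g_def by measurable
 have le: "ennreal (indicator (ball (0::'a) 1) z * norm z powr (- al)) <= (\<Sum>k. g k z)" for z
 proof (cases "z \<in> ball 0 1 \<and> z ~= 0")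
  case True
  then have z: "0 < norm z" "norm z < 1" by auto
  obtain m where m: "(1 / 2) ^ m < norm z" using real_arch_pow_inv[OF z(1), of "1 / 2"] by auto
  \<comment> \<open>The shell of z is found as the least index at which 2^(-k-1) no longer exceeds
    the norm.\<close>
  define Q where "Q k \<longleftrightarrow> (1 / 2) ^ Suc k <= norm z" for k :: nat
  define k where "k = (LEAST k. Q k)"
  have "(1 / 2 :: real) ^ Suc m <= (1 / 2) ^ m" by (rule power_decreasing) auto
  then have ex: "Q m" unfolding Q_def using m by linarith
  have "Q k" unfolding k_def by (rule LeastI[of Q, OF ex])
  then have k1: "(1 / 2) ^ Suc k <= norm z" by (simp only: Q_def)
  have k2: "norm z < (1 / 2) ^ k"
  proof (cases k)
   case (Suc k')
   then have "\<not> (1 / 2) ^ Suc k' <= norm z" using not_less_Least[of k' Q] by (simp add: k_def Q_def)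
   then show ?thesis using Suc by simp
  qed (use z in simp)
  have "norm z powr (- al) <= ((1 / 2) ^ Suc k) powr (- al)"
   using k1 a by (intro powr_mono2') auto
  also have "... = (2 powr al) ^ Suc k"
  proof -
   have "((1 / 2) ^ Suc k) powr (- al) = (((1 / 2) powr (- al))) ^ Suc k"
    by (simp add: powr_power[symmetric] powr_mult powr_realpow[symmetric] powr_powr mult.commute del: power_Suc)
   also have "(1 / 2) powr (- al) = 2 powr al" by (simp add: powr_divide powr_minus)
   finally show ?thesis .
  qed
  finally have "ennreal (indicator (ball (0::'a) 1) z * norm z powr (- al)) <= g k z"
   using True k2 by (simp add: g_def ennreal_leI)
  also have "... <= (\<Sum>k. g k z)"
   using sum_le_suminf[of "%k. g k z" "{k}"] by simp
  finally show ?thesis .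
 qed auto
 define x where "x = 2 powr (al - DIM('a))"
 have x: "0 < x" "x < 1" using a unfolding x_def by (auto simp: powr_less_one)
 have gi: "(\<integral>\<^sup>+z. g k z \<partial>lborel) = ennreal (2 powr al * V * x ^ k)" for k
 proof -
  have "(\<integral>\<^sup>+z. g k z \<partial>lborel) = ennreal ((2 powr al) ^ Suc k) * emeasure lborel (ball (0::'a) ((1 / 2) ^ k))"
   unfolding g_def by (subst nn_integral_cmult) auto
  also have "... = ennreal ((2 powr al) ^ Suc k) * ennreal (((1 / 2) ^ k) ^ DIM('a) * V)"
   by (subst emeasure_ball_scale) (auto simp: V_def)
  also have "... = ennreal ((2 powr al) ^ Suc k * (((1 / 2) ^ k) ^ DIM('a) * V))"
   by (rule ennreal_mult'[symmetric]) (simp add: V0)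
  also have "(2 powr al) ^ Suc k * (((1 / 2) ^ k) ^ DIM('a) * V) = 2 powr al * V * (2 powr al * (1 / 2) ^ DIM('a)) ^ k"
   by (simp add: power_mult_distrib power_mult[symmetric] mult_ac)
  also have "2 powr al * (1 / 2) ^ DIM('a) = x"
   by (simp add: x_def powr_diff powr_realpow power_one_over field_simps)
  finally show ?thesis .
 qed
 have "(nni (%z. indicator (ball (0::'a) 1) z * norm z powr (- al))) <= (\<integral>\<^sup>+z. (\<Sum>k. g k z) \<partial>lborel)"
  by (intro nn_integral_mono le)
 also have "... = (\<Sum>k. \<integral>\<^sup>+z. g k z \<partial>lborel)" by (rule nn_integral_suminf) measurable
 also have "... = (\<Sum>k. ennreal (2 powr al * V * x ^ k))" by (simp add: gi)
 also have "... < \<infinity>"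
 proof -
  have "summable (%k. 2 powr al * V * x ^ k)" using x by (intro summable_mult summable_geometric) auto
  then show ?thesis using V0 x by (subst suminf_ennreal2) auto
 qed
 finally show ?thesis .
qed

lemma kernel_integral:
 fixes al :: real
 assumes a: "0 <= al" "al < DIM('a::euclidean_space)"
 obtains C where "0 <= C" "!!r. 0 < r ==>
  (nni (%z. indicator (ball (0::'a) r) z * norm z powr (- al))) <= ennreal (C * r powr (DIM('a) - al))"
proof -
 define I where "I = (nni (%z. indicator (ball (0::'a) 1) z * norm z powr (- al)))"
 obtain C where C: "0 <= C" "I = ennreal C" using kernel_unit_finite[OF a] by (cases I) (auto simp: I_def)
 have [measurable]: "ball (0::'a) rho \<in> sets borel" for rho by (rule borel_open) simp
 show thesis
 proof (rule that[OF C(1)])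
  fix r :: real assume r: "0 < r"
  define J where "J = (nni (%z. indicator (ball (0::'a) r) z * norm z powr (- al)))"
  have "(nni (%z. indicator (ball (0::'a) r) (0 + r *R z) * norm (0 + r *R z) powr (- al)))
    = ennreal (inverse (r ^ DIM('a))) * J"
   unfolding J_def by (rule nn_integral_scale[OF _ r]) measurable
  also have "(nni (%z. indicator (ball (0::'a) r) (0 + r *R z) * norm (0 + r *R z) powr (- al)))
    = (\<integral>\<^sup>+z. ennreal (r powr (- al)) * ennreal (indicator (ball (0::'a) 1) z * norm z powr (- al)) \<partial>lborel)"
   using r by (intro nn_integral_cong) (auto simp: ennreal_mult[symmetric] powr_mult dist_norm split: split_indicator)
  also have "... = ennreal (r powr (- al)) * ennreal C"
   unfolding C(2)[symmetric] I_def by (rule nn_integral_cmult) measurable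
  finally have eq: "ennreal (r powr (- al)) * ennreal C = ennreal (inverse (r ^ DIM('a))) * J" .
  have "J = (ennreal (r ^ DIM('a)) * ennreal (inverse (r ^ DIM('a)))) * J"
   using r by (simp add: ennreal_mult[symmetric])
  also have "... = ennreal (r ^ DIM('a)) * (ennreal (r powr (- al)) * ennreal C)"
   unfolding eq by (simp add: mult.assoc)
  also have "... = ennreal (C * r powr (DIM('a) - al))"
   using r C(1) by (simp add: ennreal_mult[symmetric] powr_diff powr_minus powr_realpow divide_inverse mult_ac)
  finally show "J <= ennreal (C * r powr (DIM('a) - al))" by simp
 qed
qed

subsection \<open>The tensile force\<close>

text \<open>Index convention: \<open>u1 j i\<close> is the derivative of the component
  \<open>u j\<close> in direction i, and \<open>u2 j i k\<close> is that of \<open>u1 j i\<close> in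
  direction k.\<close>

definition field :: "(real^'n) set => ('n => real^'n => real) => ('n => 'n => real^'n => real)
  => ('n => 'n => 'n => real^'n => real) => bool" where
 "field D u u1 u2 \<longleftrightarrow> (\<forall>j. wclass D (u j) (u1 j) (u2 j))"

definition fbound :: "real => ('n => real^'n => real) => ('n => 'n => real^'n => real)
  => ('n => 'n => 'n => real^'n => real) => bool" where
 "fbound nu u u1 u2 \<longleftrightarrow> (\<forall>j. wbound nu (u j) (u1 j) (u2 j))"

abbreviation (input) fdist where
 "fdist nu u u1 u2 v v1 v2 \<equiv> fbound nu (%j x. u j x - v j x) (%j i x. u1 j i x - v1 j i x) (%j i k x. u2 j i k x - v2 j i k x)"

lemma fbound_nonneg: "fbound nu u u1 u2 ==> 0 <= nu"
 unfolding fbound_def using wboundD(4) by blast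

text \<open>The norm of z times the strain. In these terms the argument sqrt|z| S of the tensile
  potential is |z|^(-1/2) times \<open>rel\<close>.\<close>

definition rel :: "real^'n => ('n => real^'n => real) => real^'n => real" where
 "rel z u x = (\<Sum>j\<in>UNIV. (z $ j / norm z) * (u j (x + z) - u j x))"

lemma component_quotient_le: "\<bar>z $ j / norm z\<bar> <= 1"
 using component_le_norm_cart[of z j] by (cases "z = 0") (auto simp: field_simps)

lemma rel_wclass:
 assumes "field D u u1 u2"
 shows "wclass (D \<inter> {x. x + z \<in> D}) (rel z u) (%i. rel z (%j. u1 j i)) (%i k. rel z (%j. u2 j i k))"
proof -
 have "wclass (D \<inter> {x. x + z \<in> D}) (%x. u j (x + z) - u j x) (%i x. u1 j i (x + z) - u1 j i x) (%i k x. u2 j i k (x + z) - u2 j i k x)" for j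
 proof (rule wclass_diff)
  have u: "wclass D (u j) (u1 j) (u2 j)" using assms by (simp add: field_def)
  show "wclass (D \<inter> {x. x + z \<in> D}) (%x. u j (x + z)) (%i x. u1 j i (x + z)) (%i k x. u2 j i k (x + z))"
   by (rule wclass_mono[OF wclass_translate[OF u]]) auto
  show "wclass (D \<inter> {x. x + z \<in> D}) (u j) (%i x. u1 j i x) (%i k x. u2 j i k x)"
   by (rule wclass_mono[OF u]) auto
 qed
 from wclass_lincomb[of UNIV, OF this finite, of "%j. z $ j / norm z"]
 show ?thesis by (simp add: rel_def[abs_def])
qed

lemma rel_wbound:
 fixes u :: "'n => real^'n => real"
 assumes "fbound nu u u1 u2"
 shows "wbound (real CARD('n) * (2 * nu)) (rel z u) (%i. rel z (%j. u1 j i)) (%i k. rel z (%j. u2 j i k))"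
proof -
 have "wbound (2 * nu) (%x. u j (x + z) - u j x) (%i x. u1 j i (x + z) - u1 j i x) (%i k x. u2 j i k (x + z) - u2 j i k x)" for j
 proof -
  have "wbound nu (u j) (u1 j) (u2 j)" using assms by (simp add: fbound_def)
  from wbound_diff[OF wbound_translate[OF this] this, of z] show ?thesis by (simp only: mult_2)
 qed
 from wbound_lincomb[of UNIV, OF this finite component_quotient_le]
 show ?thesis by (simp add: rel_def[abs_def])
qed

lemma rel_diff: "rel z u x - rel z v x = rel z (%j x. u j x - v j x) x"
 by (simp add: rel_def sum_subtractf[symmetric] right_diff_distrib[symmetric] algebra_simps)

text \<open>In dimension two the cubic term against the tensile kernel is of size |z|^(-2), just not
  integrable; the power 1/6 repairs this. In dimension three |z|^(-2) is integrable.\<close>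

definition gain :: "real^'n => real" where
 "gain z = (if CARD('n) = 2 then norm z powr (1 / 6) else 1)"

text \<open>In dimension two the difference is bounded in L10 by twice 5! nu = 120 nu, and in L2 by
  |z| times the gradient; interpolation gives the sixth root of |z|. The resulting 240 exceeds the
  constant 12 of dimension three.\<close>

lemma rel_6:
 fixes u :: "'n => real^'n => real"
 assumes c: "CARD('n) = 2 \<or> CARD('n) = 3" and u: "field D u u1 u2" and b: "fbound nu u u1 u2" and z: "z ~= 0"
 shows "Lb 6 (rel z u) (real CARD('n) * (240 * gain z * nu))"
proof -
 note nu = fbound_nonneg[OF b]
 have g: "0 <= gain z" by (simp add: gain_def)
 have "Lb 6 (%x. u j (x + z) - u j x) (240 * gain z * nu)" for j
 proof (cases "CARD('n) = 2")
  case True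
  have uj: "wclass D (u j) (u1 j) (u2 j)" "wbound nu (u j) (u1 j) (u2 j)" using u b by (auto simp: field_def fbound_def)
  have "Lb 10 (u j) (fact 5 * nu)"
   using sobolev_2[OF True wclassD(1)[OF uj(1)] wboundD(1,2)[OF uj(2)], of 4] by (simp add: fact_numeral)
  from Lb_diff[OF Lb_translate[OF this] this, of z]
  have 10: "Lb 10 (%x. u j (x + z) - u j x) (240 * nu)" by (simp add: fact_numeral)
  have 2: "Lb 2 (%x. u j (x + z) - u j x) (norm z * (2 * nu))"
   using translate_diff_L2[OF wclassD(1)[OF uj(1)] wboundD(2)[OF uj(2)], of z] True by simp
  have "(nni (%x. \<bar>u j (x + z) - u j x\<bar> ^ 6)) <= ennreal (norm z * (2 * nu) * (240 * nu) ^ 5)"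
   by (rule Lb_6_gain[OF 2 10])
  also have "... <= ennreal ((240 * gain z * nu) ^ 6)"
  proof (rule ennreal_leI)
   have "gain z ^ 6 = norm z" using z True by (simp add: gain_def powr_power)
   then have "(240 * gain z * nu) ^ 6 = 240 ^ 6 * norm z * nu ^ 6" by (simp add: power_mult_distrib)
   moreover have "norm z * (2 * nu) * (240 * nu) ^ 5 = (2 * 240 ^ 5) * norm z * nu ^ 6"
    by (simp add: power_mult_distrib numeral_eq_Suc)
   moreover have "(2 * 240 ^ 5) * (norm z * nu ^ 6) <= 240 ^ 6 * (norm z * nu ^ 6)"
    using nu by (intro mult_right_mono) auto
   ultimately show "norm z * (2 * nu) * (240 * nu) ^ 5 <= (240 * gain z * nu) ^ 6" by (simp only: mult.assoc)
  qed
  finally show ?thesis using LbD(1)[OF 2] nu g by (auto simp: Lb_def)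
 next
  case False
  have uj: "wclass D (u j) (u1 j) (u2 j)" "wbound nu (u j) (u1 j) (u2 j)" using u b by (auto simp: field_def fbound_def)
  have 6: "Lb 6 (u j) (6 * nu)" by (rule sobolev_6[OF c wclassD(1)[OF uj(1)] wboundD(1,2)[OF uj(2)]])
  from Lb_diff[OF Lb_translate[OF 6] 6, of z] show ?thesis
   by (rule Lb_mono) (use nu False in \<open>auto simp: gain_def\<close>)
 qed
 from Lb_lincomb[of UNIV, OF this finite component_quotient_le] show ?thesis by (simp add: rel_def[abs_def])
qed

lemma wbound_rel_diff:
 fixes u v :: "'n => real^'n => real"
 assumes "fdist nu u u1 u2 v v1 v2"
 shows "wbound (real CARD('n) * (2 * nu)) (%x. rel z u x - rel z v x) (%i x. rel z (%j. u1 j i) x - rel z (%j. v1 j i) x)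
  (%i k x. rel z (%j. u2 j i k) x - rel z (%j. v2 j i k) x)"
 unfolding rel_diff using rel_wbound[OF assms, of z] .

lemma field_diff:
 assumes "field D u u1 u2" "field D v v1 v2"
 shows "field D (%j x. u j x - v j x) (%j i x. u1 j i x - v1 j i x) (%j i k x. u2 j i k x - v2 j i k x)"
 using assms unfolding field_def by (blast intro: wclass_diff)

lemma rel_measurable[measurable (raw)]:
 fixes u :: "'n => real^'n => real"
 assumes [measurable]: "!!j. u j \<in> bmeas" "f \<in> M \<rightarrow>\<^sub>M borel" "g \<in> M \<rightarrow>\<^sub>M borel"
 shows "(%w. rel (f w) u (g w)) \<in> borel_measurable M"
proof -
 have [measurable]: "(%z::real^'n. z $ i) \<in> bmeas" for i
  by (intro borel_measurable_continuous_onI) (auto intro!: continuous_intros)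
 have 1: "(%w. f w $ j / norm (f w) * (u j (g w + f w) - u j (g w))) \<in> borel_measurable M" for j
 proof -
  have "(%w. f w $ j) \<in> borel_measurable M" by (rule measurable_compose[OF assms(2)]) measurable
  moreover have "(%w. u j (g w + f w)) \<in> borel_measurable M" by (rule measurable_compose[of _ M borel]) measurable
  ultimately show ?thesis by measurable
 qed
 then show ?thesis unfolding rel_def by (intro borel_measurable_sum) auto
qed

locale tensile =
 fixes C K :: real and F F1 F2 :: "real => real" and D :: "(real^'n) set"
  and om :: "real^'n => real" and om1 :: "'n => real^'n => real" and om2 :: "'n => 'n => real^'n => real"
 assumes dim: "CARD('n) = 2 \<or> CARD('n) = 3" and pot: "Pot C F F1 F2" and weight: "Weight K D om om1 om2"
begin

text \<open>The scale s of the nonlinear estimates, different for each z.\<close>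

definition sz :: "real^'n => real" where "sz z = norm z powr (- 1 / 2)"

definition az :: "real^'n => real^'n => real" where "az z x = om x * om (x + z)"

definition az1 :: "real^'n => 'n => real^'n => real" where
 "az1 z i x = om1 i x * om (x + z) + om x * om1 i (x + z)"

definition az2 :: "real^'n => 'n => 'n => real^'n => real" where
 "az2 z i k x = (om2 i k x * om (x + z) + om1 i x * om1 k (x + z)) + (om1 k x * om1 i (x + z) + om x * om2 i k (x + z))"

lemma weight_az: "Weight (8 * K^2) (D \<inter> {x. x + z \<in> D}) (az z) (az1 z) (az2 z)"
 using Weight_prod_translate[OF weight, of z] by (simp add: az_def[abs_def] az1_def[abs_def] az2_def[abs_def])

definition T0 where
 "T0 u z x = nlw0 (sz z) F (az z) (rel z u) x"

definition T1 where
 "T1 u u1 i z x = nlw1 (sz z) F F1 (az z) (az1 z) (rel z u) (%i. rel z (%j. u1 j i)) i x"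

definition T2 where
 "T2 u u1 u2 i k z x = nlw2 (sz z) F F1 F2 (az z) (az1 z) (az2 z) (rel z u) (%i. rel z (%j. u1 j i)) (%i k. rel z (%j. u2 j i k)) i k x"

lemma w_measurable[measurable]:
 "om \<in> bmeas" "om1 i \<in> bmeas" "om2 i k \<in> bmeas"
 "F \<in> bmeas" "F1 \<in> bmeas" "F2 \<in> bmeas"
 using MultD(1,2)[OF WeightD(6)[OF weight]] MultD(2)[OF WeightD(7)[OF weight]] Pot_measurable[OF pot] by auto

lemma field_measurable:
 assumes "field D u u1 u2"
 shows "u j \<in> bmeas" "u1 j i \<in> bmeas" "u2 j i k \<in> bmeas"
proof -
 have "wclass D (u j) (u1 j) (u2 j)" using assms by (simp add: field_def)
 from wclassD(2-4)[OF this, THEN sq_measurable]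
 show "u j \<in> bmeas" "u1 j i \<in> bmeas" "u2 j i k \<in> bmeas" by auto
qed

lemma T_measurable:
 assumes u: "field D u u1 u2"
 shows "case_prod (T0 u) \<in> borel_measurable (borel \<Otimes>\<^sub>M borel)" "case_prod (T1 u u1 i) \<in> borel_measurable (borel \<Otimes>\<^sub>M borel)"
  "case_prod (T2 u u1 u2 i k) \<in> borel_measurable (borel \<Otimes>\<^sub>M borel)"
proof -
 note [measurable] = field_measurable[OF u]
 show "case_prod (T0 u) \<in> borel_measurable (borel \<Otimes>\<^sub>M borel)"
  unfolding T0_def nlw0_def az_def sz_def split_beta' by measurable
 show "case_prod (T1 u u1 i) \<in> borel_measurable (borel \<Otimes>\<^sub>M borel)"
  unfolding T1_def nlw1_def az_def az1_def sz_def split_beta' by measurable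
 show "case_prod (T2 u u1 u2 i k) \<in> borel_measurable (borel \<Otimes>\<^sub>M borel)"
  unfolding T2_def nlw2_def az_def az1_def az2_def sz_def split_beta' by measurable
qed

lemma sz_pos: "z ~= 0 ==> 0 < sz z" by (simp add: sz_def)

lemma nonlinear_z: "z ~= 0 ==> nonlinear_weighted C (8 * K^2) (sz z) F F1 F2 (D \<inter> {x. x + z \<in> D}) (az z) (az1 z) (az2 z)"
 using pot weight_az sz_pos by unfold_locales auto

lemma T_weak:
 assumes u: "field D u u1 u2" and z: "z ~= 0"
 shows "weak_dir UNIV (axis i 1) (T0 u z) (T1 u u1 i z)" "weak_dir UNIV (axis k 1) (T1 u u1 i z) (T2 u u1 u2 i k z)"
 using DQ_weak_dir[OF nonlinear_weighted.nl0_DQ[OF nonlinear_z[OF z] rel_wclass[OF u, of z]], of i]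
  nonlinear_weighted.nl1_weak[OF nonlinear_z[OF z] rel_wclass[OF u, of z], of k i]
 by (simp_all add: T0_def[abs_def] T1_def[abs_def] T2_def[abs_def])

text \<open>The growth in z of the L2 bounds of the integrand, \<open>sigs\<close> for one function
  and \<open>sigd\<close> for a difference. The value 1 at the origin only keeps the weights
  positive everywhere.\<close>

definition sigs :: "real^'n => real" where "sigs z = (if z = 0 then 1 else sz z + (sz z)^2)"
definition sigd :: "real^'n => real" where "sigd z = (if z = 0 then 1 else sz z + (sz z)^2 + sz z ^ 3 * gain z)"

lemma gain_nonneg: "0 <= gain z" by (simp add: gain_def)

lemma sig_measurable[measurable]: "sigs \<in> bmeas" "sigd \<in> bmeas"
 unfolding sigs_def[abs_def] sigd_def[abs_def] sz_def gain_def by measurable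

lemma sig_pos: "0 < sigs z" "0 < sigd z"
proof -
 show "0 < sigs z" using sz_pos[of z] by (auto simp: sigs_def add_pos_pos)
 have "z ~= 0 ==> 0 < sz z + (sz z)^2 + sz z ^ 3 * gain z"
  using sz_pos[of z] gain_nonneg[of z] by (intro add_pos_nonneg add_pos_pos) auto
 then show "0 < sigd z" by (auto simp: sigd_def)
qed

end

text \<open>The nonlinear estimates for one fixed z, with L the same for all z; the dependence on z
  is confined to \<open>sigs\<close> and \<open>sigd\<close>.\<close>

lemma tensile_pointwise:
 fixes C K :: real
 assumes c: "CARD('n) = 2 \<or> CARD('n) = 3" and C: "0 <= C" and K: "1 <= K"
 obtains L where "0 <= L"
  "!!F F1 F2 (D::(real^'n) set) om om1 om2 u u1 u2 nu z. tensile C K F F1 F2 D om om1 om2 ==> field D u u1 u2 ==>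
   fbound nu u u1 u2 ==> z ~= 0 ==> wbound (L * (nu + nu^2) * tensile.sigs z) (tensile.T0 F om u z)
    (%i. tensile.T1 F F1 om om1 u u1 i z) (%i k. tensile.T2 F F1 F2 om om1 om2 u u1 u2 i k z)"
  "!!F F1 F2 (D::(real^'n) set) om om1 om2 u u1 u2 v v1 v2 nu nuw z. tensile C K F F1 F2 D om om1 om2 ==> field D u u1 u2 ==>
   fbound nu u u1 u2 ==> field D v v1 v2 ==> fbound nu v v1 v2 ==> fdist nuw u u1 u2 v v1 v2 ==> z ~= 0 ==>
   wdist (L * ((1 + nu)^2 * nuw) * tensile.sigd z)
    (tensile.T0 F om u z) (%i. tensile.T1 F F1 om om1 u u1 i z) (%i k. tensile.T2 F F1 F2 om om1 om2 u u1 u2 i k z)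
    (tensile.T0 F om v z) (%i. tensile.T1 F F1 om om1 v v1 i z) (%i k. tensile.T2 F F1 F2 om om1 om2 v v1 v2 i k z)"
proof -
 have "1 <= 8 * K^2" using K mult_mono[OF K K] by (simp add: power2_eq_square)
 note K8 = this
 show thesis
 proof (rule nonlinear_estimates[OF c C K8], goal_cases)
 case (1 L)
 note L = 1(1) and L1 = 1(2) and L2 = 1(3)
 define n where "n = real CARD('n)"
 have n: "1 <= n" using c by (auto simp: n_def)
 have n2: "1 <= n^2" "n <= n^2" using n mult_mono[OF n n] mult_left_mono[OF n, of n] by (auto simp: power2_eq_square)
 \<comment> \<open>With 2 n nu as the bound of \<open>rel\<close>, the quadratic terms contribute
   (2n)^2 = 4 n^2, and the cubic term (2n)^2 times n 240 from \<open>rel_6\<close>, which is 960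
   n^3.\<close>
 define L' where "L' = L * (4 * n^2 + 960 * n ^ 3)"
 have L': "0 <= L'" "L * (4 * n^2) <= L'"
  using L n by (auto simp: L'_def intro!: mult_left_mono)
 show thesis
 proof (rule that[OF L'(1)])
  fix F F1 F2 and D :: "(real^'n) set" and om om1 om2 u u1 u2 nu and z :: "real^'n"
  assume t: "tensile C K F F1 F2 D om om1 om2" and u: "field D u u1 u2" "fbound nu u u1 u2" and z: "z ~= 0"
  interpret tensile C K F F1 F2 D om om1 om2 by (rule t)
  note nu = fbound_nonneg[OF u(2)] note s = sz_pos[OF z]
  have "2 * n * nu + (2 * n * nu)^2 <= 4 * n^2 * (nu + nu^2)"
  proof -
   have "2 * n * nu <= 4 * n^2 * nu" using n2 n nu by (intro mult_right_mono) auto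
   then show ?thesis by (simp add: power_mult_distrib algebra_simps)
  qed
  then have "L * ((sz z + (sz z)^2) * (2 * n * nu + (2 * n * nu)^2)) <= L * ((sz z + (sz z)^2) * (4 * n^2 * (nu + nu^2)))"
   using L s by (intro mult_left_mono) auto
  also have "... = L * (4 * n^2) * ((nu + nu^2) * sigs z)" using z by (simp add: sigs_def mult_ac)
  also have "... <= L' * ((nu + nu^2) * sigs z)" using L' nu sig_pos(1)[of z] by (intro mult_right_mono) auto
  finally have le: "L * ((sz z + (sz z)^2) * (2 * n * nu + (2 * n * nu)^2)) <= L' * (nu + nu^2) * sigs z" by (simp add: mult.assoc)
  have "wbound (2 * n * nu) (rel z u) (%i. rel z (%j. u1 j i)) (%i k. rel z (%j. u2 j i k))"
   using rel_wbound[OF u(2), of z] by (simp add: n_def mult_ac)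
  from wbound_mono[OF L1[OF pot weight_az s rel_wclass[OF u(1)] this] le]
  show "wbound (L' * (nu + nu^2) * sigs z) (T0 u z) (%i. T1 u u1 i z) (%i k. T2 u u1 u2 i k z)"
   by (simp only: T0_def[abs_def] T1_def[abs_def] T2_def[abs_def])
 next
  fix F F1 F2 and D :: "(real^'n) set" and om om1 om2 u u1 u2 v v1 v2 nu nuw and z :: "real^'n"
  assume t: "tensile C K F F1 F2 D om om1 om2" and u: "field D u u1 u2" "fbound nu u u1 u2"
   and v: "field D v v1 v2" "fbound nu v v1 v2"
   and w: "fdist nuw u u1 u2 v v1 v2" and z: "z ~= 0"
  interpret tensile C K F F1 F2 D om om1 om2 by (rule t)
  note nu = fbound_nonneg[OF u(2)] fbound_nonneg[OF w] note s = sz_pos[OF z]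
  define A where "A = (1 + nu)^2 * nuw"
  have A: "0 <= A" using nu by (simp add: A_def)
  have "(1 + 2 * n * nu) * (2 * n * nuw) <= 4 * n^2 * A"
  proof -
   have "1 + 2 * n * nu <= (2 * n) * (1 + nu)" using n by (simp add: algebra_simps)
   then have "(1 + 2 * n * nu) * (2 * n * nuw) <= ((2 * n) * (1 + nu)) * (2 * n * nuw)"
    using nu n by (intro mult_right_mono) auto
   also have "... = 4 * n^2 * ((1 + nu) * nuw)" by (simp add: power2_eq_square)
   also have "... <= 4 * n^2 * A"
    unfolding A_def using nu mult_left_mono[of 1 "1 + nu" "1 + nu"]
    by (intro mult_left_mono mult_right_mono) (auto simp: power2_eq_square)
   finally show ?thesis .
  qed
  moreover have "(2 * n * nu)^2 * (n * (240 * gain z * nuw)) <= 960 * n ^ 3 * A * gain z"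
  proof -
   have "(2 * n * nu)^2 * (n * (240 * gain z * nuw)) = 960 * n ^ 3 * (nu^2 * nuw) * gain z"
    by (simp add: power_mult_distrib power2_eq_square power3_eq_cube)
   also have "... <= 960 * n ^ 3 * A * gain z"
    unfolding A_def using nu n gain_nonneg[of z] by (intro mult_right_mono mult_left_mono power_mono) auto
   finally show ?thesis .
  qed
  ultimately have "(sz z + (sz z)^2) * ((1 + 2 * n * nu) * (2 * n * nuw)) + sz z ^ 3 * ((2 * n * nu)^2 * (n * (240 * gain z * nuw)))
    <= (sz z + (sz z)^2) * (4 * n^2 * A) + sz z ^ 3 * (960 * n ^ 3 * A * gain z)"
   using s by (intro add_mono mult_left_mono) auto
  also have "... <= (4 * n^2 + 960 * n ^ 3) * A * sigd z"
  proof -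
   define x where "x = sz z + (sz z)^2"
   define y where "y = sz z ^ 3 * gain z"
   have xy: "0 <= x" "0 <= y" using s gain_nonneg[of z] by (auto simp: x_def y_def)
   have "0 <= n ^ 3 * A * x" "0 <= n^2 * A * y" using xy A n by auto
   moreover have "(4 * n^2 + 960 * n ^ 3) * A * (x + y) = x * (4 * n^2 * A) + 960 * n ^ 3 * A * y + 960 * (n ^ 3 * A * x) + 4 * (n^2 * A * y)"
    by (simp add: algebra_simps)
   ultimately have "x * (4 * n^2 * A) + 960 * n ^ 3 * A * y <= (4 * n^2 + 960 * n ^ 3) * A * (x + y)" by linarith
   then show ?thesis using z by (simp add: sigd_def x_def y_def mult_ac)
  qed
  finally have "L * ((sz z + (sz z)^2) * (1 + 2 * n * nu) * (2 * n * nuw) + sz z ^ 3 * (2 * n * nu)^2 * (n * (240 * gain z * nuw)))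
    <= L * ((4 * n^2 + 960 * n ^ 3) * A * sigd z)"
   using L by (intro mult_left_mono) (simp_all only: mult.assoc)
  then have le: "L * ((sz z + (sz z)^2) * (1 + 2 * n * nu) * (2 * n * nuw) + sz z ^ 3 * (2 * n * nu)^2 * (n * (240 * gain z * nuw)))
    <= L' * ((1 + nu)^2 * nuw) * sigd z" by (simp only: L'_def A_def mult.assoc)
  have wb: "wbound (2 * n * nu) (rel z u) (%i. rel z (%j. u1 j i)) (%i k. rel z (%j. u2 j i k))"
    "wbound (2 * n * nu) (rel z v) (%i. rel z (%j. v1 j i)) (%i k. rel z (%j. v2 j i k))"
   using rel_wbound[OF u(2), of z] rel_wbound[OF v(2), of z] by (simp_all add: n_def mult_ac)
  have wbd: "wbound (2 * n * nuw) (%x. rel z u x - rel z v x) (%i x. rel z (%j. u1 j i) x - rel z (%j. v1 j i) x)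
   (%i k x. rel z (%j. u2 j i k) x - rel z (%j. v2 j i k) x)"
   using wbound_rel_diff[OF w, of z] by (simp add: n_def mult_ac)
  have "Lb 6 (%x. rel z u x - rel z v x) (n * (240 * gain z * nuw))"
   unfolding rel_diff n_def using rel_6[OF c field_diff[OF u(1) v(1)] w z] .
  from wbound_mono[OF L2[OF pot weight_az s rel_wclass[OF u(1)] wb(1) rel_wclass[OF v(1)] wb(2) wbd this] le]
  show "wdist (L' * ((1 + nu)^2 * nuw) * sigd z) (T0 u z) (%i. T1 u u1 i z) (%i k. T2 u u1 u2 i k z)
   (T0 v z) (%i. T1 v v1 i z) (%i k. T2 v v1 v2 i k z)"
   by (simp only: T0_def T1_def T2_def)
 qed
 qed
qed

text \<open>Second derivatives on the whole space, in contrast to \<open>wclass\<close>, where they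
  are available only after a cutoff.\<close>

definition h2 where
 "h2 p p1 p2 \<longleftrightarrow> (\<forall>i. DQ i p (p1 i)) \<and> (\<forall>i k. DQ k (p1 i) (p2 i k))"

section \<open>Integration against the tensile kernel\<close>

lemma nn_integral_three_kernels:
 fixes a b c :: "'a => real"
 assumes [measurable]: "a \<in> borel_measurable M" "b \<in> borel_measurable M" "c \<in> borel_measurable M"
  and 0: "!!z. 0 <= a z" "!!z. 0 <= b z" "!!z. 0 <= c z" "0 <= N" "0 <= A" "0 <= B" "0 <= C"
  and I: "(\<integral>\<^sup>+z. ennreal (a z) \<partial>M) <= ennreal A" "(\<integral>\<^sup>+z. ennreal (b z) \<partial>M) <= ennreal B" "(\<integral>\<^sup>+z. ennreal (c z) \<partial>M) <= ennreal C"
 shows "(\<integral>\<^sup>+z. ennreal (N * (a z + b z + c z)) \<partial>M) <= ennreal (N * (A + B + C))"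
proof -
 have "(\<integral>\<^sup>+z. ennreal (N * (a z + b z + c z)) \<partial>M) = (\<integral>\<^sup>+z. ennreal N * (ennreal (a z) + ennreal (b z) + ennreal (c z)) \<partial>M)"
  using 0 by (intro nn_integral_cong) (simp add: ennreal_mult ennreal_plus[symmetric] del: ennreal_plus)
 also have "... = ennreal N * ((\<integral>\<^sup>+z. ennreal (a z) \<partial>M) + (\<integral>\<^sup>+z. ennreal (b z) \<partial>M) + (\<integral>\<^sup>+z. ennreal (c z) \<partial>M))"
  by (simp add: nn_integral_cmult nn_integral_add)
 also have "... <= ennreal N * (ennreal A + ennreal B + ennreal C)" by (intro mult_left_mono add_mono I) auto
 also have "... = ennreal (N * (A + B + C))" using 0 by (simp add: ennreal_mult ennreal_plus[symmetric] del: ennreal_plus)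
 finally show ?thesis .
qed

lemma powr_le_scaled:
 fixes r R p q :: real
 assumes "0 < r" "r <= R" "q <= p"
 shows "r powr p <= R powr (p - q) * r powr q"
proof -
 have "r powr p = r powr (p - q) * r powr q" by (simp add: powr_add[symmetric])
 also have "... <= R powr (p - q) * r powr q" using assms by (intro mult_right_mono powr_mono2) auto
 finally show ?thesis .
qed

context tensile
begin

text \<open>Multiplied with the |z|^(-1/2) of the kernel, s and s^2 give |z|^(-1) and |z|^(-3/2),
  and s^3 with the gain gives |z|^(-be). The most singular power decides the exponent of r; the
  others are absorbed by powers of R, which is where r <= R enters.\<close>

lemma kernel_sig:
 fixes R :: real
 assumes R: "0 < R"
 obtains S where "0 <= S"
  "!!kk N r. 0 <= N ==> 0 < r ==> r <= R ==> (!!z::real^'n. \<bar>kk z\<bar> <= N * (indicator (ball 0 r) z * norm z powr (- 1 / 2))) ==>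
   (nni (%z. \<bar>kk z\<bar> * sigs z)) <= ennreal (N * S * r powr (real CARD('n) - 3 / 2))"
  "!!kk N r. 0 <= N ==> 0 < r ==> r <= R ==> (!!z::real^'n. \<bar>kk z\<bar> <= N * (indicator (ball 0 r) z * norm z powr (- 1 / 2))) ==>
   (nni (%z. \<bar>kk z\<bar> * sigd z)) <= ennreal (N * S * r powr (real CARD('n) - 2))"
proof -
 \<comment> \<open>The exponent 2 diminished by the gain 1/6 in dimension two, so that it stays
   below the dimension in both cases.\<close>
 define be :: real where "be = (if CARD('n) = 2 then 11 / 6 else 2)"
 have be: "0 <= be" "be < DIM(real^'n)" "be <= 2" using dim by (auto simp: be_def)
 have d2: "2 <= real CARD('n)" using dim by auto
 define I where "I al r z = indicator (ball (0::real^'n) r) z * norm z powr (- al)" for al r :: real and z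
 have I0: "0 <= I al r z" for al r z by (simp add: I_def)
 have Im[measurable]: "I al r \<in> bmeas" for al r
 proof -
  have [measurable]: "ball (0::real^'n) r \<in> sets borel" by simp
  show ?thesis unfolding I_def[abs_def] by measurable
 qed
 obtain A where A: "0 <= A" "!!r. 0 < r ==> (nni (%z. I 1 r z)) <= ennreal (A * r powr (real CARD('n) - 1))"
  using kernel_integral[of 1, where 'a="real^'n"] d2 unfolding I_def by auto
 obtain B where B: "0 <= B" "!!r. 0 < r ==> (nni (%z. I (3/2) r z)) <= ennreal (B * r powr (real CARD('n) - 3 / 2))"
  using kernel_integral[of "3 / 2", where 'a="real^'n"] d2 unfolding I_def by auto
 obtain G where G: "0 <= G" "!!r. 0 < r ==> (nni (%z. I be r z)) <= ennreal (G * r powr (real CARD('n) - be))"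
  using kernel_integral[OF be(1,2)] unfolding I_def by auto
 have h: "norm z powr (- 1 / 2) * sz z = norm z powr - 1" "norm z powr (- 1 / 2) * (sz z)^2 = norm z powr - (3 / 2)"
  "norm z powr (- 1 / 2) * (sz z ^ 3 * gain z) = norm z powr - be" if "z ~= 0" for z
 proof -
  have 2: "(sz z)^2 = norm z powr - 1" "sz z ^ 3 = norm z powr - (3 / 2)"
   using that by (simp_all add: sz_def powr_power)
  show "norm z powr (- 1 / 2) * sz z = norm z powr - 1" by (simp only: sz_def powr_add[symmetric]) simp
  show "norm z powr (- 1 / 2) * (sz z)^2 = norm z powr - (3 / 2)" by (simp only: 2 powr_add[symmetric]) simp
  show "norm z powr (- 1 / 2) * (sz z ^ 3 * gain z) = norm z powr - be"
   unfolding gain_def be_def 2 by (cases "CARD('n) = 2") (simp_all only: if_True if_False powr_add[symmetric] mult_1_right mult.assoc[symmetric], simp_all add: powr_add[symmetric])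
 qed
 have s: "indicator (ball 0 r) z * norm z powr (- 1 / 2) * sigs z = I 1 r z + I (3/2) r z + 0" for r z
 proof (cases "z = 0")
  case False
  then show ?thesis by (simp only: sigs_def I_def if_False distrib_left mult.assoc h[OF False] add_0_right)
 qed (simp add: I_def)
 have d: "indicator (ball 0 r) z * norm z powr (- 1 / 2) * sigd z = I 1 r z + I (3/2) r z + I be r z" for r z
 proof (cases "z = 0")
  case False
  then show ?thesis by (simp only: sigd_def I_def if_False distrib_left mult.assoc h[OF False])
 qed (simp add: I_def)
 define S where "S = A * R powr (1 / 2) + A * R + B + B * R powr (1 / 2) + G * R powr (2 - be)"
 have S0: "0 <= S" using A B G R by (simp add: S_def)
 show thesis
 proof (rule that[OF S0])
  fix kk :: "real^'n => real" and N r :: real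
  assume N: "0 <= N" and r: "0 < r" "r <= R" and k: "!!z. \<bar>kk z\<bar> <= N * (indicator (ball 0 r) z * norm z powr (- 1 / 2))"
  have R0: "0 <= R" using R by simp
  have "(nni (%z. \<bar>kk z\<bar> * sigs z)) <= (nni (%z. N * (I 1 r z + I (3/2) r z + 0)))"
   unfolding s[symmetric] mult.assoc[symmetric]
   using mult_right_mono[OF k less_imp_le[OF sig_pos(1)]] by (intro nn_integral_mono ennreal_leI) (simp add: mult.assoc)
  also have "... <= ennreal (N * (A * r powr (real CARD('n) - 1) + B * r powr (real CARD('n) - 3 / 2) + 0))"
   by (rule nn_integral_three_kernels) (use N A B r I0 in auto)
  also have "... <= ennreal (N * (S * r powr (real CARD('n) - 3 / 2)))"
  proof (intro ennreal_leI mult_left_mono N)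
   have "A * r powr (real CARD('n) - 1) <= A * (R powr (1 / 2) * r powr (real CARD('n) - 3 / 2))"
    using powr_le_scaled[OF r, of "real CARD('n) - 3 / 2" "real CARD('n) - 1"] A by (intro mult_left_mono) auto
   moreover have "0 <= (A * R + B * R powr (1 / 2) + G * R powr (2 - be)) * r powr (real CARD('n) - 3 / 2)"
    using A B G R0 by simp
   ultimately show "A * r powr (real CARD('n) - 1) + B * r powr (real CARD('n) - 3 / 2) + 0 <= S * r powr (real CARD('n) - 3 / 2)"
    by (simp add: S_def algebra_simps)
  qed
  finally show "(nni (%z. \<bar>kk z\<bar> * sigs z)) <= ennreal (N * S * r powr (real CARD('n) - 3 / 2))" by (simp add: mult.assoc)
  have "(nni (%z. \<bar>kk z\<bar> * sigd z)) <= (nni (%z. N * (I 1 r z + I (3/2) r z + I be r z)))"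
   unfolding d[symmetric] mult.assoc[symmetric]
   using mult_right_mono[OF k less_imp_le[OF sig_pos(2)]] by (intro nn_integral_mono ennreal_leI) (simp add: mult.assoc)
  also have "... <= ennreal (N * (A * r powr (real CARD('n) - 1) + B * r powr (real CARD('n) - 3 / 2) + G * r powr (real CARD('n) - be)))"
   by (rule nn_integral_three_kernels) (use N A B G r I0 in auto)
  also have "... <= ennreal (N * (S * r powr (real CARD('n) - 2)))"
  proof (intro ennreal_leI mult_left_mono N)
   have "A * r powr (real CARD('n) - 1) <= A * (R powr 1 * r powr (real CARD('n) - 2))"
    using powr_le_scaled[OF r, of "real CARD('n) - 2" "real CARD('n) - 1"] A by (intro mult_left_mono) auto
   moreover have "B * r powr (real CARD('n) - 3 / 2) <= B * (R powr (1 / 2) * r powr (real CARD('n) - 2))"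
    using powr_le_scaled[OF r, of "real CARD('n) - 2" "real CARD('n) - 3 / 2"] B by (intro mult_left_mono) auto
   moreover have "G * r powr (real CARD('n) - be) <= G * (R powr (2 - be) * r powr (real CARD('n) - 2))"
    using powr_le_scaled[OF r, of "real CARD('n) - 2" "real CARD('n) - be"] G be by (intro mult_left_mono) auto
   moreover have "0 <= (A * R powr (1 / 2) + B) * r powr (real CARD('n) - 2)" using A B by simp
   ultimately show "A * r powr (real CARD('n) - 1) + B * r powr (real CARD('n) - 3 / 2) + G * r powr (real CARD('n) - be) <= S * r powr (real CARD('n) - 2)"
    using R by (simp add: S_def algebra_simps)
  qed
  finally show "(nni (%z. \<bar>kk z\<bar> * sigd z)) <= ennreal (N * S * r powr (real CARD('n) - 2))" by (simp add: mult.assoc)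
 qed
qed

definition I0 where "I0 kk u x = (LINT z|lborel. kk z * T0 u z x)"
definition I1 where "I1 kk u u1 i x = (LINT z|lborel. kk z * T1 u u1 i z x)"
definition I2 where "I2 kk u u1 u2 i k x = (LINT z|lborel. kk z * T2 u u1 u2 i k z x)"

text \<open>Minkowski's inequality with the weights \<open>sigs\<close> and \<open>sigd\<close>
  integrates the estimates over z, and weak derivatives pass under the integral. Integrability for
  almost every x is recorded because it later identifies the components of the vector-valued force
  integral.\<close>

lemma tensile_integral:
 fixes R :: real
 assumes R: "0 < R"
 obtains L where "0 <= L"
  "!!kk N r u u1 u2 nu. 0 <= N ==> 0 < r ==> r <= R ==> kk \<in> bmeas ==>
   (!!z::real^'n. \<bar>kk z\<bar> <= N * (indicator (ball 0 r) z * norm z powr (- 1 / 2))) ==>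
   field D u u1 u2 ==> fbound nu u u1 u2 ==>
   h2 (I0 kk u) (I1 kk u u1) (I2 kk u u1 u2) \<and>
   wbound (L * N * r powr (real CARD('n) - 3 / 2) * (nu + nu^2)) (I0 kk u) (I1 kk u u1) (I2 kk u u1 u2) \<and>
   (AE x in lborel. integrable lborel (%z. kk z * T0 u z x))"
  "!!kk N r u u1 u2 v v1 v2 nu nuw. 0 <= N ==> 0 < r ==> r <= R ==> kk \<in> bmeas ==>
   (!!z::real^'n. \<bar>kk z\<bar> <= N * (indicator (ball 0 r) z * norm z powr (- 1 / 2))) ==>
   field D u u1 u2 ==> fbound nu u u1 u2 ==> field D v v1 v2 ==> fbound nu v v1 v2 ==>
   fdist nuw u u1 u2 v v1 v2 ==>
   wdist (L * N * r powr (real CARD('n) - 2) * ((1 + nu)^2 * nuw)) (I0 kk u) (I1 kk u u1) (I2 kk u u1 u2) (I0 kk v) (I1 kk v v1) (I2 kk v v1 v2)"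
proof -
 show thesis
 proof (rule kernel_sig[OF R], rule tensile_pointwise[OF dim PotD(7)[OF pot] WeightD(1)[OF weight]], goal_cases)
 case (1 S L)
 note S = 1(1) and Ss = 1(2) and Sd = 1(3) and L = 1(4) and Ls = 1(5)[OF tensile_axioms] and Ld = 1(6)[OF tensile_axioms]
 \<comment> \<open>At the origin the kernel bound is zero, since \<open>0 powr a\<close> is 0; hence
   only z different from 0 has to be estimated.\<close>
 have k0: "kk z ~= 0 ==> z ~= 0" if "!!z::real^'n. \<bar>kk z\<bar> <= N * (indicator (ball 0 r) z * norm z powr (- 1 / 2))" for kk N r z
  using that[of 0] by auto
 have single: "Lb 2 (I0 kk u) (N * S * r powr (real CARD('n) - 3 / 2) * (L * (nu + nu^2)))" (is ?P)
   "Lb 2 (I1 kk u u1 i) (N * S * r powr (real CARD('n) - 3 / 2) * (L * (nu + nu^2)))" (is ?Q)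
   "Lb 2 (I2 kk u u1 u2 i k) (N * S * r powr (real CARD('n) - 3 / 2) * (L * (nu + nu^2)))" (is ?R)
   "weak_dir UNIV (axis i 1) (I0 kk u) (I1 kk u u1 i)" (is ?S) "weak_dir UNIV (axis k 1) (I1 kk u u1 i) (I2 kk u u1 u2 i k)" (is ?T)
   "AE x in lborel. integrable lborel (%z. kk z * T0 u z x)" (is ?A) "AE x in lborel. integrable lborel (%z. kk z * T1 u u1 i z x)" (is ?B)
   "AE x in lborel. integrable lborel (%z. kk z * T2 u u1 u2 i k z x)" (is ?C)
  if N: "0 <= N" and r: "0 < r" "r <= R" and [measurable]: "kk \<in> bmeas"
   and k: "!!z::real^'n. \<bar>kk z\<bar> <= N * (indicator (ball 0 r) z * norm z powr (- 1 / 2))"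
   and u: "field D u u1 u2" and b: "fbound nu u u1 u2" for kk N r u u1 u2 nu i k
 proof -
  note T = T_measurable[OF u] and kz = k0[OF k]
  have S': "0 <= N * S * r powr (real CARD('n) - 3 / 2)" and b': "0 <= L * (nu + nu^2)"
   using N S L fbound_nonneg[OF b] by auto
  note P = Lb_param_integral[OF _ _ _ sig_pos(1) _ Ss[OF N r k] S' b']
  show ?P ?A using P[OF T(1)] wboundD(1)[OF Ls[OF u b kz]] unfolding I0_def by auto
  show ?Q ?B using P[OF T(2)] wboundD(2)[OF Ls[OF u b kz]] unfolding I1_def by auto
  show ?R ?C using P[OF T(3)] wboundD(3)[OF Ls[OF u b kz]] unfolding I2_def by auto
  note Q = param_weak_dir[OF _ _ _ _ sig_pos(1) _ _ Ss[OF N r k] S' b' b']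
  show ?S unfolding I0_def I1_def using wboundD[OF Ls[OF u b kz]] T_weak(1)[OF u kz] by (intro Q[OF T(1,2)]) auto
  show ?T unfolding I1_def I2_def using wboundD[OF Ls[OF u b kz]] T_weak(2)[OF u kz] by (intro Q[OF T(2,3)]) auto
 qed
 show thesis
 proof (rule that[of "S * L"])
  show "0 <= S * L" using S L by simp
  fix kk N r u u1 u2 nu
  assume a: "0 <= N" "0 < r" "r <= R" "kk \<in> bmeas"
   "!!z::real^'n. \<bar>kk z\<bar> <= N * (indicator (ball 0 r) z * norm z powr (- 1 / 2))" "field D u u1 u2" "fbound nu u u1 u2"
  note s = single[OF a]
  have h: "h2 (I0 kk u) (I1 kk u u1) (I2 kk u u1 u2)"
   unfolding h2_def using s(1-3)[THEN sqI] s by (auto intro!: weak_dir_DQ sqI)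
  have e: "S * L * N * r powr (real CARD('n) - 3 / 2) * (nu + nu^2) = N * S * r powr (real CARD('n) - 3 / 2) * (L * (nu + nu^2))" by (simp add: mult_ac)
  show "h2 (I0 kk u) (I1 kk u u1) (I2 kk u u1 u2) \<and>
   wbound (S * L * N * r powr (real CARD('n) - 3 / 2) * (nu + nu^2)) (I0 kk u) (I1 kk u u1) (I2 kk u u1 u2) \<and>
   (AE x in lborel. integrable lborel (%z. kk z * T0 u z x))"
   unfolding wbound_def e using s h by auto
 next
  fix kk N r u u1 u2 v v1 v2 nu nuw
  assume a: "0 <= N" "0 < r" "r <= R" "kk \<in> bmeas"
   "!!z::real^'n. \<bar>kk z\<bar> <= N * (indicator (ball 0 r) z * norm z powr (- 1 / 2))"
   and u: "field D u u1 u2" "fbound nu u u1 u2" and v: "field D v v1 v2" "fbound nu v v1 v2"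
   and w: "fdist nuw u u1 u2 v v1 v2"
  note su = single[OF a u] and sv = single[OF a v] and kz = k0[OF a(5)]
  have [measurable]: "kk \<in> bmeas" by fact
  note [measurable] = T_measurable[OF u(1)] T_measurable[OF v(1)]
  have S': "0 <= N * S * r powr (real CARD('n) - 2)" and b': "0 <= L * ((1 + nu)^2 * nuw)"
   using a S L fbound_nonneg[OF w] by auto
  \<comment> \<open>The difference of two integrals is the integral of the difference only where
    both integrands are integrable, that is for almost every x.\<close>
  have P: "Lb 2 (%x. (LINT z|lborel. kk z * f z x) - (LINT z|lborel. kk z * g z x)) (N * S * r powr (real CARD('n) - 2) * (L * ((1 + nu)^2 * nuw)))"
   if [measurable]: "case_prod f \<in> borel_measurable (borel \<Otimes>\<^sub>M borel)" "case_prod g \<in> borel_measurable (borel \<Otimes>\<^sub>M borel)"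
    and l: "!!z. z ~= 0 ==> Lb 2 (%x. f z x - g z x) (L * ((1 + nu)^2 * nuw) * sigd z)"
    and f: "AE x in lborel. integrable lborel (%z. kk z * f z x)" "Lb 2 (%x. LINT z|lborel. kk z * f z x) al"
    and g: "AE x in lborel. integrable lborel (%z. kk z * g z x)" "Lb 2 (%x. LINT z|lborel. kk z * g z x) be"
   for f g :: "real^'n => real^'n => real" and al be
  proof (rule Lb_cong_AE)
   have "case_prod (%z x. f z x - g z x) \<in> borel_measurable (borel \<Otimes>\<^sub>M borel)" unfolding split_beta' by measurable
   from Lb_param_integral(1)[OF this a(4) sig_measurable(2) sig_pos(2) l[OF kz] Sd[OF a(1-3,5)] S' b']
   show "Lb 2 (%x. LINT z|lborel. kk z * (f z x - g z x)) (N * S * r powr (real CARD('n) - 2) * (L * ((1 + nu)^2 * nuw)))" by simp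
   show "(%x. (LINT z|lborel. kk z * f z x) - (LINT z|lborel. kk z * g z x)) \<in> bmeas"
    using LbD(1)[OF f(2)] LbD(1)[OF g(2)] by measurable
   show "AE x in lborel. (LINT z|lborel. kk z * f z x) - (LINT z|lborel. kk z * g z x) = (LINT z|lborel. kk z * (f z x - g z x))"
    using f(1) g(1) by eventually_elim (simp add: right_diff_distrib Bochner_Integration.integral_diff)
  qed
  note d = wboundD(1-3)[OF Ld[OF u v w]]
  have e: "S * L * N * r powr (real CARD('n) - 2) * ((1 + nu)^2 * nuw) = N * S * r powr (real CARD('n) - 2) * (L * ((1 + nu)^2 * nuw))" by (simp add: mult_ac)
  show "wdist (S * L * N * r powr (real CARD('n) - 2) * ((1 + nu)^2 * nuw)) (I0 kk u) (I1 kk u u1) (I2 kk u u1 u2) (I0 kk v) (I1 kk v v1) (I2 kk v v1 v2)"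
   unfolding wbound_def e
  proof (intro conjI allI)
   show "Lb 2 (%x. I0 kk u x - I0 kk v x) (N * S * r powr (real CARD('n) - 2) * (L * ((1 + nu)^2 * nuw)))"
    unfolding I0_def using d su(1,6) sv(1,6) unfolding I0_def by (intro P) (auto intro: T_measurable[OF u(1)] T_measurable[OF v(1)])
   show "Lb 2 (%x. I1 kk u u1 i x - I1 kk v v1 i x) (N * S * r powr (real CARD('n) - 2) * (L * ((1 + nu)^2 * nuw)))" for i
    unfolding I1_def using d su(2,7) sv(2,7) unfolding I1_def by (intro P) (auto intro: T_measurable[OF u(1)] T_measurable[OF v(1)])
   show "Lb 2 (%x. I2 kk u u1 u2 i k x - I2 kk v v1 v2 i k x) (N * S * r powr (real CARD('n) - 2) * (L * ((1 + nu)^2 * nuw)))" for i k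
    unfolding I2_def using d su(3,8) sv(3,8) unfolding I2_def by (intro P) (auto intro: T_measurable[OF u(1)] T_measurable[OF v(1)])
  qed
 qed
 qed
qed

end

subsection \<open>The dilatational force\<close>

definition Mult2 :: "real => (real^'n => real) => ('n => real^'n => real) => ('n => 'n => real^'n => real) => bool" where
 "Mult2 K b b1 b2 \<longleftrightarrow> (\<forall>i. Mult K i b (b1 i)) \<and> (\<forall>i k. Mult K k (b1 i) (b2 i k))"

lemma Weight_Mult2: "Weight K E a a1 a2 ==> Mult2 K a a1 a2"
 by (simp add: Mult2_def WeightD)

definition pr0 where "pr0 b p x = b x * p x" for b p :: "real^'n => real"

definition pr1 where
 "pr1 b b1 p p1 i x = b1 i x * p x + b x * p1 i x"

definition pr2 where
 "pr2 b b1 b2 p p1 p2 i k x = (b2 i k x * p x + b1 i x * p1 k x) + (b1 k x * p1 i x + b x * p2 i k x)"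

lemma pr_diff:
 "pr0 b p x - pr0 b q x = pr0 b (%x. p x - q x) x"
 "pr1 b b1 p p1 i x - pr1 b b1 q q1 i x = pr1 b b1 (%x. p x - q x) (%i x. p1 i x - q1 i x) i x"
 "pr2 b b1 b2 p p1 p2 i k x - pr2 b b1 b2 q q1 q2 i k x =
   pr2 b b1 b2 (%x. p x - q x) (%i x. p1 i x - q1 i x) (%i k x. p2 i k x - q2 i k x) i k x"
 by (simp_all add: pr0_def pr1_def pr2_def algebra_simps)

lemma pr_wbound:
 assumes M: "Mult2 K b b1 b2" and p: "wbound nu p p1 p2"
 shows "wbound (4 * K * nu) (pr0 b p) (pr1 b b1 p p1) (pr2 b b1 b2 p p1 p2)"
proof -
 note D = wboundD[OF p]
 have b: "Mult K i b (b1 i)" "Mult K k (b1 i) (b2 i k)" for i k using M by (simp_all add: Mult2_def)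
 have K: "\<bar>K\<bar> = K" using MultD(7)[OF b(1)] by simp
 have c: "0 <= K * nu" using MultD(7)[OF b(1)] D by simp
 have bm: "Lb 2 f nu ==> Lb 2 (%x. b x * f x) (K * nu)" "Lb 2 f nu ==> Lb 2 (%x. b1 i x * f x) (K * nu)"
  "Lb 2 f nu ==> Lb 2 (%x. b2 i k x * f x) (K * nu)" for f i k
  using Lb_bounded_mult[of 2 f nu _ K, unfolded K] MultD(1,3)[OF b(1)] MultD(1,3)[OF b(2)] MultD(2,4)[OF b(2)] by auto
 have "Lb 2 (pr0 b p) (4 * (K * nu))" unfolding pr0_def by (rule Lb_mono[OF bm(1)[OF D(1)]]) (use c in simp)
 moreover have "Lb 2 (pr1 b b1 p p1 i) (4 * (K * nu))" for i
  unfolding pr1_def by (rule Lb_mono[OF Lb_add[OF bm(2)[OF D(1)] bm(1)[OF D(2)]]]) (use c in simp_all)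
 moreover have "Lb 2 (pr2 b b1 b2 p p1 p2 i k) (4 * (K * nu))" for i k
  unfolding pr2_def
  by (rule Lb_mono[OF Lb_add[OF Lb_add[OF bm(3)[OF D(1)] bm(2)[OF D(2)]] Lb_add[OF bm(2)[OF D(2)] bm(1)[OF D(3)]]]]) (use c in simp_all)
 ultimately show ?thesis by (simp add: wbound_def mult.assoc)
qed

lemma pr_h2:
 assumes M: "Mult2 K b b1 b2" and p: "h2 p p1 p2"
 shows "h2 (pr0 b p) (pr1 b b1 p p1) (pr2 b b1 b2 p p1 p2)"
proof -
 have b: "Mult K i b (b1 i)" "Mult K k (b1 i) (b2 i k)" for i k using M by (simp_all add: Mult2_def)
 have p: "DQ i p (p1 i)" "DQ k (p1 i) (p2 i k)" for i k using p by (simp_all add: h2_def)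
 show ?thesis
  unfolding h2_def pr0_def pr1_def pr2_def using DQ_mult[OF b(1) p(1)] DQ_add[OF DQ_mult[OF b(2) p(1)] DQ_mult[OF b(1) p(2)]] by blast
qed

text \<open>A twice differentiable multiplier that vanishes outside E is an admissible cutoff, so
  the product gains second derivatives on the whole space.\<close>

lemma pr_wclass_h2:
 assumes M: "Mult2 K b b1 b2" and p: "wclass E p p1 p2" and b0: "!!x. x \<notin> E ==> b x = 0"
 shows "h2 (pr0 b p) (pr1 b b1 p p1) (pr2 b b1 b2 p p1 p2)"
proof -
 have b: "Mult K i b (b1 i)" "Mult K k (b1 i) (b2 i k)" for i k using M by (simp_all add: Mult2_def)
 show ?thesis
  unfolding h2_def pr0_def pr1_def pr2_def
  using DQ_mult[OF b(1) wclassD(1)[OF p]] DQ_add[OF DQ_mult[OF b(2) wclassD(1)[OF p]] wclassD(5)[OF p b(1) b0]] by blast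
qed

lemma h2_wclass:
 assumes "h2 p p1 p2"
 shows "wclass E p p1 p2"
proof -
 have p: "DQ i p (p1 i)" "DQ k (p1 i) (p2 i k)" for i k using assms by (simp_all add: h2_def)
 show ?thesis unfolding wclass_def using p DQ_sq(2)[OF p(2)] DQ_mult[OF _ p(2)] by blast
qed

lemma pr_wclass:
 assumes M: "Mult2 K b b1 b2" and p: "wclass E p p1 p2"
 shows "wclass E (pr0 b p) (pr1 b b1 p p1) (pr2 b b1 b2 p p1 p2)"
proof -
 have b: "Mult K i b (b1 i)" "Mult K k (b1 i) (b2 i k)" for i k using M by (simp_all add: Mult2_def)
 have s: "sq (pr2 b b1 b2 p p1 p2 i k)" for i k
 proof -
  note m = sq_bounded_mult[OF _ MultD(1)[OF b(1)] MultD(3)[OF b(1)]] sq_bounded_mult[OF _ MultD(1)[OF b(2)] MultD(3)[OF b(2)]]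
   sq_bounded_mult[OF _ MultD(2)[OF b(2)] MultD(4)[OF b(2)]]
  show ?thesis unfolding pr2_def by (intro sq_add m wclassD(2-4)[OF p])
 qed
 have "DQ k (%x. rho x * pr1 b b1 p p1 i x) (%x. rho' x * pr1 b b1 p p1 i x + rho x * pr2 b b1 b2 p p1 p2 i k x)"
  if r: "Mult K' k rho rho'" and r0: "!!x. x \<notin> E ==> rho x = 0" for K' rho rho' i k
 proof -
  have "DQ k (%x. (rho x * b1 i x) * p x + (rho x * b x) * p1 i x)
   (%x. ((rho' x * b1 i x + rho x * b2 i k x) * p x + (rho x * b1 i x) * p1 k x) +
     ((rho' x * b x + rho x * b1 k x) * p1 i x + (rho x * b x) * p2 i k x))"
   using r0 by (intro DQ_add DQ_mult[OF Mult_prod[OF r b(2)] wclassD(1)[OF p]] wclassD(5)[OF p Mult_prod[OF r b(1)]]) simp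
  then show ?thesis by (simp add: pr1_def pr2_def algebra_simps)
 qed
 then show ?thesis
  unfolding wclass_def using s DQ_mult[OF b(1) wclassD(1)[OF p]] by (auto simp: pr0_def[abs_def] pr1_def[abs_def])
qed

section \<open>Correlation with an integrable kernel\<close>

definition conv :: "(real^'n => real) => (real^'n => real) => real^'n => real" where
 "conv k p x = (LINT z|lborel. k z * p (x + z))"

definition kern :: "real => (real^'n => real) => bool" where
 "kern N k \<longleftrightarrow> 0 <= N \<and> k \<in> bmeas \<and> (\<integral>\<^sup>+z. ennreal \<bar>k z\<bar> \<partial>lborel) <= ennreal N"

lemma kernD:
 assumes "kern N k"
 shows "0 <= N" "k \<in> bmeas" "(\<integral>\<^sup>+z. ennreal \<bar>k z\<bar> \<partial>lborel) <= ennreal N"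
 using assms by (auto simp: kern_def)

lemma kern_bounded:
 assumes k: "kern N k" and c: "c \<in> bmeas" "!!z. \<bar>c z\<bar> <= B"
 shows "integrable lborel (%z. k z * c z)" "\<bar>LINT z|lborel. k z * c z\<bar> <= N * B"
proof -
 note [measurable] = kernD(2)[OF k] c(1)
 have i: "integrable lborel k"
  using kernD(3)[OF k] by (intro integrableI_bounded) (auto simp: le_less_trans)
 have "ennreal (LINT z|lborel. \<bar>k z\<bar>) <= ennreal N"
  using kernD(3)[OF k] i by (subst nn_integral_eq_integral[symmetric]) auto
 then have N: "(LINT z|lborel. \<bar>k z\<bar>) <= N" using kernD(1)[OF k] by simp
 have B: "0 <= B" using c(2)[of 0] by linarith
 show *: "integrable lborel (%z. k z * c z)"
  using integrable_bounded_times[OF i, of c B] c by (simp add: mult.commute)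
 have "\<bar>LINT z|lborel. k z * c z\<bar> <= (LINT z|lborel. \<bar>k z * c z\<bar>)" by (rule integral_abs_bound)
 also have "... <= (LINT z|lborel. \<bar>k z\<bar> * B)"
  by (rule integral_mono[OF integrable_abs[OF *]]) (use i c(2) in \<open>auto simp: abs_mult intro!: mult_left_mono\<close>)
 also have "... <= N * B" using N B by (simp add: mult_right_mono)
 finally show "\<bar>LINT z|lborel. k z * c z\<bar> <= N * B" .
qed

lemma conv_Lb:
 assumes k: "kern N k" and p: "Lb 2 p b"
 shows "Lb 2 (conv k p) (N * b)" "AE x in lborel. integrable lborel (%z. k z * p (x + z))"
proof -
 note [measurable] = LbD(1)[OF p]
 have "case_prod (%z x. p (x + z)) \<in> borel_measurable (borel \<Otimes>\<^sub>M borel)" unfolding split_beta' by measurable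
 note P = Lb_param_integral[OF this kernD(2)[OF k], of "%_. 1" b N]
 show "Lb 2 (conv k p) (N * b)" "AE x in lborel. integrable lborel (%z. k z * p (x + z))"
  unfolding conv_def[abs_def] using P kernD[OF k] Lb_translate[OF p] LbD(2)[OF p] by auto
qed

lemma conv_diff:
 assumes k: "kern N k" and p: "Lb 2 p b" and q: "Lb 2 q b'" and d: "Lb 2 (%x. p x - q x) c"
 shows "Lb 2 (%x. conv k p x - conv k q x) (N * c)"
proof (rule Lb_cong_AE[OF conv_Lb(1)[OF k d]])
 show "(%x. conv k p x - conv k q x) \<in> bmeas"
  using LbD(1)[OF conv_Lb(1)[OF k p]] LbD(1)[OF conv_Lb(1)[OF k q]] by measurable
 show "AE x in lborel. conv k p x - conv k q x = conv k (%x. p x - q x) x"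
  using conv_Lb(2)[OF k p] conv_Lb(2)[OF k q]
  by eventually_elim (simp add: conv_def right_diff_distrib Bochner_Integration.integral_diff)
qed

lemma conv_DQ:
 assumes k: "kern N k" and p: "DQ i p q"
 shows "DQ i (conv k p) (conv k q)"
proof -
 obtain b b' where b: "Lb 2 p b" and b': "Lb 2 q b'" using DQ_sq[OF p] by (auto simp: sq_def)
 note [measurable] = LbD(1)[OF b] LbD(1)[OF b']
 have m: "case_prod (%z x. p (x + z)) \<in> borel_measurable (borel \<Otimes>\<^sub>M borel)" "case_prod (%z x. q (x + z)) \<in> borel_measurable (borel \<Otimes>\<^sub>M borel)"
  unfolding split_beta' by measurable
 have "weak_dir UNIV (axis i 1) (conv k p) (conv k q)"
  unfolding conv_def[abs_def]
  by (rule param_weak_dir[OF m kernD(2)[OF k], of "%_. 1" b b' N])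
   (use kernD[OF k] Lb_translate[OF b] Lb_translate[OF b'] LbD(2)[OF b] LbD(2)[OF b'] DQ_weak_dir[OF DQ_translate[OF p]] in auto)
 then show ?thesis using conv_Lb(1)[OF k b] conv_Lb(1)[OF k b'] by (intro weak_dir_DQ sqI)
qed

lemma conv_wbound: "kern N k ==> wbound nu p p1 p2 ==> wbound (N * nu) (conv k p) (%i. conv k (p1 i)) (%i j. conv k (p2 i j))"
 by (simp add: wbound_def conv_Lb(1))

lemma conv_wbound_diff:
 assumes "kern N k" "wbound nu p p1 p2" "wbound nu' q q1 q2"
  and "wdist c p p1 p2 q q1 q2"
 shows "wbound (N * c) (%x. conv k p x - conv k q x) (%i x. conv k (p1 i) x - conv k (q1 i) x) (%i j x. conv k (p2 i j) x - conv k (q2 i j) x)"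
 using assms unfolding wbound_def by (blast intro: conv_diff)

lemma conv_h2: "kern N k ==> h2 p p1 p2 ==> h2 (conv k p) (%i. conv k (p1 i)) (%i j. conv k (p2 i j))"
 by (simp add: h2_def conv_DQ)

text \<open>Averaging inherits the Lipschitz bound, and the quotients converge under the integral
  because they are dominated by K times the kernel.\<close>

lemma conv_Mult:
 assumes k: "kern N k" and b: "Mult K i b b'"
 shows "Mult (N * K) i (conv k b) (conv k b')"
proof -
 note [measurable] = kernD(2)[OF k] MultD(1,2)[OF b]
 have m: "conv k c \<in> bmeas" if [measurable]: "c \<in> bmeas" for c
  unfolding conv_def[abs_def] by measurable
 have i: "integrable lborel (%z. k z * b (x + z))" for x
  by (rule kern_bounded(1)[OF k _ MultD(3)[OF b]]) measurable
 have diff: "conv k b (x + c) - conv k b x = (LINT z|lborel. k z * (b ((x + z) + c) - b (x + z)))" for x c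
  using i[of "x + c"] i[of x] by (simp add: conv_def right_diff_distrib Bochner_Integration.integral_diff add_ac)
 have bd: "\<bar>conv k c x\<bar> <= N * K" if [measurable]: "c \<in> bmeas" and c: "!!x. \<bar>c x\<bar> <= K" for c x
  unfolding conv_def by (rule kern_bounded(2)[OF k _ c]) measurable
 show ?thesis
  unfolding Mult_def
 proof (intro conjI allI m bd MultD(1-4)[OF b])
  fix x t
  have "\<bar>LINT z|lborel. k z * (b ((x + z) + t *R axis i 1) - b (x + z))\<bar> <= N * (K * \<bar>t\<bar>)"
   by (rule kern_bounded(2)[OF k _ MultD(5)[OF b]]) measurable
  then show "\<bar>conv k b (x + t *R axis i 1) - conv k b x\<bar> <= N * K * \<bar>t\<bar>" by (simp add: diff mult.assoc)
 next
  fix x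
  have e: "dq i n (conv k b) x = (LINT z|lborel. k z * dq i n b (x + z))" for n
   by (simp add: diff divide_inverse mult.assoc[symmetric])
  have ik: "integrable lborel (%z. k z * K)" by (rule kern_bounded[OF k, where B = "\<bar>K\<bar>"]) auto
  show "(%n. dq i n (conv k b) x) \<longlonglongrightarrow> conv k b' x"
   unfolding e unfolding conv_def
  proof (rule integral_dominated_convergence[where w = "%z. \<bar>k z * K\<bar>"])
   show "AE z in lborel. (%n. k z * dq i n b (x + z)) \<longlonglongrightarrow> k z * b' (x + z)"
    using MultD(6)[OF b] by (intro AE_I2 tendsto_mult_left) auto
   show "AE z in lborel. norm (k z * dq i n b (x + z)) <= \<bar>k z * K\<bar>" for n
   proof (rule AE_I2)
    show "norm (k z * dq i n b (x + z)) <= \<bar>k z * K\<bar>" for z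
     unfolding real_norm_def abs_mult using MultD(8)[OF b, of "x + z" n] by (intro mult_left_mono) auto
   qed
   show "integrable lborel (%z. \<bar>k z * K\<bar>)" using ik by (rule integrable_abs)
  qed measurable
 qed
qed

lemma conv_Mult2: "kern N k ==> Mult2 K b b1 b2 ==> Mult2 (N * K) (conv k b) (%i. conv k (b1 i)) (%i j. conv k (b2 i j))"
 by (simp add: Mult2_def conv_Mult)

lemma wbound_add: "wbound nu p p1 p2 ==> wbound nu' q q1 q2 ==>
  wbound (nu + nu') (%x. p x + q x) (%i x. p1 i x + q1 i x) (%i k x. p2 i k x + q2 i k x)"
 by (auto simp: wbound_def intro: Lb_add)

lemma wbound_sum:
 fixes p :: "'n => real^'n => real"
 assumes "!!j. wbound nu (p j) (p1 j) (p2 j)"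
 shows "wbound (real CARD('n) * nu) (%x. \<Sum>j\<in>UNIV. p j x) (%i x. \<Sum>j\<in>UNIV. p1 j i x) (%i k x. \<Sum>j\<in>UNIV. p2 j i k x)"
 using wbound_lincomb[of UNIV, OF assms finite, of "%_. 1"] by simp

lemma h2_add: "h2 p p1 p2 ==> h2 q q1 q2 ==> h2 (%x. p x + q x) (%i x. p1 i x + q1 i x) (%i k x. p2 i k x + q2 i k x)"
 by (auto simp: h2_def intro: DQ_add)

lemma wclass_sum:
 fixes p :: "'n => real^'n => real"
 assumes "!!j. wclass E (p j) (p1 j) (p2 j)"
 shows "wclass E (%x. \<Sum>j\<in>UNIV. p j x) (%i x. \<Sum>j\<in>UNIV. p1 j i x) (%i k x. \<Sum>j\<in>UNIV. p2 j i k x)"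
 using wclass_lincomb[of UNIV, OF assms finite, of "%_. 1"] by simp

section \<open>The dilatation and its nonlinear expression\<close>

context tensile
begin

text \<open>The dilatation averages om(x+z) (u(x+z) - u(x)) against a kernel without singularity, so
  the two terms may be separated. The first is an average of om u, which has second derivatives on
  the whole space; the second is a multiplier times u and stays in \<open>wclass D\<close>.\<close>

definition Q0 where "Q0 kk u j x = conv (kk j) (pr0 om (u j)) x - pr0 (conv (kk j) om) (u j) x"
definition Q1 where "Q1 kk u u1 j i x = conv (kk j) (pr1 om om1 (u j) (u1 j) i) x
 - pr1 (conv (kk j) om) (%i. conv (kk j) (om1 i)) (u j) (u1 j) i x"
definition Q2 where "Q2 kk u u1 u2 j i k x = conv (kk j) (pr2 om om1 om2 (u j) (u1 j) (u2 j) i k) x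
 - pr2 (conv (kk j) om) (%i. conv (kk j) (om1 i)) (%i k. conv (kk j) (om2 i k)) (u j) (u1 j) (u2 j) i k x"

definition dil0 where
 "dil0 kk u x = (\<Sum>j\<in>UNIV. Q0 kk u j x)"
definition dil1 where
 "dil1 kk u u1 i x = (\<Sum>j\<in>UNIV. Q1 kk u u1 j i x)"
definition dil2 where
 "dil2 kk u u1 u2 i k x = (\<Sum>j\<in>UNIV. Q2 kk u u1 u2 j i k x)"

lemma om_Mult2: "Mult2 K om om1 om2" by (rule Weight_Mult2[OF weight])

lemma Q_parts:
 assumes k: "kern N (kk j)" and u: "field D u u1 u2" and b: "fbound nu u u1 u2"
 shows "wclass D (Q0 kk u j) (Q1 kk u u1 j) (Q2 kk u u1 u2 j)"
  "wbound (8 * N * K * nu) (Q0 kk u j) (Q1 kk u u1 j) (Q2 kk u u1 u2 j)"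
  "wbound (4 * K * nu) (pr0 om (u j)) (pr1 om om1 (u j) (u1 j)) (pr2 om om1 om2 (u j) (u1 j) (u2 j))"
proof -
 have uj: "wclass D (u j) (u1 j) (u2 j)" "wbound nu (u j) (u1 j) (u2 j)" using u b by (auto simp: field_def fbound_def)
 show "wclass D (Q0 kk u j) (Q1 kk u u1 j) (Q2 kk u u1 u2 j)"
  unfolding Q0_def[abs_def] Q1_def[abs_def] Q2_def[abs_def]
  by (intro wclass_diff h2_wclass conv_h2[OF k] pr_wclass_h2[OF om_Mult2 uj(1) WeightD(4)[OF weight]]
    pr_wclass[OF conv_Mult2[OF k om_Mult2] uj(1)])
 show p: "wbound (4 * K * nu) (pr0 om (u j)) (pr1 om om1 (u j) (u1 j)) (pr2 om om1 om2 (u j) (u1 j) (u2 j))"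
  by (rule pr_wbound[OF om_Mult2 uj(2)])
 have e: "8 * N * K * nu = N * (4 * K * nu) + 4 * (N * K) * nu" by simp
 show "wbound (8 * N * K * nu) (Q0 kk u j) (Q1 kk u u1 j) (Q2 kk u u1 u2 j)"
  unfolding e Q0_def[abs_def] Q1_def[abs_def] Q2_def[abs_def]
  by (intro wbound_diff conv_wbound[OF k] p pr_wbound[OF conv_Mult2[OF k om_Mult2] uj(2)])
qed

lemma Q_diff:
 assumes k: "kern N (kk j)" and u: "field D u u1 u2" "fbound nu u u1 u2" and v: "field D v v1 v2" "fbound nu v v1 v2"
  and w: "fdist nuw u u1 u2 v v1 v2"
 shows "wdist (8 * N * K * nuw) (Q0 kk u j) (Q1 kk u u1 j) (Q2 kk u u1 u2 j) (Q0 kk v j) (Q1 kk v v1 j) (Q2 kk v v1 v2 j)"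
proof -
 have wj: "wdist nuw (u j) (u1 j) (u2 j) (v j) (v1 j) (v2 j)"
  using w by (auto simp: fbound_def)
 note A = conv_wbound_diff[OF k Q_parts(3)[where kk=kk and j=j, OF k u] Q_parts(3)[where kk=kk and j=j, OF k v], unfolded pr_diff, OF pr_wbound[OF om_Mult2 wj]]
 note B = pr_wbound[OF conv_Mult2[OF k om_Mult2] wj]
 have d: "(a - b) - (a' - b') = (a - a') - (b - b')" for a b a' b' :: real by simp
 have e: "8 * N * K * nuw = N * (4 * K * nuw) + 4 * (N * K) * nuw" by simp
 show ?thesis unfolding e Q0_def Q1_def Q2_def d pr_diff by (rule wbound_diff[OF A B])
qed

lemma dil_parts:
 assumes k: "!!j. kern N (kk j)" and u: "field D u u1 u2" and b: "fbound nu u u1 u2"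
 shows "wclass D (dil0 kk u) (dil1 kk u u1) (dil2 kk u u1 u2)"
  "wbound (real CARD('n) * (8 * N * K * nu)) (dil0 kk u) (dil1 kk u u1) (dil2 kk u u1 u2)"
 unfolding dil0_def[abs_def] dil1_def[abs_def] dil2_def[abs_def]
 by (rule wclass_sum[OF Q_parts(1)[OF k u b]] wbound_sum[OF Q_parts(2)[OF k u b]])+

lemma dil_diff:
 assumes k: "!!j. kern N (kk j)" and u: "field D u u1 u2" "fbound nu u u1 u2" and v: "field D v v1 v2" "fbound nu v v1 v2"
  and w: "fdist nuw u u1 u2 v v1 v2"
 shows "wdist (real CARD('n) * (8 * N * K * nuw)) (dil0 kk u) (dil1 kk u u1) (dil2 kk u u1 u2) (dil0 kk v) (dil1 kk v v1) (dil2 kk v v1 v2)"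
 unfolding dil0_def dil1_def dil2_def sum_subtractf[symmetric] by (rule wbound_sum[OF Q_diff[OF k u v w]])

text \<open>With s = 1, because no singular factor stands in front of the dilatation.\<close>

definition P0 where "P0 kk u = nlw0 1 F om (dil0 kk u)"
definition P1 where "P1 kk u u1 = nlw1 1 F F1 om om1 (dil0 kk u) (dil1 kk u u1)"
definition P2 where "P2 kk u u1 u2 = nlw2 1 F F1 F2 om om1 om2 (dil0 kk u) (dil1 kk u u1) (dil2 kk u u1 u2)"

text \<open>Since N' bounds the mass of all kernels that occur, the constant does not depend on the
  horizon.\<close>

lemma P_estimates:
 fixes N' :: real
 assumes N': "0 <= N'"
 obtains L where "0 <= L"
  "!!kk N u u1 u2 nu. (!!j. kern N (kk j)) ==> N <= N' ==> field D u u1 u2 ==> fbound nu u u1 u2 ==>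
   h2 (P0 kk u) (P1 kk u u1) (P2 kk u u1 u2) \<and> wbound (L * (nu + nu^2)) (P0 kk u) (P1 kk u u1) (P2 kk u u1 u2)"
  "!!kk N u u1 u2 v v1 v2 nu nuw. (!!j. kern N (kk j)) ==> N <= N' ==>
   field D u u1 u2 ==> fbound nu u u1 u2 ==> field D v v1 v2 ==> fbound nu v v1 v2 ==>
   fdist nuw u u1 u2 v v1 v2 ==>
   wdist (L * ((1 + nu)^2 * nuw)) (P0 kk u) (P1 kk u u1) (P2 kk u u1 u2) (P0 kk v) (P1 kk v v1) (P2 kk v v1 v2)"
proof -
 show thesis
 proof (rule nonlinear_estimates[OF dim PotD(7)[OF pot] WeightD(1)[OF weight]], goal_cases)
 case (1 L)
 note L = 1(1) and L1 = 1(2) and L2 = 1(3)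
 define c where "c = real CARD('n) * (8 * N' * K)"
 have K0: "0 <= K" using WeightD(1)[OF weight] by simp
 have c: "0 <= c" using N' K0 by (simp add: c_def)
 have le: "real CARD('n) * (8 * N * K * nu) <= c * nu" if "N <= N'" "0 <= nu" for N nu
  using that K0 by (auto simp: c_def mult.assoc intro!: mult_left_mono mult_right_mono)
 have nw: "nonlinear_weighted C K 1 F F1 F2 D om om1 om2" using pot weight by unfold_locales auto
 define L' where "L' = L * (2 * (c + c^2) + 6 * c ^ 3)"
 show thesis
 proof (rule that[of L'])
  show "0 <= L'" using L c by (simp add: L'_def)
  fix kk :: "'n => real^'n => real" and N u u1 u2 nu
  assume k: "!!j. kern N (kk j)" and N: "N <= N'" and u: "field D u u1 u2" and b: "fbound nu u u1 u2"
  note nu = fbound_nonneg[OF b]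
  note d = dil_parts(1)[where kk=kk, OF k u b] wbound_mono[OF dil_parts(2)[where kk=kk, OF k u b] le[OF N nu]]
  have "2 * (c * nu + (c * nu)^2) <= (2 * (c + c^2) + 6 * c ^ 3) * (nu + nu^2)"
  proof -
   have "0 <= c ^ 3 * (nu + nu^2)" "0 <= c * nu^2" "0 <= c^2 * nu" using c nu by auto
   then show ?thesis by (simp add: algebra_simps)
  qed
  from mult_left_mono[OF this L] have le': "L * ((1 + 1^2) * (c * nu + (c * nu)^2)) <= L' * (nu + nu^2)" by (simp add: L'_def mult.assoc)
  have wb: "wbound (L' * (nu + nu^2)) (P0 kk u) (P1 kk u u1) (P2 kk u u1 u2)"
   unfolding P0_def P1_def P2_def by (rule wbound_mono[OF L1[OF pot weight zero_less_one d] le'])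
  have "DQ i (P0 kk u) (P1 kk u u1 i)" "weak_dir UNIV (axis k 1) (P1 kk u u1 i) (P2 kk u u1 u2 i k)" for i k
   unfolding P0_def P1_def P2_def by (rule nonlinear_weighted.nl0_DQ[OF nw d(1)] nonlinear_weighted.nl1_weak[OF nw d(1)])+
  with wb wboundD(1-3)[OF wb] show "h2 (P0 kk u) (P1 kk u u1) (P2 kk u u1 u2) \<and> wbound (L' * (nu + nu^2)) (P0 kk u) (P1 kk u u1) (P2 kk u u1 u2)"
   unfolding h2_def by (blast intro: weak_dir_DQ sqI)
 next
  fix kk :: "'n => real^'n => real" and N u u1 u2 v v1 v2 nu nuw
  assume k: "!!j. kern N (kk j)" and N: "N <= N'" and u: "field D u u1 u2" "fbound nu u u1 u2"
   and v: "field D v v1 v2" "fbound nu v v1 v2"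
   and w: "fdist nuw u u1 u2 v v1 v2"
  note nu = fbound_nonneg[OF u(2)] fbound_nonneg[OF w]
  note d = dil_parts(1)[where kk=kk, OF k u] wbound_mono[OF dil_parts(2)[where kk=kk, OF k u] le[OF N nu(1)]]
   dil_parts(1)[where kk=kk, OF k v] wbound_mono[OF dil_parts(2)[where kk=kk, OF k v] le[OF N nu(1)]]
   wbound_mono[OF dil_diff[where kk=kk, OF k u v w] le[OF N nu(2)]]
  \<comment> \<open>No factor has to be gained here, so Sobolev's inequality gives an L6 bound
    proportional to the distance itself.\<close>
  have m: "Lb 6 (%x. dil0 kk u x - dil0 kk v x) (6 * (c * nuw))"
   by (rule sobolev_6[OF dim DQ_diff[OF wclassD(1)[OF d(1)] wclassD(1)[OF d(3)]] wboundD(1,2)[OF d(5)]])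
  have "(1 + 1^2) * (1 + c * nu) * (c * nuw) + 1 ^ 3 * (c * nu)^2 * (6 * (c * nuw)) <= (2 * (c + c^2) + 6 * c ^ 3) * ((1 + nu)^2 * nuw)"
  proof -
   have "(2 * (c + c^2) + 6 * c ^ 3) * (1 + nu)^2 - (2 * (1 + c * nu) * c + (c * nu)^2 * (6 * c))
    = 2 * c^2 + 6 * c ^ 3 + (2 * (c + c^2) + 6 * c ^ 3) * (2 * nu) + 2 * (c + c^2) * nu^2 - 2 * c^2 * nu"
    by (simp add: power2_eq_square power3_eq_cube algebra_simps)
   also have "... = 2 * c^2 + 6 * c ^ 3 + (4 * c + 2 * c^2 + 12 * c ^ 3) * nu + 2 * (c + c^2) * nu^2" by (simp add: algebra_simps)
   also have "... >= 0" using c nu by (intro add_nonneg_nonneg mult_nonneg_nonneg) auto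
   finally have "2 * (1 + c * nu) * c + (c * nu)^2 * (6 * c) <= (2 * (c + c^2) + 6 * c ^ 3) * (1 + nu)^2" by simp
   from mult_right_mono[OF this nu(2)] show ?thesis by (simp add: algebra_simps)
  qed
  from mult_left_mono[OF this L]
  have le': "L * ((1 + 1^2) * (1 + c * nu) * (c * nuw) + 1 ^ 3 * (c * nu)^2 * (6 * (c * nuw))) <= L' * ((1 + nu)^2 * nuw)"
   by (simp only: L'_def mult.assoc)
  show "wdist (L' * ((1 + nu)^2 * nuw)) (P0 kk u) (P1 kk u u1) (P2 kk u u1 u2) (P0 kk v) (P1 kk v v1) (P2 kk v v1 v2)"
   unfolding P0_def P1_def P2_def by (rule wbound_mono[OF L2[OF pot weight zero_less_one d m] le'])
 qed
 qed
qed

text \<open>The dilatational integral after separating g'(theta(y)) from g'(theta(x)). Each is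
  multiplied with the boundary weight at its own point, and the other weight stays outside or inside
  the average.\<close>

definition D0 where "D0 kk u j x = pr0 om (conv (kk j) (P0 kk u)) x + pr0 (conv (kk j) om) (P0 kk u) x"
definition D1 where "D1 kk u u1 j i x = pr1 om om1 (conv (kk j) (P0 kk u)) (%i. conv (kk j) (P1 kk u u1 i)) i x
 + pr1 (conv (kk j) om) (%i. conv (kk j) (om1 i)) (P0 kk u) (P1 kk u u1) i x"
definition D2 where "D2 kk u u1 u2 j i k x =
 pr2 om om1 om2 (conv (kk j) (P0 kk u)) (%i. conv (kk j) (P1 kk u u1 i)) (%i k. conv (kk j) (P2 kk u u1 u2 i k)) i k x
 + pr2 (conv (kk j) om) (%i. conv (kk j) (om1 i)) (%i k. conv (kk j) (om2 i k)) (P0 kk u) (P1 kk u u1) (P2 kk u u1 u2) i k x"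

text \<open>The factor N of the kernel mass is kept, since for the actual kernel it carries the
  ratio of the reduced to the full horizon. The 8 K in the constant comes from two products with the
  factor 4 of \<open>pr_wbound\<close>.\<close>

lemma dilatational_integral:
 fixes N' :: real
 assumes N': "0 <= N'"
 obtains L where "0 <= L"
  "!!kk N u u1 u2 nu j. (!!j. kern N (kk j)) ==> N <= N' ==> field D u u1 u2 ==> fbound nu u u1 u2 ==>
   h2 (D0 kk u j) (D1 kk u u1 j) (D2 kk u u1 u2 j) \<and>
   wbound (L * N * (nu + nu^2)) (D0 kk u j) (D1 kk u u1 j) (D2 kk u u1 u2 j)"
  "!!kk N u u1 u2 v v1 v2 nu nuw j. (!!j. kern N (kk j)) ==> N <= N' ==>
   field D u u1 u2 ==> fbound nu u u1 u2 ==> field D v v1 v2 ==> fbound nu v v1 v2 ==>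
   fdist nuw u u1 u2 v v1 v2 ==>
   wdist (L * N * ((1 + nu)^2 * nuw)) (D0 kk u j) (D1 kk u u1 j) (D2 kk u u1 u2 j) (D0 kk v j) (D1 kk v v1 j) (D2 kk v v1 v2 j)"
proof -
 show thesis
 proof (rule P_estimates[OF N'], goal_cases)
 case (1 L)
 note L = 1(1) and L1 = 1(2) and L2 = 1(3)
 have K0: "0 <= K" using WeightD(1)[OF weight] by simp
 have e: "8 * K * L * N * A = 4 * K * (N * (L * A)) + 4 * (N * K) * (L * A)" for N A by simp
 show thesis
 proof (rule that[of "8 * K * L"])
  show "0 <= 8 * K * L" using L K0 by simp
  fix kk :: "'n => real^'n => real" and N u u1 u2 nu j
  assume k: "!!j. kern N (kk j)" and N: "N <= N'" and u: "field D u u1 u2" and b: "fbound nu u u1 u2"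
  note P = L1[OF k N u b, THEN conjunct1] L1[OF k N u b, THEN conjunct2]
  note c = conv_Mult2[OF k om_Mult2]
  have "h2 (D0 kk u j) (D1 kk u u1 j) (D2 kk u u1 u2 j)"
   unfolding D0_def[abs_def] D1_def[abs_def] D2_def[abs_def]
   by (intro h2_add pr_h2[OF om_Mult2 conv_h2[OF k P(1)]] pr_h2[OF c P(1)])
  moreover have "wbound (8 * K * L * N * (nu + nu^2)) (D0 kk u j) (D1 kk u u1 j) (D2 kk u u1 u2 j)"
   unfolding D0_def[abs_def] D1_def[abs_def] D2_def[abs_def] e
   by (intro wbound_add pr_wbound[OF om_Mult2 conv_wbound[OF k P(2)]] pr_wbound[OF c P(2)])
  ultimately show "h2 (D0 kk u j) (D1 kk u u1 j) (D2 kk u u1 u2 j) \<and>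
   wbound (8 * K * L * N * (nu + nu^2)) (D0 kk u j) (D1 kk u u1 j) (D2 kk u u1 u2 j)" ..
 next
  fix kk :: "'n => real^'n => real" and N u u1 u2 v v1 v2 nu nuw j
  assume k: "!!j. kern N (kk j)" and N: "N <= N'" and u: "field D u u1 u2" "fbound nu u u1 u2"
   and v: "field D v v1 v2" "fbound nu v v1 v2"
   and w: "fdist nuw u u1 u2 v v1 v2"
  note P = L1[OF k N u, THEN conjunct2] L1[OF k N v, THEN conjunct2] L2[OF k N u v w]
  have d: "(a + b) - (a' + b') = (a - a') + (b - b')" for a b a' b' :: real by simp
  show "wdist (8 * K * L * N * ((1 + nu)^2 * nuw)) (D0 kk u j) (D1 kk u u1 j) (D2 kk u u1 u2 j) (D0 kk v j) (D1 kk v v1 j) (D2 kk v v1 v2 j)"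
   unfolding D0_def D1_def D2_def d pr_diff e
   by (intro wbound_add pr_wbound[OF om_Mult2 conv_wbound_diff[OF k P]] pr_wbound[OF conv_Mult2[OF k om_Mult2] P(3)])
 qed
 qed
qed

end

subsection \<open>Borel components of Sobolev functions\<close>

lemma integral_lebesgue_borel:
 fixes f g :: "'a::euclidean_space => 'b::euclidean_space"
 assumes f: "f \<in> borel_measurable lebesgue" and g: "g \<in> bmeas" and e: "AE x in lborel. f x = g x"
 shows "integral\<^sup>L lebesgue f = integral\<^sup>L lborel g" "integrable lebesgue f \<longleftrightarrow> integrable lborel g"
proof -
 have g': "g \<in> borel_measurable lborel" "g \<in> borel_measurable lebesgue" using g by (simp_all add: measurable_completion)
 show "integral\<^sup>L lebesgue f = integral\<^sup>L lborel g"
  using integral_cong_AE[OF f g'(2) AE_completion[OF e]] integral_completion[OF g'(1)] by simp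
 show "integrable lebesgue f \<longleftrightarrow> integrable lborel g"
  using integrable_cong_AE[OF f g'(2) AE_completion[OF e]] integrable_completion[OF g'(1)] by simp
qed

text \<open>A chosen Borel representative of one component on D. It vanishes everywhere, and not
  merely almost everywhere, outside D, as the cutoff argument at the boundary requires.\<close>

definition bcomp :: "(real^'n) set => (real^'n => 'b::euclidean_space) => 'b => real^'n => real" where
 "bcomp D f b = (SOME g. g \<in> bmeas \<and> (AE x in lborel. g x = indicator D x * (f x \<bullet> b)) \<and> (\<forall>x. x \<notin> D --> g x = 0))"

lemma bcomp:
 assumes D: "open D" and f: "set_borel_measurable lebesgue D f"
 shows "bcomp D f b \<in> bmeas" "AE x in lborel. bcomp D f b x = indicator D x * (f x \<bullet> b)" "x \<notin> D ==> bcomp D f b x = 0"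
proof -
 have [measurable]: "D \<in> sets borel" using D by simp
 have "(%x. (indicator D x *R f x) \<bullet> b) \<in> borel_measurable lebesgue"
  using f unfolding set_borel_measurable_def by measurable
 then obtain g where g: "g \<in> borel_measurable lborel" "AE x in lborel. (indicator D x *R f x) \<bullet> b = g x"
  using completion_ex_borel_measurable_real by blast
 have [measurable]: "g \<in> bmeas" using g(1) by simp
 have "\<exists>g. g \<in> bmeas \<and> (AE x in lborel. g x = indicator D x * (f x \<bullet> b)) \<and> (\<forall>x. x \<notin> D --> g x = 0)"
 proof (intro exI[of _ "%x. indicator D x * g x"] conjI)
  show "(%x. indicator D x * g x) \<in> bmeas" by measurable
  show "AE x in lborel. indicator D x * g x = indicator D x * (f x \<bullet> b)"
   using g(2) by eventually_elim (auto split: split_indicator)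
 qed auto
 from someI_ex[OF this, folded bcomp_def]
 show "bcomp D f b \<in> bmeas" "AE x in lborel. bcomp D f b x = indicator D x * (f x \<bullet> b)" "x \<notin> D ==> bcomp D f b x = 0"
  unfolding comp_def by blast+
qed

lemma set_borel_measurable_cong_AE:
 fixes f f' :: "real^'n => 'b::euclidean_space"
 assumes "set_borel_measurable lebesgue D f" "AE x in lebesgue. x \<in> D --> f x = f' x"
 shows "set_borel_measurable lebesgue D f'"
 unfolding set_borel_measurable_def
 by (rule borel_measurable_AE[OF assms(1)[unfolded set_borel_measurable_def]])
  (use assms(2) in \<open>eventually_elim, auto split: split_indicator\<close>)

lemma bcomp_cong_AE:
 assumes "open D" "set_borel_measurable lebesgue D f" "AE x in lebesgue. x \<in> D --> f x = f' x"
 shows "AE x in lborel. bcomp D f b x = bcomp D f' b x"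
 using bcomp(2)[OF assms(1,2), of b] bcomp(2)[OF assms(1) set_borel_measurable_cong_AE[OF assms(2,3)], of b] assms(3)[unfolded AE_completion_iff]
 by eventually_elim (auto split: split_indicator)

lemma bcomp_integral:
 assumes D: "open D" and f: "set_borel_measurable lebesgue D f" and [measurable]: "c \<in> bmeas"
 shows "(LINT x:D|lebesgue. c x * (f x \<bullet> b)) = (LINT x|lborel. c x * bcomp D f b x)"
 unfolding set_lebesgue_integral_def
proof (rule integral_lebesgue_borel)
 note [measurable] = bcomp(1)[OF D f]
 have [measurable]: "(%x. (indicator D x *R f x) \<bullet> b) \<in> borel_measurable lebesgue" "c \<in> borel_measurable lebesgue"
  using f unfolding set_borel_measurable_def by (measurable, simp add: measurable_completion)
 have "(%x. c x * ((indicator D x *R f x) \<bullet> b)) \<in> borel_measurable lebesgue" by measurable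
 then show "(%x. indicator D x *R (c x * (f x \<bullet> b))) \<in> borel_measurable lebesgue" by (simp add: mult_ac)
 show "(%x. c x * bcomp D f b x) \<in> bmeas" by measurable
 show "AE x in lborel. indicator D x *R (c x * (f x \<bullet> b)) = c x * bcomp D f b x"
  using bcomp(2)[OF D f, of b] by eventually_elim simp
qed

text \<open>D is exhausted by compact sets, so the function is a pointwise limit of its
  restrictions.\<close>

lemma locally_integrable_measurable:
 fixes D :: "(real^'n) set"
 assumes D: "open D" and f: "locally_integrable D f"
 shows "set_borel_measurable lebesgue D f"
proof -
 obtain C :: "nat => (real^'n) set" where C: "!!n. compact (C n)" "!!n. C n \<subseteq> D" "\<Union>(range C) = D" "!!K. compact K ==> K \<subseteq> D ==> \<exists>N. \<forall>n\<ge>N. K \<subseteq> C n"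
  using open_Union_compact_subsets[OF D] by metis
 have "(%x. indicator D x *R f x) \<in> borel_measurable lebesgue"
 proof (rule borel_measurable_LIMSEQ_metric)
  show "(%x. indicator (C n) x *R f x) \<in> borel_measurable lebesgue" for n
   using f C(1,2)[of n] by (auto simp: locally_integrable_def set_integrable_def)
  show "(%n. indicator (C n) x *R f x) \<longlonglongrightarrow> indicator D x *R f x" for x
  proof (cases "x \<in> D")
   case True
   with C(4)[of "{x}"] obtain N where "\<forall>n\<ge>N. x \<in> C n" by auto
   then have "\<forall>\<^sub>F n in sequentially. indicator (C n) x *R f x = indicator D x *R f x"
    using True by (auto simp: eventually_sequentially intro!: exI[of _ N])
   then show ?thesis by (rule tendsto_eventually)
  next
   case False
   then have "x \<notin> C n" for n using C(2) by blast
   with False show ?thesis by simp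
  qed
 qed
 then show ?thesis by (simp add: set_borel_measurable_def)
qed

lemma bcomp_loc_int:
 assumes D: "open D" and f: "locally_integrable D f"
 shows "loc_int D (bcomp D f b)"
 unfolding loc_int_def
proof (intro allI impI)
 fix K assume K: "compact K \<and> K \<subseteq> D"
 note m = locally_integrable_measurable[OF D f] note [measurable] = bcomp(1)[OF D m]
 have [measurable]: "K \<in> sets borel" using K by (simp add: compact_imp_closed borel_closed)
 have "integrable lebesgue (%x. indicator K x *R f x)" using f K by (simp add: locally_integrable_def set_integrable_def)
 then have i: "integrable lebesgue (%x. (indicator K x *R f x) \<bullet> b)" by (rule integrable_inner_left)
 have "integrable lebesgue (%x. (indicator K x *R f x) \<bullet> b) \<longleftrightarrow> integrable lborel (%x. indicator K x * bcomp D f b x)"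
 proof (rule integral_lebesgue_borel(2)[OF borel_measurable_integrable[OF i]])
  show "AE x in lborel. (indicator K x *R f x) \<bullet> b = indicator K x * bcomp D f b x"
   using bcomp(2)[OF D m, of b] by eventually_elim (use K in \<open>auto split: split_indicator\<close>)
 qed measurable
 then show "set_integrable lborel K (bcomp D f b)" using i by (simp add: set_integrable_def)
qed

lemma locally_integrable_bounded_linear:
 assumes "locally_integrable D f" "bounded_linear h"
 shows "locally_integrable D (%x. h (f x))"
 unfolding locally_integrable_def
proof (intro allI impI)
 fix K assume "compact K \<and> K \<subseteq> D"
 then have "integrable lebesgue (%x. h (indicator K x *R f x))"
  using assms by (intro integrable_bounded_linear[OF assms(2)]) (auto simp: locally_integrable_def set_integrable_def)
 then show "set_integrable lebesgue K (%x. h (f x))"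
  using linear_scale[OF bounded_linear.linear[OF assms(2)]] by (simp add: set_integrable_def)
qed

lemma integrable_compact_support_scaleR:
 fixes f :: "real^'n => 'b::euclidean_space"
 assumes f: "locally_integrable D f" and c: "c \<in> bmeas" "!!x. \<bar>c x\<bar> <= B" and K: "compact K" "K \<subseteq> D" "!!x. x \<notin> K ==> c x = 0"
 shows "integrable lebesgue (%x. indicator D x *R (c x *R f x))"
proof -
 have i: "integrable lebesgue (%x. indicator K x *R f x)" using f K by (auto simp: locally_integrable_def set_integrable_def)
 note [measurable] = borel_measurable_integrable[OF i]
 have [measurable]: "c \<in> borel_measurable lebesgue" using c by (simp add: measurable_completion)
 have "integrable lebesgue (%x. c x *R (indicator K x *R f x))"
 proof (rule Bochner_Integration.integrable_bound[OF integrable_scaleR_right[OF i, of B]])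
  show "AE x in lebesgue. norm (c x *R (indicator K x *R f x)) <= norm (B *R (indicator K x *R f x))"
   unfolding norm_scaleR by (intro AE_I2 mult_right_mono order_trans[OF c(2) abs_ge_self]) auto
 qed measurable
 moreover have "(%x. c x *R (indicator K x *R f x)) = (%x. indicator D x *R (c x *R f x))"
  using K by (intro ext) (auto split: split_indicator)
 ultimately show ?thesis by (simp only:)
qed

text \<open>Both sides are the same integrals, read componentwise: test functions have compact
  support in D, so the vector-valued integrals exist and commute with inner products. This is the
  passage between the statement and the scalar calculus.\<close>

lemma has_weak_grad_iff_weak_dir:
 fixes u :: "real^'n => 'b::euclidean_space"
 assumes D: "open D" and u: "locally_integrable D u" and G: "locally_integrable D G"
 shows "has_weak_grad D u G \<longleftrightarrow> (\<forall>i. \<forall>b\<in>Basis. weak_dir D (axis i 1) (bcomp D u b) (bcomp D G (axis i b)))"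
proof -
 have A: "(LINT x:D|lebesgue. c x *R f x) \<bullet> b = (LINT x|lborel. c x * bcomp D g b' x)"
  if f: "locally_integrable D f" and g: "locally_integrable D g" and e: "!!x. f x \<bullet> b = g x \<bullet> b'"
   and c: "c \<in> bmeas" "!!x. \<bar>c x\<bar> <= B" and K: "compact K" "K \<subseteq> D" "!!x. x \<notin> K ==> c x = 0"
  for f :: "real^'n => 'b" and g :: "real^'n => 'c::euclidean_space" and b b' c B K
 proof -
  have "(LINT x:D|lebesgue. c x *R f x) \<bullet> b = (LINT x|lebesgue. (indicator D x *R (c x *R f x)) \<bullet> b)"
   unfolding set_lebesgue_integral_def
   by (rule integral_inner_left[symmetric]) (rule integrable_compact_support_scaleR[OF f c K])
  also have "... = (LINT x:D|lebesgue. c x * (g x \<bullet> b'))" by (simp add: set_lebesgue_integral_def e mult.assoc)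
  also have "... = (LINT x|lborel. c x * bcomp D g b' x)"
   by (rule bcomp_integral[OF D locally_integrable_measurable[OF D g] c(1)])
  finally show ?thesis .
 qed
 have eq: "(LINT x:D|lebesgue. (grad phi x $ i) *R u x) \<bullet> b = (LINT x|lborel. fder phi x (axis i 1) * bcomp D u b x)"
  "(LINT x:D|lebesgue. phi x *R (G x $ i)) \<bullet> b = (LINT x|lborel. phi x * bcomp D G (axis i b) x)"
  if t: "test_fun D phi" for phi :: "real^'n => real" and i b
 proof -
  obtain K where K: "compact K" "K \<subseteq> D" "!!x. x \<notin> K ==> phi x = 0" "!!x v. x \<notin> K ==> fder phi x v = 0"
   using test_fun_support[OF t] by metis
  obtain B where B: "!!x. \<bar>phi x\<bar> <= B" "!!x. \<bar>fder phi x (axis i 1)\<bar> <= B"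
   using test_fun_bounds[OF t, of "axis i 1"] unfolding real_norm_def by metis
  have m: "phi \<in> bmeas" "(%x. fder phi x (axis i 1)) \<in> bmeas"
   using test_fun_continuous[OF t] test_fun_continuous_deriv[OF t] by (auto intro: borel_measurable_continuous_onI)
  have "grad phi x $ i = fder phi x (axis i 1)" for x by (simp add: grad_def)
  then show "(LINT x:D|lebesgue. (grad phi x $ i) *R u x) \<bullet> b = (LINT x|lborel. fder phi x (axis i 1) * bcomp D u b x)"
   using A[OF u u refl m(2) B(2) K(1,2,4)] by simp
  show "(LINT x:D|lebesgue. phi x *R (G x $ i)) \<bullet> b = (LINT x|lborel. phi x * bcomp D G (axis i b) x)"
   by (rule A[OF locally_integrable_bounded_linear[OF G bounded_linear_vec_nth] G _ m(1) B(1) K(1,2,3)]) (simp add: inner_axis)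
 qed
 show ?thesis
 proof
  assume h: "has_weak_grad D u G"
  show "\<forall>i. \<forall>b\<in>Basis. weak_dir D (axis i 1) (bcomp D u b) (bcomp D G (axis i b))"
   unfolding weak_dir_def
  proof (intro allI ballI impI)
   fix i b and phi :: "real^'n => real" assume "test_fun D phi"
   with h eq[OF this, of i b]
   show "(LINT x|lborel. fder phi x (axis i 1) * bcomp D u b x) = - (LINT x|lborel. phi x * bcomp D G (axis i b) x)"
    by (simp add: has_weak_grad_def)
  qed
 next
  assume w: "\<forall>i. \<forall>b\<in>Basis. weak_dir D (axis i 1) (bcomp D u b) (bcomp D G (axis i b))"
  have "(LINT x:D|lebesgue. (grad phi x $ i) *R u x) = - (LINT x:D|lebesgue. phi x *R (G x $ i))"
   if t: "test_fun D phi" for phi :: "real^'n => real" and i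
   by (rule euclidean_eqI) (use w t in \<open>simp add: eq[OF t] weak_dir_def\<close>)
  then show "has_weak_grad D u G" using u G by (simp add: has_weak_grad_def)
 qed
qed

lemma has_weak_grad_locally_integrable:
 "has_weak_grad D u G ==> locally_integrable D u" "has_weak_grad D u G ==> locally_integrable D G"
 by (simp_all add: has_weak_grad_def)

lemma weak_dir_unique:
 assumes D: "open D" and q: "q \<in> bmeas" "loc_int D q" "q' \<in> bmeas" "loc_int D q'"
  and w: "weak_dir D v p q" "weak_dir D v p q'"
 shows "AE x in lborel. x \<in> D --> q x = q' x"
proof -
 have [measurable]: "q \<in> bmeas" "q' \<in> bmeas" by fact+
 have l: "loc_int D (%x. q x - q' x)" using q(2,4) unfolding loc_int_def by (auto intro: set_integral_diff)
 have "(LINT x|lborel. phi x * (q x - q' x)) = 0" if t: "test_fun D phi" for phi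
 proof -
  have "(LINT x|lborel. phi x * q x) = (LINT x|lborel. phi x * q' x)"
   using w(1)[unfolded weak_dir_def, rule_format, OF t] w(2)[unfolded weak_dir_def, rule_format, OF t] by simp
  then show ?thesis
   using test_fun_integrable(1)[OF t q(2)] test_fun_integrable(1)[OF t q(4)] by (simp add: right_diff_distrib Bochner_Integration.integral_diff)
 qed
 from fundamental_lemma[OF D _ l this] show ?thesis by auto
qed

lemma AE_eq_if_comp_eq:
 fixes f g :: "real^'n => 'b::euclidean_space"
 assumes D: "open D" and f: "set_borel_measurable lebesgue D f" and g: "set_borel_measurable lebesgue D g"
  and e: "!!b. b \<in> Basis ==> AE x in lborel. x \<in> D --> bcomp D f b x = bcomp D g b x"
 shows "AE x in lebesgue. x \<in> D --> f x = g x"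
 unfolding AE_completion_iff
proof -
 have "AE x in lborel. \<forall>b\<in>Basis. x \<in> D --> f x \<bullet> b = g x \<bullet> b"
 proof (rule AE_finite_allI)
  fix b :: 'b assume "b \<in> Basis"
  from e[OF this] bcomp(2)[OF D f, of b] bcomp(2)[OF D g, of b]
  show "AE x in lborel. x \<in> D --> f x \<bullet> b = g x \<bullet> b" by eventually_elim auto
 qed simp
 then show "AE x in lborel. x \<in> D --> f x = g x" by eventually_elim (auto intro: euclidean_eqI)
qed

lemma weak_grad_unique:
 fixes u :: "real^'n => 'b::euclidean_space"
 assumes D: "open D" and G: "has_weak_grad D u G" and G': "has_weak_grad D u G'"
 shows "AE x in lebesgue. x \<in> D --> G x = G' x"
proof -
 note l = has_weak_grad_locally_integrable[OF G] has_weak_grad_locally_integrable[OF G']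
 note m = locally_integrable_measurable[OF D l(2)] locally_integrable_measurable[OF D l(4)]
 show ?thesis
 proof (rule AE_eq_if_comp_eq[OF D m])
  fix b :: "'b^'n" assume "b \<in> Basis"
  then obtain i c where b: "b = axis i c" "c \<in> Basis" by (auto simp: Basis_vec_def)
  have "weak_dir D (axis i 1) (bcomp D u c) (bcomp D G b)" "weak_dir D (axis i 1) (bcomp D u c) (bcomp D G' b)"
   using G G' has_weak_grad_iff_weak_dir[OF D l(1,2)] has_weak_grad_iff_weak_dir[OF D l(3,4)] b by auto
  from weak_dir_unique[OF D bcomp(1)[OF D m(1)] bcomp_loc_int[OF D l(2)] bcomp(1)[OF D m(2)] bcomp_loc_int[OF D l(4)] this]
  show "AE x in lborel. x \<in> D --> bcomp D G b x = bcomp D G' b x" .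
 qed
qed

lemma set_integrable_cong_AE_lebesgue:
 fixes f f' :: "real^'n => 'b::euclidean_space"
 assumes "set_integrable lebesgue K f" "AE x in lebesgue. x \<in> K --> f x = f' x"
 shows "set_integrable lebesgue K f'"
proof -
 have e: "AE x in lebesgue. indicator K x *R f x = indicator K x *R f' x"
  using assms(2) by eventually_elim (auto split: split_indicator)
 show ?thesis
  using assms(1) unfolding set_integrable_def
  by (rule integrable_cong_AE_imp) (use e borel_measurable_AE[OF borel_measurable_integrable e] assms(1) in \<open>auto simp: set_integrable_def\<close>)
qed

lemma locally_integrable_cong_AE:
 assumes "locally_integrable D f" "AE x in lebesgue. x \<in> D --> f x = f' x"
 shows "locally_integrable D f'"
 unfolding locally_integrable_def
proof (intro allI impI)
 fix K assume K: "compact K \<and> K \<subseteq> D"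
 have "AE x in lebesgue. x \<in> K --> f x = f' x" using assms(2) by eventually_elim (use K in auto)
 with assms(1) K show "set_integrable lebesgue K f'"
  unfolding locally_integrable_def by (blast intro: set_integrable_cong_AE_lebesgue)
qed

lemma weak_dir_cong_AE:
 assumes w: "weak_dir D v p q" and [measurable]: "p \<in> bmeas" "q \<in> bmeas"
   "p' \<in> bmeas" "q' \<in> bmeas"
  and e: "AE x in lborel. x \<in> D --> p x = p' x" "AE x in lborel. x \<in> D --> q x = q' x"
 shows "weak_dir D v p' q'"
 unfolding weak_dir_def
proof (intro allI impI)
 fix phi :: "real^'a => real" assume t: "test_fun D phi"
 obtain K where K: "K \<subseteq> D" "!!x. x \<notin> K ==> phi x = 0" "!!x v. x \<notin> K ==> fder phi x v = 0"
  using test_fun_support[OF t] by metis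
 have [measurable]: "phi \<in> bmeas" "(%x. fder phi x v) \<in> bmeas"
  using test_fun_continuous[OF t] test_fun_continuous_deriv[OF t] by (auto intro: borel_measurable_continuous_onI)
 have "(LINT x|lborel. fder phi x v * p' x) = (LINT x|lborel. fder phi x v * p x)"
  by (rule integral_cong_AE) (use e(1) in \<open>measurable, eventually_elim, use K in fastforce\<close>)
 moreover have "(LINT x|lborel. phi x * q' x) = (LINT x|lborel. phi x * q x)"
  by (rule integral_cong_AE) (use e(2) in \<open>measurable, eventually_elim, use K in fastforce\<close>)
 ultimately show "(LINT x|lborel. fder phi x v * p' x) = - (LINT x|lborel. phi x * q' x)"
  using w t by (simp add: weak_dir_def)
qed

lemma has_weak_grad_cong_AE:
 fixes u :: "real^'n => 'b::euclidean_space"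
 assumes D: "open D" and h: "has_weak_grad D u G" and u: "AE x in lebesgue. x \<in> D --> u x = u' x" and G: "AE x in lebesgue. x \<in> D --> G x = G' x"
 shows "has_weak_grad D u' G'"
proof -
 note l = has_weak_grad_locally_integrable[OF h]
 note l' = locally_integrable_cong_AE[OF l(1) u] locally_integrable_cong_AE[OF l(2) G]
 note m = l[THEN locally_integrable_measurable[OF D]] l'[THEN locally_integrable_measurable[OF D]]
 have "weak_dir D (axis i 1) (bcomp D u' b) (bcomp D G' (axis i b))" if "b \<in> Basis" for i b
 proof (rule weak_dir_cong_AE)
  show "weak_dir D (axis i 1) (bcomp D u b) (bcomp D G (axis i b))" using has_weak_grad_iff_weak_dir[OF D l] h that by blast
  show "AE x in lborel. x \<in> D --> bcomp D u b x = bcomp D u' b x"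
   using bcomp_cong_AE[OF D m(1) u, of b] by eventually_elim simp
  show "AE x in lborel. x \<in> D --> bcomp D G (axis i b) x = bcomp D G' (axis i b) x"
   using bcomp_cong_AE[OF D m(2) G, of "axis i b"] by eventually_elim simp
 qed (use bcomp(1)[OF D] m in auto)
 then show ?thesis using has_weak_grad_iff_weak_dir[OF D l'] by blast
qed

section \<open>Membership in L2 and H2 through components\<close>

lemma L2D:
 assumes "f \<in> L2 D"
 shows "set_borel_measurable lebesgue D f" "set_integrable lebesgue D (%x. (norm (f x))\<^sup>2)"
 using assms by (simp_all add: L2_def)

lemma L2norm_nonneg: "0 <= L2norm D f"
 by (simp add: L2norm_def set_lebesgue_integral_def)

lemma L2norm_cong_AE:
 assumes f: "set_borel_measurable lebesgue D f" and e: "AE x in lebesgue. x \<in> D --> f x = f' x"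
 shows "L2norm D f = L2norm D f'"
proof -
 note [measurable] = f[unfolded set_borel_measurable_def] set_borel_measurable_cong_AE[OF f e, unfolded set_borel_measurable_def]
 have m: "(%x. indicator D x *R (norm (g x))\<^sup>2) \<in> borel_measurable lebesgue"
  if "(%x. indicator D x *R g x) \<in> borel_measurable lebesgue" for g :: "real^'a => 'b"
 proof -
  note [measurable] = that
  have "(%x. (norm (indicator D x *R g x))\<^sup>2) \<in> borel_measurable lebesgue" by measurable
  then show ?thesis by (rule measurable_cong[THEN iffD1, rotated]) (auto split: split_indicator)
 qed
 have "(LINT x:D|lebesgue. (norm (f x))\<^sup>2) = (LINT x:D|lebesgue. (norm (f' x))\<^sup>2)"
  unfolding set_lebesgue_integral_def
 proof (rule integral_cong_AE[OF m m])
  show "AE x in lebesgue. indicator D x *R (norm (f x))\<^sup>2 = indicator D x *R (norm (f' x))\<^sup>2"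
   using e by eventually_elim (auto split: split_indicator)
 qed measurable
 then show ?thesis by (simp add: L2norm_def)
qed

lemma bcomp_Lb:
 assumes D: "open D" and f: "f \<in> L2 D" and b: "b \<in> Basis"
 shows "Lb 2 (bcomp D f b) (L2norm D f)"
 unfolding Lb_def
proof (intro conjI L2norm_nonneg)
 note m = L2D(1)[OF f]
 show "bcomp D f b \<in> bmeas" by (rule bcomp(1)[OF D m])
 have "(nni (%x. \<bar>bcomp D f b x\<bar>\<^sup>2)) <= (nni (%x. indicator D x *R (norm (f x))\<^sup>2))"
 proof (rule nn_integral_mono_AE)
  show "AE x in lborel. ennreal (\<bar>bcomp D f b x\<bar>\<^sup>2) <= ennreal (indicator D x *R (norm (f x))\<^sup>2)"
   using bcomp(2)[OF D m, of b]
  proof eventually_elim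
   case (elim x)
   then show ?case using power_mono[OF Basis_le_norm[OF b, of "f x"], of 2]
    by (intro ennreal_leI) (auto split: split_indicator simp: power_mult_distrib)
  qed
 qed
 also have "... = (\<integral>\<^sup>+x. ennreal (indicator D x *R (norm (f x))\<^sup>2) \<partial>lebesgue)" by (simp add: nn_integral_completion)
 also have "... = ennreal (LINT x|lebesgue. indicator D x *R (norm (f x))\<^sup>2)"
  using L2D(2)[OF f] by (intro nn_integral_eq_integral) (auto simp: set_integrable_def)
 also have "... = ennreal ((L2norm D f)^2)" by (simp add: L2norm_def set_lebesgue_integral_def)
 finally show "(nni (%x. \<bar>bcomp D f b x\<bar> ^ 2)) <= ennreal ((L2norm D f)^2)" .
qed

lemma Lb_2_integral:
 assumes "Lb 2 f al"
 shows "integrable lborel (%x. (f x)\<^sup>2)" "(LINT x|lborel. (f x)\<^sup>2) <= al^2"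
proof -
 show i: "integrable lborel (%x. (f x)\<^sup>2)" using sqI[OF assms] by (simp add: sq_iff_integrable)
 have "ennreal (LINT x|lborel. (f x)\<^sup>2) <= ennreal (al^2)"
  using LbD(3)[OF assms] i by (subst nn_integral_eq_integral[symmetric]) auto
 then show "(LINT x|lborel. (f x)\<^sup>2) <= al^2" by simp
qed

lemma L2_if_bcomp_Lb:
 fixes f :: "real^'n => 'b::euclidean_space"
 assumes D: "open D" and m: "set_borel_measurable lebesgue D f" and b: "!!b. b \<in> Basis ==> Lb 2 (bcomp D f b) al"
 shows "f \<in> L2 D" "L2norm D f <= real DIM('b) * al"
proof -
 have a: "0 <= al" using b[OF SOME_Basis] LbD(2) by blast
 define g where "g x = (\<Sum>b\<in>Basis. (bcomp D f b x)\<^sup>2)" for x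
 have [measurable]: "bcomp D f b \<in> bmeas" for b by (rule bcomp(1)[OF D m])
 have gm: "g \<in> bmeas" unfolding g_def[abs_def] by measurable
 have "AE x in lborel. \<forall>b\<in>Basis. bcomp D f b x = indicator D x * (f x \<bullet> b)"
  by (rule AE_finite_allI) (use bcomp(2)[OF D m] in auto)
 then have e: "AE x in lborel. indicator D x *R (norm (f x))\<^sup>2 = g x"
 proof eventually_elim
  case (elim x)
  have "(norm (f x))^2 = (\<Sum>b\<in>Basis. (f x \<bullet> b)\<^sup>2)" unfolding power2_norm_eq_inner euclidean_inner[of "f x" "f x"] by (simp add: power2_eq_square)
  with elim show ?case by (auto simp: g_def split: split_indicator)
 qed
 have fm: "(%x. indicator D x *R (norm (f x))\<^sup>2) \<in> borel_measurable lebesgue"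
 proof -
  note [measurable] = m[unfolded set_borel_measurable_def]
  have "(%x. (norm (indicator D x *R f x))\<^sup>2) \<in> borel_measurable lebesgue" by measurable
  then show ?thesis by (rule measurable_cong[THEN iffD1, rotated]) (auto split: split_indicator)
 qed
 have gi: "integrable lborel g" unfolding g_def[abs_def] using Lb_2_integral(1)[OF b] by auto
 then show "f \<in> L2 D" using m integral_lebesgue_borel(2)[OF fm gm e] by (simp add: L2_def set_integrable_def)
 have "(LINT x:D|lebesgue. (norm (f x))\<^sup>2) = (\<Sum>b\<in>Basis. LINT x|lborel. (bcomp D f b x)\<^sup>2)"
  using integral_lebesgue_borel(1)[OF fm gm e] Lb_2_integral(1)[OF b]
  by (simp add: set_lebesgue_integral_def g_def Bochner_Integration.integral_sum)
 also have "... <= (\<Sum>b\<in>(Basis::'b set). al\<^sup>2)" by (intro sum_mono Lb_2_integral(2) b)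
 also have "... <= (real DIM('b) * al)^2"
 proof -
  have "real DIM('b) <= (real DIM('b))^2" using DIM_positive[where 'a='b] by (simp add: power2_eq_square)
  then show ?thesis by (simp add: power_mult_distrib mult_right_mono)
 qed
 finally show "L2norm D f <= real DIM('b) * al" unfolding L2norm_def using a by (intro real_le_lsqrt) auto
qed

lemma L2_cong_AE:
 assumes f: "f \<in> L2 D" and D: "open D" and e: "AE x in lebesgue. x \<in> D --> f x = f' x"
 shows "f' \<in> L2 D"
proof (rule L2_if_bcomp_Lb(1)[OF D set_borel_measurable_cong_AE[OF L2D(1)[OF f] e]])
 fix b :: 'b assume b: "b \<in> Basis"
 show "Lb 2 (bcomp D f' b) (L2norm D f)"
  by (rule Lb_cong_AE[OF bcomp_Lb[OF D f b] bcomp(1)[OF D set_borel_measurable_cong_AE[OF L2D(1)[OF f] e]]])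
   (use bcomp_cong_AE[OF D L2D(1)[OF f] e, of b] in \<open>eventually_elim, simp\<close>)
qed

text \<open>\<open>weak_grad\<close> is an arbitrary choice, so any pair G, H may replace the chosen
  gradients in the norm by uniqueness almost everywhere. The second choice is made for the chosen
  first gradient, for which H must first be shown to be a weak gradient as well.\<close>

lemma H2_data:
 fixes u :: "real^'n => 'b::euclidean_space"
 assumes D: "open D" and u: "u \<in> L2 D" and G: "G \<in> L2 D" and H: "H \<in> L2 D" and g: "has_weak_grad D u G" and h: "has_weak_grad D G H"
 shows "u \<in> H2 D" "H2norm D u = L2norm D u + L2norm D G + L2norm D H"
  "has_weak_grad D u (weak_grad D u)" "has_weak_grad D (weak_grad D u) (weak_grad D (weak_grad D u))"
  "weak_grad D u \<in> L2 D" "weak_grad D (weak_grad D u) \<in> L2 D"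
proof -
 show g': "has_weak_grad D u (weak_grad D u)" unfolding weak_grad_def by (rule someI[of "has_weak_grad D u", OF g])
 have e: "AE x in lebesgue. x \<in> D --> G x = weak_grad D u x" by (rule weak_grad_unique[OF D g g'])
 have h1: "has_weak_grad D (weak_grad D u) H" by (rule has_weak_grad_cong_AE[OF D h e]) simp
 show h': "has_weak_grad D (weak_grad D u) (weak_grad D (weak_grad D u))"
  using someI[of "has_weak_grad D (weak_grad D u)", OF h1] by (simp only: weak_grad_def[of D "weak_grad D u"])
 have e2: "AE x in lebesgue. x \<in> D --> H x = weak_grad D (weak_grad D u) x" by (rule weak_grad_unique[OF D h1 h'])
 show "u \<in> H2 D" using u G H g h by (auto simp: H2_def)
 show "H2norm D u = L2norm D u + L2norm D G + L2norm D H"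
  using L2norm_cong_AE[OF L2D(1)[OF G] e] L2norm_cong_AE[OF L2D(1)[OF H] e2] by (simp add: H2norm_def)
 show "weak_grad D u \<in> L2 D" "weak_grad D (weak_grad D u) \<in> L2 D" by (rule L2_cong_AE[OF G D e] L2_cong_AE[OF H D e2])+
qed

lemma H2_D:
 fixes u :: "real^'n => 'b::euclidean_space"
 assumes D: "open D" and u: "u \<in> H2 D"
 shows "u \<in> L2 D" "has_weak_grad D u (weak_grad D u)" "has_weak_grad D (weak_grad D u) (weak_grad D (weak_grad D u))"
  "weak_grad D u \<in> L2 D" "weak_grad D (weak_grad D u) \<in> L2 D"
proof -
 obtain G H where "u \<in> L2 D" "G \<in> L2 D" "H \<in> L2 D" "has_weak_grad D u G" "has_weak_grad D G H" using u by (auto simp: H2_def)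
 from this(1) H2_data[OF D this] show "u \<in> L2 D" "has_weak_grad D u (weak_grad D u)" "has_weak_grad D (weak_grad D u) (weak_grad D (weak_grad D u))"
  "weak_grad D u \<in> L2 D" "weak_grad D (weak_grad D u) \<in> L2 D" by auto
qed

lemma has_weak_grad_diff:
 fixes u :: "real^'n => 'b::euclidean_space"
 assumes D: "open D" and u: "has_weak_grad D u G" and v: "has_weak_grad D v G'"
 shows "has_weak_grad D (%x. u x - v x) (%x. G x - G' x)"
proof -
 note l = has_weak_grad_locally_integrable[OF u] has_weak_grad_locally_integrable[OF v]
 have ld: "locally_integrable D (%x. f x - g x)" if "locally_integrable D f" "locally_integrable D g"
  for f g :: "real^'n => 'c::euclidean_space"
  using that unfolding locally_integrable_def by (auto intro: set_integral_diff)
 have e: "AE x in lborel. x \<in> D --> bcomp D f b x - bcomp D g b x = bcomp D (%x. f x - g x) b x"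
  if "locally_integrable D f" "locally_integrable D g" for f g :: "real^'n => 'c::euclidean_space" and b
  using bcomp(2)[OF D locally_integrable_measurable[OF D that(1)], of b] bcomp(2)[OF D locally_integrable_measurable[OF D that(2)], of b]
   bcomp(2)[OF D locally_integrable_measurable[OF D ld[OF that]], of b]
  by eventually_elim (auto simp: inner_diff_left)
 have "weak_dir D (axis i 1) (bcomp D (%x. u x - v x) b) (bcomp D (%x. G x - G' x) (axis i b))" if b: "b \<in> Basis" for i b
 proof (rule weak_dir_cong_AE[OF _ _ _ _ _ e[OF l(1,3)] e[OF l(2,4)]])
  note c = l[THEN locally_integrable_measurable[OF D], THEN bcomp(1)[OF D]]
  have w: "weak_dir D (axis i 1) (bcomp D u b) (bcomp D G (axis i b))" "weak_dir D (axis i 1) (bcomp D v b) (bcomp D G' (axis i b))"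
   using u v b has_weak_grad_iff_weak_dir[OF D l(1,2)] has_weak_grad_iff_weak_dir[OF D l(3,4)] by auto
  show "weak_dir D (axis i 1) (%x. bcomp D u b x - bcomp D v b x) (%x. bcomp D G (axis i b) x - bcomp D G' (axis i b) x)"
   unfolding weak_dir_def
  proof (intro allI impI)
   fix phi :: "real^'n => real" assume t: "test_fun D phi"
   note i = test_fun_integrable(2)[OF t bcomp_loc_int[OF D l(1)]] test_fun_integrable(2)[OF t bcomp_loc_int[OF D l(3)]]
    test_fun_integrable(1)[OF t bcomp_loc_int[OF D l(2)]] test_fun_integrable(1)[OF t bcomp_loc_int[OF D l(4)]]
   show "(LINT x|lborel. fder phi x (axis i 1) * (bcomp D u b x - bcomp D v b x))
    = - (LINT x|lborel. phi x * (bcomp D G (axis i b) x - bcomp D G' (axis i b) x))"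
    using w[unfolded weak_dir_def, rule_format, OF t] i by (simp add: right_diff_distrib Bochner_Integration.integral_diff)
  qed
  show "(%x. bcomp D u b x - bcomp D v b x) \<in> bmeas" "(%x. bcomp D G (axis i b) x - bcomp D G' (axis i b) x) \<in> bmeas"
   using c by measurable
  show "bcomp D (%x. u x - v x) b \<in> bmeas" "bcomp D (%x. G x - G' x) (axis i b) \<in> bmeas"
   by (rule bcomp(1)[OF D locally_integrable_measurable[OF D ld]], (rule l)+)+
 qed
 then show ?thesis using has_weak_grad_iff_weak_dir[OF D ld[OF l(1,3)] ld[OF l(2,4)]] by blast
qed

lemma L2_diff:
 fixes f g :: "real^'n => 'b::euclidean_space"
 assumes D: "open D" and f: "f \<in> L2 D" and g: "g \<in> L2 D"
 shows "(%x. f x - g x) \<in> L2 D"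
proof (rule L2_if_bcomp_Lb(1)[OF D])
 note [measurable] = L2D(1)[OF f, unfolded set_borel_measurable_def] L2D(1)[OF g, unfolded set_borel_measurable_def]
 have "(%x. indicator D x *R f x - indicator D x *R g x) \<in> borel_measurable lebesgue" by measurable
 then show m: "set_borel_measurable lebesgue D (%x. f x - g x)" by (simp add: set_borel_measurable_def scaleR_diff_right)
 fix b :: 'b assume b: "b \<in> Basis"
 show "Lb 2 (bcomp D (%x. f x - g x) b) (L2norm D f + L2norm D g)"
  by (rule Lb_cong_AE[OF Lb_diff[OF bcomp_Lb[OF D f b] bcomp_Lb[OF D g b]] bcomp(1)[OF D m]])
   (simp, use bcomp(2)[OF D L2D(1)[OF f], of b] bcomp(2)[OF D L2D(1)[OF g], of b] bcomp(2)[OF D m, of b]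
    in \<open>eventually_elim, simp add: inner_diff_left right_diff_distrib\<close>)
qed

lemma bcomp_diff:
 fixes f g :: "real^'n => 'b::euclidean_space"
 assumes D: "open D" and f: "f \<in> L2 D" and g: "g \<in> L2 D"
 shows "AE x in lborel. bcomp D f b x - bcomp D g b x = bcomp D (%x. f x - g x) b x"
 using bcomp(2)[OF D L2D(1)[OF f], of b] bcomp(2)[OF D L2D(1)[OF g], of b] bcomp(2)[OF D L2D(1)[OF L2_diff[OF D f g]], of b]
 by eventually_elim (simp add: inner_diff_left right_diff_distrib)

lemma L2_locally_integrable:
 assumes D: "open D" and f: "f \<in> L2 D"
 shows "locally_integrable D f"
 unfolding locally_integrable_def set_integrable_def
proof (intro allI impI)
 fix K assume K: "compact K \<and> K \<subseteq> D"
 have [measurable]: "K \<in> sets lebesgue" using K by (simp add: compact_imp_closed borel_closed)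
 have "emeasure lborel K < \<infinity>" using K by (intro emeasure_bounded_finite) (auto simp: compact_imp_bounded)
 then have iK: "integrable lebesgue (%x. indicator K x :: real)" using K by (auto simp: compact_imp_closed borel_closed)
 note [measurable] = L2D(1)[OF f, unfolded set_borel_measurable_def]
 have i: "integrable lebesgue (%x. indicator K x + indicator D x *R (norm (f x))\<^sup>2)"
  using iK L2D(2)[OF f] by (auto simp: set_integrable_def)
 show "integrable lebesgue (%x. indicator K x *R f x)"
 proof (rule Bochner_Integration.integrable_bound[OF i])
  have "(%x. indicator K x *R (indicator D x *R f x)) \<in> borel_measurable lebesgue" by measurable
  then show "(%x. indicator K x *R f x) \<in> borel_measurable lebesgue"
   by (rule measurable_cong[THEN iffD1, rotated]) (use K in \<open>auto split: split_indicator\<close>)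
  have "r <= 1 + r^2" for r :: real
  proof -
   have "2 * r <= 1 + r^2" using zero_le_power2[of "r - 1"] by (simp add: power2_diff)
   then show ?thesis using zero_le_power2[of r] by linarith
  qed
  then show "AE x in lebesgue. norm (indicator K x *R f x) <= norm (indicator K x + indicator D x *R (norm (f x))\<^sup>2)"
   using K by (intro AE_I2) (auto split: split_indicator)
 qed
qed

lemma L2_if_inner_Lb:
 fixes f :: "real^'n => 'b::euclidean_space"
 assumes D: "open D" and f: "!!b. b \<in> Basis ==> Lb 2 (%x. f x \<bullet> b) al"
 shows "f \<in> L2 D" "L2norm D f <= real DIM('b) * al"
proof -
 have [measurable]: "f \<in> bmeas"
  unfolding borel_measurable_euclidean_space[of f] using LbD(1)[OF f] by auto
 have [measurable]: "D \<in> sets borel" using D by simp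
 have "(%x. indicator D x *R f x) \<in> borel_measurable lborel" by measurable
 then have m: "set_borel_measurable lebesgue D f" unfolding set_borel_measurable_def by (rule measurable_completion)
 have "Lb 2 (bcomp D f b) al" if b: "b \<in> Basis" for b
  by (rule Lb_dominated[OF f[OF b] bcomp(1)[OF D m]])
   (use bcomp(2)[OF D m, of b] in \<open>eventually_elim, auto split: split_indicator\<close>)
 from L2_if_bcomp_Lb[OF D m this] show "f \<in> L2 D" "L2norm D f <= real DIM('b) * al" by auto
qed

lemma L2_if_inner_sq:
 fixes f :: "real^'n => 'b::euclidean_space"
 assumes D: "open D" and f: "!!b. b \<in> Basis ==> sq (%x. f x \<bullet> b)"
 shows "f \<in> L2 D"
proof -
 from f have "\<forall>b\<in>Basis. \<exists>al. Lb 2 (%x. f x \<bullet> b) al" by (simp add: sq_def)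
 from bchoice[OF this] obtain al where a: "\<forall>b\<in>Basis. Lb 2 (%x. f x \<bullet> b) (al b)" by blast
 show ?thesis
 proof (rule L2_if_inner_Lb(1)[OF D])
  fix b :: 'b assume b: "b \<in> Basis"
  show "Lb 2 (%x. f x \<bullet> b) (\<Sum>b\<in>Basis. al b)"
   by (rule Lb_mono[OF a[rule_format, OF b]]) (use a b LbD(2) in \<open>auto intro!: member_le_sum\<close>)
 qed
qed

lemma weak_dir_mono: "weak_dir E v p q ==> D \<subseteq> E ==> weak_dir D v p q"
 unfolding weak_dir_def using test_fun_mono by blast

lemma has_weak_grad_if_inner_DQ:
 fixes u :: "real^'n => 'b::euclidean_space"
 assumes D: "open D" and w: "!!i b. b \<in> Basis ==> DQ i (%x. u x \<bullet> b) (%x. G x \<bullet> axis i b)"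
 shows "has_weak_grad D u G"
proof -
 have u: "u \<in> L2 D" by (rule L2_if_inner_sq[OF D DQ_sq(1)[OF w]])
 have "sq (%x. G x \<bullet> c)" if "c \<in> Basis" for c using DQ_sq(2)[OF w] that by (auto simp: Basis_vec_def)
 then have G: "G \<in> L2 D" by (rule L2_if_inner_sq[OF D])
 note l = L2_locally_integrable[OF D u] L2_locally_integrable[OF D G]
 have e: "AE x in lborel. x \<in> D --> f x \<bullet> c = bcomp D f c x" if "f \<in> L2 D" for f :: "real^'n => 'c::euclidean_space" and c
  using bcomp(2)[OF D L2D(1)[OF that], of c] by eventually_elim simp
 have "weak_dir D (axis i 1) (bcomp D u b) (bcomp D G (axis i b))" if b: "b \<in> Basis" for i b
  by (rule weak_dir_cong_AE[OF weak_dir_mono[OF DQ_weak_dir[OF w[OF b]] subset_UNIV] _ _ _ _ e[OF u] e[OF G]])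
   (use sq_measurable DQ_sq[OF w[OF b]] bcomp(1)[OF D L2D(1)[OF u]] bcomp(1)[OF D L2D(1)[OF G]] in auto)
 then show ?thesis using has_weak_grad_iff_weak_dir[OF D l] by blast
qed

text \<open>The factor counts components: n for the function, n^2 for the gradient and n^3 for the
  Hessian. V has to agree with the representative only almost everywhere in D.\<close>

lemma H2_if_components:
 fixes X :: "'n => real^'n => real"
 assumes D: "open D" and h: "!!j. h2 (X j) (X1 j) (X2 j)" and b: "!!j. wbound al (X j) (X1 j) (X2 j)"
  and V: "AE x in lebesgue. x \<in> D --> V x = (\<chi> j. X j x)"
 shows "V \<in> H2 D" "H2norm D V <= (real CARD('n) + real CARD('n) ^ 2 + real CARD('n) ^ 3) * al"
proof -
 define U where "U x = (\<chi> j. X j x)" for x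
 define G where "G x = (\<chi> i. \<chi> j. X1 j i x)" for x
 define H where "H x = (\<chi> k. \<chi> i. \<chi> j. X2 j i k x)" for x
 have V': "AE x in lebesgue. x \<in> D --> U x = V x" using V by eventually_elim (simp add: U_def)
 note B = wboundD(1-3)[OF b] and h' = h[unfolded h2_def]
 have bU: "c \<in> Basis ==> Lb 2 (%x. U x \<bullet> c) al" and bG: "d \<in> Basis ==> Lb 2 (%x. G x \<bullet> d) al" and bH: "e \<in> Basis ==> Lb 2 (%x. H x \<bullet> e) al" for c d e
  using B by (auto simp: Basis_vec_def inner_axis U_def G_def H_def)
 note U = L2_if_inner_Lb[OF D bU] and G = L2_if_inner_Lb[OF D bG] and H = L2_if_inner_Lb[OF D bH]
 have UG: "has_weak_grad D U G" "has_weak_grad D G H"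
  using h' by (auto intro!: has_weak_grad_if_inner_DQ[OF D] simp: Basis_vec_def inner_axis U_def G_def H_def)
 have "has_weak_grad D V G" by (rule has_weak_grad_cong_AE[OF D UG(1) V']) simp
 note R = H2_data[OF D L2_cong_AE[OF U(1) D V'] G(1) H(1) this UG(2)]
 show "V \<in> H2 D" by (rule R(1))
 have "H2norm D V = L2norm D U + L2norm D G + L2norm D H"
  using R(2) L2norm_cong_AE[OF L2D(1)[OF U(1)] V'] by simp
 also have "... <= (real CARD('n) + real CARD('n) ^ 2 + real CARD('n) ^ 3) * al"
  using U(2) G(2) H(2) by (simp add: power2_eq_square power3_eq_cube algebra_simps)
 finally show "H2norm D V <= (real CARD('n) + real CARD('n) ^ 2 + real CARD('n) ^ 3) * al" .
qed

section \<open>Zero extension of functions in H10\<close>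

lemma test_fun_Mult:
 fixes phi :: "real^'n => real"
 assumes t: "test_fun D phi"
 obtains K where "Mult K i phi (%x. fder phi x (axis i 1))"
proof -
 obtain B where B: "!!x. \<bar>phi x\<bar> <= B" "!!x. \<bar>fder phi x (axis i 1)\<bar> <= B"
  using test_fun_bounds[OF t, of "axis i 1"] unfolding real_norm_def by metis
 have "Mult B i phi (%x. fder phi x (axis i 1))"
 proof (rule MultI[OF _ _ _ B])
  show "phi \<in> bmeas" "(%x. fder phi x (axis i 1)) \<in> bmeas"
   using test_fun_continuous[OF t] test_fun_continuous_deriv[OF t] by (auto intro: borel_measurable_continuous_onI)
  show "((%s. phi (x + s *R axis i 1)) has_real_derivative fder phi x (axis i 1)) (at 0)" for x
   using frechet_line[of phi x "axis i 1"] test_fun_has_derivative[OF t, of x] by (auto simp: DERIV_def differentiable_def)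
 qed
 then show thesis by (rule that)
qed

lemma test_fun_DQ:
 fixes phi :: "real^'n => real"
 assumes t: "test_fun D phi"
 shows "DQ i phi (%x. fder phi x (axis i 1))"
proof (rule weak_dir_DQ[OF test_fun_sq[OF t] weak_dir_of_dq])
 obtain K where M: "Mult K i phi (%x. fder phi x (axis i 1))" using test_fun_Mult[OF t] .
 note [measurable] = MultD(1,2)[OF M]
 fix psi :: "real^'n => real" assume p: "test_fun UNIV psi"
 obtain C where C: "compact C" "!!x. x \<notin> C ==> psi x = 0" using test_fun_support[OF p] by metis
 have "emeasure lborel C < \<infinity>" using C by (intro emeasure_bounded_finite) (auto simp: compact_imp_bounded)
 moreover have "(%x. (indicator C x :: real)\<^sup>2) = indicator C" by (auto split: split_indicator)
 \<comment> \<open>The indicator of the support of psi turns L2 convergence of the product with psi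
   into L1 convergence.\<close>
 ultimately have "sq (indicator C :: _ => real)"
  using C by (auto simp: sq_iff_integrable compact_imp_closed borel_closed)
 then obtain k where k: "Lb 2 (indicator C :: real^'n => real) k" by (auto simp: sq_def)
 have "Lconv 2 (%n x. (dq i n phi x - fder phi x (axis i 1)) * psi x)"
 proof (rule Lconv_dct[OF test_fun_sq(1)[OF p]])
  show "(%x. dq i n phi x - fder phi x (axis i 1)) \<in> bmeas" for n by measurable
  show "\<bar>dq i n phi x - fder phi x (axis i 1)\<bar> <= K + K" for n x
   by (rule order_trans[OF abs_triangle_ineq4 add_mono[OF MultD(8)[OF M] MultD(4)[OF M]]])
  show "(%n. dq i n phi x - fder phi x (axis i 1)) \<longlonglongrightarrow> 0" for x
   using tendsto_diff[OF MultD(6)[OF M, of x] tendsto_const[of "fder phi x (axis i 1)"]] by simp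
 qed
 from Lconv_mult_22[OF this k]
 have "Lconv 1 (%n x. (dq i n phi x - fder phi x (axis i 1)) * psi x * indicator C x)" .
 moreover have "(dq i n phi x - fder phi x (axis i 1)) * psi x * indicator C x
  = psi x * (dq i n phi x - fder phi x (axis i 1))" for n x
  using C(2)[of x] by (cases "x \<in> C") simp_all
 ultimately show "Lconv 1 (%n x. psi x * (dq i n phi x - fder phi x (axis i 1)))" by (simp only:)
qed (use test_fun_sq[OF t] in \<open>auto intro: sq_measurable sq_loc_int\<close>)

text \<open>Integration by parts survives L2 limits of both functions, which makes the derivative
  operator closed.\<close>

lemma DQ_limit:
 fixes p :: "real^'n => real"
 assumes d: "!!k. DQ i (P k) (Q k)" and p: "sq p" and q: "sq q"
  and a: "!!k. Lb 2 (%x. p x - P k x) (a k)" "a \<longlonglongrightarrow> 0" and b: "!!k. Lb 2 (%x. q x - Q k x) (b k)" "b \<longlonglongrightarrow> 0"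
 shows "DQ i p q"
proof (rule weak_dir_DQ[OF p q])
 show "weak_dir UNIV (axis i 1) p q"
  unfolding weak_dir_def
 proof (intro allI impI)
  fix psi :: "real^'n => real" assume t: "test_fun UNIV psi"
  define psi' where "psi' x = fder psi x (axis i 1)" for x
  note s = test_fun_sq(1)[OF t] test_fun_sq(2)[OF t, of "axis i 1", folded psi'_def]
  obtain A B where A: "Lb 2 psi A" and B: "Lb 2 psi' B" using s by (auto simp: sq_def)
  define S where "S = (LINT x|lborel. psi' x * p x) + (LINT x|lborel. psi x * q x)"
  have "\<bar>S\<bar> <= B * a k + A * b k" for k
  proof -
   have 0: "(LINT x|lborel. psi' x * P k x) = - (LINT x|lborel. psi x * Q k x)"
    using DQ_weak_dir[OF d[of k]] t unfolding weak_dir_def psi'_def by blast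
   have "S = (LINT x|lborel. psi' x * (p x - P k x)) + (LINT x|lborel. psi x * (q x - Q k x))"
    using 0 sq_mult_integrable[OF s(2) p] sq_mult_integrable[OF s(1) q] sq_mult_integrable[OF s(2) DQ_sq(1)[OF d[of k]]]
     sq_mult_integrable[OF s(1) DQ_sq(2)[OF d[of k]]]
    by (simp add: S_def right_diff_distrib Bochner_Integration.integral_diff)
   moreover have "\<bar>LINT x|lborel. psi' x * (p x - P k x)\<bar> <= B * a k" by (rule Lb_1_integral_le[OF Lb_mult_22[OF B a(1)]])
   moreover have "\<bar>LINT x|lborel. psi x * (q x - Q k x)\<bar> <= A * b k" by (rule Lb_1_integral_le[OF Lb_mult_22[OF A b(1)]])
   ultimately show ?thesis by linarith
  qed
  moreover have "(%k. B * a k + A * b k) \<longlonglongrightarrow> B * 0 + A * 0" by (intro tendsto_intros a b)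
  ultimately have "\<bar>S\<bar> <= 0" by (intro LIMSEQ_le_const[of "%k. B * a k + A * b k"]) auto
  then show "(LINT x|lborel. fder psi x (axis i 1) * p x) = - (LINT x|lborel. psi x * q x)"
   by (simp add: S_def psi'_def)
 qed
qed

lemma grad_inner:
 fixes phi :: "real^'n => 'b::euclidean_space"
 assumes "phi differentiable (at x)"
 shows "(%x. phi x \<bullet> b) differentiable (at x)" "fder (%x. phi x \<bullet> b) x v = fder phi x v \<bullet> b"
proof -
 have "(phi has_derivative fder phi x) (at x)" using assms by (simp add: frechet_derivative_works)
 from has_derivative_inner_left[OF this, of b]
 show "(%x. phi x \<bullet> b) differentiable (at x)" "fder (%x. phi x \<bullet> b) x v = fder phi x v \<bullet> b"
  using frechet_derivative_at[of "%x. phi x \<bullet> b"] by (auto simp: differentiable_def dest!: fun_cong[of _ _ v])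
qed

lemma Ck_inner:
 fixes phi :: "real^'n => 'b::euclidean_space"
 shows "Ck k phi ==> Ck k (%x. phi x \<bullet> b)"
proof (induction k arbitrary: phi)
 case (Suc k)
 then have d: "phi differentiable (at x)" "Ck k (%x. grad phi x $ i \<bullet> b)" for x i by auto
 have "grad (%x. phi x \<bullet> b) x $ i = grad phi x $ i \<bullet> b" for x i by (simp add: grad_def grad_inner(2)[OF d(1)])
 with d grad_inner(1)[OF d(1)] show ?case by simp
qed (auto intro: continuous_intros)

lemma test_fun_inner:
 fixes phi :: "real^'n => 'b::euclidean_space"
 assumes "test_fun D phi"
 shows "test_fun D (%x. phi x \<bullet> b)"
proof -
 obtain K where "compact K" "K \<subseteq> D" "!!x. x \<notin> K ==> phi x \<bullet> b = 0" using assms by (auto simp: test_fun_def)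
 then show ?thesis using assms Ck_inner unfolding test_fun_def by blast
qed

text \<open>Approximating test functions have their derivatives on the whole space and vanish
  outside D, so their L2(D) convergence is convergence on the whole space. The limit gradient from
  the definition of H10 agrees with G by uniqueness.\<close>

lemma H10_DQ:
 fixes u :: "real^'n => 'b::euclidean_space"
 assumes D: "open D" and u: "u \<in> H10 D" and g: "has_weak_grad D u G" "G \<in> L2 D" and b: "b \<in> Basis"
 shows "DQ i (bcomp D u b) (bcomp D G (axis i b))"
proof -
 obtain G' phi where uL: "u \<in> L2 D" and G': "G' \<in> L2 D" "has_weak_grad D u G'" and t: "!!k::nat. test_fun D (phi k)"
  and l: "(%k. L2norm D (%x. u x - phi k x)) \<longlonglongrightarrow> 0" "(%k. L2norm D (%x. G' x - grad (phi k) x)) \<longlonglongrightarrow> 0"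
  using u by (auto simp: H10_def)
 have ib: "axis i b \<in> Basis" using b by (auto simp: Basis_vec_def)
 have gr: "grad (phi k) x \<bullet> axis i c = fder (%x. phi k x \<bullet> c) x (axis i 1)" for k x c i
 proof -
  have "phi k differentiable (at x)" using test_fun_has_derivative[OF t] by (auto simp: differentiable_def)
  from grad_inner(2)[OF this] show ?thesis by (simp add: inner_axis grad_def)
 qed
 have sq: "sq (%x. phi k x \<bullet> c)" for k c by (rule test_fun_sq(1)[OF test_fun_inner[OF t]])
 have sg: "sq (%x. grad (phi k) x \<bullet> c)" if "c \<in> Basis" for k c
  using that test_fun_sq(2)[OF test_fun_inner[OF t]] by (auto simp: Basis_vec_def gr)
 have L: "phi k \<in> L2 D" "grad (phi k) \<in> L2 D" for k
  using L2_if_inner_sq[OF D sq] L2_if_inner_sq[OF D sg] by blast+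
 have z: "phi k x = 0" "grad (phi k) x = 0" if "x \<notin> D" for k x
 proof -
  obtain K where "K \<subseteq> D" "!!x. x \<notin> K ==> phi k x = 0" "!!x v. x \<notin> K ==> fder (phi k) x v = 0"
   using test_fun_support[OF t[of k]] by metis
  with that show "phi k x = 0" "grad (phi k) x = 0" by (auto simp: grad_def vec_eq_iff)
 qed
 have "DQ i (bcomp D u b) (bcomp D G' (axis i b))"
 proof (rule DQ_limit[OF test_fun_DQ[OF test_fun_inner[OF t]] _ _ _ l(1) _ l(2)])
  show "sq (bcomp D u b)" "sq (bcomp D G' (axis i b))" using bcomp_Lb[OF D uL b] bcomp_Lb[OF D G'(1) ib] by (auto intro: sqI)
  fix k
  show "Lb 2 (%x. bcomp D u b x - phi k x \<bullet> b) (L2norm D (%x. u x - phi k x))"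
   by (rule Lb_cong_AE[OF bcomp_Lb[OF D L2_diff[OF D uL L(1)] b]])
    (use sq_measurable[OF sq[of k b]] bcomp(1)[OF D L2D(1)[OF uL], of b] in measurable,
     use bcomp(2)[OF D L2D(1)[OF uL], of b] bcomp(2)[OF D L2D(1)[OF L2_diff[OF D uL L(1)[of k]]], of b]
      in \<open>eventually_elim, use z in \<open>auto simp: inner_diff_left split: split_indicator\<close>\<close>)
  show "Lb 2 (%x. bcomp D G' (axis i b) x - fder (%x. phi k x \<bullet> b) x (axis i 1)) (L2norm D (%x. G' x - grad (phi k) x))"
   unfolding gr[symmetric]
   by (rule Lb_cong_AE[OF bcomp_Lb[OF D L2_diff[OF D G'(1) L(2)] ib]])
    (use sq_measurable[OF sg[OF ib, of k]] bcomp(1)[OF D L2D(1)[OF G'(1)], of "axis i b"] in measurable,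
     use bcomp(2)[OF D L2D(1)[OF G'(1)], of "axis i b"] bcomp(2)[OF D L2D(1)[OF L2_diff[OF D G'(1) L(2)[of k]]], of "axis i b"]
      in \<open>eventually_elim, use z in \<open>auto simp: inner_diff_left split: split_indicator\<close>\<close>)
 qed
 then show ?thesis
  by (rule DQ_cong_AE) (use bcomp_Lb[OF D uL b] bcomp_Lb[OF D g(2) ib] bcomp_cong_AE[OF D L2D(1)[OF g(2)] weak_grad_unique[OF D g(1) G'(2)], of "axis i b"]
   in \<open>auto intro: sqI\<close>)
qed

definition fu :: "(real^'n) set => (real^'n => real^'n) => 'n => real^'n => real" where
 "fu D u j = bcomp D u (axis j 1)"
text \<open>In a weak gradient the outer index is the direction of the newest derivative, hence the
  nesting of the axes.\<close>

definition fu1 :: "(real^'n) set => (real^'n => real^'n) => 'n => 'n => real^'n => real" where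
 "fu1 D u j i = bcomp D (weak_grad D u) (axis i (axis j 1))"
definition fu2 :: "(real^'n) set => (real^'n => real^'n) => 'n => 'n => 'n => real^'n => real" where
 "fu2 D u j i k = bcomp D (weak_grad D (weak_grad D u)) (axis k (axis i (axis j 1)))"

lemma axis_Basis: "axis j (1::real) \<in> Basis" "b \<in> Basis ==> axis j b \<in> Basis"
 by (auto simp: Basis_vec_def)

text \<open>H10 provides the first derivatives on the whole space and H2 the second ones in D;
  \<open>DQ_cutoff\<close> joins them for every multiplier vanishing outside D.\<close>

lemma W_field:
 assumes D: "open D" and u: "u \<in> W D"
 shows "field D (fu D u) (fu1 D u) (fu2 D u)" "fbound (H2norm D u) (fu D u) (fu1 D u) (fu2 D u)"
proof -
 have u': "u \<in> H2 D" "u \<in> H10 D" using u by (auto simp: W_def)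
 note h = H2_D[OF D u'(1)]
 note b = axis_Basis(1) axis_Basis(2)[OF axis_Basis(1)] axis_Basis(2)[OF axis_Basis(2)[OF axis_Basis(1)]]
 note L = bcomp_Lb[OF D h(1) b(1)] bcomp_Lb[OF D h(4) b(2)] bcomp_Lb[OF D h(5) b(3)]
 have n: "L2norm D u <= H2norm D u" "L2norm D (weak_grad D u) <= H2norm D u" "L2norm D (weak_grad D (weak_grad D u)) <= H2norm D u"
  by (simp_all add: H2norm_def L2norm_nonneg)
 show "fbound (H2norm D u) (fu D u) (fu1 D u) (fu2 D u)"
  unfolding fbound_def wbound_def fu_def fu1_def fu2_def using Lb_mono[OF L(1) n(1)] Lb_mono[OF L(2) n(2)] Lb_mono[OF L(3) n(3)] by blast
 note l = has_weak_grad_locally_integrable[OF h(3)]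
 have w: "weak_dir D (axis k 1) (bcomp D (weak_grad D u) (axis i (axis j 1))) (bcomp D (weak_grad D (weak_grad D u)) (axis k (axis i (axis j 1))))" for i j k
  using has_weak_grad_iff_weak_dir[OF D l] h(3) b(2) by blast
 show "field D (fu D u) (fu1 D u) (fu2 D u)"
  unfolding field_def wclass_def fu_def fu1_def fu2_def
  using H10_DQ[OF D u'(2) h(2,4) b(1)] sqI[OF L(3)]
   DQ_cutoff[OF D _ _ sqI[OF L(2)] bcomp(3)[OF D L2D(1)[OF h(4)]] sqI[OF L(3)] w] by blast
qed

text \<open>The components of u - v are differences of chosen gradients, while its norm refers to a
  gradient chosen for the difference; both are weak gradients of u - v, so \<open>H2_data\<close>
  equates the norms.\<close>

lemma W_diff:
 assumes D: "open D" and u: "u \<in> W D" and v: "v \<in> W D"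
 shows "fdist (H2norm D (%x. u x - v x)) (fu D u) (fu1 D u) (fu2 D u) (fu D v) (fu1 D v) (fu2 D v)"
proof -
 have u': "u \<in> H2 D" "v \<in> H2 D" using u v by (auto simp: W_def)
 note h = H2_D[OF D u'(1)] and k = H2_D[OF D u'(2)]
 note d = L2_diff[OF D h(1) k(1)] L2_diff[OF D h(4) k(4)] L2_diff[OF D h(5) k(5)]
 have e: "H2norm D (%x. u x - v x) = L2norm D (%x. u x - v x) + L2norm D (%x. weak_grad D u x - weak_grad D v x)
   + L2norm D (%x. weak_grad D (weak_grad D u) x - weak_grad D (weak_grad D v) x)"
  by (rule H2_data(2)[OF D d has_weak_grad_diff[OF D h(2) k(2)] has_weak_grad_diff[OF D h(3) k(3)]])
 have L: "Lb 2 (%x. bcomp D f b x - bcomp D g b x) (H2norm D (%x. u x - v x))"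
  if f: "f \<in> L2 D" "g \<in> L2 D" and b: "b \<in> Basis" and n: "L2norm D (%x. f x - g x) <= H2norm D (%x. u x - v x)"
  for f g :: "real^'a => 'c::euclidean_space" and b
  by (rule Lb_cong_AE[OF Lb_mono[OF bcomp_Lb[OF D L2_diff[OF D f] b] n] _ bcomp_diff[OF D f]])
   (use bcomp(1)[OF D L2D(1)[OF f(1)], of b] bcomp(1)[OF D L2D(1)[OF f(2)], of b] in measurable)
 show ?thesis
  unfolding fbound_def wbound_def fu_def fu1_def fu2_def
  by (intro allI conjI L h(1,4,5) k(1,4,5) axis_Basis) (simp_all add: e L2norm_nonneg)
qed

subsection \<open>Potentials, weights and kernels of the peridynamic force\<close>

lemma Pot_convex_concave:
 assumes c: "convex_concave f" and s: "finite_sup_derivs f"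
 obtains C where "Pot C (deriv f) ((deriv ^^ 2) f) ((deriv ^^ 3) f)"
proof -
 have d: "((deriv ^^ k) f has_real_derivative (deriv ^^ Suc k) f r) (at r)" if "k < 4" for k r
  using c that DERIV_deriv_iff_real_differentiable[of "(deriv ^^ k) f" r] by (simp add: convex_concave_def four_times_differentiable_def)
 have "\<exists>B. \<forall>r. \<bar>(deriv ^^ k) f r\<bar> <= B" if "k <= 4" for k
  using s that unfolding finite_sup_derivs_def bdd_above_def by auto
 then obtain B where B: "!!k r. k <= 4 ==> \<bar>(deriv ^^ k) f r\<bar> <= B k" by metis
 have B0: "0 <= B k" if "k <= 4" for k using B[OF that, of 0] by linarith
 define C where "C = B 2 + B 3 + B 4"
 have C: "B 2 <= C" "B 3 <= C" "B 4 <= C" using B0 by (simp_all add: C_def)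
 have "Pot C (deriv f) ((deriv ^^ 2) f) ((deriv ^^ 3) f)"
  unfolding Pot_def
 proof (intro conjI allI)
  show "deriv f 0 = 0" using c by (simp add: convex_concave_def)
  fix r s
  show "(deriv f has_real_derivative (deriv ^^ 2) f r) (at r)" using d[of 1 r] by (simp add: numeral_2_eq_2)
  show "((deriv ^^ 2) f has_real_derivative (deriv ^^ 3) f r) (at r)" using d[of 2 r] by (simp add: numeral_3_eq_3)
  show "\<bar>(deriv ^^ 2) f r\<bar> <= C" "\<bar>(deriv ^^ 3) f r\<bar> <= C" using B[of 2 r] B[of 3 r] C by linarith+
  show "\<bar>(deriv ^^ 3) f r - (deriv ^^ 3) f s\<bar> <= C * \<bar>r - s\<bar>"
   using field_differentiable_bound[of UNIV "(deriv ^^ 3) f" "(deriv ^^ 4) f" C r s] d[of 3] B[of 4] C(3)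
   by (auto intro: has_field_derivative_at_within order_trans simp: eval_nat_numeral)
 qed
 then show thesis by (rule that)
qed

lemma Pot_quadratic:
 assumes "quadratic_potential g"
 obtains C F1 F2 where "Pot C (deriv g) F1 F2"
proof -
 obtain be where b: "be > 0" "!!r. g r = be * r^2 / 2" using assms by (auto simp: quadratic_potential_def)
 have "(g has_real_derivative be * r) (at r)" for r
  unfolding b(2)[abs_def] by (auto intro!: derivative_eq_intros)
 then have "deriv g = (%r. be * r)" by (intro ext DERIV_imp_deriv)
 moreover have "Pot be (%r. be * r) (%_. be) (%_. 0)"
  unfolding Pot_def using b(1) by (auto intro!: derivative_eq_intros)
 ultimately show thesis using that[of be "%_. be" "%_. 0"] by simp
qed

text \<open>The derivative is Borel as a pointwise limit of difference quotients, although it need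
  not be continuous.\<close>

lemma Mult_if_differentiable:
 fixes b :: "real^'n => real"
 assumes d: "!!x. b differentiable (at x)" and K: "!!x. \<bar>b x\<bar> <= K" "!!x. \<bar>fder b x (axis i 1)\<bar> <= K"
 shows "Mult K i b (%x. fder b x (axis i 1))"
  "((%t. b (x + t *R axis i 1)) has_real_derivative fder b x (axis i 1)) (at 0)"
proof -
 have D: "((%t. b (x + t *R axis i 1)) has_real_derivative fder b x (axis i 1)) (at 0)" for x
  using frechet_line[OF d[of x], of "axis i 1"] by (simp add: DERIV_def)
 then show "((%t. b (x + t *R axis i 1)) has_real_derivative fder b x (axis i 1)) (at 0)" .
 have "continuous_on UNIV b" using d by (simp add: differentiable_imp_continuous_within continuous_at_imp_continuous_on)
 then have m[measurable]: "b \<in> bmeas" by (rule borel_measurable_continuous_onI)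
 have "(%x. fder b x (axis i 1)) \<in> bmeas"
 proof (rule borel_measurable_LIMSEQ_real)
  show "(%n. dq i n b x) \<longlonglongrightarrow> fder b x (axis i 1)" for x
  proof -
   have "step n ~= 0" for n using step_pos[of n] by simp
   then have "filterlim step (at 0) sequentially" by (simp add: filterlim_at step_tendsto)
   from filterlim_compose[OF frechet_line[OF d[of x], of "axis i 1"] this] show ?thesis .
  qed
  show "dq i n b \<in> bmeas" for n by measurable
 qed
 then show "Mult K i b (%x. fder b x (axis i 1))" by (rule MultI[OF m _ D K])
qed

lemma Weight_boundary_function:
 fixes om :: "real^'n => real"
 assumes w: "boundary_function D om" and b: "bdd_above (range (%x. norm (grad om x)))" "bdd_above (range (%x. norm (grad (grad om) x)))"
 obtains K where "Weight K D om (%i x. grad om x $ i) (%i k x. grad (grad om) x $ k $ i)"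
proof -
 obtain B1 B2 where B: "!!x. norm (grad om x) <= B1" "!!x. norm (grad (grad om) x) <= B2" using b by (auto simp: bdd_above_def)
 have B0: "0 <= B1" "0 <= B2" using B order_trans[OF norm_ge_zero] by blast+
 define K where "K = 1 + B1 + B2"
 have d: "om differentiable (at x)" "grad om differentiable (at x)" for x using w by (auto simp: boundary_function_def)
 have w01: "0 <= om x" "om x <= 1" "x \<notin> D ==> om x = 0" for x using w by (cases "x \<in> D"; auto simp: boundary_function_def)+
 have e: "grad om x $ i = fder om x (axis i 1)" for x i by (simp add: grad_def)
 have d2: "(%x. grad om x $ i) differentiable (at x)"
  "grad (grad om) x $ k $ i = fder (%x. grad om x $ i) x (axis k 1)" for x i k
  using grad_inner(1)[OF d(2)[of x], of "axis i 1"] grad_inner(2)[OF d(2)[of x], of "axis i 1" "axis k 1"] by (simp_all add: inner_axis grad_def[of "grad om"])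
 have n: "\<bar>om x\<bar> <= K" "\<bar>grad om x $ i\<bar> <= K" "\<bar>grad (grad om) x $ k $ i\<bar> <= K" for x i k
  using w01[of x] B0 order_trans[OF component_le_norm_cart[of "grad om x" i] B(1)]
   order_trans[OF component_le_norm_cart[of "grad (grad om) x $ k" i] order_trans[OF Finite_Cartesian_Product.norm_nth_le B(2)]]
  by (auto simp: K_def)
 have "Weight K D om (%i x. grad om x $ i) (%i k x. grad (grad om) x $ k $ i)"
  unfolding Weight_def
 proof (intro conjI allI impI w01)
  show "1 <= K" using B0 by (simp add: K_def)
  show "((%t. om (x + t *R axis i 1)) has_real_derivative grad om x $ i) (at 0)" "Mult K i om (%x. grad om x $ i)" for i x
   using Mult_if_differentiable[OF d(1), of K i] n(1,2) by (simp_all add: e)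
  show "Mult K k (%x. grad om x $ i) (%x. grad (grad om) x $ k $ i)" for i k
   using Mult_if_differentiable(1)[OF d2(1), of i K k] n(2,3) by (simp add: d2(2)[symmetric])
 qed
 then show thesis by (rule that)
qed

section \<open>Kernels of the force\<close>

definition infl_bound :: "real => (real => real) => bool" where
 "infl_bound M J \<longleftrightarrow> 0 <= M \<and> J \<in> bmeas \<and> (\<forall>r\<ge>0. \<bar>J r\<bar> <= M)"

lemma influence_function_bound:
 assumes "influence_function J"
 obtains M where "infl_bound M J"
proof -
 obtain M where J: "J \<in> bmeas" "!!r. 0 <= r ==> r < 1 ==> 0 <= J r \<and> J r <= M" "!!r. r >= 1 ==> J r = 0"
  using assms unfolding influence_function_def by blast
 have "0 <= M" using J(2)[of 0] by simp
 moreover have "\<bar>J r\<bar> <= M" if "0 <= r" for r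
  using J(2)[OF that] J(3)[of r] \<open>0 <= M\<close> by (cases "r < 1") auto
 ultimately show thesis using J(1) that by (auto simp: infl_bound_def)
qed

text \<open>The radius r of the support is separate from the horizon eps in the argument of J, so
  that r can later be min eps R. The factor 1/sqrt(norm z) belongs to the kernel and is the source
  of its singularity.\<close>

definition kT :: "(real => real) => real => real => 'n => real^'n => real" where
 "kT J eps r j z = indicator (ball 0 r) z * (J (norm z / eps) / sqrt (norm z)) * (z $ j / norm z)"

text \<open>With the normalization included, the mass is at most M (r / eps)^n, which shows the
  effect of a horizon larger than D.\<close>

definition kD :: "(real => real) => real => real => 'n => real^'n => real" where
 "kD J eps r j z = indicator (ball 0 r) z * J (norm z / eps) * (z $ j / norm z) / (eps ^ CARD('n) * ball_vol TYPE('n))"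

lemma component_measurable[measurable]: "(%z::real^'n. z $ j) \<in> bmeas"
 by (intro borel_measurable_continuous_onI) (auto intro!: continuous_intros)

lemma kT_kernel:
 fixes z :: "real^'n"
 assumes J: "infl_bound M J" and e: "0 < eps"
 shows "kT J eps r j \<in> borel_measurable (borel :: (real^'n) measure)"
  "\<bar>kT J eps r j z\<bar> <= M * (indicator (ball 0 r) z * norm z powr (- 1 / 2))"
proof -
 have [measurable]: "J \<in> bmeas" "ball (0::real^'n) r \<in> sets borel" using J by (auto simp: infl_bound_def)
 show "kT J eps r j \<in> borel_measurable (borel :: (real^'n) measure)" unfolding kT_def[abs_def] by measurable
 have s: "norm z powr (- 1 / 2) = 1 / sqrt (norm z)" by (cases "z = 0") (simp_all add: powr_minus_divide powr_half_sqrt[symmetric])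
 have "\<bar>J (norm z / eps)\<bar> <= M" using J e by (simp add: infl_bound_def)
 then have "\<bar>J (norm z / eps)\<bar> * \<bar>z $ j / norm z\<bar> <= M * 1" using component_quotient_le[of z j] by (intro mult_mono) auto
 from mult_left_mono[OF this, of "indicator (ball 0 r) z * (1 / sqrt (norm z))"]
 show "\<bar>kT J eps r j z\<bar> <= M * (indicator (ball 0 r) z * norm z powr (- 1 / 2))"
  unfolding s by (simp add: kT_def abs_mult mult_ac)
qed

lemma ball_vol: "ball_vol TYPE('n::finite) = measure lborel (ball (0::real^'n) 1)" "0 < ball_vol TYPE('n::finite)"
proof -
 show e: "ball_vol TYPE('n::finite) = measure lborel (ball (0::real^'n) 1)" by (simp add: ball_vol_def)
 have "\<not> negligible (ball (0::real^'n) 1)" by (rule open_not_negligible) auto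
 then have "emeasure lborel (ball (0::real^'n) 1) ~= 0" by (simp add: negligible_iff_null_sets null_sets_def)
 then show "0 < ball_vol TYPE('n::finite)"
  unfolding e using emeasure_lborel_ball_finite[of "0::real^'n" 1] by (simp add: measure_def enn2real_positive_iff less_top zero_less_iff_neq_zero)
qed

lemma kD_kernel:
 assumes J: "infl_bound M J" and e: "0 < eps" and r: "0 < r"
 shows "kern (M * (r / eps) ^ CARD('n)) (kD J eps r (j::'n::finite))"
 unfolding kern_def
proof (intro conjI)
 let ?n = "CARD('n)"
 define b where "b = ball_vol TYPE('n)"
 have b: "0 < b" by (simp add: b_def ball_vol)
 have M: "0 <= M" using J by (simp add: infl_bound_def)
 then show "0 <= M * (r / eps) ^ ?n" using e r by simp
 have [measurable]: "J \<in> bmeas" "ball (0::real^'n) r \<in> sets borel" using J by (auto simp: infl_bound_def)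
 show "kD J eps r j \<in> bmeas" unfolding kD_def[abs_def] by measurable
 have "\<bar>kD J eps r j z\<bar> <= M / (eps ^ ?n * b) * indicator (ball 0 r) z" for z
 proof -
  have "\<bar>J (norm z / eps)\<bar> <= M" using J e by (simp add: infl_bound_def)
  then have "\<bar>J (norm z / eps)\<bar> * \<bar>z $ j / norm z\<bar> <= M * 1" using component_quotient_le[of z j] M by (intro mult_mono) auto
  from mult_left_mono[OF this, of "indicator (ball 0 r) z / (eps ^ ?n * b)"] show ?thesis
   using e b by (simp add: kD_def abs_mult b_def[symmetric] mult_ac)
 qed
 note le = this
 have "(\<integral>\<^sup>+z. ennreal \<bar>kD J eps r j z\<bar> \<partial>lborel) <= (\<integral>\<^sup>+z. ennreal (M / (eps ^ ?n * b)) * indicator (ball (0::real^'n) r) z \<partial>lborel)"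
 proof (rule nn_integral_mono)
  show "ennreal \<bar>kD J eps r j z\<bar> <= ennreal (M / (eps ^ ?n * b)) * indicator (ball 0 r) z" for z
   using ennreal_leI[OF le[of z]] by (auto split: split_indicator)
 qed
 also have "... = ennreal (M / (eps ^ ?n * b)) * ennreal (r ^ ?n * b)"
  using emeasure_ball_scale[OF r, where 'a="real^'n"] by (simp add: nn_integral_cmult_indicator b_def ball_vol)
 also have "... = ennreal (M / (eps ^ ?n * b) * (r ^ ?n * b))"
  using M e b r by (intro ennreal_mult[symmetric]) auto
 also have "M / (eps ^ ?n * b) * (r ^ ?n * b) = M * (r / eps) ^ ?n" using b e by (simp add: power_divide)
 finally show "(\<integral>\<^sup>+z. ennreal \<bar>kD J eps r j z\<bar> \<partial>lborel) <= ennreal (M * (r / eps) ^ ?n)" .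
qed

lemma ball_integral_scalar:
 fixes w :: "real^'n => real"
 assumes w[measurable]: "w \<in> bmeas" and e: "AE y in lborel. indicator (ball x eps) y * h y = w (y - x)"
 shows "(LINT y:ball x eps|lebesgue. h y) = (LINT z|lborel. w z)"
proof -
 have g: "(%y. w (y + - x)) \<in> bmeas" by measurable
 then have "(%y. w (y + - x)) \<in> borel_measurable lebesgue" by (simp add: measurable_completion)
 then have m: "(%y. indicator (ball x eps) y *R h y) \<in> borel_measurable lebesgue"
  by (rule borel_measurable_AE) (rule AE_completion, use e in \<open>eventually_elim, simp\<close>)
 have "(LINT y:ball x eps|lebesgue. h y) = (LINT y|lborel. w (y + - x))"
  unfolding set_lebesgue_integral_def by (rule integral_lebesgue_borel(1)[OF m g]) (use e in \<open>eventually_elim, simp\<close>)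
 also have "... = (LINT z|lborel. w z)" by (rule lborel_integral_translate(1)[OF w])
 finally show ?thesis .
qed

text \<open>All components are required to be integrable: the Bochner integral of a vector function
  that is not integrable is 0, even if one of its components has a nonzero integral.\<close>

lemma ball_integral_component:
 fixes w :: "'n => real^'n => real"
 assumes w: "!!j. integrable lborel (w j)" and e: "!!j. AE y in lborel. (indicator (ball x eps) y *R h y) $ j = w j (y - x)"
 shows "(LINT y:ball x eps|lebesgue. h y) $ j = (LINT z|lborel. w j z)"
proof -
 have m[measurable]: "w j \<in> bmeas" for j using borel_measurable_integrable[OF w[of j]] by simp
 define V where "V y = (\<Sum>j\<in>UNIV. w j (y + - x) *R axis j (1::real))" for y
 have Vj: "V y $ j = w j (y - x)" for y j
  by (simp add: V_def sum_component axis_def if_distrib[of "%t. _ * t"] sum.delta cong: if_cong)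
 have i: "integrable lborel (%y. w j (y + - x))" for j using lborel_integral_translate(2)[OF m, of j "- x"] w by simp
 have V: "V \<in> bmeas" "integrable lborel V" unfolding V_def[abs_def] using i by (measurable, auto)
 have "AE y in lborel. \<forall>j. (indicator (ball x eps) y *R h y) $ j = w j (y - x)"
  using e by (intro AE_all_countable[THEN iffD2]) auto
 then have e': "AE y in lborel. V y = indicator (ball x eps) y *R h y" by eventually_elim (simp add: vec_eq_iff Vj)
 have V': "V \<in> borel_measurable lebesgue" using V(1) by (simp add: measurable_completion)
 have m': "(%y. indicator (ball x eps) y *R h y) \<in> borel_measurable lebesgue"
  by (rule borel_measurable_AE[OF V' AE_completion[OF e']])
 have "(LINT y:ball x eps|lebesgue. h y) = integral\<^sup>L lborel V"
  unfolding set_lebesgue_integral_def by (rule integral_lebesgue_borel(1)[OF m' V(1)]) (use e' in \<open>eventually_elim, simp\<close>)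
 also have "... $ j = (LINT y|lborel. V y $ j)"
  by (rule integral_bounded_linear[OF bounded_linear_vec_nth V(2), symmetric])
 also have "... = (LINT z|lborel. w j z)" using lborel_integral_translate(1)[OF m, of j "- x"] by (simp add: Vj)
 finally show ?thesis .
qed

text \<open>At z = 0 both sides are 0, as division by zero gives 0.\<close>

lemma strain_rel:
 fixes u :: "real^'n => real^'n"
 assumes "!!j. u (x + z) $ j = U j (x + z)" "!!j. u x $ j = U j x"
 shows "strain u (x + z) x = rel z U x / norm z"
proof -
 have "strain u (x + z) x = (\<Sum>j\<in>UNIV. (u (x + z) $ j - u x $ j) / norm z * (z $ j / norm z))"
  by (simp add: strain_def unit_dir_def inner_vec_def divide_inverse mult_ac)
 also have "... = rel z U x / norm z" unfolding rel_def sum_divide_distrib by (intro sum.cong refl) (simp add: assms mult_ac)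
 finally show ?thesis .
qed

section \<open>The force as an integral over relative positions\<close>

context tensile
begin

lemma W_rep:
 assumes D: "open D" and u: "u \<in> W D"
 shows "AE y in lborel. \<forall>j. u y $ j = fu D u j y"
proof -
 have m: "set_borel_measurable lebesgue D u" and 0: "!!x. x \<notin> D ==> u x = 0" using u H2_D(1)[OF D] L2D(1) by (auto simp: W_def)
 have "AE y in lborel. u y $ j = fu D u j y" for j
  using bcomp(2)[OF D m, of "axis j 1"] by eventually_elim (use 0 in \<open>auto simp: fu_def inner_axis split: split_indicator\<close>)
 then show ?thesis by (intro AE_all_countable[THEN iffD2]) auto
qed

text \<open>Two situations in which only |z| < R contributes: a horizon of at most R, or a domain of
  diameter less than R, where one of the two boundary weights vanishes for larger z.\<close>

definition reach :: "real => real => bool" where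
 "reach R eps \<longleftrightarrow> 0 < eps \<and> 0 < R \<and> (eps <= R \<or> (\<forall>x\<in>D. \<forall>y\<in>D. dist x y < R))"

text \<open>Since \<open>om\<close> vanishes outside \<open>D\<close>, the horizon may be replaced by \<open>min eps R\<close>.\<close>

lemma reach_indicator:
 assumes r: "reach R eps" and x: "x \<in> D"
 shows "indicator (ball x eps) y * om y = indicator (ball 0 (min eps R)) (y - x) * om y"
proof (cases "y \<in> D")
 case True
 have "dist x y < eps \<longleftrightarrow> norm (y - x) < min eps R"
  using r x True by (auto simp: reach_def dist_norm norm_minus_commute)
 then show ?thesis by (auto simp: indicator_def)
qed (simp add: WeightD(4)[OF weight])

lemma om_le_1: "\<bar>om x\<bar> <= 1"
 using WeightD(2,3)[OF weight, of x] by simp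

text \<open>The function u equals its Borel components almost everywhere only. The replacement is
  therefore made twice, at the outer point x and, inside the integral, at almost every y.\<close>

lemma dilation_rep:
 assumes D: "open D" and u: "u \<in> W D" and J: "infl_bound M J" and r: "reach R eps"
 shows "AE x in lborel. x \<in> D --> dilation J om eps u x = dil0 (kD J eps (min eps R)) (fu D u) x"
proof -
 define k :: "'n => real^'n => real" where "k = kD J eps (min eps R)"
 define c where "c = eps ^ CARD('n) * ball_vol TYPE('n)"
 have e: "0 < eps" "0 < min eps R" using r by (auto simp: reach_def)
 have c: "0 < c" using e by (simp add: c_def ball_vol)
 have k: "kern (M * (min eps R / eps) ^ CARD('n)) (k j)" for j unfolding k_def by (rule kD_kernel[OF J e])
 have kc: "c * k j z = indicator (ball 0 (min eps R)) z * J (norm z / eps) * (z $ j / norm z)" for j z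
  using c unfolding k_def kD_def c_def[symmetric] by simp
 note W = W_field[OF D u] and rep = W_rep[OF D u]
 have i: "AE x in lborel. \<forall>j. integrable lborel (%z. k j z * pr0 om (fu D u j) (x + z))"
  using conv_Lb(2)[OF k wboundD(1)[OF Q_parts(3)[where kk=k, OF k W]]] by (intro AE_all_countable[THEN iffD2]) auto
 have mu[measurable]: "fu D u j \<in> bmeas" for j using field_measurable(1)[OF W(1)] .
 have mk[measurable]: "k j \<in> bmeas" for j using kernD(2)[OF k] .
 show ?thesis using i rep
 proof eventually_elim
  case (elim x)
  show ?case
  proof
   assume x: "x \<in> D"
   define w where "w z = c * (\<Sum>j\<in>UNIV. k j z * (om (x + z) * (fu D u j (x + z) - fu D u j x)))" for z
   have "(LINT y:ball x eps|lebesgue. om y * J (norm (y - x) / eps) * strain u y x * norm (y - x)) = (LINT z|lborel. w z)"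
   proof (rule ball_integral_scalar)
    show "w \<in> bmeas" unfolding w_def[abs_def] by measurable
    show "AE y in lborel. indicator (ball x eps) y * (om y * J (norm (y - x) / eps) * strain u y x * norm (y - x)) = w (y - x)"
     using rep
    proof eventually_elim
     case (elim y)
     define z where "z = y - x"
     have y: "y = x + z" by (simp add: z_def)
     have s: "strain u y x * norm z = rel z (fu D u) x"
      using strain_rel[of u x z "fu D u"] elim \<open>\<forall>j. u x $ j = fu D u j x\<close> by (cases "z = 0") (simp_all add: y rel_def)
     have "indicator (ball x eps) y * (om y * J (norm (y - x) / eps) * strain u y x * norm (y - x))
      = (indicator (ball x eps) y * om y) * J (norm z / eps) * (strain u y x * norm z)" by (simp add: z_def)
     also have "... = (indicator (ball 0 (min eps R)) z * om y) * J (norm z / eps) * rel z (fu D u) x"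
      unfolding reach_indicator[OF r x] s by (simp add: z_def)
     also have "... = w z"
      unfolding w_def rel_def sum_distrib_left mult.assoc[symmetric] kc by (intro sum.cong refl) (simp add: y mult_ac)
     finally show ?case by (simp add: z_def)
    qed
   qed
   also have "... = c * (LINT z|lborel. (\<Sum>j\<in>UNIV. k j z * pr0 om (fu D u j) (x + z) - fu D u j x * (k j z * om (x + z))))"
    unfolding w_def by (simp add: pr0_def algebra_simps)
   also have "(LINT z|lborel. (\<Sum>j\<in>UNIV. k j z * pr0 om (fu D u j) (x + z) - fu D u j x * (k j z * om (x + z)))) = dil0 k (fu D u) x"
   proof -
    have iw: "integrable lborel (%z. k j z * om (x + z))" for j by (rule kern_bounded(1)[OF k _ om_le_1]) measurable
    have "(LINT z|lborel. (\<Sum>j\<in>UNIV. k j z * pr0 om (fu D u j) (x + z) - fu D u j x * (k j z * om (x + z)))) =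
     (\<Sum>j\<in>UNIV. LINT z|lborel. (k j z * pr0 om (fu D u j) (x + z) - fu D u j x * (k j z * om (x + z))))"
     using elim(1) iw by (intro Bochner_Integration.integral_sum Bochner_Integration.integrable_diff integrable_mult_right) auto
    also have "... = (\<Sum>j\<in>UNIV. (LINT z|lborel. k j z * pr0 om (fu D u j) (x + z)) - fu D u j x * (LINT z|lborel. k j z * om (x + z)))"
     using elim(1) iw by (intro sum.cong refl) (subst Bochner_Integration.integral_diff, auto)
    also have "... = dil0 k (fu D u) x" by (simp add: dil0_def Q0_def conv_def pr0_def mult.commute)
    finally show ?thesis .
   qed
   finally show "dilation J om eps u x = dil0 (kD J eps (min eps R)) (fu D u) x"
    using c by (simp add: dilation_def c_def[symmetric] k_def[symmetric])
  qed
 qed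
qed

lemma force_D_rep:
 assumes D: "open D" and u: "u \<in> W D" and J: "infl_bound M J" and r: "reach R eps" and g: "F = deriv g"
 shows "AE x in lborel. x \<in> D --> (\<forall>j. force_D J om g eps u x $ j = 1 / eps^2 * D0 (kD J eps (min eps R)) (fu D u) j x)"
proof -
 define k :: "'n => real^'n => real" where "k = kD J eps (min eps R)"
 define c where "c = eps ^ CARD('n) * ball_vol TYPE('n)"
 have e: "0 < eps" "0 < min eps R" using r by (auto simp: reach_def)
 have c: "0 < c" using e by (simp add: c_def ball_vol)
 have k: "kern (M * (min eps R / eps) ^ CARD('n)) (k j)" for j unfolding k_def by (rule kD_kernel[OF J e])
 have kc: "c * k j z = indicator (ball 0 (min eps R)) z * J (norm z / eps) * (z $ j / norm z)" for j z
  using c unfolding k_def kD_def c_def[symmetric] by simp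
 note W = W_field[OF D u] and dil = dilation_rep[OF D u J r, folded k_def]
 define P where "P = P0 k (fu D u)"
 have P: "AE y in lborel. om y * deriv g (dilation J om eps u y) = P y"
  using dil
 proof eventually_elim
  case (elim y)
  have "P y = om y * F (dil0 k (fu D u) y)" by (simp add: P_def P0_def nlw0_def)
  with elim show ?case using WeightD(4)[OF weight, of y] by (cases "y \<in> D") (simp_all add: g)
 qed
 obtain b where b: "Lb 2 P b"
 proof -
  have "0 <= M * (min eps R / eps) ^ CARD('n)" using kernD(1)[OF k] .
  then show thesis
   apply (rule P_estimates)
   subgoal premises p for L
    using p(2)[of "M * (min eps R / eps) ^ CARD('n)" k, OF k order_refl W] that wboundD(1) unfolding P_def by blast
   done
 qed
 have i: "AE x in lborel. \<forall>j. integrable lborel (%z. k j z * P (x + z))"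
  using conv_Lb(2)[OF k b] by (intro AE_all_countable[THEN iffD2]) auto
 show ?thesis using i P
 proof eventually_elim
  case (elim x)
  show ?case
  proof (intro impI allI)
   fix j assume x: "x \<in> D"
   define w where "w j z = c / eps^2 * (om x * (k j z * P (x + z)) + P x * (k j z * om (x + z)))" for j z
   have iw: "integrable lborel (%z. k j z * om (x + z))" for j
    by (rule kern_bounded(1)[OF k _ om_le_1]) measurable
   have "(LINT y:ball x eps|lebesgue. (om x * om y * (J (norm (y - x) / eps) / eps^2) *
     (deriv g (dilation J om eps u y) + deriv g (dilation J om eps u x))) *R unit_dir y x) $ j = (LINT z|lborel. w j z)"
   proof (rule ball_integral_component)
    show "integrable lborel (w j)" for j unfolding w_def[abs_def] using elim(1) iw by auto
    fix j
    show "AE y in lborel. (indicator (ball x eps) y *R ((om x * om y * (J (norm (y - x) / eps) / eps^2) *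
     (deriv g (dilation J om eps u y) + deriv g (dilation J om eps u x))) *R unit_dir y x)) $ j = w j (y - x)"
     using P
    proof eventually_elim
     case (elim y)
     define z where "z = y - x"
     have y: "y = x + z" by (simp add: z_def)
     define G where "G y = deriv g (dilation J om eps u y)" for y
     define I where "I = (indicator (ball 0 (min eps R)) z :: real)"
     have Py: "P y = om y * G y" "P x = om x * G x" using elim \<open>om x * deriv g (dilation J om eps u x) = P x\<close> by (simp_all add: G_def)
     have "(indicator (ball x eps) y *R ((om x * om y * (J (norm (y - x) / eps) / eps^2) * (G y + G x)) *R unit_dir y x)) $ j
      = (indicator (ball x eps) y * om y) * (om x * (J (norm z / eps) / eps^2) * (G y + G x) * (z $ j / norm z))"
      by (simp add: unit_dir_def z_def divide_inverse mult_ac)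
     also have "indicator (ball x eps) y * om y = I * om y" unfolding I_def reach_indicator[OF r x] by (simp add: z_def)
     also have "I * om y * (om x * (J (norm z / eps) / eps^2) * (G y + G x) * (z $ j / norm z)) = c / eps^2 * (om x * (k j z * P y) + P x * (k j z * om y))"
     proof -
      have "c / eps^2 * (om x * (k j z * P y) + P x * (k j z * om y)) = (c * k j z) / eps^2 * (om x * P y + P x * om y)"
       by (simp add: algebra_simps add_divide_distrib)
      then show ?thesis by (simp only: kc Py I_def[symmetric]) (simp add: algebra_simps add_divide_distrib)
     qed
     finally show ?case by (simp add: w_def G_def y)
    qed
   qed
   also have "... = c / eps^2 * (om x * (LINT z|lborel. k j z * P (x + z)) + P x * (LINT z|lborel. k j z * om (x + z)))"
    unfolding w_def using elim(1) iw by (subst integral_mult_right_zero, subst Bochner_Integration.integral_add) auto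
   also have "... = c / eps^2 * D0 k (fu D u) j x" by (simp add: D0_def pr0_def conv_def P_def)
   finally show "force_D J om g eps u x $ j = 1 / eps^2 * D0 (kD J eps (min eps R)) (fu D u) j x"
    using c by (simp add: force_D_def c_def[symmetric] k_def[symmetric])
  qed
 qed
qed

lemma force_T_rep:
 assumes D: "open D" and u: "u \<in> W D" and J: "infl_bound M J" and r: "reach R eps" and f: "F = deriv f"
 shows "AE x in lborel. x \<in> D --> (\<forall>j. force_T J om f eps u x $ j =
  2 / (eps ^ (CARD('n) + 1) * ball_vol TYPE('n)) * I0 (kT J eps (min eps R) j) (fu D u) x)"
proof -
 define k :: "'n => real^'n => real" where "k = kT J eps (min eps R)"
 have e: "0 < eps" "0 < min eps R" "min eps R <= R" "0 < R" using r by (auto simp: reach_def)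
 have M: "0 <= M" using J by (simp add: infl_bound_def)
 note W = W_field[OF D u] and rep = W_rep[OF D u]
 have "AE x in lborel. integrable lborel (%z. k j z * T0 (fu D u) z x)" for j
  apply (rule tensile_integral[OF e(4)])
  subgoal premises p for L
   using p(2)[OF M e(2,3) kT_kernel[OF J e(1)] W, of j] unfolding k_def by blast
  done
 then have i: "AE x in lborel. \<forall>j. integrable lborel (%z. k j z * T0 (fu D u) z x)"
  by (intro AE_all_countable[THEN iffD2]) auto
 show ?thesis using i rep
 proof eventually_elim
  case (elim x)
  show ?case
  proof (intro impI allI)
   fix j assume x: "x \<in> D"
   have "(LINT y:ball x eps|lebesgue. (om x * om y * (J (norm (y - x) / eps) / sqrt (norm (y - x))) *
     deriv f (sqrt (norm (y - x)) * strain u y x)) *R unit_dir y x) $ j = (LINT z|lborel. k j z * T0 (fu D u) z x)"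
   proof (rule ball_integral_component)
    show "integrable lborel (%z. k j z * T0 (fu D u) z x)" for j using elim(1) by blast
    fix j
    show "AE y in lborel. (indicator (ball x eps) y *R ((om x * om y * (J (norm (y - x) / eps) / sqrt (norm (y - x))) *
     deriv f (sqrt (norm (y - x)) * strain u y x)) *R unit_dir y x)) $ j = k j (y - x) * T0 (fu D u) (y - x) x"
     using rep
    proof eventually_elim
     case (elim y)
     define z where "z = y - x"
     have y: "y = x + z" by (simp add: z_def)
     define Q where "Q = deriv f (sqrt (norm z) * strain u y x)"
     have "strain u y x = rel z (fu D u) x / norm z"
      using strain_rel[of u x z "fu D u"] elim \<open>\<forall>j. u x $ j = fu D u j x\<close> by (simp add: y)
     \<comment> \<open>Since the strain is \<open>rel\<close> divided by the norm, the factor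
       sqrt(norm z) leaves |z|^(-1/2) in front of \<open>rel\<close>; at z = 0 both sides
       vanish.\<close>
     moreover have "sqrt (norm z) * (a / norm z) = sz z * a" for a
     proof (cases "z = 0")
      case False
      then have "sz z = 1 / sqrt (norm z)" by (simp add: sz_def powr_minus_divide powr_half_sqrt[symmetric])
      moreover have "s * (a / (s * s)) = 1 / s * a" if "s ~= 0" for s :: real using that by (simp add: field_simps)
      from this[of "sqrt (norm z)"] have "sqrt (norm z) * (a / norm z) = 1 / sqrt (norm z) * a" using False by simp
      ultimately show ?thesis by simp
     qed (simp add: sz_def)
     ultimately have Q: "F (sz z * rel z (fu D u) x) = Q" by (simp add: Q_def f)
     have "(indicator (ball x eps) y *R ((om x * om y * (J (norm (y - x) / eps) / sqrt (norm (y - x))) * Q) *R unit_dir y x)) $ j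
      = (indicator (ball x eps) y * om y) * (om x * (J (norm z / eps) / sqrt (norm z)) * Q * (z $ j / norm z))"
      by (simp add: unit_dir_def z_def divide_inverse mult_ac)
     also have "indicator (ball x eps) y * om y = indicator (ball 0 (min eps R)) z * om y" unfolding reach_indicator[OF r x] by (simp add: z_def)
     also have "indicator (ball 0 (min eps R)) z * om y * (om x * (J (norm z / eps) / sqrt (norm z)) * Q * (z $ j / norm z)) = k j z * T0 (fu D u) z x"
      unfolding T0_def nlw0_def Q az_def k_def kT_def by (simp add: y mult_ac)
     finally show ?case by (simp add: z_def Q_def)
    qed
   qed
   then show "force_T J om f eps u x $ j = 2 / (eps ^ (CARD('n) + 1) * ball_vol TYPE('n)) * I0 (kT J eps (min eps R) j) (fu D u) x"
    by (simp add: force_T_def I0_def k_def)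
  qed
 qed
qed

end

section \<open>Dependence of the estimates on the horizon\<close>

definition force_bounds where
 "force_bounds D L X0 X1 X2 \<longleftrightarrow> (\<forall>eps>0. \<forall>u\<in>W D. \<forall>j. h2 (X0 eps u j) (X1 eps u j) (X2 eps u j) \<and>
   wbound (L * (H2norm D u + (H2norm D u)^2) / eps powr (5 / 2)) (X0 eps u j) (X1 eps u j) (X2 eps u j)) \<and>
  (\<forall>eps>0. \<forall>u\<in>W D. \<forall>v\<in>W D. \<forall>j. wdist (L * (1 + H2norm D u + H2norm D v)^2 / eps ^ 3 * H2norm D (%x. u x - v x))
   (X0 eps u j) (X1 eps u j) (X2 eps u j) (X0 eps v j) (X1 eps v j) (X2 eps v j))"

lemma h2_cmult: "h2 p p1 p2 ==> h2 (%x. c * p x) (%i x. c * p1 i x) (%i k x. c * p2 i k x)"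
 by (auto simp: h2_def intro: DQ_cmult)

lemma h2_diff: "h2 p p1 p2 ==> h2 q q1 q2 ==> h2 (%x. p x - q x) (%i x. p1 i x - q1 i x) (%i k x. p2 i k x - q2 i k x)"
 by (auto simp: h2_def intro: DQ_diff)

lemma wbound_cmult:
 assumes "wbound nu p p1 p2" "0 <= c" "c * nu <= nu'"
 shows "wbound nu' (%x. c * p x) (%i x. c * p1 i x) (%i k x. c * p2 i k x)"
proof -
 have "Lb 2 f nu ==> Lb 2 (%x. c * f x) nu'" for f :: "real^'a => real"
  using Lb_cmult[of 2 f nu c] assms(2,3) by (auto intro: Lb_mono)
 then show ?thesis using assms(1) by (simp add: wbound_def)
qed

lemma fbound_mono: "fbound nu u u1 u2 ==> nu <= nu' ==> fbound nu' u u1 u2"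
 unfolding fbound_def using wbound_mono by blast

lemma horizon_scaling:
 fixes eps r a b :: real
 assumes "0 < r" "r <= eps" "0 <= a" "0 < b"
 shows "2 / (eps ^ (n + 1) * b) * r powr a <= 2 / b / eps powr (real n + 1 - a)"
proof -
 have e: "0 < eps" using assms by simp
 have "2 / (eps ^ (n + 1) * b) * r powr a <= 2 / (eps ^ (n + 1) * b) * eps powr a"
  using assms e by (intro mult_left_mono powr_mono2) auto
 also have "... = 2 / b / eps powr (real n + 1 - a)"
 proof -
  have "eps ^ (n + 1) = eps powr (real n + 1)" using powr_realpow[OF e, of "n + 1"] by (simp add: add.commute)
  then show ?thesis using e by (simp add: powr_diff)
 qed
 finally show ?thesis .
qed

text \<open>For t = min eps R / eps one has t^n <= t, and t is at most both 1 and R / eps, hence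
  also at most sqrt(R / eps). These two bounds provide the missing powers eps^(-1) and
  eps^(-1/2).\<close>

lemma horizon_ratio:
 fixes eps R :: real
 assumes e: "0 < eps" and R: "0 < R" and n: "0 < n"
 shows "(min eps R / eps) ^ n <= 1" "1 / eps^2 * (min eps R / eps) ^ n <= R / eps ^ 3"
  "1 / eps^2 * (min eps R / eps) ^ n <= sqrt R / eps powr (5 / 2)"
proof -
 define t where "t = min eps R / eps"
 have t: "0 <= t" "t <= 1" "t <= R / eps" using e R by (auto simp: t_def divide_right_mono)
 have "t ^ n <= t" using power_decreasing[of 1 n t] t n by simp
 show "(min eps R / eps) ^ n <= 1" using power_le_one[OF t(1,2)] by (simp add: t_def)
 have "1 / eps^2 * t ^ n <= 1 / eps^2 * (R / eps)" using \<open>t ^ n <= t\<close> t e by (intro mult_left_mono) auto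
 then show "1 / eps^2 * (min eps R / eps) ^ n <= R / eps ^ 3" by (simp add: t_def power2_eq_square power3_eq_cube mult_ac)
 have "t = sqrt t * sqrt t" using t by simp
 also have "... <= sqrt (R / eps) * 1" using t by (intro mult_mono real_sqrt_le_mono) auto
 finally have "1 / eps^2 * t ^ n <= 1 / eps^2 * (sqrt R / sqrt eps)" using \<open>t ^ n <= t\<close> e by (intro mult_left_mono) (auto simp: real_sqrt_divide)
 moreover have "eps powr (5 / 2) = eps^2 * sqrt eps"
  using e powr_add[of eps 2 "1 / 2"] by (simp add: powr_half_sqrt)
 ultimately show "1 / eps^2 * (min eps R / eps) ^ n <= sqrt R / eps powr (5 / 2)" by (simp add: t_def)
qed

context tensile
begin

definition cT :: "real => real" where "cT eps = 2 / (eps ^ (CARD('n) + 1) * ball_vol TYPE('n))"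

definition FT0 where "FT0 J R eps u j x = cT eps * I0 (kT J eps (min eps R) j) (fu D u) x"
definition FT1 where "FT1 J R eps u j i x = cT eps * I1 (kT J eps (min eps R) j) (fu D u) (fu1 D u) i x"
definition FT2 where "FT2 J R eps u j i k x = cT eps * I2 (kT J eps (min eps R) j) (fu D u) (fu1 D u) (fu2 D u) i k x"
definition FD0 where "FD0 J R eps u j x = 1 / eps^2 * D0 (kD J eps (min eps R)) (fu D u) j x"
definition FD1 where "FD1 J R eps u j i x = 1 / eps^2 * D1 (kD J eps (min eps R)) (fu D u) (fu1 D u) j i x"
definition FD2 where "FD2 J R eps u j i k x = 1 / eps^2 * D2 (kD J eps (min eps R)) (fu D u) (fu1 D u) (fu2 D u) j i k x"

lemma W_pair:
 assumes D: "open D" and u: "u \<in> W D" and v: "v \<in> W D"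
 shows "fbound (H2norm D u + H2norm D v) (fu D u) (fu1 D u) (fu2 D u)" "fbound (H2norm D u + H2norm D v) (fu D v) (fu1 D v) (fu2 D v)"
 using fbound_mono[OF W_field(2)[OF D u], of "H2norm D u + H2norm D v"] fbound_mono[OF W_field(2)[OF D v], of "H2norm D u + H2norm D v"]
  fbound_nonneg[OF W_field(2)[OF D u]] fbound_nonneg[OF W_field(2)[OF D v]] by auto

text \<open>The prefactor eps^(-n-1) meets r^(n-3/2) for one function and r^(n-2) for a difference,
  with r <= eps; the exponents n + 1 - (n - 3/2) and n + 1 - (n - 2) are 5/2 and 3.\<close>

lemma FT_estimates:
 assumes D: "open D" and J: "infl_bound M J" and R: "0 < R"
 obtains L where
  "force_bounds D L (FT0 J R) (FT1 J R) (FT2 J R)"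
proof (rule tensile_integral[OF R], goal_cases)
 case (1 L)
 note est = 1(3,4) and L = 1(2)
 define b where "b = ball_vol TYPE('n)"
 have b: "0 < b" by (simp add: b_def ball_vol)
 have M: "0 <= M" using J by (simp add: infl_bound_def)
 have d2: "2 <= real CARD('n)" using dim by auto
 have cT0: "0 < eps ==> 0 <= cT eps" for eps using b by (simp add: cT_def b_def[symmetric])
 have scale: "cT eps * (L * M * min eps R powr a * A) <= L * M * (2 / b) * A / eps powr (real CARD('n) + 1 - a)"
  if "0 < eps" "0 <= a" "0 <= A" for eps a A
 proof -
  have "cT eps * min eps R powr a <= 2 / b / eps powr (real CARD('n) + 1 - a)"
   unfolding cT_def b_def[symmetric] using that R b by (intro horizon_scaling) auto
  from mult_left_mono[OF this, of "L * M * A"] L M that(3) show ?thesis by (simp add: mult_ac)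
 qed
 show ?case
 proof (rule 1(1)[of "L * M * (2 / b)"], unfold force_bounds_def, (rule conjI; intro allI impI ballI), goal_cases)
  case (1 eps u j)
  note W = W_field[OF D 1(2)]
  have e: "0 < min eps R" "min eps R <= R" using 1(1) R by auto
  note est1 = est(1)[OF M e kT_kernel[OF J 1(1)] W, of j]
  have "cT eps * (L * M * min eps R powr (real CARD('n) - 3 / 2) * (H2norm D u + (H2norm D u)^2))
   <= L * M * (2 / b) * (H2norm D u + (H2norm D u)^2) / eps powr (5 / 2)"
   using scale[OF 1(1), of "real CARD('n) - 3 / 2" "H2norm D u + (H2norm D u)^2"] d2 fbound_nonneg[OF W(2)] by (simp add: algebra_simps)
  with est1 show ?case
   unfolding FT0_def[abs_def] FT1_def[abs_def] FT2_def[abs_def] using cT0[OF 1(1)] by (blast intro: h2_cmult wbound_cmult)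
 next
  case (2 eps u v j)
  note W = W_field(1)[OF D 2(2)] W_pair(1)[OF D 2(2,3)] W_field(1)[OF D 2(3)] W_pair(2)[OF D 2(2,3)] W_diff[OF D 2(2,3)]
  have e: "0 < min eps R" "min eps R <= R" using 2(1) R by auto
  note est2 = est(2)[OF M e kT_kernel[OF J 2(1)] W, of j]
  have "cT eps * (L * M * min eps R powr (real CARD('n) - 2) * ((1 + (H2norm D u + H2norm D v))^2 * H2norm D (%x. u x - v x)))
   <= L * M * (2 / b) * (1 + H2norm D u + H2norm D v)^2 / eps ^ 3 * H2norm D (%x. u x - v x)"
   using scale[OF 2(1), of "real CARD('n) - 2" "(1 + (H2norm D u + H2norm D v))^2 * H2norm D (%x. u x - v x)"] d2 fbound_nonneg[OF W(5)] 2(1)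
   by (simp add: add.assoc mult_ac)
  from wbound_cmult[OF est2 cT0[OF 2(1)] this] show ?case
   unfolding FT0_def FT1_def FT2_def by (simp add: right_diff_distrib)
 qed
qed

lemma FD_estimates:
 assumes D: "open D" and J: "infl_bound M J" and R: "0 < R"
 obtains L where
  "force_bounds D L (FD0 J R) (FD1 J R) (FD2 J R)"
proof -
 have M: "0 <= M" using J by (simp add: infl_bound_def)
 show thesis
 proof (rule dilatational_integral[OF M], goal_cases)
  case (1 L)
  note est = 1(2,3) and L = 1(1)
  have scale: "1 / eps^2 * (L * (M * (min eps R / eps) ^ CARD('n)) * A) <= L * M * S * A"
   if "1 / eps^2 * (min eps R / eps) ^ CARD('n) <= S" "0 <= A" for eps A S
   using mult_left_mono[OF that(1), of "L * M * A"] L M that(2) by (simp add: mult_ac)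
  have le: "M * (min eps R / eps) ^ CARD('n) <= M" if "0 < eps" for eps
   using mult_left_mono[OF horizon_ratio(1)[OF that R] M] by simp
  have ker: "kern (M * (min eps R / eps) ^ CARD('n)) (kD J eps (min eps R) (j::'n))" if "0 < eps" for eps j
   by (rule kD_kernel[OF J that]) (use that R in simp)
  \<comment> \<open>The two estimates come with sqrt R and R respectively; the sum serves for
    both.\<close>
  have S: "sqrt R <= R + sqrt R" "R <= R + sqrt R" using R by auto
  show ?case
  proof (rule that[of "L * M * (R + sqrt R)"], unfold force_bounds_def, (rule conjI; intro allI impI ballI), goal_cases)
   case (1 eps u j)
   note W = W_field[OF D 1(2)]
   note est1 = est(1)[of _ "kD J eps (min eps R)", OF ker[OF 1(1)] le[OF 1(1)] W, of j]
   have "1 / eps^2 * (min eps R / eps) ^ CARD('n) <= (R + sqrt R) / eps powr (5 / 2)"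
    using horizon_ratio(3)[OF 1(1) R, of "CARD('n)"] divide_right_mono[OF S(1), of "eps powr (5 / 2)"] by simp
   from scale[OF this, of "H2norm D u + (H2norm D u)^2"] fbound_nonneg[OF W(2)]
   have "1 / eps^2 * (L * (M * (min eps R / eps) ^ CARD('n)) * (H2norm D u + (H2norm D u)^2))
    <= L * M * (R + sqrt R) * (H2norm D u + (H2norm D u)^2) / eps powr (5 / 2)" by (simp add: mult_ac)
   moreover have "0 <= 1 / eps^2" by simp
   ultimately show ?case
    using est1 unfolding FD0_def[abs_def] FD1_def[abs_def] FD2_def[abs_def] by (blast intro: h2_cmult wbound_cmult)
  next
   case (2 eps u v j)
   note W = W_field(1)[OF D 2(2)] W_pair(1)[OF D 2(2,3)] W_field(1)[OF D 2(3)] W_pair(2)[OF D 2(2,3)] W_diff[OF D 2(2,3)]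
   note est2 = est(2)[of _ "kD J eps (min eps R)", OF ker[OF 2(1)] le[OF 2(1)] W, of j]
   have "1 / eps^2 * (min eps R / eps) ^ CARD('n) <= (R + sqrt R) / eps ^ 3"
    using horizon_ratio(2)[OF 2(1) R, of "CARD('n)"] divide_right_mono[OF S(2), of "eps ^ 3"] 2(1) by simp
   from scale[OF this, of "(1 + (H2norm D u + H2norm D v))^2 * H2norm D (%x. u x - v x)"] fbound_nonneg[OF W(5)]
   have "1 / eps^2 * (L * (M * (min eps R / eps) ^ CARD('n)) * ((1 + (H2norm D u + H2norm D v))^2 * H2norm D (%x. u x - v x)))
    <= L * M * (R + sqrt R) * (1 + H2norm D u + H2norm D v)^2 / eps ^ 3 * H2norm D (%x. u x - v x)" by (simp add: mult_ac add.assoc)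
   from wbound_cmult[OF est2 _ this] show ?case unfolding FD0_def FD1_def FD2_def right_diff_distrib[symmetric] by simp
  qed
 qed
qed

end

theorem theorem2p1:
  fixes D :: "(real^'n) set"
    and J f g :: "real \<Rightarrow> real"
    and \<omega> :: "real^'n \<Rightarrow> real"
    and \<epsilon>\<^sub>0 :: real
  assumes "CARD('n) = 2 \<or> CARD('n) = 3"
    and "open D" and "C1_boundary D"
    and "influence_function J"
    and "convex_concave f" and "finite_sup_derivs f"
    and "quadratic_potential g \<or> (convex_concave g \<and> finite_sup_derivs g)"
    and "boundary_function D \<omega>"
    and "bdd_above (range (\<lambda>x. norm (grad \<omega> x)))"
    and "bdd_above (range (\<lambda>x. norm (grad (grad \<omega>) x)))"
  shows "(\<exists>L\<^sub>1::real. \<forall>\<epsilon>>0. bounded D \<or> \<epsilon> \<le> \<epsilon>\<^sub>0 \<longrightarrow>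
            (\<forall>u\<in>W D. \<forall>v\<in>W D.
               (\<lambda>x. force J \<omega> f g \<epsilon> u x - force J \<omega> f g \<epsilon> v x) \<in> H2 D \<and>
               H2norm D (\<lambda>x. force J \<omega> f g \<epsilon> u x - force J \<omega> f g \<epsilon> v x)
                 \<le> L\<^sub>1 * (1 + H2norm D u + H2norm D v)\<^sup>2 / \<epsilon> ^ 3 * H2norm D (\<lambda>x. u x - v x))) \<and>
         (\<exists>L\<^sub>2::real. \<forall>\<epsilon>>0. bounded D \<or> \<epsilon> \<le> \<epsilon>\<^sub>0 \<longrightarrow>
            (\<forall>u\<in>W D.
               force J \<omega> f g \<epsilon> u \<in> H2 D \<and>
               H2norm D (force J \<omega> f g \<epsilon> u)
                 \<le> L\<^sub>2 * (H2norm D u + (H2norm D u)\<^sup>2) / \<epsilon> powr (5 / 2)))"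
proof -
 note D = assms(2)
 obtain M where J: "infl_bound M J" using influence_function_bound[OF assms(4)] .
 obtain C where C: "Pot C (deriv f) ((deriv ^^ 2) f) ((deriv ^^ 3) f)" using Pot_convex_concave[OF assms(5,6)] .
 obtain C' G1 G2 where C': "Pot C' (deriv g) G1 G2" using assms(7) Pot_quadratic[of g] Pot_convex_concave[of g] by metis
 obtain K where K: "Weight K D \<omega> (%i x. grad \<omega> x $ i) (%i k x. grad (grad \<omega>) x $ k $ i)"
  using Weight_boundary_function[OF assms(8-10)] .
 \<comment> \<open>The same weight is used with two potentials: F = f' for the tensile part, and
   below F = g' for the dilatational part.\<close>
 interpret T: tensile C K "deriv f" "(deriv ^^ 2) f" "(deriv ^^ 3) f" D \<omega> "%i x. grad \<omega> x $ i" "%i k x. grad (grad \<omega>) x $ k $ i"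
  using assms(1) C K by unfold_locales
 interpret G: tensile C' K "deriv g" G1 G2 D \<omega> "%i x. grad \<omega> x $ i" "%i k x. grad (grad \<omega>) x $ k $ i"
  using assms(1) C' K by unfold_locales
 obtain R' where R': "bounded D ==> \<forall>x\<in>D. \<forall>y\<in>D. dist x y < R'"
 proof (cases "bounded D")
  case True
  then obtain e where "\<forall>x\<in>D. \<forall>y\<in>D. dist x y <= e" unfolding bounded_two_points by blast
  then have "\<forall>x\<in>D. \<forall>y\<in>D. dist x y < e + 1" by fastforce
  then show thesis using that by blast
 qed (use that in blast)
 \<comment> \<open>R exceeds the diameter if D is bounded and is at least
   \<open>\<epsilon>\<^sub>0\<close> otherwise; the entry 1 makes it positive also for a nonpositive
   \<open>\<epsilon>\<^sub>0\<close>. The constants may depend on R, but not on the horizon.\<close>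
 define R where "R = max (max \<epsilon>\<^sub>0 1) R'"
 have R: "0 < R" by (simp add: R_def)
 have reach: "T.reach R eps" if "0 < eps" "bounded D \<or> eps <= \<epsilon>\<^sub>0" for eps
 proof (cases "bounded D")
  case True
  then have "\<forall>x\<in>D. \<forall>y\<in>D. dist x y < R" using R' unfolding R_def by (meson less_max_iff_disj)
  then show ?thesis using that R by (simp add: T.reach_def)
 next
  case False
  then have "eps <= R" using that by (simp add: R_def)
  then show ?thesis using that R by (simp add: T.reach_def)
 qed
 show ?thesis
 proof (rule T.FT_estimates[OF D J R], rule G.FD_estimates[OF D J R], goal_cases)
 case (1 LT LD)
 note LT = 1(1)[unfolded force_bounds_def, THEN conjunct1, rule_format] 1(1)[unfolded force_bounds_def, THEN conjunct2, rule_format]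
  and LD = 1(2)[unfolded force_bounds_def, THEN conjunct1, rule_format] 1(2)[unfolded force_bounds_def, THEN conjunct2, rule_format]
 have rep: "AE x in lebesgue. x \<in> D --> force J \<omega> f g eps u x = (\<chi> j. T.FT0 J R eps u j x + G.FD0 J R eps u j x)"
  if e: "0 < eps" "bounded D \<or> eps <= \<epsilon>\<^sub>0" and u: "u \<in> W D" for eps u
  unfolding AE_completion_iff
  using T.force_T_rep[OF D u J reach[OF e] refl] G.force_D_rep[OF D u J reach[OF e] refl]
  by eventually_elim (simp add: force_def vec_eq_iff T.FT0_def G.FD0_def T.cT_def)
 \<comment> \<open>The number of components of a function, its gradient and its Hessian, as in
   \<open>H2_if_components\<close>.\<close>
 define n where "n = real CARD('n) + real CARD('n) ^ 2 + real CARD('n) ^ 3"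
 show ?thesis
 proof (rule conjI; (rule exI[of _ "n * (LT + LD)"], intro allI impI ballI conjI))
  fix eps u v
  assume e: "0 < eps" "bounded D \<or> eps <= \<epsilon>\<^sub>0" and u: "u \<in> W D" and v: "v \<in> W D"
  define A where "A = (1 + H2norm D u + H2norm D v)^2 / eps ^ 3 * H2norm D (%x. u x - v x)"
  have A: "LT * (1 + H2norm D u + H2norm D v)^2 / eps ^ 3 * H2norm D (%x. u x - v x) = LT * A"
   "LD * (1 + H2norm D u + H2norm D v)^2 / eps ^ 3 * H2norm D (%x. u x - v x) = LD * A"
   "n * (LT + LD) * (1 + H2norm D u + H2norm D v)^2 / eps ^ 3 * H2norm D (%x. u x - v x) = n * (LT * A + LD * A)"
   by (simp_all add: A_def algebra_simps add_divide_distrib)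
  note h = h2_add[OF h2_diff[OF LT(1)[OF e(1) u, THEN conjunct1] LT(1)[OF e(1) v, THEN conjunct1]]
   h2_diff[OF LD(1)[OF e(1) u, THEN conjunct1] LD(1)[OF e(1) v, THEN conjunct1]]]
  note w = wbound_add[OF LT(2)[OF e(1) u v] LD(2)[OF e(1) u v], unfolded A(1,2)]
  have V: "AE x in lebesgue. x \<in> D --> force J \<omega> f g eps u x - force J \<omega> f g eps v x =
   (\<chi> j. (T.FT0 J R eps u j x - T.FT0 J R eps v j x) + (G.FD0 J R eps u j x - G.FD0 J R eps v j x))"
   using rep[OF e u] rep[OF e v] by eventually_elim (simp add: vec_eq_iff)
  note H = H2_if_components[OF D h w V]
  show "(%x. force J \<omega> f g eps u x - force J \<omega> f g eps v x) \<in> H2 D" by (rule H(1))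
  show "H2norm D (%x. force J \<omega> f g eps u x - force J \<omega> f g eps v x)
    <= n * (LT + LD) * (1 + H2norm D u + H2norm D v)^2 / eps ^ 3 * H2norm D (%x. u x - v x)"
   unfolding A(3) using H(2) by (simp add: n_def)
 next
  fix eps u
  assume e: "0 < eps" "bounded D \<or> eps <= \<epsilon>\<^sub>0" and u: "u \<in> W D"
  define A where "A = (H2norm D u + (H2norm D u)^2) / eps powr (5 / 2)"
  have A: "LT * (H2norm D u + (H2norm D u)^2) / eps powr (5 / 2) = LT * A" "LD * (H2norm D u + (H2norm D u)^2) / eps powr (5 / 2) = LD * A"
   "n * (LT + LD) * (H2norm D u + (H2norm D u)^2) / eps powr (5 / 2) = n * (LT * A + LD * A)"
   by (simp_all add: A_def algebra_simps add_divide_distrib)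
  note h = h2_add[OF LT(1)[OF e(1) u, THEN conjunct1] LD(1)[OF e(1) u, THEN conjunct1]]
  note w = wbound_add[OF LT(1)[OF e(1) u, THEN conjunct2] LD(1)[OF e(1) u, THEN conjunct2], unfolded A(1,2)]
  note H = H2_if_components[OF D h w rep[OF e u]]
  show "force J \<omega> f g eps u \<in> H2 D" by (rule H(1))
  show "H2norm D (force J \<omega> f g eps u) <= n * (LT + LD) * (H2norm D u + (H2norm D u)^2) / eps powr (5 / 2)"
   unfolding A(3) using H(2) by (simp add: n_def)
 qed
 qed
qed

end
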